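(* Let $n\ge 1$ and let $R$ be a finitely generated commutative ring such that $\mathrm{Spec}\,R$ is smooth over $\mathrm{Spec}\,\mathbb Z$. Let $f\in\mathrm{Aut}(A_{n,R})$ be an $R$-algebra automorphism of the Weyl algebra $A_{n,R}$. Then for all sufficiently large primes $p$ the corresponding symplectomorphism $f_p^{centr}\in \mathrm{Aut}(P_{n,R/pR})$ is defined over the subring $(R/pR)^p=\{a^p : a\in R/pR\}\subset R/pR$.
   Context: Let $\omega_{ij}=\delta_{i,n+j}-\delta_{n+i,j}$ for $1\le i,j\le 2n$. For a commutative ring $S$, the Weyl algebra $A_{n,S}$ is the associative unital $S$-algebra with generators $\hat x_1,\dots,\hat x_{2n}$ and relations $[\hat x_i,\hat x_j]=\omega_{ij}$, and $P_{n,S}$ is the polynomial algebra $S[x_1,\dots,x_{2n}]$ with the Poisson bracket determined by $\{x_i,x_j\}=\omega_{ij}$; $\mathrm{Aut}(P_{n,S})$ is the group of $S$-algebra automorphisms preserving the bracket. If $p\cdot 1_S=0$ for a prime $p$, the center $C_{n,S}$ of $A_{n,S}$ is the polynomial algebra $S[y_1,\dots,y_{2n}]$ with $y_i=\hat x_i^p$ (known fact). For $f\in\mathrm{Aut}(A_{n,R})$ and a prime $p$, let $f_p$ be the automorphism of $A_{n,R/pR}=A_{n,R}/pA_{n,R}$ induced by $f$, and let $f_p^{centr}$ be the automorphism of the center $C_{n,R/pR}= (R/pR)[y_1,\dots,y_{2n}]$ obtained by restricting $f_p$. Identifying $y_i$ with $x_i$, $f_p^{centr}$ is an automorphism of the Poisson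 algebra $P_{n,R/pR}$ (it is a known fact that it preserves the bracket for such $R$). An automorphism of $P_{n,S}$ is said to be defined over a subring $S'\subset S$ if it and its inverse send each variable to a polynomial with coefficients in $S'$, i.e. if it comes by extension of scalars from an automorphism of $P_{n,S'}$. *)

theory Defs
  imports "HOL-Computational_Algebra.Primes" "HOL-Library.Multiset" "HOL-Library.Countable_Set"
    "HOL-Algebra.Algebra"
begin

section \<open>Smooth rings over the integers\<close>

definition finitely_generated_ring :: "('a, 'm) ring_scheme \<Rightarrow> bool" where
  "finitely_generated_ring R \<longleftrightarrow>
     (\<exists>A. finite A \<and> A \<subseteq> carrier R \<and> generate_ring R A = carrier R)"

text \<open>
  Infinitesimal lifting against all square-zero ideals \<open>J\<close> of commutative rings \<open>B\<close> with elements
  in the type \<open>'b\<close>.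
\<close>
definition formally_smooth :: "'b itself \<Rightarrow> ('a, 'm) ring_scheme \<Rightarrow> bool" where
  "formally_smooth (_ :: 'b itself) R \<longleftrightarrow>
     (\<forall>(B :: 'b ring) J g.
        cring B \<longrightarrow> ideal J B \<longrightarrow> (\<forall>a\<in>J. \<forall>b\<in>J. a \<otimes>\<^bsub>B\<^esub> b = \<zero>\<^bsub>B\<^esub>) \<longrightarrow> g \<in> ring_hom R (B Quot J) \<longrightarrow>
        (\<exists>h \<in> ring_hom R B. \<forall>r \<in> carrier R. J +>\<^bsub>B\<^esub> h r = g r))"

text \<open>
  Smooth means formally smooth and of finite presentation (EGA IV 17.3.1).  Over the Noetherian
  ring of integers finite generation and finite presentation agree.  Countable test rings suffice
  for finitely generated rings: see \<open>formally_smooth_all_test_rings\<close> below.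
\<close>
definition smooth_over_Z :: "('a, 'm) ring_scheme \<Rightarrow> bool" where
  "smooth_over_Z R \<longleftrightarrow> finitely_generated_ring R \<and> formally_smooth TYPE(nat) R"

lemma countable_generate_ring:
  assumes "countable H"
  shows "countable (generate_ring B H)"
proof -
  define step where "step Y = Y \<union> a_inv B ` Y \<union> case_prod (add B) ` (Y \<times> Y)
      \<union> case_prod (monoid.mult B) ` (Y \<times> Y)" for Y
  define L where "L k = (step ^^ k) (insert \<one>\<^bsub>B\<^esub> H)" for k
  have L_Suc: "L (Suc k) = step (L k)" for k
    by (simp add: L_def)
  have "countable (L k)" for k
  proof (induction k)
    case 0
    then show ?case using assms by (simp add: L_def)
  next
    case (Suc k)
    then show ?case unfolding L_Suc step_def by auto
  qed
  moreover have "generate_ring B H \<subseteq> (\<Union>k. L k)"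
  proof
    have mono: "L k \<subseteq> L l" if "k \<le> l" for k l
      using that by (rule lift_Suc_mono_le[rotated]) (auto simp: L_Suc step_def)
    have binop: "\<exists>k. h1 \<in> L k \<and> h2 \<in> L k" if "h1 \<in> L i" "h2 \<in> L j" for h1 h2 i j
      using that mono[of i "max i j"] mono[of j "max i j"] by auto
    fix x assume "x \<in> generate_ring B H"
    then show "x \<in> (\<Union>k. L k)"
    proof induction
      case one
      show ?case by (rule UN_I[of 0]) (auto simp: L_def)
    next
      case (incl h)
      then show ?case by (intro UN_I[of 0]) (auto simp: L_def)
    next
      case (a_inv h)
      then obtain k where "h \<in> L k" by auto
      then show ?case by (intro UN_I[of "Suc k"]) (auto simp: L_Suc step_def)
    next
      case (eng_add h1 h2)
      then obtain k where "h1 \<in> L k" "h2 \<in> L k" using binop by blast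
      then show ?case by (intro UN_I[of "Suc k"]) (auto simp: L_Suc step_def)
    next
      case (eng_mult h1 h2)
      then obtain k where "h1 \<in> L k" "h2 \<in> L k" using binop by blast
      then show ?case by (intro UN_I[of "Suc k"]) (auto simp: L_Suc step_def)
    qed
  qed
  ultimately show ?thesis
    by (meson countable_UN countable_subset countableI_type)
qed

lemma formally_smooth_all_test_rings:
  fixes R :: "('a, 'm) ring_scheme"
  assumes "cring R" "finitely_generated_ring R" "formally_smooth TYPE(nat) R"
  shows "formally_smooth TYPE('b) R"
  unfolding formally_smooth_def
proof (intro allI impI)
  fix B :: "'b ring" and J g
  assume "cring B" "ideal J B" and J0: "\<forall>a\<in>J. \<forall>b\<in>J. a \<otimes>\<^bsub>B\<^esub> b = \<zero>\<^bsub>B\<^esub>"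
    and g: "g \<in> ring_hom R (B Quot J)"
  interpret R: cring R by fact
  interpret B: cring B by fact
  interpret J: ideal J B by fact
  interpret Q: ring "B Quot J" by (rule J.quotient_is_ring)
  interpret g: ring_hom_ring R "B Quot J" g
    by (rule ring_hom_ringI2[OF R.ring_axioms Q.ring_axioms g])
  interpret q: ring_hom_ring B "B Quot J" "(+>\<^bsub>B\<^esub>) J" by (rule J.rcos_ring_hom_ring)
  obtain A where A: "finite A" "A \<subseteq> carrier R" "generate_ring R A = carrier R"
    using assms(2) unfolding finitely_generated_ring_def by blast
  have "\<exists>b\<in>carrier B. g r = J +>\<^bsub>B\<^esub> b" if "r \<in> carrier R" for r
    using g.hom_closed[OF that] unfolding FactRing_def A_RCOSETS_def' by auto
  then obtain b where b: "\<And>r. r \<in> carrier R \<Longrightarrow> b r \<in> carrier B \<and> g r = J +>\<^bsub>B\<^esub> b r"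
    by metis
  define E where "E = generate_ring B (b ` A)"
  have bA: "b ` A \<subseteq> carrier B" using b A by auto
  have E_sub: "E \<subseteq> carrier B"
    unfolding E_def by (rule B.generate_ring_incl[OF bA])
  have E_countable: "countable E"
    unfolding E_def by (intro countable_generate_ring countable_finite finite_imageI A)
  have subring_E: "subring E B"
    unfolding E_def by (rule B.generate_ring_is_subring[OF bA])
  have "\<exists>e\<in>E. g r = J +>\<^bsub>B\<^esub> e" if "r \<in> generate_ring R A" for r
    using that
  proof induction
    case one
    have "\<one>\<^bsub>B\<^esub> \<in> E" unfolding E_def by (rule generate_ring.one)
    then show ?case using g.hom_one q.hom_one by metis
  next
    case (incl h)
    then have "b h \<in> E" unfolding E_def by (intro generate_ring.incl) auto
    then show ?case using b A incl by blast
  next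
    case (a_inv h)
    then obtain e where e: "e \<in> E" "g h = J +>\<^bsub>B\<^esub> e" by blast
    have "\<ominus>\<^bsub>B\<^esub> e \<in> E" using e unfolding E_def by (intro generate_ring.a_inv)
    moreover have "g (\<ominus>\<^bsub>R\<^esub> h) = J +>\<^bsub>B\<^esub> (\<ominus>\<^bsub>B\<^esub> e)"
      using e E_sub a_inv A by auto
    ultimately show ?case by blast
  next
    case (eng_add h1 h2)
    then obtain e1 e2 where e: "e1 \<in> E" "g h1 = J +>\<^bsub>B\<^esub> e1" "e2 \<in> E" "g h2 = J +>\<^bsub>B\<^esub> e2" by blast
    have "e1 \<oplus>\<^bsub>B\<^esub> e2 \<in> E" using e unfolding E_def by (intro generate_ring.eng_add)
    moreover have "g (h1 \<oplus>\<^bsub>R\<^esub> h2) = J +>\<^bsub>B\<^esub> (e1 \<oplus>\<^bsub>B\<^esub> e2)"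
      using e E_sub eng_add A by (simp add: subset_iff)
    ultimately show ?case by blast
  next
    case (eng_mult h1 h2)
    then obtain e1 e2 where e: "e1 \<in> E" "g h1 = J +>\<^bsub>B\<^esub> e1" "e2 \<in> E" "g h2 = J +>\<^bsub>B\<^esub> e2" by blast
    have "e1 \<otimes>\<^bsub>B\<^esub> e2 \<in> E" using e unfolding E_def by (intro generate_ring.eng_mult)
    moreover have "g (h1 \<otimes>\<^bsub>R\<^esub> h2) = J +>\<^bsub>B\<^esub> (e1 \<otimes>\<^bsub>B\<^esub> e2)"
      using e E_sub eng_mult A by (simp add: subset_iff)
    ultimately show ?case by blast
  qed
  then obtain e where e: "\<And>r. r \<in> carrier R \<Longrightarrow> e r \<in> E \<and> g r = J +>\<^bsub>B\<^esub> e r"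
    unfolding A(3) by metis
  define E' where "E' = B \<lparr> carrier := E \<rparr>"
  have "subcring E B" by (rule B.subcringI'[OF subring_E])
  then have "cring E'" using B.subcring_iff[OF E_sub] by (simp add: E'_def)
  then interpret E': cring E' .
  define \<phi> where "\<phi> = to_nat_on E"
  define T where "T = image_ring \<phi> E'"
  have inj: "inj_on \<phi> (carrier E')"
    using inj_on_to_nat_on[OF E_countable] by (simp add: \<phi>_def E'_def)
  have iso: "\<phi> \<in> ring_iso E' T"
    unfolding T_def by (rule inj_imp_image_ring_iso[OF inj])
  have "cring (T \<lparr> zero := \<phi> \<zero>\<^bsub>E'\<^esub> \<rparr>)"
    using E'.ring_iso_imp_img_cring[OF iso] by simp
  then have "cring T"
    by (simp add: T_def image_ring_def image_group_def monoid.defs)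
  then interpret T: cring T .
  interpret \<phi>: ring_hom_ring E' T \<phi>
    using iso by (intro ring_hom_ringI2) (auto simp: ring_iso_def E'.ring_axioms T.ring_axioms)
  define \<psi> where "\<psi> = inv_into (carrier E') \<phi>"
  have "\<psi> \<in> ring_iso T E'"
    unfolding \<psi>_def by (rule ring_iso_set_sym[OF E'.ring_axioms iso])
  then interpret \<psi>: ring_hom_ring T E' \<psi>
    by (intro ring_hom_ringI2) (auto simp: ring_iso_def E'.ring_axioms T.ring_axioms)
  have \<psi>\<phi>: "\<psi> (\<phi> x) = x" if "x \<in> carrier E'" for x
    unfolding \<psi>_def using inj that by simp
  have minus_E': "x \<ominus>\<^bsub>E'\<^esub> y = x \<ominus>\<^bsub>B\<^esub> y" if "x \<in> E" "y \<in> E" for x y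
  proof -
    have "y \<oplus>\<^bsub>B\<^esub> (\<ominus>\<^bsub>E'\<^esub> y) = \<zero>\<^bsub>B\<^esub>" "\<ominus>\<^bsub>E'\<^esub> y \<in> E"
      using E'.r_neg[of y] E'.a_inv_closed[of y] that by (auto simp: E'_def)
    then have "\<ominus>\<^bsub>E'\<^esub> y = \<ominus>\<^bsub>B\<^esub> y"
      using E_sub that B.minus_equality[of "\<ominus>\<^bsub>E'\<^esub> y" y] B.a_comm[of y "\<ominus>\<^bsub>E'\<^esub> y"] by (simp add: subset_iff)
    then show ?thesis by (simp add: a_minus_def E'_def)
  qed
  define J' where "J' = {t \<in> carrier T. \<psi> t \<in> J}"
  have "\<psi> t \<in> E" if "t \<in> carrier T" for t
    using \<psi>.hom_closed[OF that] by (simp add: E'_def)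
  note \<psi>_E = this this[THEN subsetD[OF E_sub]]
  have E'_simps: "monoid.mult E' = monoid.mult B" "add E' = add B" "\<zero>\<^bsub>E'\<^esub> = \<zero>\<^bsub>B\<^esub>" "\<one>\<^bsub>E'\<^esub> = \<one>\<^bsub>B\<^esub>" "carrier E' = E"
    by (simp_all add: E'_def)
  have \<psi>_minus: "\<psi> (s \<ominus>\<^bsub>T\<^esub> t) = \<psi> s \<ominus>\<^bsub>B\<^esub> \<psi> t" if "s \<in> carrier T" "t \<in> carrier T" for s t
    using that minus_E'[of "\<psi> s" "\<psi> t"] \<psi>_E by (simp add: a_minus_def)
  have zero_J': "\<zero>\<^bsub>T\<^esub> \<in> J'"
    using J.zero_closed by (simp add: J'_def E'_simps)
  have "ideal J' T"
  proof (rule idealI)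
    show "ring T" by (rule T.ring_axioms)
    show "subgroup J' (add_monoid T)"
    proof (rule T.add.subgroupI)
      show "J' \<subseteq> carrier T" by (auto simp: J'_def)
      show "J' \<noteq> {}" using zero_J' by blast
      fix t assume t: "t \<in> J'"
      have "\<psi> (\<zero>\<^bsub>T\<^esub> \<ominus>\<^bsub>T\<^esub> t) = \<zero>\<^bsub>B\<^esub> \<ominus>\<^bsub>B\<^esub> \<psi> t"
        using t by (simp add: \<psi>_minus J'_def E'_simps)
      then show "\<ominus>\<^bsub>T\<^esub> t \<in> J'"
        using t \<psi>_E by (simp add: J'_def a_minus_def)
      fix s assume "s \<in> J'"
      then show "t \<oplus>\<^bsub>T\<^esub> s \<in> J'"
        using t J.a_closed by (simp add: J'_def E'_simps)
    qed
    fix t x assume "t \<in> J'" "x \<in> carrier T"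
    then show "x \<otimes>\<^bsub>T\<^esub> t \<in> J'" "t \<otimes>\<^bsub>T\<^esub> x \<in> J'"
      using \<psi>_E J.I_l_closed J.I_r_closed by (simp_all add: J'_def E'_simps)
  qed
  then interpret J': ideal J' T .
  have J'_eq: "J' +>\<^bsub>T\<^esub> s = J' +>\<^bsub>T\<^esub> t \<longleftrightarrow> J +>\<^bsub>B\<^esub> \<psi> s = J +>\<^bsub>B\<^esub> \<psi> t"
    if "s \<in> carrier T" "t \<in> carrier T" for s t
  proof -
    have "J' +>\<^bsub>T\<^esub> s = J' +>\<^bsub>T\<^esub> t \<longleftrightarrow> s \<ominus>\<^bsub>T\<^esub> t \<in> J'"
      using T.quotient_eq_iff_same_a_r_cos[OF J'.ideal_axioms that] by (rule sym)
    also have "\<dots> \<longleftrightarrow> \<psi> (s \<ominus>\<^bsub>T\<^esub> t) \<in> J"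
      unfolding J'_def using T.minus_closed[OF that] by blast
    also have "\<dots> \<longleftrightarrow> J +>\<^bsub>B\<^esub> \<psi> s = J +>\<^bsub>B\<^esub> \<psi> t"
      unfolding \<psi>_minus[OF that]
      by (rule B.quotient_eq_iff_same_a_r_cos[OF J.ideal_axioms \<psi>_E(2) \<psi>_E(2)]) (use that in auto)
    finally show ?thesis .
  qed
  have J'0: "\<forall>s\<in>J'. \<forall>t\<in>J'. s \<otimes>\<^bsub>T\<^esub> t = \<zero>\<^bsub>T\<^esub>"
  proof (intro ballI)
    fix s t assume st: "s \<in> J'" "t \<in> J'"
    then have st': "s \<in> carrier T" "t \<in> carrier T" "\<psi> s \<otimes>\<^bsub>B\<^esub> \<psi> t = \<zero>\<^bsub>B\<^esub>"
      using J0 unfolding J'_def by blast+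
    then have "\<psi> (s \<otimes>\<^bsub>T\<^esub> t) = \<zero>\<^bsub>E'\<^esub>"
      by (simp add: E'_simps)
    moreover have "inj_on \<psi> (carrier T)"
      using \<open>\<psi> \<in> ring_iso T E'\<close> by (simp add: ring_iso_def bij_betw_def)
    ultimately show "s \<otimes>\<^bsub>T\<^esub> t = \<zero>\<^bsub>T\<^esub>"
      using \<psi>.hom_zero T.m_closed[OF st'(1,2)] T.zero_closed inj_onD[of \<psi> "carrier T"] by metis
  qed
  have \<phi>e: "\<phi> (e r) \<in> carrier T" "\<psi> (\<phi> (e r)) = e r" if "r \<in> carrier R" for r
    using e[OF that] \<phi>.hom_closed \<psi>\<phi> by (auto simp: E'_simps)
  have hom: "(\<lambda>r. J' +>\<^bsub>T\<^esub> \<phi> (e r)) \<in> ring_hom R (T Quot J')"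
  proof (rule ring_hom_memI)
    interpret q': ring_hom_ring T "T Quot J'" "(+>\<^bsub>T\<^esub>) J'" by (rule J'.rcos_ring_hom_ring)
    have eB: "e r \<in> carrier B" if "r \<in> carrier R" for r
      using e[OF that] E_sub by blast
    show "J' +>\<^bsub>T\<^esub> \<phi> (e r) \<in> carrier (T Quot J')" if "r \<in> carrier R" for r
      using \<phi>e[OF that] by simp
    show "J' +>\<^bsub>T\<^esub> \<phi> (e \<one>\<^bsub>R\<^esub>) = \<one>\<^bsub>T Quot J'\<^esub>"
    proof -
      have "J +>\<^bsub>B\<^esub> e \<one>\<^bsub>R\<^esub> = J +>\<^bsub>B\<^esub> \<one>\<^bsub>B\<^esub>"
        using e[of "\<one>\<^bsub>R\<^esub>"] g.hom_one q.hom_one by (metis R.one_closed)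
      then have "J' +>\<^bsub>T\<^esub> \<phi> (e \<one>\<^bsub>R\<^esub>) = J' +>\<^bsub>T\<^esub> \<one>\<^bsub>T\<^esub>"
        by (subst J'_eq) (simp_all add: \<phi>e E'_simps)
      then show ?thesis by simp
    qed
    fix r s assume rs: "r \<in> carrier R" "s \<in> carrier R"
    have "J +>\<^bsub>B\<^esub> e (r \<otimes>\<^bsub>R\<^esub> s) = J +>\<^bsub>B\<^esub> (e r \<otimes>\<^bsub>B\<^esub> e s)"
      using e[of "r \<otimes>\<^bsub>R\<^esub> s"] e[of r] e[of s] g.hom_mult[OF rs] rs eB by simp
    then have "J' +>\<^bsub>T\<^esub> \<phi> (e (r \<otimes>\<^bsub>R\<^esub> s)) = J' +>\<^bsub>T\<^esub> (\<phi> (e r) \<otimes>\<^bsub>T\<^esub> \<phi> (e s))"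
      using rs by (subst J'_eq) (simp_all add: \<phi>e E'_simps)
    then show "J' +>\<^bsub>T\<^esub> \<phi> (e (r \<otimes>\<^bsub>R\<^esub> s)) = (J' +>\<^bsub>T\<^esub> \<phi> (e r)) \<otimes>\<^bsub>T Quot J'\<^esub> (J' +>\<^bsub>T\<^esub> \<phi> (e s))"
      using rs \<phi>e by simp
    have "J +>\<^bsub>B\<^esub> e (r \<oplus>\<^bsub>R\<^esub> s) = J +>\<^bsub>B\<^esub> (e r \<oplus>\<^bsub>B\<^esub> e s)"
      using e[of "r \<oplus>\<^bsub>R\<^esub> s"] e[of r] e[of s] g.hom_add[OF rs] rs eB by simp
    then have "J' +>\<^bsub>T\<^esub> \<phi> (e (r \<oplus>\<^bsub>R\<^esub> s)) = J' +>\<^bsub>T\<^esub> (\<phi> (e r) \<oplus>\<^bsub>T\<^esub> \<phi> (e s))"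
      using rs by (subst J'_eq) (simp_all add: \<phi>e E'_simps)
    then show "J' +>\<^bsub>T\<^esub> \<phi> (e (r \<oplus>\<^bsub>R\<^esub> s)) = (J' +>\<^bsub>T\<^esub> \<phi> (e r)) \<oplus>\<^bsub>T Quot J'\<^esub> (J' +>\<^bsub>T\<^esub> \<phi> (e s))"
      using rs \<phi>e by simp
  qed
  obtain h where h: "h \<in> ring_hom R T"
      "\<And>r. r \<in> carrier R \<Longrightarrow> J' +>\<^bsub>T\<^esub> h r = J' +>\<^bsub>T\<^esub> \<phi> (e r)"
    using assms(3)[unfolded formally_smooth_def, THEN spec, THEN spec, THEN spec, THEN mp, THEN mp,
        THEN mp, THEN mp, OF \<open>cring T\<close> \<open>ideal J' T\<close> J'0 hom] by blast
  interpret h: ring_hom_ring R T h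
    by (rule ring_hom_ringI2[OF R.ring_axioms T.ring_axioms h(1)])
  show "\<exists>h\<in>ring_hom R B. \<forall>r\<in>carrier R. J +>\<^bsub>B\<^esub> h r = g r"
  proof (intro bexI ballI)
    show "\<psi> \<circ> h \<in> ring_hom R B"
      by (rule ring_hom_memI) (simp_all add: \<psi>_E E'_simps)
    fix r assume r: "r \<in> carrier R"
    show "J +>\<^bsub>B\<^esub> (\<psi> \<circ> h) r = g r"
      using h(2)[OF r] J'_eq[of "h r" "\<phi> (e r)"] \<phi>e[OF r] e[OF r] r by simp
  qed
qed

section \<open>Weyl and Poisson algebras\<close>

text \<open>Finitely supported functions on a monoid, with convolution.\<close>
definition monoid_ring :: "('a, 'm) ring_scheme \<Rightarrow> ('g, 'k) monoid_scheme \<Rightarrow> ('g \<Rightarrow> 'a) ring" where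
  "monoid_ring R G =
     \<lparr>carrier = {a. range a \<subseteq> carrier R \<and> finite {u. a u \<noteq> \<zero>\<^bsub>R\<^esub>} \<and> {u. a u \<noteq> \<zero>\<^bsub>R\<^esub>} \<subseteq> carrier G},
      monoid.mult = (\<lambda>a b w. finsum R (\<lambda>(u, v). a u \<otimes>\<^bsub>R\<^esub> b v)
        {(u, v). a u \<noteq> \<zero>\<^bsub>R\<^esub> \<and> b v \<noteq> \<zero>\<^bsub>R\<^esub> \<and> u \<otimes>\<^bsub>G\<^esub> v = w}),
      one = (\<lambda>w. if w = \<one>\<^bsub>G\<^esub> then \<one>\<^bsub>R\<^esub> else \<zero>\<^bsub>R\<^esub>),
      ring.zero = (\<lambda>w. \<zero>\<^bsub>R\<^esub>),
      add = (\<lambda>a b w. a w \<oplus>\<^bsub>R\<^esub> b w)\<rparr>"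

definition monoid_ring_const :: "('a, 'm) ring_scheme \<Rightarrow> ('g, 'k) monoid_scheme \<Rightarrow> 'a \<Rightarrow> 'g \<Rightarrow> 'a" where
  "monoid_ring_const R G r = (\<lambda>w. if w = \<one>\<^bsub>G\<^esub> then r else \<zero>\<^bsub>R\<^esub>)"

definition monoid_ring_gen :: "('a, 'm) ring_scheme \<Rightarrow> 'g \<Rightarrow> 'g \<Rightarrow> 'a" where
  "monoid_ring_gen R g = (\<lambda>w. if w = g then \<one>\<^bsub>R\<^esub> else \<zero>\<^bsub>R\<^esub>)"

definition words :: "nat \<Rightarrow> nat list monoid" where
  "words n = \<lparr>carrier = lists {1..2 * n}, monoid.mult = (@), one = []\<rparr>"

definition monomials :: "nat \<Rightarrow> nat multiset monoid" where
  "monomials n = \<lparr>carrier = {m. set_mset m \<subseteq> {1..2 * n}}, monoid.mult = (+), one = {#}\<rparr>"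

definition free_alg :: "nat \<Rightarrow> ('a, 'm) ring_scheme \<Rightarrow> (nat list \<Rightarrow> 'a) ring" where
  "free_alg n R = monoid_ring R (words n)"

definition poly_alg :: "nat \<Rightarrow> ('a, 'm) ring_scheme \<Rightarrow> (nat multiset \<Rightarrow> 'a) ring" where
  "poly_alg n R = monoid_ring R (monomials n)"

definition omega :: "('a, 'm) ring_scheme \<Rightarrow> nat \<Rightarrow> nat \<Rightarrow> nat \<Rightarrow> 'a" where
  "omega R n i j = (if i = n + j then \<one>\<^bsub>R\<^esub> else \<zero>\<^bsub>R\<^esub>) \<ominus>\<^bsub>R\<^esub> (if n + i = j then \<one>\<^bsub>R\<^esub> else \<zero>\<^bsub>R\<^esub>)"

definition weyl_rel :: "nat \<Rightarrow> ('a, 'm) ring_scheme \<Rightarrow> nat \<Rightarrow> nat \<Rightarrow> nat list \<Rightarrow> 'a" where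
  "weyl_rel n R i j =
     (let F = free_alg n R; x = (\<lambda>i. monoid_ring_gen R [i])
      in (x i \<otimes>\<^bsub>F\<^esub> x j \<ominus>\<^bsub>F\<^esub> x j \<otimes>\<^bsub>F\<^esub> x i) \<ominus>\<^bsub>F\<^esub> monoid_ring_const R (words n) (omega R n i j))"

definition weyl_ideal :: "nat \<Rightarrow> ('a, 'm) ring_scheme \<Rightarrow> (nat list \<Rightarrow> 'a) set" where
  "weyl_ideal n R = Idl\<^bsub>free_alg n R\<^esub> {weyl_rel n R i j | i j. i \<in> {1..2 * n} \<and> j \<in> {1..2 * n}}"

definition weyl :: "nat \<Rightarrow> ('a, 'm) ring_scheme \<Rightarrow> (nat list \<Rightarrow> 'a) set ring" where
  "weyl n R = free_alg n R Quot weyl_ideal n R"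

definition weyl_class :: "nat \<Rightarrow> ('a, 'm) ring_scheme \<Rightarrow> (nat list \<Rightarrow> 'a) \<Rightarrow> (nat list \<Rightarrow> 'a) set" where
  "weyl_class n R a = weyl_ideal n R +>\<^bsub>free_alg n R\<^esub> a"

definition weyl_const :: "nat \<Rightarrow> ('a, 'm) ring_scheme \<Rightarrow> 'a \<Rightarrow> (nat list \<Rightarrow> 'a) set" where
  "weyl_const n R r = weyl_class n R (monoid_ring_const R (words n) r)"

definition weyl_gen :: "nat \<Rightarrow> ('a, 'm) ring_scheme \<Rightarrow> nat \<Rightarrow> (nat list \<Rightarrow> 'a) set" where
  "weyl_gen n R i = weyl_class n R (monoid_ring_gen R [i])"

definition poly_const :: "nat \<Rightarrow> ('a, 'm) ring_scheme \<Rightarrow> 'a \<Rightarrow> nat multiset \<Rightarrow> 'a" where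
  "poly_const n R r = monoid_ring_const R (monomials n) r"

definition poly_gen :: "('a, 'm) ring_scheme \<Rightarrow> nat \<Rightarrow> nat multiset \<Rightarrow> 'a" where
  "poly_gen R i = monoid_ring_gen R {#i#}"

text \<open>Automorphisms of an \<open>R\<close>-algebra \<open>A\<close> with structure map \<open>c\<close>.\<close>
definition algebra_aut :: "('a, 'm) ring_scheme \<Rightarrow> ('b, 'k) ring_scheme \<Rightarrow> ('a \<Rightarrow> 'b) \<Rightarrow> ('b \<Rightarrow> 'b) set" where
  "algebra_aut R A c = {f \<in> ring_iso A A. \<forall>r \<in> carrier R. f (c r) = c r}"

definition weyl_aut ::
  "nat \<Rightarrow> ('a, 'm) ring_scheme \<Rightarrow> ((nat list \<Rightarrow> 'a) set \<Rightarrow> (nat list \<Rightarrow> 'a) set) set" where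
  "weyl_aut n R = algebra_aut R (weyl n R) (weyl_const n R)"

definition poly_partial :: "('a, 'm) ring_scheme \<Rightarrow> nat \<Rightarrow> (nat multiset \<Rightarrow> 'a) \<Rightarrow> nat multiset \<Rightarrow> 'a" where
  "poly_partial S i a = (\<lambda>m. [Suc (count m i)] \<cdot>\<^bsub>S\<^esub> a (add_mset i m))"

text \<open>The unique biderivation over \<open>S\<close> taking the value \<open>omega S n i j\<close> on the variables \<open>i\<close> and \<open>j\<close>.\<close>
definition poisson_bracket ::
  "nat \<Rightarrow> ('a, 'm) ring_scheme \<Rightarrow> (nat multiset \<Rightarrow> 'a) \<Rightarrow> (nat multiset \<Rightarrow> 'a) \<Rightarrow> nat multiset \<Rightarrow> 'a" where
  "poisson_bracket n S a b =
     (let P = poly_alg n S in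
      finsum P (\<lambda>i. finsum P (\<lambda>j. poly_const n S (omega S n i j) \<otimes>\<^bsub>P\<^esub> (poly_partial S i a \<otimes>\<^bsub>P\<^esub> poly_partial S j b))
        {1..2 * n}) {1..2 * n})"

definition poisson_aut ::
  "nat \<Rightarrow> ('a, 'm) ring_scheme \<Rightarrow> ((nat multiset \<Rightarrow> 'a) \<Rightarrow> nat multiset \<Rightarrow> 'a) set" where
  "poisson_aut n S =
     {g \<in> algebra_aut S (poly_alg n S) (poly_const n S).
        \<forall>a \<in> carrier (poly_alg n S). \<forall>b \<in> carrier (poly_alg n S).
          g (poisson_bracket n S a b) = poisson_bracket n S (g a) (g b)}"

definition defined_over ::
  "nat \<Rightarrow> ('a, 'm) ring_scheme \<Rightarrow> 'a set \<Rightarrow> ((nat multiset \<Rightarrow> 'a) \<Rightarrow> nat multiset \<Rightarrow> 'a) \<Rightarrow> bool" where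
  "defined_over n S S' g \<longleftrightarrow>
     (\<forall>i \<in> {1..2 * n}. range (g (poly_gen S i)) \<subseteq> S' \<and>
        range (inv_into (carrier (poly_alg n S)) g (poly_gen S i)) \<subseteq> S')"

section \<open>Reduction modulo a prime and restriction to the center\<close>

definition mod_ideal :: "('a, 'm) ring_scheme \<Rightarrow> nat \<Rightarrow> 'a set" where
  "mod_ideal R p = PIdl\<^bsub>R\<^esub> ([p] \<cdot>\<^bsub>R\<^esub> \<one>\<^bsub>R\<^esub>)"

definition mod_ring :: "('a, 'm) ring_scheme \<Rightarrow> nat \<Rightarrow> 'a set ring" where
  "mod_ring R p = R Quot mod_ideal R p"

definition pth_powers :: "('a, 'm) ring_scheme \<Rightarrow> nat \<Rightarrow> 'a set" where
  "pth_powers S p = {a [^]\<^bsub>S\<^esub> p | a. a \<in> carrier S}"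

text \<open>
  Coefficientwise reduction from the Weyl algebra over \<open>R\<close> to that over \<open>R/pR\<close>; the class of the
  image does not depend on the representative.
\<close>
definition weyl_reduce ::
  "nat \<Rightarrow> ('a, 'm) ring_scheme \<Rightarrow> nat \<Rightarrow> (nat list \<Rightarrow> 'a) set \<Rightarrow> (nat list \<Rightarrow> 'a set) set" where
  "weyl_reduce n R p A =
     the_elem ((\<lambda>a. weyl_class n (mod_ring R p) (\<lambda>w. mod_ideal R p +>\<^bsub>R\<^esub> a w)) ` A)"

text \<open>
  The map \<open>f\<^sub>p\<close> with \<open>f\<^sub>p (weyl_reduce n R p A) = weyl_reduce n R p (f A)\<close>.
\<close>
definition reduced_aut ::
  "nat \<Rightarrow> ('a, 'm) ring_scheme \<Rightarrow> nat \<Rightarrow> ((nat list \<Rightarrow> 'a) set \<Rightarrow> (nat list \<Rightarrow> 'a) set) \<Rightarrow>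
   (nat list \<Rightarrow> 'a set) set \<Rightarrow> (nat list \<Rightarrow> 'a set) set" where
  "reduced_aut n R p f B =
     the_elem ((\<lambda>A. weyl_reduce n R p (f A)) ` {A \<in> carrier (weyl n R). weyl_reduce n R p A = B})"

definition ring_center :: "('a, 'm) ring_scheme \<Rightarrow> 'a set" where
  "ring_center A = {z \<in> carrier A. \<forall>a \<in> carrier A. z \<otimes>\<^bsub>A\<^esub> a = a \<otimes>\<^bsub>A\<^esub> z}"

text \<open>
  Evaluation at \<open>y\<^sub>i = weyl_gen n S i [^] p\<close>, an isomorphism of \<open>poly_alg n S\<close> onto the center of
  \<open>weyl n S\<close> when \<open>p\<close> is a prime with \<open>p \<cdot> 1 = 0\<close> in \<open>S\<close>.
\<close>
definition center_eval ::
  "nat \<Rightarrow> ('a, 'm) ring_scheme \<Rightarrow> nat \<Rightarrow> (nat multiset \<Rightarrow> 'a) \<Rightarrow> (nat list \<Rightarrow> 'a) set" where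
  "center_eval n S p a =
     (let W = weyl n S in
      finsum W (\<lambda>m. weyl_const n S (a m) \<otimes>\<^bsub>W\<^esub>
          foldr (\<lambda>i r. (weyl_gen n S i [^]\<^bsub>W\<^esub> p) [^]\<^bsub>W\<^esub> count m i \<otimes>\<^bsub>W\<^esub> r) [1..<2 * n + 1] \<one>\<^bsub>W\<^esub>)
        {m. a m \<noteq> \<zero>\<^bsub>S\<^esub>})"

definition centr_aut ::
  "nat \<Rightarrow> ('a, 'm) ring_scheme \<Rightarrow> nat \<Rightarrow> ((nat list \<Rightarrow> 'a) set \<Rightarrow> (nat list \<Rightarrow> 'a) set) \<Rightarrow>
   (nat multiset \<Rightarrow> 'a set) \<Rightarrow> nat multiset \<Rightarrow> 'a set" where
  "centr_aut n R p f =
     (let S = mod_ring R p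
      in inv_into (carrier (poly_alg n S)) (center_eval n S p)
           \<circ> restrict (reduced_aut n R p f) (ring_center (weyl n S))
           \<circ> center_eval n S p)"

end

theory Submission
  imports Defs "HOL-Number_Theory.Residues"
begin

text \<open>
  Let \<open>S = R / p R\<close>. A derivation \<open>\<delta>\<close> of \<open>S\<close>, extended coefficientwise to the Weyl algebra, satisfies
  \<open>\<delta> (z\<^sup>p) = ad(z)\<^sup>p\<^sup>-\<^sup>1 (\<delta> z)\<close>. For \<open>z = f\<^sub>p (x\<^sub>i)\<close> the inverse of \<open>f\<^sub>p\<close> turns the right hand side into
  \<open>ad(x\<^sub>i)\<^sup>p\<^sup>-\<^sup>1\<close> of an element in the \<open>S\<close>-span of finitely many elements that depend neither on \<open>p\<close>
  nor on \<open>\<delta>\<close>. As \<open>ad(x\<^sub>i)\<close> is locally nilpotent, this vanishes for large \<open>p\<close>, so every derivation of \<open>S\<close> kills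
  the coefficients of \<open>f\<^sub>p (y\<^sub>i) = f\<^sub>p (x\<^sub>i)\<^sup>p\<close>.

  Such elements are \<open>p\<close>-th powers (a form of Cartier's theorem): present \<open>S\<close> as a quotient of \<open>S[x]\<close> by the
  Frobenius on constants and generators of \<open>S\<close> on the variables, and lift the identity of \<open>S\<close> by formal
  smoothness to sections modulo deeper and deeper ideals. If all derivations kill \<open>s\<close>, then the partial derivatives
  of its lift lie deep in this filtration, and the terms whose exponents are not divisible by \<open>p\<close> can be removed
  without changing the image \<open>s\<close>.

  The bracket on the center is \<open>[z', w'] / p\<close> up to sign, for lifts \<open>z'\<close>, \<open>w'\<close> to \<open>R\<close>, hence it is preserved by \<open>f\<close>. This
  needs \<open>R\<close> to have no \<open>p\<close>-torsion, which holds for large \<open>p\<close> because \<open>R\<close> is noetherian.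
\<close>

section \<open>Monoid rings\<close>

text \<open>Coefficients of a Weyl algebra element refer to a basis, and the coefficient ring is
  arbitrary, so the ordered monomials are shown to be a basis over every commutative ring, by
  letting the generators act on coefficient functions. The extension of \<delta>, the nilpotency of
  \<open>ad\<close>, the kernel of reduction and the passage of torsion-freeness from R to the
  algebra are read off in these coordinates. The bound on p is found over R, for f and its inverse,
  since both have to be defined over the p-th powers.

  In the Cartier step formal smoothness over the integers yields lifts that are ring homomorphisms
  only and need not respect the constants of S[x]. The link is the chain rule: in characteristic p a
  derivation along any ring homomorphism kills p-th powers, so its values on generators of S
  determine it. A first order section already supplies derivations of S that see the partial
  derivatives of a representative of s; the chain rule then forces the derivatives of deeper lifts
  of s to vanish. Depth is needed because clearing one variable takes p - 1 Euler operators, and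
  derivatives lose levels.\<close>

definition single :: "('a, 'm) ring_scheme \<Rightarrow> 'a \<Rightarrow> 'g \<Rightarrow> 'g \<Rightarrow> 'a" where
  "single R r u = (\<lambda>w. if w = u then r else \<zero>\<^bsub>R\<^esub>)"

lemma monoid_ring_const_eq_single: "monoid_ring_const R G r = single R r \<one>\<^bsub>G\<^esub>"
  by (simp add: monoid_ring_const_def single_def)

lemma monoid_ring_gen_eq_single: "monoid_ring_gen R g = single R \<one>\<^bsub>R\<^esub> g"
  by (simp add: monoid_ring_gen_def single_def)

text \<open>The linear extension of \<phi>, with coefficients pushed through c. It yields the
  homomorphisms out of the free algebra, the normal ordering map \<open>\<Psi>\<close>, the
  evaluation at the p-th powers of the generators and the Frobenius-twisted evaluation
  \<open>\<epsilon>\<close>; for \<open>\<Psi>\<close> it is additive but not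
  multiplicative.\<close>

definition lin_ext :: "('a, 'm) ring_scheme \<Rightarrow> ('b, 'k) ring_scheme \<Rightarrow> ('a \<Rightarrow> 'b) \<Rightarrow> ('g \<Rightarrow> 'b) \<Rightarrow> ('g \<Rightarrow> 'a) \<Rightarrow> 'b" where
  "lin_ext R A c \<phi> a = finsum A (\<lambda>u. c (a u) \<otimes>\<^bsub>A\<^esub> \<phi> u) {u. a u \<noteq> \<zero>\<^bsub>R\<^esub>}"

locale monoid_algebra = R?: cring R + G: monoid G
  for R :: "('a, 'm) ring_scheme" (structure) and G :: "('g, 'k) monoid_scheme"
begin

abbreviation M where "M \<equiv> monoid_ring R G"

lemma carrier_iff:
  "a \<in> carrier M \<longleftrightarrow> (\<forall>u. a u \<in> carrier R) \<and> finite {u. a u \<noteq> \<zero>} \<and> {u. a u \<noteq> \<zero>} \<subseteq> carrier G"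
  by (auto simp: monoid_ring_def)

lemma coeff_closed: "a \<in> carrier M \<Longrightarrow> a u \<in> carrier R"
  by (simp add: carrier_iff)

lemma finite_support: "a \<in> carrier M \<Longrightarrow> finite {u. a u \<noteq> \<zero>}"
  by (simp add: carrier_iff)

lemma support_subset: "a \<in> carrier M \<Longrightarrow> {u. a u \<noteq> \<zero>} \<subseteq> carrier G"
  by (simp add: carrier_iff)

lemma add_apply: "(a \<oplus>\<^bsub>M\<^esub> b) w = a w \<oplus> b w"
  by (simp add: monoid_ring_def)

lemma zero_apply: "\<zero>\<^bsub>M\<^esub> w = \<zero>"
  by (simp add: monoid_ring_def)

lemma one_eq: "\<one>\<^bsub>M\<^esub> = single R \<one> \<one>\<^bsub>G\<^esub>"
  by (simp add: monoid_ring_def single_def)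

text \<open>The sum may run over any finite sets containing the supports, so that products of
  elements with different supports can be compared over one index set, as in the distributive
  laws.\<close>

lemma mult_apply:
  assumes "finite A" "finite B" "\<And>u. a u \<in> carrier R" "\<And>u. b u \<in> carrier R"
    "{u. a u \<noteq> \<zero>} \<subseteq> A" "{u. b u \<noteq> \<zero>} \<subseteq> B"
  shows "(a \<otimes>\<^bsub>M\<^esub> b) w = (\<Oplus>z\<in>A \<times> B. if fst z \<otimes>\<^bsub>G\<^esub> snd z = w then a (fst z) \<otimes> b (snd z) else \<zero>)"
proof -
  have "(a \<otimes>\<^bsub>M\<^esub> b) w = (\<Oplus>z\<in>{(u, v). a u \<noteq> \<zero> \<and> b v \<noteq> \<zero> \<and> u \<otimes>\<^bsub>G\<^esub> v = w}. a (fst z) \<otimes> b (snd z))"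
    by (simp add: monoid_ring_def case_prod_unfold)
  also have "\<dots> = (\<Oplus>z\<in>A \<times> B. if fst z \<otimes>\<^bsub>G\<^esub> snd z = w then a (fst z) \<otimes> b (snd z) else \<zero>)"
  proof (rule R.add.finprod_mono_neutral_cong_left)
    fix z assume "z \<in> A \<times> B - {(u, v). a u \<noteq> \<zero> \<and> b v \<noteq> \<zero> \<and> u \<otimes>\<^bsub>G\<^esub> v = w}"
    then have "fst z \<otimes>\<^bsub>G\<^esub> snd z = w \<Longrightarrow> a (fst z) = \<zero> \<or> b (snd z) = \<zero>"
      by (auto simp: case_prod_unfold)
    then show "(if fst z \<otimes>\<^bsub>G\<^esub> snd z = w then a (fst z) \<otimes> b (snd z) else \<zero>) = \<zero>"
      using assms(3,4) by auto
  qed (use assms in auto)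
  finally show ?thesis .
qed

lemma single_closed [simp]: "r \<in> carrier R \<Longrightarrow> u \<in> carrier G \<Longrightarrow> single R r u \<in> carrier M"
  by (auto simp: carrier_iff single_def intro: finite_subset[of _ "{u}"])

lemma zero_closed' [simp]: "\<zero>\<^bsub>M\<^esub> \<in> carrier M"
  by (simp add: carrier_iff zero_apply)

lemma add_closed' [simp]:
  assumes "a \<in> carrier M" "b \<in> carrier M"
  shows "a \<oplus>\<^bsub>M\<^esub> b \<in> carrier M"
proof -
  have "{u. a u \<oplus> b u \<noteq> \<zero>} \<subseteq> {u. a u \<noteq> \<zero>} \<union> {u. b u \<noteq> \<zero>}"
    by auto
  then show ?thesis
    using assms unfolding carrier_iff add_apply
    by (meson R.add.m_closed finite_UnI finite_subset le_sup_iff order_trans)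
qed

lemma single_zero: "single R \<zero> u = \<zero>\<^bsub>M\<^esub>"
  by (auto simp: single_def zero_apply)

lemma single_add: "r \<in> carrier R \<Longrightarrow> s \<in> carrier R \<Longrightarrow> single R r u \<oplus>\<^bsub>M\<^esub> single R s u = single R (r \<oplus> s) u"
  by (auto simp: single_def add_apply)

text \<open>Peels off one coefficient at a time. Identities that are additive in each argument, such
  as associativity, thereby need checking on monomials only.\<close>

lemma induct [consumes 1, case_names zero single add]:
  assumes "a \<in> carrier M"
    and "P \<zero>\<^bsub>M\<^esub>"
    and single: "\<And>r u. r \<in> carrier R \<Longrightarrow> u \<in> carrier G \<Longrightarrow> P (single R r u)"
    and add: "\<And>a b. a \<in> carrier M \<Longrightarrow> b \<in> carrier M \<Longrightarrow> P a \<Longrightarrow> P b \<Longrightarrow> P (a \<oplus>\<^bsub>M\<^esub> b)"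
  shows "P a"
proof -
  have "\<forall>a \<in> carrier M. {u. a u \<noteq> \<zero>} \<subseteq> U \<longrightarrow> P a" if "finite U" for U
    using that
  proof (induction U)
    case empty
    have "a = \<zero>\<^bsub>M\<^esub>" if "{u. a u \<noteq> \<zero>} \<subseteq> {}" for a
      using that by (auto simp: zero_apply)
    then show ?case using assms(2) by blast
  next
    case (insert x U)
    show ?case
    proof (intro ballI impI)
      fix a assume a: "a \<in> carrier M" "{u. a u \<noteq> \<zero>} \<subseteq> insert x U"
      show "P a"
      proof (cases "a x = \<zero>")
        case True
        then have "{u. a u \<noteq> \<zero>} \<subseteq> U" using a by auto
        then show ?thesis using insert.IH a by blast
      next
        case False
        then have x: "x \<in> carrier G" using a support_subset by blast
        define b where "b = a(x := \<zero>)"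
        have supp: "{u. b u \<noteq> \<zero>} \<subseteq> {u. a u \<noteq> \<zero>}" "{u. b u \<noteq> \<zero>} \<subseteq> U"
          using a by (auto simp: b_def)
        have b: "b \<in> carrier M"
          using a(1) supp(1) finite_subset[OF supp(1)] unfolding carrier_iff
          by (auto simp: b_def)
        have "a = single R (a x) x \<oplus>\<^bsub>M\<^esub> b"
          using coeff_closed[OF a(1)] by (auto simp: b_def add_apply single_def)
        moreover have "P b" using insert.IH b supp by blast
        ultimately show ?thesis
          using add[OF single_closed b, of "a x" x] single[of "a x" x] coeff_closed[OF a(1)] x by simp
      qed
    qed
  qed
  then show ?thesis using assms(1) finite_support by blast
qed

lemma mult_closed' [simp]:
  assumes "a \<in> carrier M" "b \<in> carrier M"
  shows "a \<otimes>\<^bsub>M\<^esub> b \<in> carrier M"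
proof -
  let ?A = "{u. a u \<noteq> \<zero>}" and ?B = "{u. b u \<noteq> \<zero>}"
  note [simp] = assms[THEN coeff_closed] assms[THEN finite_support]
  note eq = mult_apply[of ?A ?B a b, OF _ _ _ _ subset_refl subset_refl]
  have "(a \<otimes>\<^bsub>M\<^esub> b) w \<in> carrier R" for w
    using assms by (subst eq) (auto intro!: R.finsum_closed)
  moreover have sub: "{w. (a \<otimes>\<^bsub>M\<^esub> b) w \<noteq> \<zero>} \<subseteq> (\<lambda>(u, v). u \<otimes>\<^bsub>G\<^esub> v) ` (?A \<times> ?B)"
  proof
    fix w assume w: "w \<in> {w. (a \<otimes>\<^bsub>M\<^esub> b) w \<noteq> \<zero>}"
    show "w \<in> (\<lambda>(u, v). u \<otimes>\<^bsub>G\<^esub> v) ` (?A \<times> ?B)"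
    proof (rule ccontr)
      assume "w \<notin> (\<lambda>(u, v). u \<otimes>\<^bsub>G\<^esub> v) ` (?A \<times> ?B)"
      then have "fst z \<otimes>\<^bsub>G\<^esub> snd z \<noteq> w" if "z \<in> ?A \<times> ?B" for z
        using that by force
      then have "(a \<otimes>\<^bsub>M\<^esub> b) w = \<zero>"
        using assms by (subst eq) (auto intro!: R.add.finprod_one_eqI)
      then show False using w by simp
    qed
  qed
  moreover have "finite ((\<lambda>(u, v). u \<otimes>\<^bsub>G\<^esub> v) ` (?A \<times> ?B))"
    using assms by (intro finite_imageI finite_cartesian_product) auto
  moreover have "(\<lambda>(u, v). u \<otimes>\<^bsub>G\<^esub> v) ` (?A \<times> ?B) \<subseteq> carrier G"
    using assms support_subset by fastforce
  ultimately show ?thesis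
    unfolding carrier_iff by (meson finite_subset order_trans)
qed

lemma single_mult:
  assumes "r \<in> carrier R" "s \<in> carrier R"
  shows "single R r u \<otimes>\<^bsub>M\<^esub> single R s v = single R (r \<otimes> s) (u \<otimes>\<^bsub>G\<^esub> v)"
proof
  fix w
  show "(single R r u \<otimes>\<^bsub>M\<^esub> single R s v) w = single R (r \<otimes> s) (u \<otimes>\<^bsub>G\<^esub> v) w"
    using assms by (subst mult_apply[of "{u}" "{v}"]) (auto simp: single_def)
qed

lemma mult_add_left:
  assumes "a \<in> carrier M" "a' \<in> carrier M" "b \<in> carrier M"
  shows "(a \<oplus>\<^bsub>M\<^esub> a') \<otimes>\<^bsub>M\<^esub> b = a \<otimes>\<^bsub>M\<^esub> b \<oplus>\<^bsub>M\<^esub> a' \<otimes>\<^bsub>M\<^esub> b"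
proof
  fix w
  let ?A = "{u. a u \<noteq> \<zero>} \<union> {u. a' u \<noteq> \<zero>}" and ?B = "{u. b u \<noteq> \<zero>}"
  note [simp] = assms[THEN coeff_closed] assms[THEN finite_support]
  have f: "finite ?A" "finite ?B" using assms by auto
  have "(a \<oplus>\<^bsub>M\<^esub> a') u = \<zero>" if "a u = \<zero>" "a' u = \<zero>" for u
    using that by (simp add: add_apply)
  then have s: "{u. (a \<oplus>\<^bsub>M\<^esub> a') u \<noteq> \<zero>} \<subseteq> ?A" by auto
  show "((a \<oplus>\<^bsub>M\<^esub> a') \<otimes>\<^bsub>M\<^esub> b) w = (a \<otimes>\<^bsub>M\<^esub> b \<oplus>\<^bsub>M\<^esub> a' \<otimes>\<^bsub>M\<^esub> b) w"
    unfolding add_apply[of "a \<otimes>\<^bsub>M\<^esub> b"] using assms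
    by (subst (1 2 3) mult_apply[OF f]) (use s in \<open>auto simp: add_apply R.l_distr simp flip: R.finsum_addf intro!: R.finsum_cong'\<close>)
qed

lemma mult_add_right:
  assumes "a \<in> carrier M" "a' \<in> carrier M" "b \<in> carrier M"
  shows "b \<otimes>\<^bsub>M\<^esub> (a \<oplus>\<^bsub>M\<^esub> a') = b \<otimes>\<^bsub>M\<^esub> a \<oplus>\<^bsub>M\<^esub> b \<otimes>\<^bsub>M\<^esub> a'"
proof
  fix w
  let ?A = "{u. a u \<noteq> \<zero>} \<union> {u. a' u \<noteq> \<zero>}" and ?B = "{u. b u \<noteq> \<zero>}"
  note [simp] = assms[THEN coeff_closed] assms[THEN finite_support]
  have f: "finite ?B" "finite ?A" using assms by auto
  have "(a \<oplus>\<^bsub>M\<^esub> a') u = \<zero>" if "a u = \<zero>" "a' u = \<zero>" for u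
    using that by (simp add: add_apply)
  then have s: "{u. (a \<oplus>\<^bsub>M\<^esub> a') u \<noteq> \<zero>} \<subseteq> ?A" by auto
  show "(b \<otimes>\<^bsub>M\<^esub> (a \<oplus>\<^bsub>M\<^esub> a')) w = (b \<otimes>\<^bsub>M\<^esub> a \<oplus>\<^bsub>M\<^esub> b \<otimes>\<^bsub>M\<^esub> a') w"
    unfolding add_apply[of "b \<otimes>\<^bsub>M\<^esub> a"] using assms
    by (subst (1 2 3) mult_apply[OF f]) (use s in \<open>auto simp: add_apply R.r_distr simp flip: R.finsum_addf intro!: R.finsum_cong'\<close>)
qed

lemma mult_zero':
  assumes "a \<in> carrier M"
  shows "a \<otimes>\<^bsub>M\<^esub> \<zero>\<^bsub>M\<^esub> = \<zero>\<^bsub>M\<^esub>" "\<zero>\<^bsub>M\<^esub> \<otimes>\<^bsub>M\<^esub> a = \<zero>\<^bsub>M\<^esub>"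
  using assms coeff_closed[OF assms] finite_support[OF assms] mult_apply[of "{u. a u \<noteq> \<zero>}" "{}" a "\<zero>\<^bsub>M\<^esub>"] mult_apply[of "{}" "{u. a u \<noteq> \<zero>}" "\<zero>\<^bsub>M\<^esub>" a]
  by (auto simp: zero_apply)

sublocale M: ring "monoid_ring R G"
proof (rule ringI)
  show "abelian_group M"
  proof (rule abelian_groupI)
    fix a assume a: "a \<in> carrier M"
    note [simp] = coeff_closed[OF a] finite_support[OF a]
    show "\<exists>b\<in>carrier M. b \<oplus>\<^bsub>M\<^esub> a = \<zero>\<^bsub>M\<^esub>"
    proof
      have "{u. \<ominus> a u \<noteq> \<zero>} = {u. a u \<noteq> \<zero>}" using a by (auto dest: R.add.inv_eq_1_iff[THEN iffD1, rotated])
      then show "(\<lambda>u. \<ominus> a u) \<in> carrier M" using a by (simp add: carrier_iff)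
      show "(\<lambda>u. \<ominus> a u) \<oplus>\<^bsub>M\<^esub> a = \<zero>\<^bsub>M\<^esub>"
        using a by (auto simp: add_apply zero_apply R.l_neg)
    qed
  next
    fix a b c assume "a \<in> carrier M" "b \<in> carrier M" "c \<in> carrier M"
    note [simp] = this[THEN coeff_closed] this[THEN finite_support]
    show "a \<oplus>\<^bsub>M\<^esub> b \<oplus>\<^bsub>M\<^esub> c = a \<oplus>\<^bsub>M\<^esub> (b \<oplus>\<^bsub>M\<^esub> c)"
      by (auto simp: add_apply R.a_assoc)
  next
    fix a b assume "a \<in> carrier M" "b \<in> carrier M"
    note [simp] = this[THEN coeff_closed] this[THEN finite_support]
    show "a \<oplus>\<^bsub>M\<^esub> b = b \<oplus>\<^bsub>M\<^esub> a"
      by (auto simp: add_apply R.a_comm)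
  next
    fix a assume "a \<in> carrier M"
    note [simp] = this[THEN coeff_closed] this[THEN finite_support]
    show "\<zero>\<^bsub>M\<^esub> \<oplus>\<^bsub>M\<^esub> a = a"
      by (auto simp: add_apply zero_apply)
  qed auto
  have one: "\<one>\<^bsub>M\<^esub> \<in> carrier M" by (simp add: one_eq)
  show "Group.monoid M"
  proof (rule monoidI)
    fix a b c assume abc: "a \<in> carrier M" "b \<in> carrier M" "c \<in> carrier M"
    show "a \<otimes>\<^bsub>M\<^esub> b \<otimes>\<^bsub>M\<^esub> c = a \<otimes>\<^bsub>M\<^esub> (b \<otimes>\<^bsub>M\<^esub> c)"
      using abc(1)
    proof (induction a rule: induct)
      case (single r u)
      show ?case
        using abc(2)
      proof (induction b rule: induct)
        case (single s v)
        show ?case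
          using abc(3)
        proof (induction c rule: induct)
          case (single t w)
          then show ?case using \<open>r \<in> _\<close> \<open>u \<in> _\<close> \<open>s \<in> _\<close> \<open>v \<in> _\<close>
            by (simp add: single_mult R.m_assoc G.m_assoc)
        qed (use \<open>r \<in> _\<close> \<open>u \<in> _\<close> \<open>s \<in> _\<close> \<open>v \<in> _\<close> in \<open>simp_all add: mult_zero' mult_add_right\<close>)
      qed (use \<open>r \<in> _\<close> \<open>u \<in> _\<close> abc in \<open>simp_all add: mult_zero' mult_add_right mult_add_left\<close>)
    qed (use abc in \<open>simp_all add: mult_zero' mult_add_left\<close>)
  next
    fix a assume "a \<in> carrier M"
    then show "\<one>\<^bsub>M\<^esub> \<otimes>\<^bsub>M\<^esub> a = a"
      using one by (induction a rule: induct)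
        (simp_all add: mult_zero' mult_add_right, simp add: one_eq single_mult)
  next
    fix a assume "a \<in> carrier M"
    then show "a \<otimes>\<^bsub>M\<^esub> \<one>\<^bsub>M\<^esub> = a"
      using one by (induction a rule: induct)
        (simp_all add: mult_zero' mult_add_left, simp add: one_eq single_mult)
  qed (simp_all add: one)
qed (simp_all add: mult_add_left mult_add_right)

lemma minus_apply: "a \<in> carrier M \<Longrightarrow> (\<ominus>\<^bsub>M\<^esub> a) w = \<ominus> a w"
  by (rule R.minus_equality[symmetric])
     (simp_all add: M.l_neg zero_apply coeff_closed flip: add_apply)

lemma diff_apply: "a \<in> carrier M \<Longrightarrow> b \<in> carrier M \<Longrightarrow> (a \<ominus>\<^bsub>M\<^esub> b) w = a w \<ominus> b w"
  by (simp add: a_minus_def add_apply minus_apply)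

text \<open>Additivity in each factor reduces multiplicativity to products of two monomials. The
  value at zero is obtained from additivity by cancellation.\<close>

lemma ring_homI_singles:
  assumes "ring A"
    and closed: "\<And>a. a \<in> carrier M \<Longrightarrow> h a \<in> carrier A"
    and add: "\<And>a b. a \<in> carrier M \<Longrightarrow> b \<in> carrier M \<Longrightarrow> h (a \<oplus>\<^bsub>M\<^esub> b) = h a \<oplus>\<^bsub>A\<^esub> h b"
    and mult: "\<And>r s u v. r \<in> carrier R \<Longrightarrow> s \<in> carrier R \<Longrightarrow> u \<in> carrier G \<Longrightarrow> v \<in> carrier G \<Longrightarrow>
        h (single R (r \<otimes> s) (u \<otimes>\<^bsub>G\<^esub> v)) = h (single R r u) \<otimes>\<^bsub>A\<^esub> h (single R s v)"
    and one: "h (single R \<one> \<one>\<^bsub>G\<^esub>) = \<one>\<^bsub>A\<^esub>"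
  shows "h \<in> ring_hom M A"
proof (rule ring_hom_memI)
  interpret A: ring A by fact
  have "h \<zero>\<^bsub>M\<^esub> \<oplus>\<^bsub>A\<^esub> h \<zero>\<^bsub>M\<^esub> = h \<zero>\<^bsub>M\<^esub>"
    by (simp flip: add)
  then have zero: "h \<zero>\<^bsub>M\<^esub> = \<zero>\<^bsub>A\<^esub>"
    by (metis A.add.l_cancel_one closed zero_closed')
  fix a b assume ab: "a \<in> carrier M" "b \<in> carrier M"
  show "h (a \<otimes>\<^bsub>M\<^esub> b) = h a \<otimes>\<^bsub>A\<^esub> h b"
    using ab(1)
  proof (induction a rule: induct)
    case (single r u)
    show ?case
      using ab(2)
    proof (induction b rule: induct)
      case (single s v)
      then show ?case using \<open>r \<in> _\<close> \<open>u \<in> _\<close> by (simp add: single_mult mult)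
    qed (use \<open>r \<in> _\<close> \<open>u \<in> _\<close> in \<open>simp_all add: M.r_distr A.r_distr add closed zero\<close>)
  qed (use ab in \<open>simp_all add: M.l_distr A.l_distr add closed zero\<close>)
qed (simp_all add: closed add one one_eq)

lemma lin_ext_eq:
  assumes "ring A" "c \<in> ring_hom R A" "\<And>u. u \<in> carrier G \<Longrightarrow> \<phi> u \<in> carrier A"
    and "a \<in> carrier M" "finite U" "{u. a u \<noteq> \<zero>} \<subseteq> U" "U \<subseteq> carrier G"
  shows "lin_ext R A c \<phi> a = finsum A (\<lambda>u. c (a u) \<otimes>\<^bsub>A\<^esub> \<phi> u) U"
proof -
  interpret A: ring A by fact
  interpret c: ring_hom_ring R A c
    by (rule ring_hom_ringI2[OF R.ring_axioms A.ring_axioms assms(2)])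
  show ?thesis
    unfolding lin_ext_def
    by (rule A.add.finprod_mono_neutral_cong_left)
       (use assms(3,5-) coeff_closed[OF assms(4)] in auto)
qed

lemma lin_ext:
  assumes "ring A" "c \<in> ring_hom R A" and \<phi>: "\<And>u. u \<in> carrier G \<Longrightarrow> \<phi> u \<in> carrier A"
  shows lin_ext_closed: "a \<in> carrier M \<Longrightarrow> lin_ext R A c \<phi> a \<in> carrier A"
    and lin_ext_add: "a \<in> carrier M \<Longrightarrow> b \<in> carrier M \<Longrightarrow>
      lin_ext R A c \<phi> (a \<oplus>\<^bsub>M\<^esub> b) = lin_ext R A c \<phi> a \<oplus>\<^bsub>A\<^esub> lin_ext R A c \<phi> b"
    and lin_ext_single: "r \<in> carrier R \<Longrightarrow> u \<in> carrier G \<Longrightarrow>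
      lin_ext R A c \<phi> (single R r u) = c r \<otimes>\<^bsub>A\<^esub> \<phi> u"
proof -
  interpret A: ring A by fact
  interpret c: ring_hom_ring R A c
    by (rule ring_hom_ringI2[OF R.ring_axioms A.ring_axioms assms(2)])
  note eq = lin_ext_eq[where \<phi> = \<phi>, OF assms]
  show "lin_ext R A c \<phi> (single R r u) = c r \<otimes>\<^bsub>A\<^esub> \<phi> u" if "r \<in> carrier R" "u \<in> carrier G" for r u
    using that \<phi> by (subst eq[OF _ single_closed[OF that], of "{u}"]) (auto simp: single_def)
  fix a assume a: "a \<in> carrier M"
  then show "lin_ext R A c \<phi> a \<in> carrier A"
    unfolding lin_ext_def using \<phi> support_subset[OF a] coeff_closed[OF a] finite_support[OF a]
    by (auto intro!: A.finsum_closed)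
  fix b assume b: "b \<in> carrier M"
  note [simp] = a[THEN coeff_closed] b[THEN coeff_closed] a[THEN finite_support] b[THEN finite_support]
  let ?U = "{u. a u \<noteq> \<zero>} \<union> {u. b u \<noteq> \<zero>}"
  have "(a \<oplus>\<^bsub>M\<^esub> b) u = \<zero>" if "a u = \<zero>" "b u = \<zero>" for u
    using that by (simp add: add_apply)
  then have U: "finite ?U" "{u. (a \<oplus>\<^bsub>M\<^esub> b) u \<noteq> \<zero>} \<subseteq> ?U" "?U \<subseteq> carrier G"
    using a b support_subset by auto
  show "lin_ext R A c \<phi> (a \<oplus>\<^bsub>M\<^esub> b) = lin_ext R A c \<phi> a \<oplus>\<^bsub>A\<^esub> lin_ext R A c \<phi> b"
    using a b U \<phi>
    by (subst (1 2 3) eq[of _ ?U])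
       (auto simp: add_apply A.l_distr subset_iff simp flip: A.finsum_addf intro!: A.finsum_cong')
qed

text \<open>The target may be noncommutative: the last condition on \<phi> is what moves
  \<open>c s\<close> past \<open>\<phi> u\<close> in the product of two monomials.\<close>

lemma lin_ext_ring_hom:
  assumes "ring A" and c: "c \<in> ring_hom R A"
    and \<phi>: "\<And>u. u \<in> carrier G \<Longrightarrow> \<phi> u \<in> carrier A" "\<phi> \<one>\<^bsub>G\<^esub> = \<one>\<^bsub>A\<^esub>"
      "\<And>u v. u \<in> carrier G \<Longrightarrow> v \<in> carrier G \<Longrightarrow> \<phi> (u \<otimes>\<^bsub>G\<^esub> v) = \<phi> u \<otimes>\<^bsub>A\<^esub> \<phi> v"
      "\<And>r u. r \<in> carrier R \<Longrightarrow> u \<in> carrier G \<Longrightarrow> \<phi> u \<otimes>\<^bsub>A\<^esub> c r = c r \<otimes>\<^bsub>A\<^esub> \<phi> u"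
  shows "lin_ext R A c \<phi> \<in> ring_hom M A"
proof (rule ring_homI_singles[OF \<open>ring A\<close>])
  interpret A: ring A by fact
  interpret c: ring_hom_ring R A c
    by (rule ring_hom_ringI2[OF R.ring_axioms A.ring_axioms c])
  note single = lin_ext_single[where \<phi> = \<phi>, OF assms(1-3)]
  fix r s u v assume rsuv: "r \<in> carrier R" "s \<in> carrier R" "u \<in> carrier G" "v \<in> carrier G"
  have "c (r \<otimes> s) \<otimes>\<^bsub>A\<^esub> \<phi> (u \<otimes>\<^bsub>G\<^esub> v) = c r \<otimes>\<^bsub>A\<^esub> (c s \<otimes>\<^bsub>A\<^esub> \<phi> u) \<otimes>\<^bsub>A\<^esub> \<phi> v"
    using rsuv \<phi>(1,3) by (simp add: A.m_assoc)
  also have "\<dots> = c r \<otimes>\<^bsub>A\<^esub> (\<phi> u \<otimes>\<^bsub>A\<^esub> c s) \<otimes>\<^bsub>A\<^esub> \<phi> v"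
    using rsuv by (simp add: \<phi>(4))
  also have "\<dots> = (c r \<otimes>\<^bsub>A\<^esub> \<phi> u) \<otimes>\<^bsub>A\<^esub> (c s \<otimes>\<^bsub>A\<^esub> \<phi> v)"
    using rsuv \<phi>(1) by (simp add: A.m_assoc)
  finally show "lin_ext R A c \<phi> (single R (r \<otimes> s) (u \<otimes>\<^bsub>G\<^esub> v)) =
      lin_ext R A c \<phi> (single R r u) \<otimes>\<^bsub>A\<^esub> lin_ext R A c \<phi> (single R s v)"
    using rsuv by (simp add: single)
next
  interpret A: ring A by fact
  interpret c: ring_hom_ring R A c
    by (rule ring_hom_ringI2[OF R.ring_axioms A.ring_axioms c])
  show "lin_ext R A c \<phi> (single R \<one> \<one>\<^bsub>G\<^esub>) = \<one>\<^bsub>A\<^esub>"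
    using \<phi>(2) by (simp add: lin_ext_single[where \<phi> = \<phi>, OF assms(1-3)])
qed (rule lin_ext_closed[where \<phi> = \<phi>, OF assms(1-3)] lin_ext_add[where \<phi> = \<phi>, OF assms(1-3)]; assumption)+

lemma map_ring_hom:
  assumes "cring S" "q \<in> ring_hom R S"
  shows "(\<lambda>a w. q (a w)) \<in> ring_hom M (monoid_ring S G)"
proof -
  interpret S: monoid_algebra S G
    using assms(1) by (simp add: monoid_algebra_def G.monoid_axioms)
  interpret q: ring_hom_ring R S q
    by (rule ring_hom_ringI2[OF R.ring_axioms S.R.ring_axioms assms(2)])
  have single: "(\<lambda>w. q (single R r u w)) = single S (q r) u" for r u
    by (auto simp: single_def)
  show ?thesis
  proof (rule ring_homI_singles[OF S.M.ring_axioms])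
    fix a assume a: "a \<in> carrier M"
    note [simp] = coeff_closed[OF a] finite_support[OF a]
    have "{u. q (a u) \<noteq> \<zero>\<^bsub>S\<^esub>} \<subseteq> {u. a u \<noteq> \<zero>}"
      by auto
    then show "(\<lambda>w. q (a w)) \<in> carrier S.M"
      using a unfolding S.carrier_iff by (auto simp: carrier_iff finite_subset)
  next
    fix a b assume "a \<in> carrier M" "b \<in> carrier M"
    note [simp] = this[THEN coeff_closed] this[THEN finite_support]
    show "(\<lambda>w. q ((a \<oplus>\<^bsub>M\<^esub> b) w)) = (\<lambda>w. q (a w)) \<oplus>\<^bsub>S.M\<^esub> (\<lambda>w. q (b w))"
      by (auto simp: add_apply S.add_apply)
  qed (auto simp: single S.single_mult S.one_eq)
qed

end

lemma (in monoid_algebra) cring_M: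
  assumes "comm_monoid G"
  shows "cring M"
proof -
  interpret G: comm_monoid G by fact
  show ?thesis
  proof (intro cring.intro comm_monoid.intro comm_monoid_axioms.intro M.ring_axioms M.monoid_axioms)
    fix a b assume ab: "a \<in> carrier M" "b \<in> carrier M"
    show "a \<otimes>\<^bsub>M\<^esub> b = b \<otimes>\<^bsub>M\<^esub> a"
      using ab(1)
    proof (induction a rule: induct)
      case (single r u)
      show ?case
        using ab(2)
        by (induction b rule: induct)
           (use single in \<open>simp_all add: M.r_distr M.l_distr single_mult R.m_comm G.m_comm\<close>)
    qed (use ab in \<open>simp_all add: M.l_distr M.r_distr\<close>)
  qed
qed

section \<open>Commutators and p-th powers\<close>

definition ad :: "('a, 'm) ring_scheme \<Rightarrow> 'a \<Rightarrow> 'a \<Rightarrow> 'a" where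
  "ad A z d = z \<otimes>\<^bsub>A\<^esub> d \<ominus>\<^bsub>A\<^esub> d \<otimes>\<^bsub>A\<^esub> z"

text \<open>The sum of the products \<open>z\<^sup>k d z\<^sup>l\<close> over \<open>k + l + 1 = N\<close>.\<close>
primrec pow_deriv :: "('a, 'm) ring_scheme \<Rightarrow> 'a \<Rightarrow> 'a \<Rightarrow> nat \<Rightarrow> 'a" where
  "pow_deriv A z d 0 = \<zero>\<^bsub>A\<^esub>"
| "pow_deriv A z d (Suc N) = pow_deriv A z d N \<otimes>\<^bsub>A\<^esub> z \<oplus>\<^bsub>A\<^esub> z [^]\<^bsub>A\<^esub> N \<otimes>\<^bsub>A\<^esub> d"

context ring
begin

lemma ad_closed [simp]: "z \<in> carrier R \<Longrightarrow> d \<in> carrier R \<Longrightarrow> ad R z d \<in> carrier R"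
  by (simp add: ad_def)

lemma funpow_ad_closed [simp]:
  "z \<in> carrier R \<Longrightarrow> d \<in> carrier R \<Longrightarrow> (ad R z ^^ k) d \<in> carrier R"
  by (induction k) simp_all

lemma pow_deriv_closed [simp]:
  "z \<in> carrier R \<Longrightarrow> d \<in> carrier R \<Longrightarrow> pow_deriv R z d N \<in> carrier R"
  by (induction N) simp_all

lemma minus_swap: "a \<in> carrier R \<Longrightarrow> b \<in> carrier R \<Longrightarrow> \<ominus> (a \<ominus> b) = b \<ominus> a"
  by (simp add: a_minus_def minus_add a_comm)

lemma mult_eq_ad:
  assumes "z \<in> carrier R" "d \<in> carrier R"
  shows "z \<otimes> d = d \<otimes> z \<oplus> ad R z d"
proof -
  have "d \<otimes> z \<oplus> (z \<otimes> d \<ominus> d \<otimes> z) = z \<otimes> d \<oplus> (d \<otimes> z \<ominus> d \<otimes> z)"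
    using assms by (simp only: a_minus_def a_ac m_closed a_inv_closed)
  then show ?thesis using assms by (simp add: ad_def r_neg a_minus_def)
qed

lemma ad_mult:
  assumes "z \<in> carrier R" "a \<in> carrier R" "b \<in> carrier R"
  shows "ad R z (a \<otimes> b) = ad R z a \<otimes> b \<oplus> a \<otimes> ad R z b"
proof -
  have "ad R z a \<otimes> b \<oplus> a \<otimes> ad R z b
      = (z \<otimes> a \<otimes> b \<ominus> a \<otimes> z \<otimes> b) \<oplus> (a \<otimes> z \<otimes> b \<ominus> a \<otimes> b \<otimes> z)"
    using assms by (simp add: ad_def a_minus_def l_distr r_distr m_assoc l_minus r_minus)
  also have "\<dots> = z \<otimes> a \<otimes> b \<oplus> (\<ominus> (a \<otimes> z \<otimes> b) \<oplus> a \<otimes> z \<otimes> b) \<ominus> a \<otimes> b \<otimes> z"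
    using assms by (simp only: a_minus_def a_assoc m_closed a_inv_closed a_closed)
  finally show ?thesis
    using assms by (simp add: ad_def l_neg m_assoc)
qed

lemma ad_add:
  assumes "z \<in> carrier R" "a \<in> carrier R" "b \<in> carrier R"
  shows "ad R z (a \<oplus> b) = ad R z a \<oplus> ad R z b"
  using assms by (simp add: ad_def a_minus_def l_distr r_distr minus_add a_ac)

lemma ad_add_left:
  assumes "z \<in> carrier R" "a \<in> carrier R" "b \<in> carrier R"
  shows "ad R (a \<oplus> b) z = ad R a z \<oplus> ad R b z"
  using assms by (simp add: ad_def a_minus_def l_distr r_distr minus_add a_ac)

lemma ad_zero [simp]: "z \<in> carrier R \<Longrightarrow> ad R z \<zero> = \<zero>" "z \<in> carrier R \<Longrightarrow> ad R \<zero> z = \<zero>"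
  by (simp_all add: ad_def a_minus_def)

lemma ad_one [simp]: "z \<in> carrier R \<Longrightarrow> ad R z \<one> = \<zero>"
  by (simp add: ad_def a_minus_def r_neg)

lemma ad_minus:
  assumes "z \<in> carrier R" "a \<in> carrier R"
  shows "ad R a z = \<ominus> ad R z a"
  using assms by (simp add: ad_def minus_swap)

text \<open>Left multiplication by z is right multiplication by z plus \<open>ad z\<close>, and
  these two operators commute, so the powers of their sum expand by the binomial theorem.\<close>

lemma nat_pow_mult_ad:
  assumes "z \<in> carrier R" "d \<in> carrier R"
  shows "z [^] N \<otimes> d = (\<Oplus>i\<in>{..N}. [(N choose i)] \<cdot>\<^bsub>R\<^esub> ((ad R z ^^ i) d \<otimes> z [^] (N - i)))"
  using assms(2)
proof (induction N arbitrary: d)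
  case 0
  then show ?case by simp
next
  case (Suc N)
  note [simp] = assms(1) Suc.prems
  let ?a = "\<lambda>i. (ad R z ^^ i) d \<otimes> z [^] (Suc N - i)"
  have a: "(\<Oplus>i\<in>{..N}. [(N choose i)] \<cdot>\<^bsub>R\<^esub> ((ad R z ^^ i) d \<otimes> z [^] (N - i))) \<otimes> z
      = (\<Oplus>i\<in>{..Suc N}. [(N choose i)] \<cdot>\<^bsub>R\<^esub> ?a i)"
    by (simp add: finsum_ldistr Pi_def binomial_eq_0)
       (auto intro!: finsum_cong' simp: add_pow_ldistr m_assoc Suc_diff_le Pi_def)
  have b: "(\<Oplus>i\<in>{..N}. [(N choose i)] \<cdot>\<^bsub>R\<^esub> ((ad R z ^^ i) (ad R z d) \<otimes> z [^] (N - i)))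
      = (\<Oplus>i\<in>{..N}. [(N choose i)] \<cdot>\<^bsub>R\<^esub> ?a (Suc i))"
    by (simp add: funpow_swap1)
  have "z [^] Suc N \<otimes> d = z [^] N \<otimes> d \<otimes> z \<oplus> z [^] N \<otimes> ad R z d"
    by (simp add: m_assoc mult_eq_ad[OF assms(1) Suc.prems] r_distr)
  also have "\<dots> = (\<Oplus>i\<in>{..Suc N}. [(N choose i)] \<cdot>\<^bsub>R\<^esub> ?a i) \<oplus> (\<Oplus>i\<in>{..N}. [(N choose i)] \<cdot>\<^bsub>R\<^esub> ?a (Suc i))"
    by (simp only: Suc.IH[OF Suc.prems] Suc.IH[OF ad_closed[OF assms(1) Suc.prems]] a b)
  also have "(\<Oplus>i\<in>{..Suc N}. [(N choose i)] \<cdot>\<^bsub>R\<^esub> ?a i)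
      = (\<Oplus>i\<in>{..N}. [(N choose Suc i)] \<cdot>\<^bsub>R\<^esub> ?a (Suc i)) \<oplus> [(1::nat)] \<cdot>\<^bsub>R\<^esub> ?a 0"
    by (subst finsum_Suc2) (simp_all add: Pi_def del: finsum_Suc)
  also have "(\<Oplus>i\<in>{..N}. [(N choose Suc i)] \<cdot>\<^bsub>R\<^esub> ?a (Suc i)) \<oplus> [(1::nat)] \<cdot>\<^bsub>R\<^esub> ?a 0 \<oplus> (\<Oplus>i\<in>{..N}. [(N choose i)] \<cdot>\<^bsub>R\<^esub> ?a (Suc i))
      = (\<Oplus>i\<in>{..N}. [(Suc N choose Suc i)] \<cdot>\<^bsub>R\<^esub> ?a (Suc i)) \<oplus> [(Suc N choose 0)] \<cdot>\<^bsub>R\<^esub> ?a 0"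
    by (simp add: Pi_def finsum_addf a_ac flip: add.nat_pow_mult del: add.nat_pow_Suc)
  also have "\<dots> = (\<Oplus>i\<in>{..Suc N}. [(Suc N choose i)] \<cdot>\<^bsub>R\<^esub> ?a i)"
    by (subst finsum_Suc2) (simp_all add: Pi_def del: finsum_Suc)
  finally show ?case .
qed

text \<open>Adding up the expansions of \<open>nat_pow_mult_ad\<close> over the powers of z turns
  the coefficients C(k, i) into C(N + 1, i + 1); the induction carries out this column sum by
  Pascal's rule.\<close>

lemma pow_deriv_eq:
  assumes "z \<in> carrier R" "d \<in> carrier R"
  shows "pow_deriv R z d (Suc N) = (\<Oplus>i\<in>{..N}. [(Suc N choose Suc i)] \<cdot>\<^bsub>R\<^esub> ((ad R z ^^ i) d \<otimes> z [^] (N - i)))"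
proof (induction N)
  case 0
  then show ?case using assms by simp
next
  case (Suc N)
  note [simp] = assms
  let ?a = "\<lambda>i. (ad R z ^^ i) d \<otimes> z [^] (Suc N - i)"
  have a: "(\<Oplus>i\<in>{..N}. [(Suc N choose Suc i)] \<cdot>\<^bsub>R\<^esub> ((ad R z ^^ i) d \<otimes> z [^] (N - i))) \<otimes> z
      = (\<Oplus>i\<in>{..Suc N}. [(Suc N choose Suc i)] \<cdot>\<^bsub>R\<^esub> ?a i)"
    by (simp add: finsum_ldistr Pi_def binomial_eq_0 del: binomial_Suc_Suc)
       (auto intro!: finsum_cong' simp: add_pow_ldistr m_assoc Suc_diff_le Pi_def simp del: binomial_Suc_Suc)
  have "pow_deriv R z d (Suc (Suc N)) = (\<Oplus>i\<in>{..Suc N}. [(Suc N choose Suc i)] \<cdot>\<^bsub>R\<^esub> ?a i)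
      \<oplus> (\<Oplus>i\<in>{..Suc N}. [(Suc N choose i)] \<cdot>\<^bsub>R\<^esub> ?a i)"
    unfolding pow_deriv.simps(2)[of _ _ _ "Suc N"] Suc.IH a nat_pow_mult_ad[OF assms] ..
  also have "\<dots> = (\<Oplus>i\<in>{..Suc N}. [(Suc (Suc N) choose Suc i)] \<cdot>\<^bsub>R\<^esub> ?a i)"
    by (subst finsum_addf[symmetric])
       (simp_all add: Pi_def add.nat_pow_mult add.commute del: finsum_Suc add.nat_pow_Suc flip: binomial_Suc_Suc)
  finally show ?case .
qed

lemma add_pow_dvd:
  assumes "[(p::nat)] \<cdot>\<^bsub>R\<^esub> \<one> = \<zero>" "p dvd k" "a \<in> carrier R"
  shows "[(k::nat)] \<cdot>\<^bsub>R\<^esub> a = \<zero>"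
proof -
  obtain l where k: "k = p * l" using assms(2) by blast
  have "[p] \<cdot>\<^bsub>R\<^esub> a = \<zero>" using assms add_pow_ldistr[of \<one> a p] by simp
  then have "[l] \<cdot>\<^bsub>R\<^esub> ([p] \<cdot>\<^bsub>R\<^esub> a) = \<zero>" by simp
  then show ?thesis using assms(3) by (simp add: k add.nat_pow_pow)
qed

text \<open>The binomial coefficients C(p, i + 1) with i < p - 1 are divisible by p. The surviving
  term i = p - 1 has coefficient 1 and carries no power of z.\<close>

lemma pow_deriv_char:
  assumes p: "Factorial_Ring.prime (p::nat)" "[p] \<cdot>\<^bsub>R\<^esub> \<one> = \<zero>" and zd: "z \<in> carrier R" "d \<in> carrier R"
  shows "pow_deriv R z d p = (ad R z ^^ (p - 1)) d"
proof -
  obtain N where N: "p = Suc N"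
    using p(1) by (metis not_prime_0 old.nat.exhaust)
  have "[(Suc N choose Suc i)] \<cdot>\<^bsub>R\<^esub> ((ad R z ^^ i) d \<otimes> z [^] (N - i)) = \<zero>" if "i < N" for i
    using that dvd_choose_prime[of "Suc i" "Suc N"] p zd
    by (intro add_pow_dvd[OF p(2)]) (simp_all add: N del: binomial_Suc_Suc)
  then have "(\<Oplus>i\<in>{..<N}. [(Suc N choose Suc i)] \<cdot>\<^bsub>R\<^esub> ((ad R z ^^ i) d \<otimes> z [^] (N - i))) = \<zero>"
    by (intro add.finprod_one_eqI) auto
  then show ?thesis
    using zd unfolding N pow_deriv_eq[OF zd] lessThan_Suc_atMost[symmetric] lessThan_Suc
    by (subst finsum_insert) (auto simp del: binomial_Suc_Suc)
qed

lemma pow_deriv_add_pow: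
  assumes "z \<in> carrier R" "d \<in> carrier R"
  shows "pow_deriv R z ([(k::nat)] \<cdot>\<^bsub>R\<^esub> d) N = [k] \<cdot>\<^bsub>R\<^esub> pow_deriv R z d N"
  using assms
  by (induction N) (simp_all add: add_pow_ldistr add_pow_rdistr add.nat_pow_distrib a_comm)

end

text \<open>Stated for any D with the product rule and \<open>D \<one> = \<zero>\<close>, so that it
  serves both for commutators and for coefficientwise derivations of the Weyl algebra.\<close>

lemma derivation_nat_pow:
  assumes "ring A" "D \<one>\<^bsub>A\<^esub> = \<zero>\<^bsub>A\<^esub>"
    and "\<And>a b. a \<in> carrier A \<Longrightarrow> b \<in> carrier A \<Longrightarrow> D (a \<otimes>\<^bsub>A\<^esub> b) = D a \<otimes>\<^bsub>A\<^esub> b \<oplus>\<^bsub>A\<^esub> a \<otimes>\<^bsub>A\<^esub> D b"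
    and "z \<in> carrier A"
  shows "D (z [^]\<^bsub>A\<^esub> (N::nat)) = pow_deriv A z (D z) N"
proof -
  interpret A: ring A by fact
  show ?thesis using assms(2-) by (induction N) simp_all
qed

lemma (in cring) binomial:
  assumes "a \<in> carrier R" "b \<in> carrier R"
  shows "(a \<oplus> b) [^] N = (\<Oplus>i\<in>{..N}. [(N choose i)] \<cdot>\<^bsub>R\<^esub> (a [^] i \<otimes> b [^] (N - i)))"
proof (induction N)
  case 0
  then show ?case using assms by simp
next
  case (Suc N)
  note [simp] = assms
  let ?a = "\<lambda>i. a [^] i \<otimes> b [^] (Suc N - i)"
  have 1: "(\<Oplus>i\<in>{..N}. [(N choose i)] \<cdot>\<^bsub>R\<^esub> (a [^] i \<otimes> b [^] (N - i))) \<otimes> b = (\<Oplus>i\<in>{..Suc N}. [(N choose i)] \<cdot>\<^bsub>R\<^esub> ?a i)"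
    by (simp add: finsum_ldistr Pi_def binomial_eq_0)
       (auto intro!: finsum_cong' simp: add_pow_ldistr m_assoc Suc_diff_le Pi_def)
  have 2: "(\<Oplus>i\<in>{..N}. [(N choose i)] \<cdot>\<^bsub>R\<^esub> (a [^] i \<otimes> b [^] (N - i))) \<otimes> a = (\<Oplus>i\<in>{..N}. [(N choose i)] \<cdot>\<^bsub>R\<^esub> ?a (Suc i))"
    by (simp add: finsum_ldistr Pi_def)
       (auto intro!: finsum_cong' simp: add_pow_ldistr add_pow_rdistr m_ac Suc_diff_le Pi_def)
  have "(a \<oplus> b) [^] Suc N = (\<Oplus>i\<in>{..Suc N}. [(N choose i)] \<cdot>\<^bsub>R\<^esub> ?a i) \<oplus> (\<Oplus>i\<in>{..N}. [(N choose i)] \<cdot>\<^bsub>R\<^esub> ?a (Suc i))"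
    unfolding nat_pow_Suc Suc.IH by (subst a_comm) (simp_all add: r_distr 1 2 Pi_def del: finsum_Suc)
  also have "(\<Oplus>i\<in>{..Suc N}. [(N choose i)] \<cdot>\<^bsub>R\<^esub> ?a i)
      = (\<Oplus>i\<in>{..N}. [(N choose Suc i)] \<cdot>\<^bsub>R\<^esub> ?a (Suc i)) \<oplus> [(1::nat)] \<cdot>\<^bsub>R\<^esub> ?a 0"
    by (subst finsum_Suc2) (simp_all add: Pi_def del: finsum_Suc)
  also have "(\<Oplus>i\<in>{..N}. [(N choose Suc i)] \<cdot>\<^bsub>R\<^esub> ?a (Suc i)) \<oplus> [(1::nat)] \<cdot>\<^bsub>R\<^esub> ?a 0 \<oplus> (\<Oplus>i\<in>{..N}. [(N choose i)] \<cdot>\<^bsub>R\<^esub> ?a (Suc i))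
      = (\<Oplus>i\<in>{..N}. [(Suc N choose Suc i)] \<cdot>\<^bsub>R\<^esub> ?a (Suc i)) \<oplus> [(Suc N choose 0)] \<cdot>\<^bsub>R\<^esub> ?a 0"
    by (simp add: Pi_def finsum_addf a_ac flip: add.nat_pow_mult del: add.nat_pow_Suc)
  also have "\<dots> = (\<Oplus>i\<in>{..Suc N}. [(Suc N choose i)] \<cdot>\<^bsub>R\<^esub> ?a i)"
    by (subst finsum_Suc2) (simp_all add: Pi_def del: finsum_Suc)
  finally show ?case .
qed

lemma (in cring) frobenius_add:
  assumes p: "Factorial_Ring.prime (p::nat)" "[p] \<cdot>\<^bsub>R\<^esub> \<one> = \<zero>" and ab: "a \<in> carrier R" "b \<in> carrier R"
  shows "(a \<oplus> b) [^] p = a [^] p \<oplus> b [^] p"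
proof -
  obtain N where N: "p = Suc N"
    using p(1) by (metis not_prime_0 old.nat.exhaust)
  let ?f = "\<lambda>i. [(Suc N choose i)] \<cdot>\<^bsub>R\<^esub> (a [^] i \<otimes> b [^] (Suc N - i))"
  have "?f (Suc i) = \<zero>" if "i < N" for i
    using that dvd_choose_prime[of "Suc i" "Suc N"] p ab
    by (intro add_pow_dvd[OF p(2)]) (simp_all add: N del: binomial_Suc_Suc)
  then have 0: "(\<Oplus>i\<in>{..<N}. ?f (Suc i)) = \<zero>"
    by (intro add.finprod_one_eqI) auto
  have "(a \<oplus> b) [^] p = (\<Oplus>i\<in>{..N}. ?f (Suc i)) \<oplus> ?f 0"
    using ab unfolding N binomial[OF ab] by (subst finsum_Suc2) (simp_all add: Pi_def)
  also have "(\<Oplus>i\<in>{..N}. ?f (Suc i)) = ?f (Suc N)"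
    using 0 ab unfolding lessThan_Suc_atMost[symmetric] lessThan_Suc
    by (subst finsum_insert) (auto simp del: binomial_Suc_Suc)
  finally show ?thesis using ab by (simp add: N)
qed

lemma (in cring) frobenius_hom:
  assumes p: "Factorial_Ring.prime (p::nat)" "[p] \<cdot>\<^bsub>R\<^esub> \<one> = \<zero>"
  shows "(\<lambda>a. a [^] p) \<in> ring_hom R R"
  by (rule ring_hom_memI) (simp_all add: frobenius_add[OF p] nat_pow_distrib)

lemma (in cring) finsum_pth_powers:
  assumes p: "Factorial_Ring.prime (p::nat)" "[p] \<cdot>\<^bsub>R\<^esub> \<one> = \<zero>" and "finite I" "\<And>i. i \<in> I \<Longrightarrow> h i \<in> pth_powers R p"
  shows "finsum R h I \<in> pth_powers R p"
  using assms(3,4)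
proof (induction I rule: finite_induct)
  case empty
  have "\<zero> = \<zero> [^] p" using p(1) by (simp add: nat_pow_zero prime_gt_0_nat)
  then show ?case unfolding pth_powers_def by auto
next
  case (insert i I)
  have sub: "pth_powers R p \<subseteq> carrier R" by (auto simp: pth_powers_def)
  have "h i \<in> pth_powers R p" "finsum R h I \<in> pth_powers R p"
    using insert by auto
  then obtain a b where ab: "a \<in> carrier R" "h i = a [^] p" "b \<in> carrier R" "finsum R h I = b [^] p"
    by (auto simp: pth_powers_def)
  have "finsum R h (insert i I) = h i \<oplus> finsum R h I"
    using insert sub by (intro finsum_insert) auto
  then have "finsum R h (insert i I) = (a \<oplus> b) [^] p"
    using ab by (simp add: frobenius_add[OF p])
  then show ?case using ab unfolding pth_powers_def by auto
qed

section \<open>The basis of ordered monomials of the Weyl algebra\<close>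

lemma monoid_words: "Group.monoid (words n)"
  by (rule monoidI) (auto simp: words_def)

lemma comm_monoid_monomials: "Group.comm_monoid (monomials n)"
  by (rule comm_monoidI) (auto simp: monomials_def)

lemma quotient_ring_hom_lift:
  assumes "ideal I F" "ring A" "h \<in> ring_hom F A" "\<forall>a\<in>I. h a = \<zero>\<^bsub>A\<^esub>"
  shows "\<exists>H \<in> ring_hom (F Quot I) A. \<forall>a \<in> carrier F. H (I +>\<^bsub>F\<^esub> a) = h a"
proof -
  interpret I: ideal I F by fact
  interpret A: ring A by fact
  interpret h: ring_hom_ring F A h
    by (rule ring_hom_ringI2[OF I.ring_axioms A.ring_axioms assms(3)])
  interpret Q: ring "F Quot I" by (rule I.quotient_is_ring)
  interpret q: ring_hom_ring F "F Quot I" "(+>\<^bsub>F\<^esub>) I" by (rule I.rcos_ring_hom_ring)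
  have wd: "h a = h b" if "a \<in> carrier F" "b \<in> carrier F" "I +>\<^bsub>F\<^esub> a = I +>\<^bsub>F\<^esub> b" for a b
  proof -
    have "a \<ominus>\<^bsub>F\<^esub> b \<in> I"
      using I.quotient_eq_iff_same_a_r_cos[OF I.ideal_axioms that(1,2)] that(3) by simp
    then have "h a \<ominus>\<^bsub>A\<^esub> h b = \<zero>\<^bsub>A\<^esub>"
      using bspec[OF assms(4), of "a \<ominus>\<^bsub>F\<^esub> b"] that by (simp add: a_minus_def)
    then show ?thesis using that by (simp add: A.r_right_minus_eq)
  qed
  have rep: "\<exists>a\<in>carrier F. C = I +>\<^bsub>F\<^esub> a" if "C \<in> carrier (F Quot I)" for C
    using that unfolding FactRing_def A_RCOSETS_def' by auto
  then obtain r where r: "\<And>C. C \<in> carrier (F Quot I) \<Longrightarrow> r C \<in> carrier F \<and> C = I +>\<^bsub>F\<^esub> r C"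
    by metis
  define H where "H = h \<circ> r"
  have H: "H (I +>\<^bsub>F\<^esub> a) = h a" if "a \<in> carrier F" for a
  proof -
    have "I +>\<^bsub>F\<^esub> a \<in> carrier (F Quot I)" using that by simp
    note rC = r[OF this]
    show ?thesis
      unfolding H_def comp_def by (rule wd[OF conjunct1[OF rC] that conjunct2[OF rC, symmetric]])
  qed
  have "H \<in> ring_hom (F Quot I) A"
  proof (rule ring_hom_memI)
    fix C D assume CD: "C \<in> carrier (F Quot I)" "D \<in> carrier (F Quot I)"
    obtain a where a: "a \<in> carrier F" "C = I +>\<^bsub>F\<^esub> a" using rep[OF CD(1)] by (elim bexE)
    obtain b where b: "b \<in> carrier F" "D = I +>\<^bsub>F\<^esub> b" using rep[OF CD(2)] by (elim bexE)
    show "H (C \<otimes>\<^bsub>F Quot I\<^esub> D) = H C \<otimes>\<^bsub>A\<^esub> H D"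
      unfolding a(2) b(2) q.hom_mult[OF a(1) b(1), symmetric] using a(1) b(1) by (simp add: H del: q.hom_mult q.hom_add)
    show "H (C \<oplus>\<^bsub>F Quot I\<^esub> D) = H C \<oplus>\<^bsub>A\<^esub> H D"
      unfolding a(2) b(2) q.hom_add[OF a(1) b(1), symmetric] using a(1) b(1) by (simp add: H del: q.hom_mult q.hom_add)
  next
    fix C assume "C \<in> carrier (F Quot I)"
    from rep[OF this] obtain a where a: "a \<in> carrier F" "C = I +>\<^bsub>F\<^esub> a" by (elim bexE)
    show "H C \<in> carrier A" unfolding a(2) using a(1) by (simp add: H)
  next
    show "H \<one>\<^bsub>F Quot I\<^esub> = \<one>\<^bsub>A\<^esub>" unfolding q.hom_one[symmetric] by (simp add: H del: q.hom_one)
  qed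
  then show ?thesis using H by (intro bexI[of _ H] ballI)
qed

section \<open>Operators on coefficient functions that satisfy the Weyl relations\<close>

definition coeff_space :: "('a, 'm) ring_scheme \<Rightarrow> ('g \<Rightarrow> 'a) set" where
  "coeff_space S = {v. \<forall>m. v m \<in> carrier S}"

text \<open>Additive maps on all coefficient functions, finitely supported or not, so that closure
  of the operators is immediate; finiteness of the supports that actually arise is proved separately
  in \<open>coef_poly\<close>. The maps are undefined outside the space so that equal endomorphisms
  are equal functions.\<close>

definition end_ring :: "('a, 'm) ring_scheme \<Rightarrow> (('g \<Rightarrow> 'a) \<Rightarrow> 'g \<Rightarrow> 'a) ring" where
  "end_ring S =
     \<lparr>carrier = {h \<in> coeff_space S \<rightarrow>\<^sub>E coeff_space S.
        \<forall>v\<in>coeff_space S. \<forall>w\<in>coeff_space S. h (\<lambda>m. v m \<oplus>\<^bsub>S\<^esub> w m) = (\<lambda>m. h v m \<oplus>\<^bsub>S\<^esub> h w m)},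
      monoid.mult = (\<lambda>g h. \<lambda>v\<in>coeff_space S. g (h v)),
      one = (\<lambda>v\<in>coeff_space S. v),
      ring.zero = (\<lambda>v\<in>coeff_space S. \<lambda>m. \<zero>\<^bsub>S\<^esub>),
      add = (\<lambda>g h. \<lambda>v\<in>coeff_space S. \<lambda>m. g v m \<oplus>\<^bsub>S\<^esub> h v m)\<rparr>"

definition mulvar :: "('a, 'm) ring_scheme \<Rightarrow> nat \<Rightarrow> (nat multiset \<Rightarrow> 'a) \<Rightarrow> nat multiset \<Rightarrow> 'a" where
  "mulvar S i v = (\<lambda>m. if i \<in># m then v (m - {#i#}) else \<zero>\<^bsub>S\<^esub>)"

text \<open>
  Left multiplication by the \<open>i\<close>-th generator in normal ordered coordinates: the first \<open>n\<close>
  generators multiply by a variable, and the generator \<open>n + j\<close> acts as \<open>x\<^sub>n\<^sub>+\<^sub>j + \<partial>\<^sub>j\<close>.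
\<close>
definition gen_op :: "nat \<Rightarrow> ('a, 'm) ring_scheme \<Rightarrow> nat \<Rightarrow> (nat multiset \<Rightarrow> 'a) \<Rightarrow> nat multiset \<Rightarrow> 'a" where
  "gen_op n S i v = (\<lambda>m. mulvar S i v m \<oplus>\<^bsub>S\<^esub> (if n < i then poly_partial S (i - n) v m else \<zero>\<^bsub>S\<^esub>))"

context cring
begin

lemma coeff_space_iff: "v \<in> coeff_space R \<longleftrightarrow> (\<forall>m. v m \<in> carrier R)"
  by (simp add: coeff_space_def)

lemma ring_end_ring: "ring (end_ring R)"
proof (rule ringI)
  show "abelian_group (end_ring R)"
  proof (rule abelian_groupI)
    fix h :: "('g \<Rightarrow> 'a) \<Rightarrow> 'g \<Rightarrow> 'a" assume h: "h \<in> carrier (end_ring R)"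
    then have [simp]: "h v m \<in> carrier R" if "v \<in> coeff_space R" for v m
      using that by (auto simp: end_ring_def coeff_space_def)
    show "\<exists>g\<in>carrier (end_ring R). g \<oplus>\<^bsub>end_ring R\<^esub> h = \<zero>\<^bsub>end_ring R\<^esub>"
    proof
      show "(\<lambda>v\<in>coeff_space R. \<lambda>m. \<ominus> h v m) \<in> carrier (end_ring R)"
        using h by (auto simp: end_ring_def coeff_space_def minus_add)
      show "(\<lambda>v\<in>coeff_space R. \<lambda>m. \<ominus> h v m) \<oplus>\<^bsub>end_ring R\<^esub> h = \<zero>\<^bsub>end_ring R\<^esub>"
        by (auto simp: end_ring_def l_neg)
    qed
  qed (auto simp: end_ring_def coeff_space_def a_ac PiE_def Pi_def extensional_def fun_eq_iff restrict_def)
  show "Group.monoid (end_ring R)"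
  proof (rule monoidI)
    fix g h :: "('g \<Rightarrow> 'a) \<Rightarrow> 'g \<Rightarrow> 'a"
    assume "g \<in> carrier (end_ring R)" "h \<in> carrier (end_ring R)"
    then have gh: "g \<in> coeff_space R \<rightarrow> coeff_space R" "h \<in> coeff_space R \<rightarrow> coeff_space R"
      "\<And>v w. v \<in> coeff_space R \<Longrightarrow> w \<in> coeff_space R \<Longrightarrow> g (\<lambda>m. v m \<oplus> w m) = (\<lambda>m. g v m \<oplus> g w m)"
      "\<And>v w. v \<in> coeff_space R \<Longrightarrow> w \<in> coeff_space R \<Longrightarrow> h (\<lambda>m. v m \<oplus> w m) = (\<lambda>m. h v m \<oplus> h w m)"
      by (auto simp: end_ring_def)
    moreover have "(\<lambda>m. v m \<oplus> w m) \<in> coeff_space R"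
      if "v \<in> coeff_space R" "w \<in> coeff_space R" for v w :: "'g \<Rightarrow> 'a"
      using that by (simp add: coeff_space_def)
    ultimately show "g \<otimes>\<^bsub>end_ring R\<^esub> h \<in> carrier (end_ring R)"
      by (auto simp: end_ring_def Pi_iff)
  qed (auto simp: end_ring_def coeff_space_def PiE_def Pi_def extensional_def fun_eq_iff restrict_def)
qed (auto simp: end_ring_def coeff_space_def PiE_def Pi_def extensional_def fun_eq_iff restrict_def)

lemma mulvar_closed [simp]: "v \<in> coeff_space R \<Longrightarrow> mulvar R i v \<in> coeff_space R"
  by (simp add: mulvar_def coeff_space_def)

lemma poly_partial_closed [simp]: "v \<in> coeff_space R \<Longrightarrow> poly_partial R i v \<in> coeff_space R"
  by (simp add: poly_partial_def coeff_space_def)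

lemma gen_op_closed [simp]: "v \<in> coeff_space R \<Longrightarrow> gen_op n R i v \<in> coeff_space R"
  using mulvar_closed poly_partial_closed by (auto simp: gen_op_def coeff_space_iff)

lemma poly_partial_add:
  assumes "v \<in> coeff_space R" "w \<in> coeff_space R"
  shows "poly_partial R i (\<lambda>m. v m \<oplus> w m) = (\<lambda>m. poly_partial R i v m \<oplus> poly_partial R i w m)"
  using assms by (simp add: poly_partial_def coeff_space_def add.nat_pow_distrib del: add.nat_pow_Suc)

lemma poly_partial_smult:
  assumes "v \<in> coeff_space R" "s \<in> carrier R"
  shows "poly_partial R i (\<lambda>m. s \<otimes> v m) = (\<lambda>m. s \<otimes> poly_partial R i v m)"
  using assms by (simp add: poly_partial_def coeff_space_def add_pow_rdistr del: add.nat_pow_Suc)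

lemma gen_op_add:
  assumes "v \<in> coeff_space R" "w \<in> coeff_space R"
  shows "gen_op n R i (\<lambda>m. v m \<oplus> w m) = (\<lambda>m. gen_op n R i v m \<oplus> gen_op n R i w m)"
  using assms poly_partial_closed[OF assms(1)] poly_partial_closed[OF assms(2)]
  by (auto simp: gen_op_def mulvar_def poly_partial_add a_ac coeff_space_iff)

lemma gen_op_smult:
  assumes "v \<in> coeff_space R" "s \<in> carrier R"
  shows "gen_op n R i (\<lambda>m. s \<otimes> v m) = (\<lambda>m. s \<otimes> gen_op n R i v m)"
  using assms poly_partial_closed[OF assms(1)]
  by (auto simp: gen_op_def mulvar_def poly_partial_smult r_distr coeff_space_iff)

lemma mulvar_commute: "mulvar R i (mulvar R j v) = mulvar R j (mulvar R i v)"
proof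
  fix m
  have "i \<in># m \<and> j \<in># m - {#i#} \<longleftrightarrow> j \<in># m \<and> i \<in># m - {#j#}"
    by (cases "i = j") (auto simp: in_diff_count)
  then show "mulvar R i (mulvar R j v) m = mulvar R j (mulvar R i v) m"
    by (auto simp: mulvar_def diff_diff_add add_mset_commute)
qed

lemma poly_partial_commute:
  assumes "v \<in> coeff_space R"
  shows "poly_partial R i (poly_partial R j v) = poly_partial R j (poly_partial R i v)"
  using assms
  by (cases "i = j") (simp_all add: poly_partial_def coeff_space_def add.nat_pow_pow mult.commute add_mset_commute del: add.nat_pow_Suc)

text \<open>The canonical commutation relation, which comes from (k + 1) v = k v + v. If the
  variable i = j is absent from m, the product vanishes there and the derivative contributes v m
  with multiplicity 1.\<close>

lemma poly_partial_mulvar: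
  assumes "v \<in> coeff_space R"
  shows "poly_partial R i (mulvar R j v) = (\<lambda>m. mulvar R j (poly_partial R i v) m \<oplus> (if i = j then v m else \<zero>))"
proof
  fix m
  note [simp] = assms[unfolded coeff_space_iff, rule_format]
  show "poly_partial R i (mulvar R j v) m = mulvar R j (poly_partial R i v) m \<oplus> (if i = j then v m else \<zero>)"
  proof (cases "i = j")
    case True
    show ?thesis
    proof (cases "i \<in># m")
      case True
      then have "Suc (count (m - {#i#}) i) = count m i"
        by (metis Suc_pred count_diff count_greater_zero_iff count_single diff_Suc_1 One_nat_def)
      then have "[count m i] \<cdot>\<^bsub>R\<^esub> v m = [(count (m - {#i#}) i)] \<cdot>\<^bsub>R\<^esub> v m \<oplus> v m"
        using add.nat_pow_Suc[of "count (m - {#i#}) i" "v m"] by (simp only:)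
      then show ?thesis using True \<open>i = j\<close>
        by (simp add: poly_partial_def mulvar_def del: count_diff)
    next
      case False
      then have "count m i = 0" by (simp add: not_in_iff)
      then show ?thesis using False \<open>i = j\<close>
        by (simp add: poly_partial_def mulvar_def)
    qed
  next
    case False
    then show ?thesis
      by (auto simp: poly_partial_def mulvar_def)
  qed
qed

text \<open>Each composite has four terms. Two multiplications commute and so do two derivatives,
  hence only the mixed terms contribute, by the canonical commutation relation.\<close>

lemma gen_op_commute:
  assumes v: "v \<in> coeff_space R" and "i \<in> {1..2 * n}" "j \<in> {1..2 * n}"
  shows "gen_op n R i (gen_op n R j v) m = gen_op n R j (gen_op n R i v) m \<oplus> omega R n i j \<otimes> v m"
proof -
  define P where "P i w = (\<lambda>m. if n < i then poly_partial R (i - n) w m else \<zero>)" for i and w :: "nat multiset \<Rightarrow> 'a"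
  have P: "P i w \<in> coeff_space R" if "w \<in> coeff_space R" for i w
    using that poly_partial_closed[OF that] by (auto simp: P_def coeff_space_iff)
  have G: "gen_op n R i w = (\<lambda>m. mulvar R i w m \<oplus> P i w m)" for i w
    by (simp add: gen_op_def P_def)
  have closed [simp]: "w m \<in> carrier R" if "w \<in> coeff_space R" for w m
    using that by (simp add: coeff_space_iff)
  have GG: "gen_op n R i (gen_op n R j v) m =
      mulvar R i (mulvar R j v) m \<oplus> mulvar R i (P j v) m \<oplus> (P i (mulvar R j v) m \<oplus> P i (P j v) m)" for i j
  proof -
    have "mulvar R i (gen_op n R j v) m = mulvar R i (mulvar R j v) m \<oplus> mulvar R i (P j v) m"
      by (simp add: G mulvar_def)
    moreover have "P i (gen_op n R j v) m = P i (mulvar R j v) m \<oplus> P i (P j v) m"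
      using v P[OF v] by (simp add: G P_def poly_partial_add)
    ultimately show ?thesis unfolding G[of i] by simp
  qed
  have PM: "P i (mulvar R j v) m = mulvar R j (P i v) m \<oplus> (if i = n + j then v m else \<zero>)"
    if "j \<in> {1..2 * n}" for i j
  proof (cases "n < i")
    case True
    then have "i - n = j \<longleftrightarrow> i = n + j" by auto
    then show ?thesis using True by (simp add: P_def poly_partial_mulvar[OF v])
  next
    case False
    \<comment> \<open>The operator \<open>P i\<close> is zero here, and i = n + j is excluded
      because j is at least 1.\<close>
    then show ?thesis using that by (auto simp: P_def mulvar_def)
  qed
  have PP: "P i (P j v) m = P j (P i v) m"
  proof -
    have z: "poly_partial R k (\<lambda>m. \<zero>) = (\<lambda>m. \<zero>)" for k by (simp add: poly_partial_def)
    show ?thesis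
      by (cases "n < i"; cases "n < j") (simp_all add: P_def z poly_partial_commute[OF v, of "i - n" "j - n"])
  qed
  note cl = closed[OF mulvar_closed[OF mulvar_closed[OF v]]] closed[OF mulvar_closed[OF P[OF v]]]
    closed[OF P[OF P[OF v]]] closed[OF v]
  have "gen_op n R j (gen_op n R i v) m \<oplus> omega R n i j \<otimes> v m =
      mulvar R i (mulvar R j v) m \<oplus> mulvar R i (P j v) m \<oplus> (mulvar R j (P i v) m \<oplus> P i (P j v) m)
      \<oplus> ((if j = n + i then v m else \<zero>) \<oplus> omega R n i j \<otimes> v m)"
    unfolding GG PM[OF assms(2)] PP mulvar_commute[of j i] using cl by (simp add: a_ac omega_def a_minus_def)
  also have "(if j = n + i then v m else \<zero>) \<oplus> omega R n i j \<otimes> v m = (if i = n + j then v m else \<zero>)"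
    using assms(2,3) closed[OF v] by (auto simp: omega_def a_minus_def l_minus r_neg)
  also have "mulvar R i (mulvar R j v) m \<oplus> mulvar R i (P j v) m \<oplus> (mulvar R j (P i v) m \<oplus> P i (P j v) m)
      \<oplus> (if i = n + j then v m else \<zero>) = gen_op n R i (gen_op n R j v) m"
    unfolding GG PM[OF assms(3)] using cl by (simp add: a_ac)
  finally show ?thesis by simp
qed

end

lemma (in abelian_group) add_minus_cancel:
  "a \<in> carrier G \<Longrightarrow> b \<in> carrier G \<Longrightarrow> a \<oplus> b \<ominus> a = b"
  by (simp add: a_minus_def a_comm[of a b] a_assoc r_neg)

section \<open>The Weyl algebra by generators and relations\<close>

locale weyl_algebra = S?: cring S for S :: "('a, 'm) ring_scheme" (structure) + fixes n :: nat
begin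

sublocale F: monoid_algebra S "words n"
  by (simp add: monoid_algebra_def monoid_words cring_axioms)

sublocale P: monoid_algebra S "monomials n"
  using comm_monoid_monomials by (simp add: monoid_algebra_def cring_axioms comm_monoid_def)

sublocale P: cring "monoid_ring S (monomials n)"
  by (rule P.cring_M[OF comm_monoid_monomials])

abbreviation "W \<equiv> weyl n S"
abbreviation "\<kappa> \<equiv> weyl_const n S"
abbreviation "x \<equiv> weyl_gen n S"

lemma free_alg_eq: "free_alg n S = F.M"
  by (simp add: free_alg_def)

lemma poly_alg_eq: "poly_alg n S = P.M"
  by (simp add: poly_alg_def)

lemma words_simps [simp]:
  "carrier (words n) = lists {1..2 * n}" "u \<otimes>\<^bsub>words n\<^esub> v = u @ v" "\<one>\<^bsub>words n\<^esub> = []"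
  by (simp_all add: words_def)

lemma monomials_simps [simp]:
  "carrier (monomials n) = {m. set_mset m \<subseteq> {1..2 * n}}" "u \<otimes>\<^bsub>monomials n\<^esub> v = u + v" "\<one>\<^bsub>monomials n\<^esub> = {#}"
  by (simp_all add: monomials_def)

lemma const_hom: "(\<lambda>r. single S r []) \<in> ring_hom S F.M"
  by (rule ring_hom_memI) (simp_all add: F.single_mult F.single_add F.one_eq)

lemma omega_closed [simp]: "omega S n i j \<in> carrier S"
  by (simp add: omega_def)

lemma weyl_rel_eq:
  "weyl_rel n S i j = (single S \<one> [i, j] \<ominus>\<^bsub>F.M\<^esub> single S \<one> [j, i]) \<ominus>\<^bsub>F.M\<^esub> single S (omega S n i j) []"
  by (simp add: weyl_rel_def Let_def free_alg_eq monoid_ring_gen_eq_single monoid_ring_const_eq_single F.single_mult)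

lemma weyl_rel_closed [simp]:
  "i \<in> {1..2 * n} \<Longrightarrow> j \<in> {1..2 * n} \<Longrightarrow> weyl_rel n S i j \<in> carrier F.M"
  by (simp add: weyl_rel_eq)

lemma weyl_gens_subset: "{weyl_rel n S i j | i j. i \<in> {1..2 * n} \<and> j \<in> {1..2 * n}} \<subseteq> carrier F.M"
  by (auto simp del: atLeastAtMost_iff)

lemma weyl_ideal: "ideal (weyl_ideal n S) F.M"
  unfolding weyl_ideal_def free_alg_eq by (rule F.M.genideal_ideal[OF weyl_gens_subset])

sublocale I: ideal "weyl_ideal n S" "monoid_ring S (words n)"
  by (rule weyl_ideal)

lemma W_eq: "W = F.M Quot weyl_ideal n S"
  by (simp add: weyl_def free_alg_eq)

sublocale W: ring "weyl n S"
  unfolding W_eq by (rule I.quotient_is_ring)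

lemma weyl_class_hom: "weyl_class n S \<in> ring_hom F.M W"
  unfolding W_eq weyl_class_def[abs_def] free_alg_eq by (rule I.rcos_ring_hom)

sublocale cl: ring_hom_ring "monoid_ring S (words n)" "weyl n S" "weyl_class n S"
  by (rule ring_hom_ringI2[OF F.M.ring_axioms W.ring_axioms weyl_class_hom])

lemma weyl_class_surj:
  assumes "w \<in> carrier W"
  obtains a where "a \<in> carrier F.M" "w = weyl_class n S a"
proof -
  have "\<exists>a\<in>carrier F.M. w = weyl_class n S a"
    using assms unfolding W_eq weyl_class_def free_alg_eq FactRing_def A_RCOSETS_def' by auto
  then show thesis using that by blast
qed

lemma const_eq: "\<kappa> r = weyl_class n S (single S r [])"
  by (simp add: weyl_const_def monoid_ring_const_eq_single)

lemma gen_eq: "x i = weyl_class n S (single S \<one> [i])"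
  by (simp add: weyl_gen_def monoid_ring_gen_eq_single)

lemma \<kappa>_hom: "\<kappa> \<in> ring_hom S W"
proof -
  have "\<kappa> = weyl_class n S \<circ> (\<lambda>r. single S r [])" by (auto simp: const_eq)
  then show ?thesis using ring_hom_trans[OF const_hom weyl_class_hom] by simp
qed

sublocale \<kappa>: ring_hom_ring S "weyl n S" "weyl_const n S"
  by (rule ring_hom_ringI2[OF S.ring_axioms W.ring_axioms \<kappa>_hom])

lemma x_closed [simp]: "i \<in> {1..2 * n} \<Longrightarrow> x i \<in> carrier W"
  unfolding gen_eq by (rule cl.hom_closed) simp

lemma weyl_class_rel: "i \<in> {1..2 * n} \<Longrightarrow> j \<in> {1..2 * n} \<Longrightarrow> weyl_class n S (weyl_rel n S i j) = \<zero>\<^bsub>W\<^esub>"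
  unfolding W_eq weyl_class_def free_alg_eq FactRing_def
  using F.M.genideal_self[OF weyl_gens_subset] I.a_rcos_const
  by (auto simp: weyl_ideal_def free_alg_eq)

lemma x_ad:
  assumes ij: "i \<in> {1..2 * n}" "j \<in> {1..2 * n}"
  shows "ad W (x i) (x j) = \<kappa> (omega S n i j)"
proof -
  have "x i \<otimes>\<^bsub>W\<^esub> x j \<ominus>\<^bsub>W\<^esub> x j \<otimes>\<^bsub>W\<^esub> x i \<ominus>\<^bsub>W\<^esub> \<kappa> (omega S n i j) = weyl_class n S (weyl_rel n S i j)"
    using ij unfolding weyl_rel_eq gen_eq const_eq
    by (simp add: F.single_mult a_minus_def flip: cl.hom_mult)
  then show ?thesis
    using ij weyl_class_rel[OF ij] by (simp add: ad_def W.r_right_minus_eq)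
qed

lemma \<kappa>_central:
  assumes "s \<in> carrier S" "w \<in> carrier W"
  shows "w \<otimes>\<^bsub>W\<^esub> \<kappa> s = \<kappa> s \<otimes>\<^bsub>W\<^esub> w"
proof -
  obtain a where a: "a \<in> carrier F.M" "w = weyl_class n S a" using weyl_class_surj assms(2) by blast
  have "a \<otimes>\<^bsub>F.M\<^esub> single S s [] = single S s [] \<otimes>\<^bsub>F.M\<^esub> a"
    using a(1)
    by (induction a rule: F.induct)
       (use assms(1) in \<open>simp_all add: F.single_mult F.M.l_distr F.M.r_distr S.m_comm\<close>)
  then show ?thesis
    unfolding a(2) const_eq using a(1) assms(1) by (simp flip: cl.hom_mult)
qed

text \<open>Every element is a combination of words, and a word grows by multiplication with
  generators from the left. The cases match the operators \<open>gen_op\<close>, which describe left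
  multiplication in coordinates.\<close>

lemma left_induct [consumes 1, case_names one add const gen]:
  assumes "w \<in> carrier W"
    and one: "Q \<one>\<^bsub>W\<^esub>"
    and add: "\<And>v w. v \<in> carrier W \<Longrightarrow> w \<in> carrier W \<Longrightarrow> Q v \<Longrightarrow> Q w \<Longrightarrow> Q (v \<oplus>\<^bsub>W\<^esub> w)"
    and const: "\<And>s w. s \<in> carrier S \<Longrightarrow> w \<in> carrier W \<Longrightarrow> Q w \<Longrightarrow> Q (\<kappa> s \<otimes>\<^bsub>W\<^esub> w)"
    and gen: "\<And>i w. i \<in> {1..2 * n} \<Longrightarrow> w \<in> carrier W \<Longrightarrow> Q w \<Longrightarrow> Q (x i \<otimes>\<^bsub>W\<^esub> w)"
  shows "Q w"
proof -
  obtain a where a: "a \<in> carrier F.M" "w = weyl_class n S a" using weyl_class_surj assms(1) by blast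
  have word: "Q (weyl_class n S (single S \<one> u))" if "u \<in> lists {1..2 * n}" for u
    using that
  proof (induction u)
    case Nil
    then show ?case using one by (simp flip: F.one_eq[simplified])
  next
    case (Cons i u)
    then have "weyl_class n S (single S \<one> (i # u)) = x i \<otimes>\<^bsub>W\<^esub> weyl_class n S (single S \<one> u)"
      by (simp add: gen_eq F.single_mult flip: cl.hom_mult)
    then show ?case using Cons gen by simp
  qed
  have "Q (weyl_class n S a)"
    using a(1)
  proof (induction a rule: F.induct)
    case zero
    have "\<zero>\<^bsub>W\<^esub> = \<kappa> \<zero> \<otimes>\<^bsub>W\<^esub> \<one>\<^bsub>W\<^esub>" by simp
    then show ?case using const[OF _ _ one, of \<zero>] by simp
  next
    case (single r u)
    then have "weyl_class n S (single S r u) = \<kappa> r \<otimes>\<^bsub>W\<^esub> weyl_class n S (single S \<one> u)"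
      by (simp add: const_eq F.single_mult flip: cl.hom_mult)
    then show ?case using single const word by simp
  next
    case (add a b)
    then show ?case using assms(3) by simp
  qed
  then show ?thesis by (simp add: a)
qed

text \<open>The target may be noncommutative. It suffices that scalars commute with the images of
  the generators, since words in these images inherit the property.\<close>

lemma universal:
  assumes "ring A" "c \<in> ring_hom S A" "\<And>i. i \<in> {1..2 * n} \<Longrightarrow> t i \<in> carrier A"
    and central: "\<And>s i. s \<in> carrier S \<Longrightarrow> i \<in> {1..2 * n} \<Longrightarrow> t i \<otimes>\<^bsub>A\<^esub> c s = c s \<otimes>\<^bsub>A\<^esub> t i"
    and rel: "\<And>i j. i \<in> {1..2 * n} \<Longrightarrow> j \<in> {1..2 * n} \<Longrightarrow>
      t i \<otimes>\<^bsub>A\<^esub> t j = t j \<otimes>\<^bsub>A\<^esub> t i \<oplus>\<^bsub>A\<^esub> c (omega S n i j)"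
  obtains H where "H \<in> ring_hom W A" "\<And>s. s \<in> carrier S \<Longrightarrow> H (\<kappa> s) = c s"
    "\<And>i. i \<in> {1..2 * n} \<Longrightarrow> H (x i) = t i"
proof -
  interpret A: ring A by fact
  interpret c: ring_hom_ring S A c
    by (rule ring_hom_ringI2[OF S.ring_axioms A.ring_axioms assms(2)])
  define \<phi> where "\<phi> u = foldr (\<lambda>i h. t i \<otimes>\<^bsub>A\<^esub> h) u \<one>\<^bsub>A\<^esub>" for u
  have \<phi>_Cons: "\<phi> (i # u) = t i \<otimes>\<^bsub>A\<^esub> \<phi> u" for i u by (simp add: \<phi>_def)
  have \<phi>1: "\<phi> u \<in> carrier A" if "u \<in> lists {1..2 * n}" for u
    using that by (induction u) (simp_all add: \<phi>_def assms(3))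
  have \<phi>2: "\<phi> (u @ v) = \<phi> u \<otimes>\<^bsub>A\<^esub> \<phi> v" if "u \<in> lists {1..2 * n}" "v \<in> lists {1..2 * n}" for u v
    using that(1)
  proof (induction u)
    case Nil
    then show ?case using \<phi>1[OF that(2)] by (simp add: \<phi>_def)
  next
    case (Cons i u)
    then have "\<phi> ((i # u) @ v) = t i \<otimes>\<^bsub>A\<^esub> (\<phi> u \<otimes>\<^bsub>A\<^esub> \<phi> v)" by (simp add: \<phi>_def)
    also have "\<dots> = \<phi> (i # u) \<otimes>\<^bsub>A\<^esub> \<phi> v"
      using Cons \<phi>1[of u] \<phi>1[OF that(2)] assms(3)[of i] by (simp add: A.m_assoc[symmetric]) (simp add: \<phi>_def)
    finally show ?case .
  qed
  have \<phi>3: "\<phi> u \<otimes>\<^bsub>A\<^esub> c s = c s \<otimes>\<^bsub>A\<^esub> \<phi> u" if "s \<in> carrier S" "u \<in> lists {1..2 * n}" for s u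
    using that(2)
  proof (induction u)
    case Nil
    then show ?case using that(1) by (simp add: \<phi>_def)
  next
    case (Cons i u)
    have [simp]: "t i \<in> carrier A" "\<phi> u \<in> carrier A" "c s \<in> carrier A"
      using Cons assms(3) \<phi>1 that(1) by auto
    have "\<phi> (i # u) \<otimes>\<^bsub>A\<^esub> c s = t i \<otimes>\<^bsub>A\<^esub> (\<phi> u \<otimes>\<^bsub>A\<^esub> c s)"
      by (simp add: \<phi>_Cons A.m_assoc)
    also have "\<dots> = t i \<otimes>\<^bsub>A\<^esub> c s \<otimes>\<^bsub>A\<^esub> \<phi> u" using Cons by (simp add: A.m_assoc)
    also have "\<dots> = c s \<otimes>\<^bsub>A\<^esub> t i \<otimes>\<^bsub>A\<^esub> \<phi> u" using central[OF that(1), of i] Cons by simp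
    also have "\<dots> = c s \<otimes>\<^bsub>A\<^esub> \<phi> (i # u)" by (simp add: \<phi>_Cons A.m_assoc)
    finally show ?case .
  qed
  define h where "h = lin_ext S A c \<phi>"
  have h: "h \<in> ring_hom F.M A"
    unfolding h_def
    by (rule F.lin_ext_ring_hom[OF assms(1,2)]) (use \<phi>1 \<phi>2 \<phi>3 in \<open>auto simp: \<phi>_def\<close>)
  have h_single: "h (single S r u) = c r \<otimes>\<^bsub>A\<^esub> \<phi> u" if "r \<in> carrier S" "u \<in> lists {1..2 * n}" for r u
    unfolding h_def by (rule F.lin_ext_single[where \<phi> = \<phi>, OF assms(1,2)]) (use \<phi>1 that in auto)
  interpret h: ring_hom_ring F.M A h
    by (rule ring_hom_ringI2[OF F.M.ring_axioms A.ring_axioms h])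
  have "h (weyl_rel n S i j) = \<zero>\<^bsub>A\<^esub>" if "i \<in> {1..2 * n}" "j \<in> {1..2 * n}" for i j
  proof -
    have [simp]: "t i \<in> carrier A" "t j \<in> carrier A" "c (omega S n i j) \<in> carrier A"
      using assms(3) that by auto
    have "h (weyl_rel n S i j) = t i \<otimes>\<^bsub>A\<^esub> t j \<ominus>\<^bsub>A\<^esub> t j \<otimes>\<^bsub>A\<^esub> t i \<ominus>\<^bsub>A\<^esub> c (omega S n i j)"
      using that by (simp add: weyl_rel_eq a_minus_def h_single \<phi>_def)
    then show ?thesis
      unfolding rel[OF that] by (simp add: A.add_minus_cancel a_minus_def[symmetric] A.r_right_minus_eq)
  qed
  then have "{weyl_rel n S i j | i j. i \<in> {1..2 * n} \<and> j \<in> {1..2 * n}} \<subseteq> a_kernel F.M A h"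
    using weyl_gens_subset unfolding a_kernel_def' by blast
  then have "weyl_ideal n S \<subseteq> a_kernel F.M A h"
    unfolding weyl_ideal_def free_alg_eq by (rule F.M.genideal_minimal[OF h.kernel_is_ideal])
  from subsetD[OF this] have h_zero: "\<forall>a\<in>weyl_ideal n S. h a = \<zero>\<^bsub>A\<^esub>"
    unfolding a_kernel_def' by simp
  obtain H where H: "H \<in> ring_hom (F.M Quot weyl_ideal n S) A"
      "\<And>a. a \<in> carrier F.M \<Longrightarrow> H (weyl_ideal n S +>\<^bsub>F.M\<^esub> a) = h a"
    using quotient_ring_hom_lift[OF weyl_ideal A.ring_axioms h h_zero] by (elim bexE) simp
  show thesis
  proof
    show "H \<in> ring_hom W A" using H(1) by (simp add: W_eq)
    show "H (\<kappa> s) = c s" if "s \<in> carrier S" for s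
      using that H(2)[of "single S s []"] by (simp add: const_eq weyl_class_def free_alg_eq h_single \<phi>_def)
    show "H (x i) = t i" if "i \<in> {1..2 * n}" for i
      using that H(2)[of "single S \<one> [i]"] assms(3)[OF that]
      by (simp add: gen_eq weyl_class_def free_alg_eq h_single \<phi>_def)
  qed
qed

text \<open>The universal property gives a representation by the operators \<open>gen_op\<close>;
  applying it to the constant polynomial 1 produces a function of w with these properties.\<close>

lemma ex_coef:
  "\<exists>coef. (\<forall>w \<in> carrier W. coef w \<in> coeff_space S) \<and> coef \<one>\<^bsub>W\<^esub> = single S \<one> {#} \<and>
     (\<forall>v \<in> carrier W. \<forall>w \<in> carrier W. coef (v \<oplus>\<^bsub>W\<^esub> w) = (\<lambda>m. coef v m \<oplus> coef w m)) \<and>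
     (\<forall>s \<in> carrier S. \<forall>w \<in> carrier W. coef (\<kappa> s \<otimes>\<^bsub>W\<^esub> w) = (\<lambda>m. s \<otimes> coef w m)) \<and>
     (\<forall>i \<in> {1..2 * n}. \<forall>w \<in> carrier W. coef (x i \<otimes>\<^bsub>W\<^esub> w) = gen_op n S i (coef w))"
proof -
  let ?V = "coeff_space S :: (nat multiset \<Rightarrow> 'a) set" and ?E = "end_ring S :: ((nat multiset \<Rightarrow> 'a) \<Rightarrow> nat multiset \<Rightarrow> 'a) ring"
  define c where "c s = (\<lambda>v\<in>?V. \<lambda>m. s \<otimes> v m)" for s
  define t where "t i = (\<lambda>v\<in>?V. gen_op n S i v)" for i
  interpret E: ring ?E by (rule ring_end_ring)
  have sV: "(\<lambda>m. s \<otimes> v m) \<in> ?V" if "s \<in> carrier S" "v \<in> ?V" for s v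
    using that by (simp add: coeff_space_def)
  have aV: "(\<lambda>m. w m \<oplus> v m) \<in> ?V" if "w \<in> ?V" "v \<in> ?V" for w v
    using that by (simp add: coeff_space_def)
  have t: "t i \<in> carrier ?E" for i
    using aV by (auto simp: end_ring_def t_def gen_op_add)
  have c: "c \<in> ring_hom S ?E"
  proof (rule ring_hom_memI)
    show "c s \<in> carrier ?E" if "s \<in> carrier S" for s
      using aV that by (auto simp: end_ring_def c_def coeff_space_def r_distr)
  qed (auto simp: end_ring_def c_def coeff_space_def l_distr m_assoc restrict_def fun_eq_iff)
  obtain H where H: "H \<in> ring_hom W ?E" "\<And>s. s \<in> carrier S \<Longrightarrow> H (\<kappa> s) = c s"
    "\<And>i. i \<in> {1..2 * n} \<Longrightarrow> H (x i) = t i"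
  proof (rule universal[where t = t, OF E.ring_axioms c t])
    fix s i assume "s \<in> carrier S" "i \<in> {1..2 * n}"
    then show "t i \<otimes>\<^bsub>?E\<^esub> c s = c s \<otimes>\<^bsub>?E\<^esub> t i"
      by (auto simp: end_ring_def t_def c_def gen_op_smult sV restrict_def fun_eq_iff)
  next
    fix i j assume ij: "i \<in> {1..2 * n}" "j \<in> {1..2 * n}"
    show "t i \<otimes>\<^bsub>?E\<^esub> t j = t j \<otimes>\<^bsub>?E\<^esub> t i \<oplus>\<^bsub>?E\<^esub> c (omega S n i j)"
      using gen_op_commute[OF _ ij] by (auto simp: end_ring_def t_def c_def restrict_def fun_eq_iff)
  qed blast
  interpret H: ring_hom_ring W ?E H
    by (rule ring_hom_ringI2[OF W.ring_axioms E.ring_axioms H(1)])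
  define e where "e = (single S \<one> {#} :: nat multiset \<Rightarrow> 'a)"
  have e: "e \<in> ?V" by (simp add: e_def single_def coeff_space_def)
  have HV: "H w v \<in> ?V" if "w \<in> carrier W" "v \<in> ?V" for w v
    using H.hom_closed[OF that(1)] that(2) by (auto simp: end_ring_def)
  show ?thesis
  proof (intro exI[of _ "\<lambda>w. H w e"] conjI ballI)
    show "H \<one>\<^bsub>W\<^esub> e = single S \<one> {#}" using e by (simp add: end_ring_def e_def)
  qed (use e HV in \<open>simp_all add: H end_ring_def c_def t_def del: atLeastAtMost_iff\<close>)
qed

text \<open>The normal ordered coordinates. By \<open>left_induct\<close> the listed properties
  determine them on the carrier, so the choice is only a way to name them.\<close>

definition "coef = (SOME coef. (\<forall>w \<in> carrier W. coef w \<in> coeff_space S) \<and> coef \<one>\<^bsub>W\<^esub> = single S \<one> {#} \<and>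
     (\<forall>v \<in> carrier W. \<forall>w \<in> carrier W. coef (v \<oplus>\<^bsub>W\<^esub> w) = (\<lambda>m. coef v m \<oplus> coef w m)) \<and>
     (\<forall>s \<in> carrier S. \<forall>w \<in> carrier W. coef (\<kappa> s \<otimes>\<^bsub>W\<^esub> w) = (\<lambda>m. s \<otimes> coef w m)) \<and>
     (\<forall>i \<in> {1..2 * n}. \<forall>w \<in> carrier W. coef (x i \<otimes>\<^bsub>W\<^esub> w) = gen_op n S i (coef w)))"

lemma
  coef_closed: "w \<in> carrier W \<Longrightarrow> coef w \<in> coeff_space S"
  and coef_one: "coef \<one>\<^bsub>W\<^esub> = single S \<one> {#}"
  and coef_add: "v \<in> carrier W \<Longrightarrow> w \<in> carrier W \<Longrightarrow> coef (v \<oplus>\<^bsub>W\<^esub> w) = (\<lambda>m. coef v m \<oplus> coef w m)"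
  and coef_smult: "s \<in> carrier S \<Longrightarrow> w \<in> carrier W \<Longrightarrow> coef (\<kappa> s \<otimes>\<^bsub>W\<^esub> w) = (\<lambda>m. s \<otimes> coef w m)"
  and coef_gen: "i \<in> {1..2 * n} \<Longrightarrow> w \<in> carrier W \<Longrightarrow> coef (x i \<otimes>\<^bsub>W\<^esub> w) = gen_op n S i (coef w)"
  using someI_ex[OF ex_coef, folded coef_def] by blast+

end

section \<open>Commutators with powers, and the basis theorem for ordered monomials\<close>

context ring
begin

lemma pow_deriv_zero [simp]: "z \<in> carrier R \<Longrightarrow> pow_deriv R z \<zero> N = \<zero>"
  by (induction N) simp_all

lemma pow_deriv_one: "z \<in> carrier R \<Longrightarrow> pow_deriv R z \<one> N = [N] \<cdot>\<^bsub>R\<^esub> (z [^] (N - 1))"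
proof (induction N)
  case (Suc N)
  then show ?case
    by (cases N) (simp_all add: add_pow_ldistr l_distr)
qed simp

lemma ad_pow:
  assumes "t \<in> carrier R" "z \<in> carrier R"
  shows "ad R t (z [^] (N::nat)) = pow_deriv R z (ad R t z) N"
  by (rule derivation_nat_pow[OF ring_axioms]) (use assms in \<open>simp_all add: ad_mult\<close>)

lemma ad_eq_zero_iff:
  assumes "z \<in> carrier R" "d \<in> carrier R"
  shows "ad R z d = \<zero> \<longleftrightarrow> z \<otimes> d = d \<otimes> z"
  using assms by (simp add: ad_def r_right_minus_eq)

end

context weyl_algebra
begin

lemma mulvar_poly [simp]:
  assumes a: "a \<in> carrier P.M" and i: "i \<in> {1..2 * n}"
  shows "mulvar S i a \<in> carrier P.M"
proof -
  have sub: "{m. mulvar S i a m \<noteq> \<zero>} \<subseteq> add_mset i ` {m. a m \<noteq> \<zero>}"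
  proof
    fix m assume "m \<in> {m. mulvar S i a m \<noteq> \<zero>}"
    then have "i \<in># m" "a (m - {#i#}) \<noteq> \<zero>" by (auto simp: mulvar_def split: if_splits)
    then show "m \<in> add_mset i ` {m. a m \<noteq> \<zero>}" by (intro image_eqI[of _ _ "m - {#i#}"]) auto
  qed
  have "finite {m. mulvar S i a m \<noteq> \<zero>}"
    by (rule finite_subset[OF sub]) (simp add: P.finite_support[OF a])
  moreover have "{m. mulvar S i a m \<noteq> \<zero>} \<subseteq> carrier (monomials n)"
    using sub P.support_subset[OF a] i by fastforce
  ultimately show ?thesis
    using P.coeff_closed[OF a] by (simp add: P.carrier_iff mulvar_def)
qed

lemma poly_partial_poly [simp]:
  assumes a: "a \<in> carrier P.M"
  shows "poly_partial S i a \<in> carrier P.M"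
proof -
  note [simp] = P.coeff_closed[OF a]
  have sub: "{m. poly_partial S i a m \<noteq> \<zero>} \<subseteq> (\<lambda>m. m - {#i#}) ` {m. a m \<noteq> \<zero>}"
  proof
    fix m assume "m \<in> {m. poly_partial S i a m \<noteq> \<zero>}"
    then have "a (add_mset i m) \<noteq> \<zero>" by (auto simp: poly_partial_def)
    then show "m \<in> (\<lambda>m. m - {#i#}) ` {m. a m \<noteq> \<zero>}" by (intro image_eqI[of _ _ "add_mset i m"]) auto
  qed
  have "finite {m. poly_partial S i a m \<noteq> \<zero>}"
    by (rule finite_subset[OF sub]) (simp add: P.finite_support[OF a])
  moreover have "{m. poly_partial S i a m \<noteq> \<zero>} \<subseteq> carrier (monomials n)"
    using sub P.support_subset[OF a] by (force dest: in_diffD)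
  ultimately show ?thesis
    by (simp add: P.carrier_iff poly_partial_def)
qed

lemma poly_in_coeff_space: "a \<in> carrier P.M \<Longrightarrow> a \<in> coeff_space S"
  using P.coeff_closed by (auto simp: coeff_space_def)

lemma gen_op_eq_add:
  "gen_op n S i a = mulvar S i a \<oplus>\<^bsub>P.M\<^esub> (if n < i then poly_partial S (i - n) a else \<zero>\<^bsub>P.M\<^esub>)"
  by (auto simp: gen_op_def P.add_apply P.zero_apply)

lemma gen_op_poly [simp]: "a \<in> carrier P.M \<Longrightarrow> i \<in> {1..2 * n} \<Longrightarrow> gen_op n S i a \<in> carrier P.M"
  by (simp add: gen_op_eq_add del: atLeastAtMost_iff)

lemma smult_poly [simp]:
  assumes "a \<in> carrier P.M" "s \<in> carrier S"
  shows "(\<lambda>m. s \<otimes> a m) \<in> carrier P.M"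
proof -
  have "{m. s \<otimes> a m \<noteq> \<zero>} \<subseteq> {m. a m \<noteq> \<zero>}" using assms(2) by auto
  then show ?thesis
    using assms P.coeff_closed[OF assms(1)] P.finite_support[OF assms(1)] P.support_subset[OF assms(1)]
    unfolding P.carrier_iff by (auto intro: finite_subset)
qed

lemma coef_poly: "w \<in> carrier W \<Longrightarrow> coef w \<in> carrier P.M"
proof (induction w rule: left_induct)
  case (add v w)
  then have "coef v \<oplus>\<^bsub>P.M\<^esub> coef w \<in> carrier P.M" by simp
  moreover have "coef v \<oplus>\<^bsub>P.M\<^esub> coef w = coef (v \<oplus>\<^bsub>W\<^esub> w)"
    using add by (auto simp: coef_add P.add_apply)
  ultimately show ?case by simp
qed (simp_all add: coef_one coef_smult coef_gen del: atLeastAtMost_iff)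

text \<open>The order of the factors is given by a list and the exponents by a function, so that an
  ordered monomial can be cut into two blocks of mutually commuting generators.\<close>

definition "pw L e = foldr (\<lambda>i r. x i [^]\<^bsub>W\<^esub> (e i :: nat) \<otimes>\<^bsub>W\<^esub> r) L \<one>\<^bsub>W\<^esub>"

definition "ordmon m = pw [1..<2 * n + 1] (count m)"

lemma pw_Nil [simp]: "pw [] e = \<one>\<^bsub>W\<^esub>"
  by (simp add: pw_def)

lemma pw_Cons: "pw (i # L) e = x i [^]\<^bsub>W\<^esub> e i \<otimes>\<^bsub>W\<^esub> pw L e"
  by (simp add: pw_def)

lemma pw_closed [simp]: "set L \<subseteq> {1..2 * n} \<Longrightarrow> pw L e \<in> carrier W"
  by (induction L) (simp_all add: pw_Cons)

lemma pw_cong: "(\<And>i. i \<in> set L \<Longrightarrow> e i = e' i) \<Longrightarrow> pw L e = pw L e'"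
  by (induction L) (simp_all add: pw_Cons)

lemma pw_append:
  "set L \<subseteq> {1..2 * n} \<Longrightarrow> set L' \<subseteq> {1..2 * n} \<Longrightarrow> pw (L @ L') e = pw L e \<otimes>\<^bsub>W\<^esub> pw L' e"
  by (induction L) (simp_all add: pw_Cons W.m_assoc)

lemma ordmon_closed [simp]: "ordmon m \<in> carrier W"
  by (auto simp: ordmon_def intro!: pw_closed)

lemma ad_pw_zero:
  assumes "t \<in> carrier W" "set L \<subseteq> {1..2 * n}" "\<And>j. j \<in> set L \<Longrightarrow> ad W t (x j) = \<zero>\<^bsub>W\<^esub>"
  shows "ad W t (pw L e) = \<zero>\<^bsub>W\<^esub>"
  using assms(2,3)
  by (induction L) (use assms(1) in \<open>simp_all add: pw_Cons W.ad_mult W.ad_pow\<close>)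

text \<open>A commutator is a derivation, and here only the variable k is not annihilated. If e k =
  0, the multiple is zero and the truncated exponent does not matter.\<close>

lemma ad_pw_single:
  assumes "t \<in> carrier W" "set L \<subseteq> {1..2 * n}" "distinct L" "k \<in> set L"
    and "ad W t (x k) = \<one>\<^bsub>W\<^esub>" "\<And>j. j \<in> set L \<Longrightarrow> j \<noteq> k \<Longrightarrow> ad W t (x j) = \<zero>\<^bsub>W\<^esub>"
  shows "ad W t (pw L e) = [(e k)] \<cdot>\<^bsub>W\<^esub> pw L (e(k := e k - 1))"
  using assms(2,3,4,6)
proof (induction L)
  case (Cons j L)
  show ?case
  proof (cases "j = k")
    case True
    have "ad W t (pw L e) = \<zero>\<^bsub>W\<^esub>" using Cons True assms(1) by (intro ad_pw_zero) auto
    moreover have "pw L (e(k := e k - 1)) = pw L e" using Cons True by (intro pw_cong) auto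
    ultimately show ?thesis
      using True Cons assms(1,5)
      by (simp add: pw_Cons W.ad_mult W.ad_pow W.pow_deriv_one W.add_pow_ldistr fun_upd_def)
  next
    case False
    then show ?thesis
      using Cons assms(1)
      by (simp add: pw_Cons W.ad_mult W.ad_pow W.add_pow_rdistr fun_upd_def)
  qed
qed simp

lemma gen_pw:
  assumes "set L \<subseteq> {1..2 * n}" "distinct L" "i \<in> set L" "\<And>j. j \<in> set L \<Longrightarrow> ad W (x i) (x j) = \<zero>\<^bsub>W\<^esub>"
  shows "x i \<otimes>\<^bsub>W\<^esub> pw L e = pw L (e(i := Suc (e i)))"
  using assms
proof (induction L)
  case (Cons j L)
  have [simp]: "x i \<in> carrier W" "x j \<in> carrier W" "pw L e \<in> carrier W" using Cons by auto
  have "ad W (x i) (x j [^]\<^bsub>W\<^esub> e j) = \<zero>\<^bsub>W\<^esub>" using Cons by (simp add: W.ad_pow)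
  then have c: "x i \<otimes>\<^bsub>W\<^esub> x j [^]\<^bsub>W\<^esub> e j = x j [^]\<^bsub>W\<^esub> e j \<otimes>\<^bsub>W\<^esub> x i" by (simp add: W.ad_eq_zero_iff)
  have "x i \<otimes>\<^bsub>W\<^esub> pw (j # L) e = x j [^]\<^bsub>W\<^esub> e j \<otimes>\<^bsub>W\<^esub> x i \<otimes>\<^bsub>W\<^esub> pw L e"
    by (simp add: pw_Cons W.m_assoc[symmetric] c)
  also have "\<dots> = pw (j # L) (e(i := Suc (e i)))"
  proof (cases "j = i")
    case True
    then have "pw L (e(i := Suc (e i))) = pw L e" using Cons by (intro pw_cong) auto
    then show ?thesis using True by (simp add: pw_Cons)
  next
    case False
    then show ?thesis using Cons by (simp add: pw_Cons W.m_assoc fun_upd_def)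
  qed
  finally show ?case .
qed simp

lemma omega_eq:
  assumes "i \<in> {1..2 * n}" "j \<in> {1..2 * n}"
  shows "omega S n i j = (if i = n + j then \<one> else if j = n + i then \<ominus> \<one> else \<zero>)"
  using assms by (auto simp: omega_def a_minus_def)

lemma ordmon_split: "ordmon m = pw [1..<n + 1] (count m) \<otimes>\<^bsub>W\<^esub> pw [n + 1..<2 * n + 1] (count m)"
proof -
  have eq: "[1..<2 * n + 1] = [1..<n + 1] @ [n + 1..<2 * n + 1]"
    using upt_add_eq_append[of 1 "n + 1" n] by (simp add: mult_2)
  have "ordmon m = pw ([1..<n + 1] @ [n + 1..<2 * n + 1]) (count m)"
    unfolding ordmon_def eq ..
  also have "\<dots> = pw [1..<n + 1] (count m) \<otimes>\<^bsub>W\<^esub> pw [n + 1..<2 * n + 1] (count m)"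
    by (rule pw_append) auto
  finally show ?thesis .
qed

text \<open>For i \<le> n the generator commutes with the first block and joins it. For i > n it has
  to pass the first block, where its commutator is the derivative in the variable i - n, before it
  joins the second block.\<close>

lemma gen_ordmon:
  assumes i: "i \<in> {1..2 * n}"
  shows "x i \<otimes>\<^bsub>W\<^esub> ordmon m = ordmon (add_mset i m) \<oplus>\<^bsub>W\<^esub>
    (if n < i then [(count m (i - n))] \<cdot>\<^bsub>W\<^esub> ordmon (m - {#i - n#}) else \<zero>\<^bsub>W\<^esub>)"
proof -
  define A B where AB: "A = [1..<n + 1]" "B = [n + 1..<2 * n + 1]"
  let ?e = "count m"
  have [simp]: "x i \<in> carrier W" using i by (rule x_closed)
  have L: "set A \<subseteq> {1..2 * n}" "distinct A" and R: "set B \<subseteq> {1..2 * n}" "distinct B"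
    and A_iff: "j \<in> set A \<longleftrightarrow> 1 \<le> j \<and> j \<le> n" and B_iff: "j \<in> set B \<longleftrightarrow> n + 1 \<le> j \<and> j \<le> 2 * n" for j
    by (auto simp: AB)
  note osplit = ordmon_split[folded AB]
  have cl [simp]: "pw A e \<in> carrier W" "pw B e \<in> carrier W" for e
    using pw_closed[OF L(1)] pw_closed[OF R(1)] by auto
  have e: "count (add_mset i m) = ?e(i := Suc (?e i))" by auto
  show ?thesis
  proof (cases "n < i")
    case False
    have "x i \<otimes>\<^bsub>W\<^esub> pw A ?e = pw A (?e(i := Suc (?e i)))"
      by (rule gen_pw[OF L]) (use i False in \<open>auto simp: x_ad omega_eq A_iff B_iff\<close>)
    moreover have "pw B (?e(i := Suc (?e i))) = pw B ?e" using False by (intro pw_cong) (auto simp: B_iff)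
    ultimately show ?thesis using False by (simp add: osplit e W.m_assoc[symmetric])
  next
    case True
    define k where "k = i - n"
    have k: "k \<in> {1..n}" "i = n + k" using True i by (auto simp: k_def)
    have 1: "x i \<otimes>\<^bsub>W\<^esub> pw B ?e = pw B (?e(i := Suc (?e i)))"
      by (rule gen_pw[OF R]) (use i True in \<open>auto simp: x_ad omega_eq A_iff B_iff\<close>)
    have 2: "pw A (?e(i := Suc (?e i))) = pw A ?e" using True by (intro pw_cong) (auto simp: A_iff)
    have 3: "ad W (x i) (pw A ?e) = [(?e k)] \<cdot>\<^bsub>W\<^esub> pw A (?e(k := ?e k - 1))"
      by (rule ad_pw_single[OF _ L]) (use i k in \<open>auto simp: x_ad omega_eq A_iff B_iff\<close>)
    have 4: "pw B (?e(k := ?e k - 1)) = pw B ?e" using k by (intro pw_cong) (auto simp: B_iff)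
    have 5: "count (m - {#k#}) = ?e(k := ?e k - 1)" by auto
    have "x i \<otimes>\<^bsub>W\<^esub> ordmon m = (pw A ?e \<otimes>\<^bsub>W\<^esub> x i \<oplus>\<^bsub>W\<^esub> ad W (x i) (pw A ?e)) \<otimes>\<^bsub>W\<^esub> pw B ?e"
      by (simp add: osplit W.m_assoc[symmetric] W.mult_eq_ad[of "x i" "pw A ?e"])
    also have "\<dots> = pw A ?e \<otimes>\<^bsub>W\<^esub> (x i \<otimes>\<^bsub>W\<^esub> pw B ?e)
        \<oplus>\<^bsub>W\<^esub> [(?e k)] \<cdot>\<^bsub>W\<^esub> (pw A (?e(k := ?e k - 1)) \<otimes>\<^bsub>W\<^esub> pw B ?e)"
      by (simp add: W.l_distr W.m_assoc 3 W.add_pow_ldistr)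
    finally show ?thesis
      unfolding 1 using True by (simp only: osplit e 5 2 4 k_def[symmetric] if_True)
  qed
qed

definition "\<Psi> = lin_ext S W \<kappa> ordmon"

lemma \<Psi>_closed [simp]: "a \<in> carrier P.M \<Longrightarrow> \<Psi> a \<in> carrier W"
  unfolding \<Psi>_def by (rule P.lin_ext_closed[where \<phi> = ordmon, OF W.ring_axioms \<kappa>_hom ordmon_closed])

lemma \<Psi>_add: "a \<in> carrier P.M \<Longrightarrow> b \<in> carrier P.M \<Longrightarrow> \<Psi> (a \<oplus>\<^bsub>P.M\<^esub> b) = \<Psi> a \<oplus>\<^bsub>W\<^esub> \<Psi> b"
  unfolding \<Psi>_def by (rule P.lin_ext_add[where \<phi> = ordmon, OF W.ring_axioms \<kappa>_hom ordmon_closed])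

lemma \<Psi>_single: "r \<in> carrier S \<Longrightarrow> set_mset m \<subseteq> {1..2 * n} \<Longrightarrow> \<Psi> (single S r m) = \<kappa> r \<otimes>\<^bsub>W\<^esub> ordmon m"
  unfolding \<Psi>_def using P.lin_ext_single[where \<phi> = ordmon, OF W.ring_axioms \<kappa>_hom ordmon_closed] by simp

lemma \<Psi>_zero [simp]: "\<Psi> \<zero>\<^bsub>P.M\<^esub> = \<zero>\<^bsub>W\<^esub>"
  using \<Psi>_single[of \<zero> "{#}"] by (simp add: P.single_zero)

lemma mulvar_single: "mulvar S i (single S r m) = single S r (add_mset i m)"
proof
  fix l
  have "i \<in># l \<and> l - {#i#} = m \<longleftrightarrow> l = add_mset i m" by auto
  then show "mulvar S i (single S r m) l = single S r (add_mset i m) l"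
    by (auto simp: mulvar_def single_def)
qed

lemma poly_partial_single:
  assumes "r \<in> carrier S"
  shows "poly_partial S i (single S r m) = single S ([(count m i)] \<cdot>\<^bsub>S\<^esub> r) (m - {#i#})"
proof
  fix l
  show "poly_partial S i (single S r m) l = single S ([(count m i)] \<cdot>\<^bsub>S\<^esub> r) (m - {#i#}) l"
  proof (cases "i \<in># m")
    case True
    then have "add_mset i l = m \<longleftrightarrow> l = m - {#i#}" by auto
    moreover obtain k where "count m i = Suc k" using True by (auto simp: count_greater_zero_iff[symmetric] gr0_conv_Suc)
    ultimately show ?thesis using assms by (auto simp: poly_partial_def single_def)
  next
    case False
    then have "add_mset i l \<noteq> m" "count m i = 0" by (auto simp: not_in_iff)
    then show ?thesis by (simp add: poly_partial_def single_def)
  qed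
qed

lemma gen_op_single:
  assumes "r \<in> carrier S"
  shows "gen_op n S i (single S r m) = single S r (add_mset i m) \<oplus>\<^bsub>P.M\<^esub>
    (if n < i then single S ([(count m (i - n))] \<cdot>\<^bsub>S\<^esub> r) (m - {#i - n#}) else \<zero>\<^bsub>P.M\<^esub>)"
  by (simp add: gen_op_eq_add mulvar_single poly_partial_single[OF assms])

lemma \<kappa>_add_pow: "s \<in> carrier S \<Longrightarrow> \<kappa> ([(k::nat)] \<cdot>\<^bsub>S\<^esub> s) = [k] \<cdot>\<^bsub>W\<^esub> \<kappa> s"
  by (induction k) simp_all

text \<open>Intertwines the operators \<open>gen_op\<close> with left multiplication. Together with
  the recursion for \<open>coef\<close> it shows that the ordered monomials span.\<close>

lemma \<Psi>_gen_op:
  assumes "a \<in> carrier P.M" and i: "i \<in> {1..2 * n}"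
  shows "\<Psi> (gen_op n S i a) = x i \<otimes>\<^bsub>W\<^esub> \<Psi> a"
  using assms(1)
proof (induction a rule: P.induct)
  case zero
  have "gen_op n S i \<zero>\<^bsub>P.M\<^esub> = \<zero>\<^bsub>P.M\<^esub>"
    by (auto simp: gen_op_def mulvar_def poly_partial_def P.zero_apply)
  then show ?case using i by simp
next
  case (single r m)
  then have m: "set_mset m \<subseteq> {1..2 * n}" "set_mset (add_mset i m) \<subseteq> {1..2 * n}" "set_mset (m - {#i - n#}) \<subseteq> {1..2 * n}"
    using i by (auto dest: in_diffD)
  have cl [simp]: "x i \<in> carrier W" "\<kappa> r \<in> carrier W" using i single by auto
  have "x i \<otimes>\<^bsub>W\<^esub> (\<kappa> r \<otimes>\<^bsub>W\<^esub> ordmon m) = \<kappa> r \<otimes>\<^bsub>W\<^esub> (x i \<otimes>\<^bsub>W\<^esub> ordmon m)"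
    using \<kappa>_central[of r "x i"] single by (simp add: W.m_assoc[symmetric])
  also have "\<dots> = \<Psi> (gen_op n S i (single S r m))"
    using single m
    by (auto simp: gen_op_single gen_ordmon[OF i] \<Psi>_add \<Psi>_single W.r_distr \<kappa>_add_pow W.add_pow_ldistr W.add_pow_rdistr
        simp del: set_mset_add_mset_insert)
  finally show ?case using single by (simp add: \<Psi>_single)
next
  case (add a b)
  have "gen_op n S i (a \<oplus>\<^bsub>P.M\<^esub> b) = gen_op n S i (\<lambda>m. a m \<oplus> b m)"
    by (simp add: P.add_apply[abs_def])
  also have "\<dots> = gen_op n S i a \<oplus>\<^bsub>P.M\<^esub> gen_op n S i b"
    using add poly_in_coeff_space by (auto simp: gen_op_add P.add_apply)
  finally show ?case using add i by (simp add: \<Psi>_add W.r_distr del: atLeastAtMost_iff)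
qed

lemma \<Psi>_smult:
  assumes "a \<in> carrier P.M" and s: "s \<in> carrier S"
  shows "\<Psi> (\<lambda>m. s \<otimes> a m) = \<kappa> s \<otimes>\<^bsub>W\<^esub> \<Psi> a"
  using assms(1)
proof (induction a rule: P.induct)
  case zero
  have "(\<lambda>m. s \<otimes> \<zero>\<^bsub>P.M\<^esub> m) = \<zero>\<^bsub>P.M\<^esub>" using s by (auto simp: P.zero_apply)
  then show ?case using s by simp
next
  case (single r m)
  have "(\<lambda>l. s \<otimes> single S r m l) = single S (s \<otimes> r) m" using s by (auto simp: single_def)
  then show ?case using single s by (simp add: \<Psi>_single W.m_assoc)
next
  case (add a b)
  have "(\<lambda>m. s \<otimes> (a \<oplus>\<^bsub>P.M\<^esub> b) m) = (\<lambda>m. s \<otimes> a m) \<oplus>\<^bsub>P.M\<^esub> (\<lambda>m. s \<otimes> b m)"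
    using add s P.coeff_closed by (auto simp: P.add_apply r_distr)
  then show ?case using add s by (simp add: \<Psi>_add W.r_distr)
qed

lemma ordmon_empty [simp]: "ordmon {#} = \<one>\<^bsub>W\<^esub>"
proof -
  have "pw L (\<lambda>_. 0) = \<one>\<^bsub>W\<^esub>" for L
    by (induction L) (simp_all add: pw_Cons)
  then show ?thesis by (simp add: ordmon_def zero_multiset.rep_eq)
qed

lemma \<Psi>_coef: "w \<in> carrier W \<Longrightarrow> \<Psi> (coef w) = w"
proof (induction w rule: left_induct)
  case one
  then show ?case by (simp add: coef_one \<Psi>_single)
next
  case (add v w)
  have "coef (v \<oplus>\<^bsub>W\<^esub> w) = coef v \<oplus>\<^bsub>P.M\<^esub> coef w"
    using add by (auto simp: coef_add P.add_apply)
  then show ?case using add by (simp add: \<Psi>_add coef_poly)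
qed (simp_all add: coef_smult \<Psi>_smult coef_poly coef_gen \<Psi>_gen_op del: atLeastAtMost_iff)

lemma coef_inject: "v \<in> carrier W \<Longrightarrow> w \<in> carrier W \<Longrightarrow> coef v = coef w \<longleftrightarrow> v = w"
  by (metis \<Psi>_coef)

lemma coef_zero: "coef \<zero>\<^bsub>W\<^esub> = \<zero>\<^bsub>P.M\<^esub>"
  using coef_smult[of \<zero> "\<one>\<^bsub>W\<^esub>"] coef_closed[of "\<one>\<^bsub>W\<^esub>"] by (auto simp: P.zero_apply coeff_space_iff)

lemma coef_add_poly: "v \<in> carrier W \<Longrightarrow> w \<in> carrier W \<Longrightarrow> coef (v \<oplus>\<^bsub>W\<^esub> w) = coef v \<oplus>\<^bsub>P.M\<^esub> coef w"
  by (auto simp: coef_add P.add_apply)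

lemma coef_add_pow: "w \<in> carrier W \<Longrightarrow> coef ([(k::nat)] \<cdot>\<^bsub>W\<^esub> w) = (\<lambda>m. [k] \<cdot>\<^bsub>S\<^esub> coef w m)"
  by (induction k) (auto simp: coef_zero P.zero_apply coef_add)

text \<open>Gives the independence of the ordered monomials. The coefficients of
  \<open>x i \<otimes> ordmon l\<close> are computed twice, by normal ordering and by the operators;
  the lower order terms agree by induction on the size and cancel.\<close>

lemma coef_ordmon: "set_mset m \<subseteq> {1..2 * n} \<Longrightarrow> coef (ordmon m) = single S \<one> m"
proof (induction "size m" arbitrary: m rule: less_induct)
  case less
  show ?case
  proof (cases m)
    case empty
    then show ?thesis by (simp add: coef_one)
  next
    case (add i l)
    then have i: "i \<in> {1..2 * n}" and l: "set_mset l \<subseteq> {1..2 * n}" "set_mset (l - {#i - n#}) \<subseteq> {1..2 * n}"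
      using less.prems by (auto dest: in_diffD)
    have IH: "coef (ordmon l) = single S \<one> l" using less.hyps[of l] l add by simp
    have "size (l - {#i - n#}) < size m"
      by (metis add diff_subset_eq_self le_imp_less_Suc size_add_mset size_mset_mono)
    then have IH': "coef (ordmon (l - {#i - n#})) = single S \<one> (l - {#i - n#})" using less.hyps l by blast
    let ?t = "if n < i then [(count l (i - n))] \<cdot>\<^bsub>W\<^esub> ordmon (l - {#i - n#}) else \<zero>\<^bsub>W\<^esub>"
    let ?s = "if n < i then single S ([(count l (i - n))] \<cdot>\<^bsub>S\<^esub> \<one>) (l - {#i - n#}) else \<zero>\<^bsub>P.M\<^esub>"
    have s: "(\<lambda>m. [k] \<cdot>\<^bsub>S\<^esub> single S \<one> l m) = single S ([k] \<cdot>\<^bsub>S\<^esub> \<one>) l" for k :: nat and l :: "nat multiset"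
      by (auto simp: single_def)
    have tc: "?t \<in> carrier W" by simp
    have t: "coef ?t = ?s" by (simp add: coef_add_pow IH' coef_zero s)
    have "coef (ordmon m) \<oplus>\<^bsub>P.M\<^esub> ?s = coef (x i \<otimes>\<^bsub>W\<^esub> ordmon l)"
      unfolding gen_ordmon[OF i] add using coef_add_poly[OF ordmon_closed tc, of "add_mset i l"] by (simp only: t)
    also have "\<dots> = single S \<one> m \<oplus>\<^bsub>P.M\<^esub> ?s"
      using i by (simp add: coef_gen IH gen_op_single add)
    finally show ?thesis
      using coef_poly[of "ordmon m"] l less.prems P.M.add.r_cancel[of ?s "coef (ordmon m)" "single S \<one> m"] by simp
  qed
qed

lemma coef_\<Psi>: "a \<in> carrier P.M \<Longrightarrow> coef (\<Psi> a) = a"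
proof (induction a rule: P.induct)
  case (single r m)
  then have "(\<lambda>l. r \<otimes> single S \<one> m l) = single S r m" by (auto simp: single_def)
  then show ?case using single by (simp add: \<Psi>_single coef_smult coef_ordmon)
qed (simp_all add: coef_zero \<Psi>_add coef_add_poly)

text \<open>Both sides obey the same recursion under left multiplication by constants and
  generators. Nilpotency of \<open>ad\<close> and centrality become statements about partial
  derivatives of polynomials in this way.\<close>

lemma coef_ad:
  assumes i: "i \<in> {1..2 * n}" and "w \<in> carrier W"
  shows "coef (ad W (x i) w) = (if n < i then poly_partial S (i - n) (coef w) else (\<lambda>m. \<ominus> poly_partial S (i + n) (coef w) m))"
proof -
  define D where "D a = (if n < i then poly_partial S (i - n) a else (\<lambda>m. \<ominus> poly_partial S (i + n) a m))" for a
  note [simp] = coef_closed[unfolded coeff_space_iff, rule_format]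
    poly_partial_closed[OF coef_closed, unfolded coeff_space_iff, rule_format]
  have [simp]: "x i \<in> carrier W" using i by (rule x_closed)
  have "coef (ad W (x i) w) = D (coef w)"
    using assms(2)
  proof (induction w rule: left_induct)
    case one
    then show ?case
      by (auto simp: coef_zero D_def coef_one poly_partial_single P.single_zero P.zero_apply)
  next
    case (add v w)
    then show ?case
      by (auto simp: W.ad_add coef_add D_def poly_partial_add coef_closed minus_add)
  next
    case (const s w)
    have "ad W (x i) (\<kappa> s \<otimes>\<^bsub>W\<^esub> w) = \<kappa> s \<otimes>\<^bsub>W\<^esub> ad W (x i) w"
      using const \<kappa>_central[of s "x i"] by (simp add: W.ad_mult W.ad_eq_zero_iff[THEN iffD2])
    then show ?case using const by (auto simp: coef_smult D_def poly_partial_smult coef_closed r_minus)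
  next
    case (gen k w)
    let ?a = "coef w"
    have a: "?a \<in> coeff_space S" using gen by (simp add: coef_closed)
    have [simp]: "x k \<in> carrier W" using gen(1) by (rule x_closed)
    have "coef (ad W (x i) (x k \<otimes>\<^bsub>W\<^esub> w)) = (\<lambda>m. omega S n i k \<otimes> ?a m \<oplus> gen_op n S k (D ?a) m)"
      using gen i by (simp add: W.ad_mult x_ad coef_add coef_smult coef_gen del: atLeastAtMost_iff)
    moreover have "D (gen_op n S k ?a) m = omega S n i k \<otimes> ?a m \<oplus> gen_op n S k (D ?a) m" for m
    proof -
      \<comment> \<open>The derivative part of \<open>gen_op\<close> commutes with every partial
        derivative; only multiplication by the variable k leaves an extra term, when j = k.\<close>
      have G: "poly_partial S j (gen_op n S k ?a) m = gen_op n S k (poly_partial S j ?a) m \<oplus> (if j = k then ?a m else \<zero>)" for j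
      proof -
        let ?Q = "if n < k then poly_partial S (k - n) ?a else (\<lambda>_. \<zero>)"
        have Q: "?Q \<in> coeff_space S" using poly_partial_closed[OF a] by (auto simp: coeff_space_iff)
        have "gen_op n S k ?a = (\<lambda>m. mulvar S k ?a m \<oplus> ?Q m)" by (auto simp: gen_op_def)
        then have "poly_partial S j (gen_op n S k ?a) =
            (\<lambda>m. poly_partial S j (mulvar S k ?a) m \<oplus> poly_partial S j ?Q m)"
          using poly_partial_add[OF mulvar_closed[OF a] Q] by simp
        also have "poly_partial S j (if n < k then poly_partial S (k - n) ?a else (\<lambda>_. \<zero>))
            = (if n < k then poly_partial S (k - n) (poly_partial S j ?a) else (\<lambda>_. \<zero>))"
          using a poly_partial_commute[OF a, of j "k - n"] by (simp add: poly_partial_def[of _ _ "\<lambda>_. \<zero>"])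
        finally show ?thesis
          using gen by (simp add: poly_partial_mulvar[OF a] gen_op_def a_ac
              mulvar_closed[OF poly_partial_closed[OF a], unfolded coeff_space_iff, rule_format]
              poly_partial_closed[OF poly_partial_closed[OF a], unfolded coeff_space_iff, rule_format])
      qed
      show ?thesis
      proof (cases "n < i")
        case True
        then show ?thesis
          using i gen gen_op_closed[OF poly_partial_closed[OF a], unfolded coeff_space_iff]
          by (auto simp: D_def G omega_eq a_comm)
      next
        case False
        have gm: "gen_op n S k (\<lambda>m. \<ominus> poly_partial S (i + n) ?a m) m = \<ominus> gen_op n S k (poly_partial S (i + n) ?a) m"
          using gen_op_smult[OF poly_partial_closed[OF a], of "\<ominus> \<one>" n k "i + n"] gen
            gen_op_closed[OF poly_partial_closed[OF a], unfolded coeff_space_iff]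
          by (simp add: l_minus fun_eq_iff)
        show ?thesis
          using False i gen gen_op_closed[OF poly_partial_closed[OF a], unfolded coeff_space_iff]
          by (auto simp: D_def G gm omega_eq minus_add a_comm l_minus)
      qed
    qed
    ultimately show ?case using gen by (simp add: coef_gen fun_eq_iff del: atLeastAtMost_iff)
  qed
  then show ?thesis by (simp add: D_def)
qed

end

section \<open>Coefficientwise derivations\<close>

definition ring_derivation :: "('a, 'm) ring_scheme \<Rightarrow> ('a \<Rightarrow> 'a) \<Rightarrow> bool" where
  "ring_derivation S \<delta> \<longleftrightarrow> \<delta> \<in> carrier S \<rightarrow> carrier S \<and>
     (\<forall>a \<in> carrier S. \<forall>b \<in> carrier S. \<delta> (a \<oplus>\<^bsub>S\<^esub> b) = \<delta> a \<oplus>\<^bsub>S\<^esub> \<delta> b) \<and>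
     (\<forall>a \<in> carrier S. \<forall>b \<in> carrier S. \<delta> (a \<otimes>\<^bsub>S\<^esub> b) = \<delta> a \<otimes>\<^bsub>S\<^esub> b \<oplus>\<^bsub>S\<^esub> a \<otimes>\<^bsub>S\<^esub> \<delta> b)"

locale derivation = S?: cring S for S :: "('a, 'm) ring_scheme" (structure) +
  fixes \<delta> assumes derivation: "ring_derivation S \<delta>"
begin

lemma closed [simp]: "a \<in> carrier S \<Longrightarrow> \<delta> a \<in> carrier S"
  using derivation by (auto simp: ring_derivation_def)

lemma add [simp]: "a \<in> carrier S \<Longrightarrow> b \<in> carrier S \<Longrightarrow> \<delta> (a \<oplus> b) = \<delta> a \<oplus> \<delta> b"
  using derivation by (auto simp: ring_derivation_def)

lemma mult: "a \<in> carrier S \<Longrightarrow> b \<in> carrier S \<Longrightarrow> \<delta> (a \<otimes> b) = \<delta> a \<otimes> b \<oplus> a \<otimes> \<delta> b"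
  using derivation by (auto simp: ring_derivation_def)

lemma zero [simp]: "\<delta> \<zero> = \<zero>"
proof -
  have "\<delta> \<zero> \<oplus> \<delta> \<zero> = \<delta> \<zero>" by (simp flip: add)
  then show ?thesis by (metis S.add.l_cancel_one closed zero_closed)
qed

lemma one [simp]: "\<delta> \<one> = \<zero>"
proof -
  have "\<delta> \<one> \<oplus> \<delta> \<one> = \<delta> \<one>" using mult[of \<one> \<one>] by simp
  then show ?thesis by (metis S.add.l_cancel_one closed one_closed)
qed

lemma add_pow: "a \<in> carrier S \<Longrightarrow> \<delta> ([(k::nat)] \<cdot>\<^bsub>S\<^esub> a) = [k] \<cdot>\<^bsub>S\<^esub> \<delta> a"
  by (induction k) simp_all

end

locale weyl_derivation = weyl_algebra S n + derivation S \<delta>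
  for S :: "('a, 'm) ring_scheme" (structure) and n \<delta>
begin

lemma derivation_poly [simp]:
  assumes a: "a \<in> carrier P.M"
  shows "(\<lambda>m. \<delta> (a m)) \<in> carrier P.M"
proof -
  have "{m. \<delta> (a m) \<noteq> \<zero>} \<subseteq> {m. a m \<noteq> \<zero>}" by auto
  then show ?thesis
    using P.coeff_closed[OF a] P.finite_support[OF a] P.support_subset[OF a]
    unfolding P.carrier_iff by (auto intro: finite_subset)
qed

text \<open>The extension of \<delta> that annihilates the generators. Acting on normal ordered
  coefficients avoids a separate check that the defining relations are respected.\<close>

definition "weyl_der w = \<Psi> (\<lambda>m. \<delta> (coef w m))"

lemma weyl_der_closed [simp]: "w \<in> carrier W \<Longrightarrow> weyl_der w \<in> carrier W"
  by (simp add: weyl_der_def coef_poly)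

lemma coef_weyl_der: "w \<in> carrier W \<Longrightarrow> coef (weyl_der w) = (\<lambda>m. \<delta> (coef w m))"
  by (simp add: weyl_der_def coef_\<Psi> coef_poly)

lemma weyl_derI: "v \<in> carrier W \<Longrightarrow> w \<in> carrier W \<Longrightarrow> (\<And>m. \<delta> (coef w m) = coef v m) \<Longrightarrow> weyl_der w = v"
  using \<Psi>_coef[of v] unfolding weyl_der_def by presburger

lemma weyl_der_one [simp]: "weyl_der \<one>\<^bsub>W\<^esub> = \<zero>\<^bsub>W\<^esub>"
  by (rule weyl_derI) (auto simp: coef_zero coef_one single_def P.zero_apply)

lemma weyl_der_add:
  assumes "v \<in> carrier W" "w \<in> carrier W"
  shows "weyl_der (v \<oplus>\<^bsub>W\<^esub> w) = weyl_der v \<oplus>\<^bsub>W\<^esub> weyl_der w"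
  using assms coef_closed[OF assms(1)] coef_closed[OF assms(2)]
  by (intro weyl_derI) (simp_all add: coef_add coef_weyl_der coeff_space_iff)

lemma weyl_der_const_mult:
  assumes "s \<in> carrier S" "w \<in> carrier W"
  shows "weyl_der (\<kappa> s \<otimes>\<^bsub>W\<^esub> w) = \<kappa> (\<delta> s) \<otimes>\<^bsub>W\<^esub> w \<oplus>\<^bsub>W\<^esub> \<kappa> s \<otimes>\<^bsub>W\<^esub> weyl_der w"
  using assms coef_closed[OF assms(2)]
  by (intro weyl_derI) (simp_all add: coef_add coef_smult coef_weyl_der coeff_space_iff mult)

text \<open>The operators \<open>gen_op\<close> shift coefficients, add them and take integral
  multiples, and \<delta> commutes with all of this.\<close>

lemma weyl_der_gen_mult:
  assumes "i \<in> {1..2 * n}" "w \<in> carrier W"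
  shows "weyl_der (x i \<otimes>\<^bsub>W\<^esub> w) = x i \<otimes>\<^bsub>W\<^esub> weyl_der w"
proof (rule weyl_derI)
  fix m
  have "\<delta> (gen_op n S i (coef w) m) = gen_op n S i (\<lambda>m. \<delta> (coef w m)) m"
    using coef_closed[OF assms(2)] by (auto simp: gen_op_def mulvar_def poly_partial_def coeff_space_iff add_pow)
  then show "\<delta> (coef (x i \<otimes>\<^bsub>W\<^esub> w) m) = coef (x i \<otimes>\<^bsub>W\<^esub> weyl_der w) m"
    using assms by (simp add: coef_gen coef_weyl_der del: atLeastAtMost_iff)
qed (use assms x_closed in auto)

lemma weyl_der_mult:
  assumes "v \<in> carrier W" "w \<in> carrier W"
  shows "weyl_der (v \<otimes>\<^bsub>W\<^esub> w) = weyl_der v \<otimes>\<^bsub>W\<^esub> w \<oplus>\<^bsub>W\<^esub> v \<otimes>\<^bsub>W\<^esub> weyl_der w"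
  using assms(1)
proof (induction v rule: left_induct)
  case one
  then show ?case using assms(2) by simp
next
  case (add u v)
  then show ?case using assms(2) by (simp add: W.l_distr weyl_der_add W.a_ac)
next
  case (const s v)
  have "weyl_der (\<kappa> s \<otimes>\<^bsub>W\<^esub> v \<otimes>\<^bsub>W\<^esub> w) = weyl_der (\<kappa> s \<otimes>\<^bsub>W\<^esub> (v \<otimes>\<^bsub>W\<^esub> w))"
    using const assms(2) by (simp add: W.m_assoc)
  then show ?case
    using const assms(2) by (simp add: weyl_der_const_mult W.l_distr W.r_distr W.m_assoc W.a_ac)
next
  case (gen i v)
  have [simp]: "x i \<in> carrier W" using gen(1) by (rule x_closed)
  have "weyl_der (x i \<otimes>\<^bsub>W\<^esub> v \<otimes>\<^bsub>W\<^esub> w) = weyl_der (x i \<otimes>\<^bsub>W\<^esub> (v \<otimes>\<^bsub>W\<^esub> w))"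
    using gen assms(2) by (simp add: W.m_assoc)
  then show ?case
    using gen assms(2) by (simp add: weyl_der_gen_mult W.l_distr W.r_distr W.m_assoc del: atLeastAtMost_iff)
qed

end

context weyl_algebra
begin

text \<open>The subspace will be the set where a power of \<open>ad\<close> vanishes after the
  inverse automorphism. Vanishing then has to be verified only on the monomials that occur, whatever
  their coefficients are.\<close>

lemma \<Psi>_in_subspace:
  assumes a: "a \<in> carrier P.M"
    and N: "\<zero>\<^bsub>W\<^esub> \<in> N" "\<And>v w. v \<in> N \<Longrightarrow> w \<in> N \<Longrightarrow> v \<oplus>\<^bsub>W\<^esub> w \<in> N"
      "\<And>s w. s \<in> carrier S \<Longrightarrow> w \<in> N \<Longrightarrow> \<kappa> s \<otimes>\<^bsub>W\<^esub> w \<in> N"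
    and mon: "\<And>m. a m \<noteq> \<zero> \<Longrightarrow> ordmon m \<in> N"
  shows "\<Psi> a \<in> N"
proof -
  note [simp] = P.coeff_closed[OF a]
  have "finsum W (\<lambda>m. \<kappa> (a m) \<otimes>\<^bsub>W\<^esub> ordmon m) A \<in> N" if "finite A" "A \<subseteq> {m. a m \<noteq> \<zero>}" for A
    using that
  proof (induction A rule: finite_induct)
    case (insert m A)
    then have "finsum W (\<lambda>m. \<kappa> (a m) \<otimes>\<^bsub>W\<^esub> ordmon m) (insert m A) =
        \<kappa> (a m) \<otimes>\<^bsub>W\<^esub> ordmon m \<oplus>\<^bsub>W\<^esub> finsum W (\<lambda>m. \<kappa> (a m) \<otimes>\<^bsub>W\<^esub> ordmon m) A"
      by (intro W.finsum_insert) auto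
    then show ?case using insert N mon by auto
  qed (simp add: N)
  from this[OF P.finite_support[OF a] subset_refl] show ?thesis
    by (simp add: \<Psi>_def lin_ext_def)
qed

section \<open>The center in positive characteristic\<close>

lemma centralI:
  assumes z: "z \<in> carrier W" and "\<And>i. i \<in> {1..2 * n} \<Longrightarrow> ad W (x i) z = \<zero>\<^bsub>W\<^esub>"
  shows "z \<in> ring_center W"
proof -
  have "z \<otimes>\<^bsub>W\<^esub> w = w \<otimes>\<^bsub>W\<^esub> z" if "w \<in> carrier W" for w
    using that
  proof (induction w rule: left_induct)
    case one
    then show ?case using z by simp
  next
    case (add v w)
    then show ?case using z by (simp add: W.l_distr W.r_distr)
  next
    case (const s w)
    then show ?case using z \<kappa>_central[of s z] by (simp add: W.m_assoc[symmetric]) (simp add: W.m_assoc)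
  next
    case (gen i w)
    have [simp]: "x i \<in> carrier W" using gen(1) by (rule x_closed)
    have "z \<otimes>\<^bsub>W\<^esub> x i = x i \<otimes>\<^bsub>W\<^esub> z" using assms(2)[OF gen(1)] z by (simp add: W.ad_eq_zero_iff)
    then have "z \<otimes>\<^bsub>W\<^esub> (x i \<otimes>\<^bsub>W\<^esub> w) = x i \<otimes>\<^bsub>W\<^esub> z \<otimes>\<^bsub>W\<^esub> w"
      using gen(2) z W.m_assoc[of z "x i" w] by simp
    also have "\<dots> = x i \<otimes>\<^bsub>W\<^esub> (z \<otimes>\<^bsub>W\<^esub> w)"
      using gen(2) z by (simp add: W.m_assoc)
    finally show ?case using gen(2,3) z by (simp add: W.m_assoc)
  qed
  then show ?thesis using z by (simp add: ring_center_def)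
qed

lemma central_ad: "z \<in> ring_center W \<Longrightarrow> w \<in> carrier W \<Longrightarrow> ad W w z = \<zero>\<^bsub>W\<^esub>"
  by (auto simp: ring_center_def W.ad_eq_zero_iff)

end

text \<open>As k is invertible modulo p, some multiple k u has the form p v + 1, and a is the
  difference of two vanishing multiples of itself.\<close>

lemma (in ring) add_pow_prime_cancel:
  assumes p: "Factorial_Ring.prime (p::nat)" "[p] \<cdot>\<^bsub>R\<^esub> a = \<zero>" and "\<not> p dvd k" "a \<in> carrier R" "[k] \<cdot>\<^bsub>R\<^esub> a = \<zero>"
  shows "a = \<zero>"
proof -
  have "coprime k p" using assms(1,3) by (metis coprime_commute prime_imp_coprime)
  then obtain u where "[k * u = 1] (mod p)" using cong_solve_coprime_nat by auto
  then have "(k * u) mod p = 1" using prime_gt_1_nat[OF p(1)] by (simp add: cong_def)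
  then have eq: "k * u = p * ((k * u) div p) + 1" by (metis mult_div_mod_eq)
  have 1: "[(k * u)] \<cdot>\<^bsub>R\<^esub> a = [u] \<cdot>\<^bsub>R\<^esub> ([k] \<cdot>\<^bsub>R\<^esub> a)" using assms(4) by (simp add: add.nat_pow_pow mult.commute)
  have 2: "[(p * v)] \<cdot>\<^bsub>R\<^esub> a = [v] \<cdot>\<^bsub>R\<^esub> ([p] \<cdot>\<^bsub>R\<^esub> a)" for v using assms(4) by (simp add: add.nat_pow_pow mult.commute)
  have "\<zero> = [(k * u)] \<cdot>\<^bsub>R\<^esub> a" using assms(5) 1 by simp
  also have "\<dots> = [(p * ((k * u) div p))] \<cdot>\<^bsub>R\<^esub> a \<oplus> a"
    using assms(4) by (subst eq) simp
  also have "\<dots> = a" using 2 assms(2,4) by simp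
  finally show ?thesis by simp
qed

lemma set_mset_repeat_mset: "p > 0 \<Longrightarrow> set_mset (repeat_mset p m) = set_mset m"
  by (rule Set.set_eqI) (metis count_repeat_mset less_not_refl mult_eq_0_iff not_in_iff)

lemma repeat_mset_exhaust:
  assumes "p > 0" "\<And>i. p dvd count l i"
  obtains m where "l = repeat_mset p m" "set_mset m = set_mset l"
proof -
  have fin: "finite {i. 0 < count l i div p}"
  proof (rule finite_subset[OF _ finite_set_mset[of l]], rule subsetI)
    fix i assume "i \<in> {i. 0 < count l i div p}"
    then have "count l i \<noteq> 0" by (intro notI) simp
    then show "i \<in># l" by (simp add: not_in_iff[symmetric])
  qed
  define m where "m = Abs_multiset (\<lambda>i. count l i div p)"
  have "count m i = count l i div p" for i
    using fin by (simp add: m_def count_Abs_multiset)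
  then have l: "l = repeat_mset p m" using assms(2) by (intro multiset_eqI) simp
  then show thesis using that assms(1) by (simp add: set_mset_repeat_mset)
qed

locale weyl_char = weyl_algebra S n for S :: "('a, 'm) ring_scheme" (structure) and n +
  fixes p :: nat
  assumes p: "Factorial_Ring.prime p" and char: "[p] \<cdot>\<^bsub>S\<^esub> \<one> = \<zero>"
begin

lemma p_pos: "p > 0"
  using p by (rule prime_gt_0_nat)

lemma char_W: "[p] \<cdot>\<^bsub>W\<^esub> \<one>\<^bsub>W\<^esub> = \<zero>\<^bsub>W\<^esub>"
  using \<kappa>_add_pow[of \<one> p] by (simp add: char)

text \<open>The generator conjugate to the variable i, which is n + i or i - n, acts as plus or
  minus the partial derivative in i and has to annihilate z. So the coefficient at m is killed by
  \<open>count m i\<close> as well as by p.\<close>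

lemma central_coef:
  assumes z: "z \<in> ring_center W" and m: "coef z m \<noteq> \<zero>"
  shows "p dvd count m i"
proof (rule ccontr)
  assume ndvd: "\<not> p dvd count m i"
  have zW: "z \<in> carrier W" using z by (simp add: ring_center_def)
  note [simp] = coef_closed[OF zW, unfolded coeff_space_iff, rule_format]
  have "i \<in># m" using ndvd by (metis dvd_0_right not_in_iff)
  then have i: "i \<in> {1..2 * n}" using subsetD[OF P.support_subset[OF coef_poly[OF zW]], of m] m by auto
  have "poly_partial S i (coef z) l = \<zero>" for l
  proof (cases "i \<le> n")
    case True
    then show ?thesis
      using coef_ad[of "n + i" z] zW i central_ad[OF z, of "x (n + i)"]
      by (auto simp: coef_zero P.zero_apply fun_eq_iff)
  next
    case False
    then have "i - n \<in> {1..2 * n}" "\<not> n < i - n" "i - n + n = i" using i by auto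
    then have "\<ominus> poly_partial S i (coef z) l = \<zero>"
      using coef_ad[of "i - n" z] zW x_closed[of "i - n"] central_ad[OF z, of "x (i - n)"]
      by (auto simp: coef_zero P.zero_apply fun_eq_iff)
    then show ?thesis
      by (simp add: poly_partial_def)
  qed
  from this[of "m - {#i#}"] have "[(Suc (count (m - {#i#}) i))] \<cdot>\<^bsub>S\<^esub> coef z m = \<zero>"
    using \<open>i \<in># m\<close> by (simp add: poly_partial_def del: add.nat_pow_Suc count_diff)
  moreover have "Suc (count (m - {#i#}) i) = count m i"
    using \<open>i \<in># m\<close> by (metis count_add_mset insert_DiffM)
  ultimately show False
    using add_pow_prime_cancel[OF p _ ndvd, of "coef z m"] add_pow_dvd[OF char dvd_refl, of "coef z m"] m by (simp only:) simp
qed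

abbreviation "y i \<equiv> x i [^]\<^bsub>W\<^esub> p"

text \<open>By the formula for p-th powers the commutator is \<open>ad (x i)\<close> applied p - 1
  times to a constant. As p - 1 is at least 1 and constants commute with \<open>x i\<close>, it
  vanishes.\<close>

lemma y_central: "i \<in> {1..2 * n} \<Longrightarrow> y i \<in> ring_center W"
proof (rule centralI)
  fix j assume i: "i \<in> {1..2 * n}" and j: "j \<in> {1..2 * n}"
  note [simp] = x_closed[OF i] x_closed[OF j]
  obtain k where k: "p = Suc (Suc k)" using prime_ge_2_nat[OF p] by (metis add_2_eq_Suc le_Suc_ex)
  have "ad W (x j) (y i) = (ad W (x i) ^^ (p - 1)) (\<kappa> (omega S n j i))"
    by (simp add: W.ad_pow W.pow_deriv_char[OF p char_W] x_ad[OF j i])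
  also have "\<dots> = (ad W (x i) ^^ k) (ad W (x i) (\<kappa> (omega S n j i)))"
    by (simp add: k funpow_swap1)
  also have "ad W (x i) (\<kappa> (omega S n j i)) = \<zero>\<^bsub>W\<^esub>"
    by (simp add: W.ad_eq_zero_iff \<kappa>_central)
  also have "(ad W (x i) ^^ k) \<zero>\<^bsub>W\<^esub> = \<zero>\<^bsub>W\<^esub>" for k
    by (induction k) simp_all
  finally show "ad W (x j) (y i) = \<zero>\<^bsub>W\<^esub>" .
qed (auto simp: x_closed)

text \<open>Has literally the fold that occurs in \<open>center_eval\<close>, so that the latter is
  a linear extension by mere unfolding.\<close>

definition "yprod L e = foldr (\<lambda>i r. y i [^]\<^bsub>W\<^esub> (e i :: nat) \<otimes>\<^bsub>W\<^esub> r) L \<one>\<^bsub>W\<^esub>"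

lemma yprod_closed [simp]: "set L \<subseteq> {1..2 * n} \<Longrightarrow> yprod L e \<in> carrier W"
  by (induction L) (simp_all add: yprod_def)

lemma yprod_eq_pw: "set L \<subseteq> {1..2 * n} \<Longrightarrow> yprod L e = pw L (\<lambda>i. p * e i)"
  by (induction L) (simp_all add: yprod_def pw_def W.nat_pow_pow)

lemma y_pow_commute:
  assumes "i \<in> {1..2 * n}" "w \<in> carrier W"
  shows "w \<otimes>\<^bsub>W\<^esub> y i [^]\<^bsub>W\<^esub> (k::nat) = y i [^]\<^bsub>W\<^esub> k \<otimes>\<^bsub>W\<^esub> w"
proof -
  have [simp]: "x i \<in> carrier W" using assms(1) by (rule x_closed)
  have "ad W w (y i [^]\<^bsub>W\<^esub> k) = \<zero>\<^bsub>W\<^esub>"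
    using central_ad[OF y_central[OF assms(1)] assms(2)] assms(2) by (simp add: W.ad_pow)
  then show ?thesis using assms(2) by (simp add: W.ad_eq_zero_iff)
qed

lemma yprod_add:
  assumes "set L \<subseteq> {1..2 * n}"
  shows "yprod L (\<lambda>i. e i + e' i) = yprod L e \<otimes>\<^bsub>W\<^esub> yprod L e'"
  using assms
proof (induction L)
  case Nil
  then show ?case by (simp add: yprod_def)
next
  case (Cons i L)
  have i: "i \<in> {1..2 * n}" using Cons by simp
  have [simp]: "x i \<in> carrier W" "yprod L e \<in> carrier W" "yprod L e' \<in> carrier W"
    using Cons x_closed[OF i] by auto
  have c: "yprod (i # L) e = y i [^]\<^bsub>W\<^esub> e i \<otimes>\<^bsub>W\<^esub> yprod L e" for e by (simp add: yprod_def)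
  have "yprod (i # L) (\<lambda>i. e i + e' i) = y i [^]\<^bsub>W\<^esub> e i \<otimes>\<^bsub>W\<^esub> (y i [^]\<^bsub>W\<^esub> e' i \<otimes>\<^bsub>W\<^esub> yprod L e) \<otimes>\<^bsub>W\<^esub> yprod L e'"
    using Cons by (simp add: c W.nat_pow_mult[symmetric] W.m_assoc)
  also have "y i [^]\<^bsub>W\<^esub> e' i \<otimes>\<^bsub>W\<^esub> yprod L e = yprod L e \<otimes>\<^bsub>W\<^esub> y i [^]\<^bsub>W\<^esub> e' i"
    by (rule y_pow_commute[OF i, symmetric]) simp
  also have "y i [^]\<^bsub>W\<^esub> e i \<otimes>\<^bsub>W\<^esub> (yprod L e \<otimes>\<^bsub>W\<^esub> y i [^]\<^bsub>W\<^esub> e' i) \<otimes>\<^bsub>W\<^esub> yprod L e' = yprod (i # L) e \<otimes>\<^bsub>W\<^esub> yprod (i # L) e'"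
    by (simp add: c W.m_assoc)
  finally show ?case .
qed

definition "ymon m = yprod [1..<2 * n + 1] (count m)"

lemma ymon_closed [simp]: "ymon m \<in> carrier W"
  unfolding ymon_def by (rule yprod_closed) auto

text \<open>Links the center with the basis: monomials in the y_i become distinct basis elements,
  which separate the coefficients of \<open>center_eval\<close>.\<close>

lemma ymon_eq_ordmon: "ymon m = ordmon (repeat_mset p m)"
proof -
  have "(\<lambda>i. p * count m i) = count (repeat_mset p m)" by auto
  moreover have "set [1..<2 * n + 1] \<subseteq> {1..2 * n}" by auto
  ultimately show ?thesis unfolding ymon_def ordmon_def by (simp only: yprod_eq_pw)
qed

lemma center_eval_eq: "center_eval n S p = lin_ext S W \<kappa> ymon"
  by (rule ext) (simp add: center_eval_def Let_def lin_ext_def ymon_def yprod_def)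

abbreviation "\<gamma> \<equiv> center_eval n S p"

lemma \<gamma>_hom: "\<gamma> \<in> ring_hom P.M W"
  unfolding center_eval_eq
proof (rule P.lin_ext_ring_hom[OF W.ring_axioms \<kappa>_hom])
  show "ymon \<one>\<^bsub>monomials n\<^esub> = \<one>\<^bsub>W\<^esub>" by (simp add: ymon_eq_ordmon)
  show "ymon (u \<otimes>\<^bsub>monomials n\<^esub> v) = ymon u \<otimes>\<^bsub>W\<^esub> ymon v" for u v
  proof -
    have "count (u + v) = (\<lambda>i. count u i + count v i)" by auto
    moreover have "set [1..<2 * n + 1] \<subseteq> {1..2 * n}" by auto
    ultimately show ?thesis unfolding ymon_def by (simp only: monomials_simps yprod_add)
  qed
qed (simp_all add: \<kappa>_central)

sublocale \<gamma>: ring_hom_ring "monoid_ring S (monomials n)" "weyl n S" "center_eval n S p"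
  by (rule ring_hom_ringI2[OF P.M.ring_axioms W.ring_axioms \<gamma>_hom])

lemma \<gamma>_single: "r \<in> carrier S \<Longrightarrow> set_mset m \<subseteq> {1..2 * n} \<Longrightarrow> \<gamma> (single S r m) = \<kappa> r \<otimes>\<^bsub>W\<^esub> ymon m"
  unfolding center_eval_eq using P.lin_ext_single[where \<phi> = ymon, OF W.ring_axioms \<kappa>_hom ymon_closed] by simp

lemma ymon_central: "ymon m \<in> ring_center W"
proof (rule centralI)
  fix j assume j: "j \<in> {1..2 * n}"
  have zero: "ad W (x j) (yprod L e) = \<zero>\<^bsub>W\<^esub>" if "set L \<subseteq> {1..2 * n}" for L e
    using that
  proof (induction L)
    case Nil
    then show ?case using x_closed[OF j] by (simp add: yprod_def)
  next
    case (Cons i L)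
    then have "ad W (x j) (y i [^]\<^bsub>W\<^esub> e i) = \<zero>\<^bsub>W\<^esub>"
      using y_pow_commute[of i "x j"] x_closed[of i] x_closed[OF j] by (simp add: W.ad_eq_zero_iff)
    moreover have "yprod (i # L) e = y i [^]\<^bsub>W\<^esub> e i \<otimes>\<^bsub>W\<^esub> yprod L e" by (simp add: yprod_def)
    ultimately show ?case using Cons x_closed[of i] x_closed[OF j] by (simp add: W.ad_mult)
  qed
  then show "ad W (x j) (ymon m) = \<zero>\<^bsub>W\<^esub>" unfolding ymon_def by (intro zero) auto
qed simp

lemma \<gamma>_central: "a \<in> carrier P.M \<Longrightarrow> \<gamma> a \<in> ring_center W"
proof (induction a rule: P.induct)
  case (single r m)
  then have "ad W (x i) (\<kappa> r \<otimes>\<^bsub>W\<^esub> ymon m) = \<zero>\<^bsub>W\<^esub>" if "i \<in> {1..2 * n}" for i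
    using that x_closed[OF that] central_ad[OF ymon_central, of "x i" m] \<kappa>_central[of r "x i"]
    by (simp add: W.ad_mult W.ad_eq_zero_iff[THEN iffD2])
  then show ?case using single by (simp add: \<gamma>_single) (rule centralI; simp)
qed (auto simp: ring_center_def W.l_distr W.r_distr)

lemma coef_\<gamma>: "a \<in> carrier P.M \<Longrightarrow> coef (\<gamma> a) (repeat_mset p m) = a m"
proof (induction a rule: P.induct)
  case zero
  show ?case by (simp only: \<gamma>.hom_zero coef_zero) (simp only: P.zero_apply)
next
  case (single r l)
  have "set_mset (repeat_mset p l) \<subseteq> {1..2 * n}"
    using single p_pos by (simp add: set_mset_repeat_mset)
  moreover have "repeat_mset p m = repeat_mset p l \<longleftrightarrow> m = l"
    using p_pos by (simp add: repeat_mset_cancel1)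
  ultimately show ?case
    using single by (simp add: \<gamma>_single coef_smult ymon_eq_ordmon coef_ordmon) (simp add: single_def)
next
  case (add a b)
  then show ?case by (simp add: coef_add) (simp add: P.add_apply)
qed

lemma coef_central:
  assumes "z \<in> ring_center W" "w \<in> ring_center W" "\<And>m. coef z (repeat_mset p m) = coef w (repeat_mset p m)"
  shows "z = w"
proof -
  have "coef z l = coef w l" for l
  proof (cases "\<forall>i. p dvd count l i")
    case True
    then show ?thesis using repeat_mset_exhaust[OF p_pos, of l] assms(3) by metis
  next
    case False
    then show ?thesis using central_coef assms(1,2) by metis
  qed
  then show ?thesis using assms(1,2) coef_inject[of z w] by (auto simp: ring_center_def)
qed

text \<open>The coefficients of a reappear as those of \<open>\<gamma> a\<close> at the multiples of
  p, which gives injectivity. A central element has no other coefficients by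
  \<open>central_coef\<close>, so reading them off at the multiples of p yields its
  preimage.\<close>

lemma \<gamma>_bij: "bij_betw \<gamma> (carrier P.M) (ring_center W)"
proof (rule bij_betw_imageI)
  show "inj_on \<gamma> (carrier P.M)"
    by (rule inj_onI) (metis coef_\<gamma> ext)
  show "\<gamma> ` carrier P.M = ring_center W"
  proof
    show "ring_center W \<subseteq> \<gamma> ` carrier P.M"
    proof
      fix z assume z: "z \<in> ring_center W"
      then have zW: "z \<in> carrier W" by (simp add: ring_center_def)
      define a where "a m = coef z (repeat_mset p m)" for m
      have inj: "inj (repeat_mset p :: nat multiset \<Rightarrow> _)"
        using p_pos by (simp add: inj_def repeat_mset_cancel1)
      have "{m. a m \<noteq> \<zero>} = repeat_mset p -` {m. coef z m \<noteq> \<zero>}" by (auto simp: a_def)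
      then have "finite {m. a m \<noteq> \<zero>}"
        using finite_vimageI[OF P.finite_support[OF coef_poly[OF zW]] inj] by simp
      moreover have "set_mset m \<subseteq> {1..2 * n}" if "a m \<noteq> \<zero>" for m
        using that P.support_subset[OF coef_poly[OF zW]] set_mset_repeat_mset[OF p_pos, of m] by (auto simp: a_def)
      ultimately have a: "a \<in> carrier P.M"
        using coef_closed[OF zW] by (auto simp: P.carrier_iff a_def coeff_space_iff)
      have "\<gamma> a = z"
        by (rule coef_central[OF \<gamma>_central[OF a] z]) (simp add: coef_\<gamma>[OF a] a_def)
      then show "z \<in> \<gamma> ` carrier P.M" using a by blast
    qed
  qed (auto simp: \<gamma>_central)
qed

end

section \<open>Reduction modulo a prime\<close>

context weyl_algebra
begin

lemma funpow_ad_zero [simp]: "z \<in> carrier W \<Longrightarrow> (ad W z ^^ k) \<zero>\<^bsub>W\<^esub> = \<zero>\<^bsub>W\<^esub>"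
  by (induction k) simp_all

lemma funpow_ad_add:
  "z \<in> carrier W \<Longrightarrow> v \<in> carrier W \<Longrightarrow> w \<in> carrier W \<Longrightarrow>
    (ad W z ^^ k) (v \<oplus>\<^bsub>W\<^esub> w) = (ad W z ^^ k) v \<oplus>\<^bsub>W\<^esub> (ad W z ^^ k) w"
  by (induction k) (simp_all add: W.ad_add)

lemma funpow_ad_const_mult:
  assumes "z \<in> carrier W" "s \<in> carrier S" "w \<in> carrier W"
  shows "(ad W z ^^ k) (\<kappa> s \<otimes>\<^bsub>W\<^esub> w) = \<kappa> s \<otimes>\<^bsub>W\<^esub> (ad W z ^^ k) w"
proof -
  have "ad W z (\<kappa> s) = \<zero>\<^bsub>W\<^esub>" using assms \<kappa>_central[of s z] by (simp add: W.ad_eq_zero_iff)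
  then show ?thesis using assms by (induction k) (simp_all add: W.ad_mult)
qed

text \<open>In coordinates each application is a derivative up to sign and lowers the degree by one.
  If K bounds the degrees in w, a monomial still present after k applications has degree at most K -
  k.\<close>

lemma ad_nilpotent:
  assumes w: "w \<in> carrier W" and j: "j \<in> {1..2 * n}"
  shows "\<forall>\<^sub>F k in sequentially. (ad W (x j) ^^ k) w = \<zero>\<^bsub>W\<^esub>"
proof -
  note [simp] = x_closed[OF j]
  obtain K where K: "size m \<le> K" if "coef w m \<noteq> \<zero>" for m
    using finite_nat_set_iff_bounded_le[of "size ` {m. coef w m \<noteq> \<zero>}"] P.finite_support[OF coef_poly[OF w]] by auto
  have "size m + k \<le> K" if "coef ((ad W (x j) ^^ k) w) m \<noteq> \<zero>" for k m
    using that
  proof (induction k arbitrary: m)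
    case 0
    then show ?case using K by simp
  next
    case (Suc k)
    let ?v = "(ad W (x j) ^^ k) w"
    have "?v \<in> carrier W" using w by simp
    then obtain i where i: "poly_partial S i (coef ?v) m \<noteq> \<zero>"
      using Suc.prems coef_ad[OF j, of ?v] by (cases "n < j") (auto, metis minus_zero)
    have "coef ?v (add_mset i m) \<noteq> \<zero>"
      using i by (intro notI) (simp add: poly_partial_def)
    from Suc.IH[OF this] show ?case by simp
  qed
  then have "(ad W (x j) ^^ k) w = \<zero>\<^bsub>W\<^esub>" if "k > K" for k
    using that w coef_inject[of "(ad W (x j) ^^ k) w" "\<zero>\<^bsub>W\<^esub>"]
    by (force simp: coef_zero P.zero_apply fun_eq_iff)
  then show ?thesis
    by (auto simp: eventually_sequentially intro!: exI[of _ "Suc K"])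
qed

end

locale weyl_mod = A: weyl_algebra R n for R :: "('a, 'm) ring_scheme" (structure) and n +
  fixes p :: nat
  assumes prime_p: "Factorial_Ring.prime p"
begin

abbreviation "S \<equiv> mod_ring R p"
abbreviation "q \<equiv> (+>) (mod_ideal R p)"
abbreviation "red \<equiv> weyl_reduce n R p"

lemma mod_ideal: "ideal (mod_ideal R p) R"
  unfolding mod_ideal_def by (rule A.cgenideal_ideal) simp

sublocale J: ideal "mod_ideal R p" R
  by (rule mod_ideal)

lemma cring_S: "cring S"
  unfolding mod_ring_def by (rule J.quotient_is_cring[OF A.cring_axioms])

lemma q_hom: "q \<in> ring_hom R S"
  unfolding mod_ring_def by (rule J.rcos_ring_hom)

lemma mod_ideal_iff: "r \<in> mod_ideal R p \<longleftrightarrow> (\<exists>c \<in> carrier R. r = [p] \<cdot>\<^bsub>R\<^esub> c)"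
proof -
  have "c \<otimes> [p] \<cdot>\<^bsub>R\<^esub> \<one> = [p] \<cdot>\<^bsub>R\<^esub> c" if "c \<in> carrier R" for c
    using that by (simp add: A.add_pow_rdistr)
  then show ?thesis unfolding mod_ideal_def cgenideal_def mem_Collect_eq by metis
qed

lemma q_eq_zero_iff: "r \<in> carrier R \<Longrightarrow> q r = \<zero>\<^bsub>S\<^esub> \<longleftrightarrow> (\<exists>c \<in> carrier R. r = [p] \<cdot>\<^bsub>R\<^esub> c)"
  using J.rcos_const_imp_mem J.a_rcos_const unfolding mod_ideal_iff[symmetric] by (auto simp: mod_ring_def FactRing_def)

lemma q_surj: "s \<in> carrier S \<Longrightarrow> \<exists>r \<in> carrier R. s = q r"
  unfolding mod_ring_def FactRing_def A_RCOSETS_def' by auto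

lemma char_S: "[p] \<cdot>\<^bsub>S\<^esub> \<one>\<^bsub>S\<^esub> = \<zero>\<^bsub>S\<^esub>"
proof -
  interpret S0: cring S by (rule cring_S)
  interpret q0: ring_hom_ring R S q
    by (rule ring_hom_ringI2[OF A.ring_axioms S0.ring_axioms q_hom])
  have "q ([k] \<cdot>\<^bsub>R\<^esub> \<one>) = [k] \<cdot>\<^bsub>S\<^esub> \<one>\<^bsub>S\<^esub>" for k :: nat
    by (induction k) simp_all
  from this[of p] show ?thesis
    using q_eq_zero_iff[of "[p] \<cdot>\<^bsub>R\<^esub> \<one>"] by auto
qed

sublocale B: weyl_char "mod_ring R p" n p
  by (simp add: weyl_char_def weyl_char_axioms_def weyl_algebra_def cring_S prime_p char_S)

sublocale q: ring_hom_ring R "mod_ring R p" "(+>) (mod_ideal R p)"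
  by (rule ring_hom_ringI2[OF A.ring_axioms B.S.ring_axioms q_hom])

lemma q_add_pow: "r \<in> carrier R \<Longrightarrow> q ([(k::nat)] \<cdot>\<^bsub>R\<^esub> r) = [k] \<cdot>\<^bsub>S\<^esub> q r"
  by (induction k) simp_all

definition "mapq a = (\<lambda>w. q (a w))"

definition "\<rho> a = weyl_class n S (mapq a)"

lemma mapq_hom: "mapq \<in> ring_hom A.F.M B.F.M"
  unfolding mapq_def[abs_def] by (rule A.F.map_ring_hom[OF cring_S q_hom])

sublocale mapq: ring_hom_ring "monoid_ring R (words n)" "monoid_ring (mod_ring R p) (words n)" mapq
  by (rule ring_hom_ringI2[OF A.F.M.ring_axioms B.F.M.ring_axioms mapq_hom])

lemma \<rho>_hom: "\<rho> \<in> ring_hom A.F.M B.W"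
  using ring_hom_trans[OF mapq_hom B.weyl_class_hom] by (simp add: \<rho>_def[abs_def] comp_def)

lemma map_q_single: "(\<lambda>w. q (single R r u w)) = single S (q r) u"
proof
  fix w
  show "q (single R r u w) = single S (q r) u w" by (cases "w = u") (simp_all add: single_def)
qed

lemma mapq_single: "mapq (single R r u) = single S (q r) u"
  by (simp add: mapq_def map_q_single)

lemma q_omega: "q (omega R n i j) = omega S n i j"
  by (simp add: omega_def a_minus_def)

lemma map_q_rel:
  assumes "i \<in> {1..2 * n}" "j \<in> {1..2 * n}"
  shows "mapq (weyl_rel n R i j) = weyl_rel n S i j"
  using assms unfolding A.weyl_rel_eq B.weyl_rel_eq a_minus_def by (simp add: mapq_single q_omega)

text \<open>Identifies the reduction, given through representatives and \<open>the_elem\<close>,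
  with the homomorphism induced on the quotient of the free algebra: all representatives of a class
  have the same image, so the set in question is a singleton.\<close>

lemma ex_red:
  "\<exists>H \<in> ring_hom A.W B.W. (\<forall>w \<in> carrier A.W. red w = H w) \<and> (\<forall>a \<in> carrier A.F.M. H (weyl_class n R a) = \<rho> a)"
proof -
  interpret \<rho>: ring_hom_ring "monoid_ring R (words n)" B.W \<rho>
    by (rule ring_hom_ringI2[OF A.F.M.ring_axioms B.W.ring_axioms \<rho>_hom])
  have "\<rho> (weyl_rel n R i j) = \<zero>\<^bsub>B.W\<^esub>" if "i \<in> {1..2 * n}" "j \<in> {1..2 * n}" for i j
    unfolding \<rho>_def map_q_rel[OF that] by (rule B.weyl_class_rel[OF that])
  then have "{weyl_rel n R i j | i j. i \<in> {1..2 * n} \<and> j \<in> {1..2 * n}} \<subseteq> a_kernel A.F.M B.W \<rho>"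
    using A.weyl_gens_subset unfolding a_kernel_def' by blast
  then have "weyl_ideal n R \<subseteq> a_kernel A.F.M B.W \<rho>"
    unfolding weyl_ideal_def A.free_alg_eq by (rule A.F.M.genideal_minimal[OF \<rho>.kernel_is_ideal])
  from subsetD[OF this] have \<rho>_zero: "\<forall>a\<in>weyl_ideal n R. \<rho> a = \<zero>\<^bsub>B.W\<^esub>"
    unfolding a_kernel_def' by simp
  obtain H where H: "H \<in> ring_hom (A.F.M Quot weyl_ideal n R) B.W"
      "\<And>a. a \<in> carrier A.F.M \<Longrightarrow> H (weyl_ideal n R +>\<^bsub>A.F.M\<^esub> a) = \<rho> a"
    using quotient_ring_hom_lift[OF A.weyl_ideal B.W.ring_axioms \<rho>_hom \<rho>_zero] by (elim bexE) simp
  have red: "red w = H w" if wW: "w \<in> carrier A.W" for w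
  proof -
    obtain a where a: "a \<in> carrier A.F.M" "w = weyl_class n R a" using A.weyl_class_surj[OF wW] by blast
    then have w: "w = weyl_ideal n R +>\<^bsub>A.F.M\<^esub> a" by (simp add: weyl_class_def A.free_alg_eq)
    have b: "\<rho> b = H w" if "b \<in> w" for b
    proof -
      have "b \<in> carrier A.F.M"
        using A.I.a_elemrcos_carrier[OF a(1), of b] that unfolding w by blast
      moreover have "weyl_ideal n R +>\<^bsub>A.F.M\<^esub> b = w"
        using A.I.a_repr_independence'[of b a] that a(1) unfolding w by simp
      ultimately show ?thesis using H(2)[of b] by simp
    qed
    have "a \<in> w" using A.I.a_rcos_self[OF a(1)] by (simp add: w)
    then have "\<rho> ` w = {H w}" using b by (auto intro!: image_eqI)
    then show ?thesis unfolding weyl_reduce_def \<rho>_def mapq_def by simp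
  qed
  show ?thesis
  proof (intro bexI[of _ H] conjI ballI)
    show "H \<in> ring_hom A.W B.W" using H(1) by (simp add: A.W_eq)
    show "H (weyl_class n R a) = \<rho> a" if "a \<in> carrier A.F.M" for a
      using H(2)[OF that] by (simp add: weyl_class_def A.free_alg_eq)
  qed (rule red)
qed

lemma red_hom: "red \<in> ring_hom A.W B.W"
proof -
  obtain H where H: "H \<in> ring_hom A.W B.W" "\<And>w. w \<in> carrier A.W \<Longrightarrow> red w = H w"
    using ex_red by blast
  show ?thesis
    by (rule ring_hom_memI)
       (simp_all add: H(2) ring_hom_closed[OF H(1)] ring_hom_mult[OF H(1)] ring_hom_add[OF H(1)] ring_hom_one[OF H(1)])
qed

sublocale red: ring_hom_ring "weyl n R" "weyl n (mod_ring R p)" "weyl_reduce n R p"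
  by (rule ring_hom_ringI2[OF A.W.ring_axioms B.W.ring_axioms red_hom])

lemma red_class: "a \<in> carrier A.F.M \<Longrightarrow> red (weyl_class n R a) = \<rho> a"
  using ex_red A.cl.hom_closed by metis

lemma red_const: "r \<in> carrier R \<Longrightarrow> red (A.\<kappa> r) = B.\<kappa> (q r)"
  unfolding A.const_eq B.const_eq by (simp add: red_class \<rho>_def mapq_single)

lemma red_gen: "i \<in> {1..2 * n} \<Longrightarrow> red (A.x i) = B.x i"
  unfolding A.gen_eq B.gen_eq by (simp add: red_class \<rho>_def mapq_single)

text \<open>Both sides satisfy the recursion for left multiplication, because the operators
  \<open>gen_op\<close> involve only integral multiples and \<open>q\<close> respects these.\<close>

lemma coef_red: "w \<in> carrier A.W \<Longrightarrow> B.coef (red w) = (\<lambda>m. q (A.coef w m))"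
proof (induction w rule: A.left_induct)
  case one
  then show ?case by (simp add: A.coef_one B.coef_one map_q_single)
next
  case (add v w)
  then show ?case
    using A.coef_closed[OF add(1)] A.coef_closed[OF add(2)] by (simp add: A.coef_add B.coef_add A.coeff_space_iff)
next
  case (const s w)
  then show ?case
    using A.coef_closed[OF const(2)] by (simp add: A.coef_smult B.coef_smult red_const A.coeff_space_iff)
next
  case (gen i w)
  have "gen_op n S i (\<lambda>m. q (A.coef w m)) m = q (gen_op n R i (A.coef w) m)" for m
    using A.coef_closed[OF gen(2)]
    by (simp add: gen_op_def mulvar_def poly_partial_def A.coeff_space_iff q_add_pow
        del: A.S.add.nat_pow_Suc B.S.add.nat_pow_Suc)
  then show ?case
    using gen A.x_closed[OF gen(1)]
    by (simp add: A.coef_gen B.coef_gen red_gen del: atLeastAtMost_iff)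
qed

lemma red_surj: "v \<in> carrier B.W \<Longrightarrow> \<exists>w \<in> carrier A.W. red w = v"
proof (induction v rule: B.left_induct)
  case one
  show ?case by (rule bexI[of _ "\<one>\<^bsub>A.W\<^esub>"]) simp_all
next
  case (add v w)
  then obtain v' w' where "v' \<in> carrier A.W" "red v' = v" "w' \<in> carrier A.W" "red w' = w" by blast
  then show ?case by (intro bexI[of _ "v' \<oplus>\<^bsub>A.W\<^esub> w'"]) simp_all
next
  case (const s w)
  then obtain w' where "w' \<in> carrier A.W" "red w' = w" by blast
  moreover obtain r where "r \<in> carrier R" "s = q r" using q_surj[OF const(1)] by blast
  ultimately show ?case by (intro bexI[of _ "A.\<kappa> r \<otimes>\<^bsub>A.W\<^esub> w'"]) (simp_all add: red_const)
next
  case (gen i w)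
  then obtain w' where "w' \<in> carrier A.W" "red w' = w" by blast
  then show ?case using A.x_closed[OF gen(1)] red_gen[OF gen(1)]
    by (intro bexI[of _ "A.x i \<otimes>\<^bsub>A.W\<^esub> w'"]) simp_all
qed

lemma red_add_pow: "w \<in> carrier A.W \<Longrightarrow> red ([(k::nat)] \<cdot>\<^bsub>A.W\<^esub> w) = [k] \<cdot>\<^bsub>B.W\<^esub> red w"
  by (induction k) simp_all

lemma red_p: "w \<in> carrier A.W \<Longrightarrow> red ([p] \<cdot>\<^bsub>A.W\<^esub> w) = \<zero>\<^bsub>B.W\<^esub>"
  by (simp add: red_add_pow B.W.add_pow_dvd[OF B.char_W])

text \<open>Coordinates make this immediate: every coefficient of w is a multiple of p, and the
  quotients are taken as the coefficients of u.\<close>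

lemma red_eq_zero:
  assumes w: "w \<in> carrier A.W" and "red w = \<zero>\<^bsub>B.W\<^esub>"
  shows "\<exists>u \<in> carrier A.W. w = [p] \<cdot>\<^bsub>A.W\<^esub> u"
proof -
  note [simp] = A.coef_closed[OF w, unfolded A.coeff_space_iff, rule_format]
  have "q (A.coef w m) = \<zero>\<^bsub>S\<^esub>" for m
    using coef_red[OF w] assms(2) by (metis B.coef_zero B.P.zero_apply)
  then have "\<exists>c \<in> carrier R. A.coef w m = [p] \<cdot>\<^bsub>R\<^esub> c" for m
    by (simp add: q_eq_zero_iff)
  then obtain c where c: "\<And>m. c m \<in> carrier R" "\<And>m. A.coef w m = [p] \<cdot>\<^bsub>R\<^esub> c m" by metis
  \<comment> \<open>Where the coefficient of w vanishes, the chosen quotient could still be a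
    nonzero element killed by p. It is reset to zero there to keep the support finite.\<close>
  define b where "b m = (if A.coef w m = \<zero> then \<zero> else c m)" for m
  have "{m. b m \<noteq> \<zero>} \<subseteq> {m. A.coef w m \<noteq> \<zero>}" by (auto simp: b_def)
  then have b: "b \<in> carrier A.P.M"
    using c(1) A.P.finite_support[OF A.coef_poly[OF w]] A.P.support_subset[OF A.coef_poly[OF w]]
    unfolding A.P.carrier_iff by (auto simp: b_def intro: finite_subset)
  have "A.coef ([p] \<cdot>\<^bsub>A.W\<^esub> A.\<Psi> b) = A.coef w"
    using b c by (auto simp: A.coef_add_pow A.coef_\<Psi>) (auto simp: b_def c)
  then show ?thesis using A.coef_inject w b by (intro bexI[of _ "A.\<Psi> b"]) auto
qed

lemma red_ad: "v \<in> carrier A.W \<Longrightarrow> w \<in> carrier A.W \<Longrightarrow> red (ad A.W v w) = ad B.W (red v) (red w)"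
  by (simp add: ad_def a_minus_def)

lemma red_funpow_ad: "v \<in> carrier A.W \<Longrightarrow> w \<in> carrier A.W \<Longrightarrow> red ((ad A.W v ^^ k) w) = (ad B.W (red v) ^^ k) (red w)"
  by (induction k) (simp_all add: red_ad)

lemma red_nat_pow: "v \<in> carrier A.W \<Longrightarrow> red (v [^]\<^bsub>A.W\<^esub> (k::nat)) = red v [^]\<^bsub>B.W\<^esub> k"
  by (induction k) simp_all

lemma red_pw: "set L \<subseteq> {1..2 * n} \<Longrightarrow> red (A.pw L e) = B.pw L e"
  by (induction L) (simp_all add: A.pw_Cons B.pw_Cons red_nat_pow red_gen)

lemma red_ordmon: "red (A.ordmon m) = B.ordmon m"
  unfolding A.ordmon_def B.ordmon_def by (rule red_pw) auto

end

section \<open>An automorphism and its inverse modulo p\<close>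

locale weyl_mod_aut = weyl_mod R n p for R :: "('a, 'm) ring_scheme" (structure) and n p +
  fixes f g
  assumes f: "f \<in> weyl_aut n R" and g: "g \<in> weyl_aut n R"
    and gf: "\<And>w. w \<in> carrier (weyl n R) \<Longrightarrow> g (f w) = w"
    and fg: "\<And>w. w \<in> carrier (weyl n R) \<Longrightarrow> f (g w) = w"
begin

lemma f_hom: "f \<in> ring_hom A.W A.W"
  using f by (simp add: weyl_aut_def algebra_aut_def ring_iso_def)

lemma g_hom: "g \<in> ring_hom A.W A.W"
  using g by (simp add: weyl_aut_def algebra_aut_def ring_iso_def)

sublocale f: ring_hom_ring "weyl n R" "weyl n R" f
  by (rule ring_hom_ringI2[OF A.W.ring_axioms A.W.ring_axioms f_hom])

sublocale g: ring_hom_ring "weyl n R" "weyl n R" g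
  by (rule ring_hom_ringI2[OF A.W.ring_axioms A.W.ring_axioms g_hom])

abbreviation "fp \<equiv> reduced_aut n R p f"
abbreviation "gp \<equiv> reduced_aut n R p g"

text \<open>Elements with equal reductions differ by a multiple of p, and h preserves such
  multiples; so \<open>the_elem\<close> in \<open>reduced_aut\<close> is applied to a singleton. The
  letter h stands for either f or g.\<close>

lemma reduced_hom_aux:
  assumes h: "h \<in> weyl_aut n R"
  shows "w \<in> carrier A.W \<Longrightarrow> reduced_aut n R p h (red w) = red (h w)"
    and "reduced_aut n R p h \<in> ring_hom B.W B.W"
    and "s \<in> carrier S \<Longrightarrow> reduced_aut n R p h (B.\<kappa> s) = B.\<kappa> s"
proof -
  have hom: "h \<in> ring_hom A.W A.W" and hc: "\<And>r. r \<in> carrier R \<Longrightarrow> h (A.\<kappa> r) = A.\<kappa> r"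
    using h by (auto simp: weyl_aut_def algebra_aut_def ring_iso_def)
  interpret h: ring_hom_ring "weyl n R" "weyl n R" h
    by (rule ring_hom_ringI2[OF A.W.ring_axioms A.W.ring_axioms hom])
  have hpow: "h ([k] \<cdot>\<^bsub>A.W\<^esub> w) = [k] \<cdot>\<^bsub>A.W\<^esub> h w" if "w \<in> carrier A.W" for w and k :: nat
    using that by (induction k) simp_all
  show red: "reduced_aut n R p h (red w) = red (h w)" if w: "w \<in> carrier A.W" for w
  proof -
    have wd: "red (h v) = red (h w)" if v: "v \<in> carrier A.W" "red v = red w" for v
    proof -
      have "red (v \<ominus>\<^bsub>A.W\<^esub> w) = \<zero>\<^bsub>B.W\<^esub>"
        using v w by (simp add: a_minus_def B.W.r_neg)
      then obtain u where u: "u \<in> carrier A.W" "v \<ominus>\<^bsub>A.W\<^esub> w = [p] \<cdot>\<^bsub>A.W\<^esub> u"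
        using red_eq_zero[of "v \<ominus>\<^bsub>A.W\<^esub> w"] v w by auto
      have "red (h (v \<ominus>\<^bsub>A.W\<^esub> w)) = \<zero>\<^bsub>B.W\<^esub>"
        unfolding u(2) using u(1) by (simp add: hpow red_p)
      then show ?thesis using v w by (simp add: a_minus_def B.W.r_right_minus_eq[unfolded a_minus_def])
    qed
    show ?thesis
      unfolding reduced_aut_def by (rule the_elem_image_unique) (use w wd in blast)+
  qed
  show "reduced_aut n R p h \<in> ring_hom B.W B.W"
  proof (rule ring_hom_memI)
    fix v w assume "v \<in> carrier B.W" "w \<in> carrier B.W"
    then obtain v' w' where vw: "v' \<in> carrier A.W" "red v' = v" "w' \<in> carrier A.W" "red w' = w"
      using red_surj by meson
    show "reduced_aut n R p h (v \<otimes>\<^bsub>B.W\<^esub> w) = reduced_aut n R p h v \<otimes>\<^bsub>B.W\<^esub> reduced_aut n R p h w"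
      using red[of "v' \<otimes>\<^bsub>A.W\<^esub> w'"] red[of v'] red[of w'] vw by simp
    show "reduced_aut n R p h (v \<oplus>\<^bsub>B.W\<^esub> w) = reduced_aut n R p h v \<oplus>\<^bsub>B.W\<^esub> reduced_aut n R p h w"
      using red[of "v' \<oplus>\<^bsub>A.W\<^esub> w'"] red[of v'] red[of w'] vw by simp
  next
    fix v assume "v \<in> carrier B.W"
    then obtain v' where vw: "v' \<in> carrier A.W" "red v' = v"
      using red_surj by meson
    show "reduced_aut n R p h v \<in> carrier B.W" using red[of v'] vw by simp
  next
    show "reduced_aut n R p h \<one>\<^bsub>B.W\<^esub> = \<one>\<^bsub>B.W\<^esub>" using red[of "\<one>\<^bsub>A.W\<^esub>"] by simp
  qed
  show "reduced_aut n R p h (B.\<kappa> s) = B.\<kappa> s" if s: "s \<in> carrier S"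
  proof -
    obtain r where r: "r \<in> carrier R" "s = q r" using q_surj[OF s] by blast
    then show ?thesis using red[of "A.\<kappa> r"] by (simp add: red_const hc)
  qed
qed

lemmas fp_red = reduced_hom_aux(1)[OF f] and fp_hom = reduced_hom_aux(2)[OF f] and fp_const = reduced_hom_aux(3)[OF f]
lemmas gp_red = reduced_hom_aux(1)[OF g] and gp_hom = reduced_hom_aux(2)[OF g] and gp_const = reduced_hom_aux(3)[OF g]

sublocale fp: ring_hom_ring "weyl n (mod_ring R p)" "weyl n (mod_ring R p)" "reduced_aut n R p f"
  by (rule ring_hom_ringI2[OF B.W.ring_axioms B.W.ring_axioms fp_hom])

sublocale gp: ring_hom_ring "weyl n (mod_ring R p)" "weyl n (mod_ring R p)" "reduced_aut n R p g"
  by (rule ring_hom_ringI2[OF B.W.ring_axioms B.W.ring_axioms gp_hom])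

lemma fp_gp: "v \<in> carrier B.W \<Longrightarrow> fp (gp v) = v"
  using red_surj[of v] by (auto simp: fp_red gp_red fg)

lemma fp_ad: "v \<in> carrier B.W \<Longrightarrow> w \<in> carrier B.W \<Longrightarrow> fp (ad B.W v w) = ad B.W (fp v) (fp w)"
  by (simp add: ad_def a_minus_def)

text \<open>Relies on surjectivity: any v is the image of \<open>gp v\<close>, and z commutes with
  \<open>gp v\<close>.\<close>

lemma fp_central:
  assumes "z \<in> ring_center B.W"
  shows "fp z \<in> ring_center B.W"
proof -
  have z: "z \<in> carrier B.W" using assms by (simp add: ring_center_def)
  have "fp z \<otimes>\<^bsub>B.W\<^esub> v = v \<otimes>\<^bsub>B.W\<^esub> fp z" if v: "v \<in> carrier B.W" for v
  proof -
    have "fp (z \<otimes>\<^bsub>B.W\<^esub> gp v) = fp (gp v \<otimes>\<^bsub>B.W\<^esub> z)"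
      using assms v by (simp add: ring_center_def)
    then show ?thesis using z v by (simp add: fp_gp)
  qed
  then show ?thesis using z by (simp add: ring_center_def)
qed

text \<open>
  The hypothesis holds for all large \<open>p\<close> because the inner derivations of the generators are locally
  nilpotent; it does not mention \<open>\<delta>\<close>.
\<close>
lemma derivation_center_coeff:
  assumes \<delta>: "ring_derivation S \<delta>" and i: "i \<in> {1..2 * n}"
    and nilp: "\<And>m. A.coef (f (A.x i)) m \<noteq> \<zero> \<Longrightarrow> (ad A.W (A.x i) ^^ (p - 1)) (g (A.ordmon m)) = \<zero>\<^bsub>A.W\<^esub>"
    and a: "a \<in> carrier B.P.M" "center_eval n S p a = fp (B.x i [^]\<^bsub>B.W\<^esub> p)"
  shows "\<delta> (a m) = \<zero>\<^bsub>S\<^esub>"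
proof -
  interpret D: weyl_derivation S n \<delta>
    by (simp add: weyl_derivation_def derivation_def derivation_axioms_def \<delta> cring_S B.weyl_algebra_axioms)
  note [simp] = A.x_closed[OF i] B.x_closed[OF i]
  let ?z = "fp (B.x i)" and ?d = "D.weyl_der (fp (B.x i))"
  have z: "?z = red (f (A.x i))" using fp_red[of "A.x i"] red_gen[OF i] by simp
  \<comment> \<open>The set where p - 1 commutators with the generator annihilate the preimage. It
    is an S-submodule because \<open>gp\<close> and \<open>ad\<close> are S-linear, so membership of
    ?d can be tested on the monomials in its support.\<close>
  define N where "N = {v \<in> carrier B.W. (ad B.W (B.x i) ^^ (p - 1)) (gp v) = \<zero>\<^bsub>B.W\<^esub>}"
  have "?d \<in> N"
    unfolding D.weyl_der_def
  proof (rule B.\<Psi>_in_subspace)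
    show "(\<lambda>m. \<delta> (B.coef ?z m)) \<in> carrier B.P.M" by (simp add: B.coef_poly)
    show "\<zero>\<^bsub>B.W\<^esub> \<in> N" by (simp add: N_def)
    show "v \<oplus>\<^bsub>B.W\<^esub> w \<in> N" if "v \<in> N" "w \<in> N" for v w
      using that by (simp add: N_def B.funpow_ad_add)
    show "B.\<kappa> s \<otimes>\<^bsub>B.W\<^esub> w \<in> N" if "s \<in> carrier S" "w \<in> N" for s w
      using that by (simp add: N_def gp_const B.funpow_ad_const_mult)
    fix m assume m: "\<delta> (B.coef ?z m) \<noteq> \<zero>\<^bsub>S\<^esub>"
    have nz: "A.coef (f (A.x i)) m \<noteq> \<zero>"
    proof
      assume "A.coef (f (A.x i)) m = \<zero>"
      then have "B.coef ?z m = \<zero>\<^bsub>S\<^esub>" by (simp add: z coef_red)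
      then show False using m D.zero by (simp only:)
    qed
    have "red ((ad A.W (A.x i) ^^ (p - 1)) (g (A.ordmon m))) = \<zero>\<^bsub>B.W\<^esub>"
      unfolding nilp[OF nz] by (rule red.hom_zero)
    then have "(ad B.W (B.x i) ^^ (p - 1)) (gp (B.ordmon m)) = \<zero>\<^bsub>B.W\<^esub>"
      using red_gen[OF i] gp_red[of "A.ordmon m"] by (simp add: red_funpow_ad red_ordmon)
    then show "B.ordmon m \<in> N" by (simp add: N_def)
  qed
  then have d: "(ad B.W (B.x i) ^^ (p - 1)) (gp ?d) = \<zero>\<^bsub>B.W\<^esub>" by (simp add: N_def)
  \<comment> \<open>Conjugation by \<open>fp\<close> carries \<open>ad (x i)\<close> to
    \<open>ad ?z\<close>, which moves the computation from ?z to the generator.\<close>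
  have fp_ad: "(ad B.W ?z ^^ k) ?d = fp ((ad B.W (B.x i) ^^ k) (gp ?d))" for k
    by (induction k) (simp_all add: fp_gp fp_ad)
  have "fp (B.x i [^]\<^bsub>B.W\<^esub> k) = ?z [^]\<^bsub>B.W\<^esub> k" for k :: nat
    by (induction k) simp_all
  then have "D.weyl_der (center_eval n S p a) = D.weyl_der (?z [^]\<^bsub>B.W\<^esub> p)"
    by (simp add: a)
  also have "\<dots> = pow_deriv B.W ?z ?d p"
    by (rule derivation_nat_pow[OF B.W.ring_axioms]) (simp_all add: D.weyl_der_mult)
  also have "\<dots> = (ad B.W ?z ^^ (p - 1)) ?d"
    by (rule B.W.pow_deriv_char[OF prime_p B.char_W]) simp_all
  also have "\<dots> = \<zero>\<^bsub>B.W\<^esub>"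
    unfolding fp_ad d by (rule fp.hom_zero)
  finally have "\<delta> (B.coef (center_eval n S p a) l) = \<zero>\<^bsub>S\<^esub>" for l
    using D.coef_weyl_der[of "center_eval n S p a"] a(1)
    by (simp add: B.coef_zero fun_eq_iff) (simp add: B.P.zero_apply)
  \<comment> \<open>The coefficient of a at m is the normal ordered coefficient of its evaluation at
    p times m.\<close>
  from this[of "repeat_mset p m"] show ?thesis by (simp add: B.coef_\<gamma>[OF a(1)])
qed

end

section \<open>Elements killed by all derivations\<close>

context weyl_algebra
begin

lemma poly_partial_apply_add:
  assumes "a \<in> carrier P.M" "b \<in> carrier P.M"
  shows "poly_partial S i (a \<oplus>\<^bsub>P.M\<^esub> b) = poly_partial S i a \<oplus>\<^bsub>P.M\<^esub> poly_partial S i b"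
proof
  fix m
  show "poly_partial S i (a \<oplus>\<^bsub>P.M\<^esub> b) m = (poly_partial S i a \<oplus>\<^bsub>P.M\<^esub> poly_partial S i b) m"
    using P.coeff_closed[OF assms(1)] P.coeff_closed[OF assms(2)]
    by (simp add: poly_partial_def P.add_apply add.nat_pow_distrib del: add.nat_pow_Suc)
qed

lemma poly_partial_zero [simp]: "poly_partial S i \<zero>\<^bsub>P.M\<^esub> = \<zero>\<^bsub>P.M\<^esub>"
proof
  fix m
  show "poly_partial S i \<zero>\<^bsub>P.M\<^esub> m = \<zero>\<^bsub>P.M\<^esub> m"
    by (simp add: poly_partial_def P.zero_apply del: add.nat_pow_Suc)
qed

text \<open>The product rule on monomials. Truncated subtraction of multisets gives the wrong
  exponent when the variable i is missing from a factor, but then the coefficient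
  \<open>count\<close> is 0.\<close>

lemma poly_partial_single_mult:
  assumes "r \<in> carrier S" "s \<in> carrier S"
  shows "single S ([(count (u + v) i)] \<cdot>\<^bsub>S\<^esub> (r \<otimes> s)) (u + v - {#i#}) =
    single S ([(count u i)] \<cdot>\<^bsub>S\<^esub> r \<otimes> s) (u - {#i#} + v) \<oplus>\<^bsub>P.M\<^esub> single S (r \<otimes> [(count v i)] \<cdot>\<^bsub>S\<^esub> s) (u + (v - {#i#}))"
proof -
  have u: "single S ([(count u i)] \<cdot>\<^bsub>S\<^esub> r \<otimes> s) (u - {#i#} + v) = single S ([(count u i)] \<cdot>\<^bsub>S\<^esub> (r \<otimes> s)) (u + v - {#i#})"
  proof (cases "i \<in># u")
    case False
    then have "count u i = 0" by (simp add: not_in_iff)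
    then show ?thesis using assms by (simp add: P.single_zero)
  qed (use assms in \<open>simp add: add_pow_ldistr\<close>)
  have v: "single S (r \<otimes> [(count v i)] \<cdot>\<^bsub>S\<^esub> s) (u + (v - {#i#})) = single S ([(count v i)] \<cdot>\<^bsub>S\<^esub> (r \<otimes> s)) (u + v - {#i#})"
  proof (cases "i \<in># v")
    case False
    then have "count v i = 0" by (simp add: not_in_iff)
    then show ?thesis using assms by (simp add: P.single_zero)
  qed (use assms in \<open>simp add: add_pow_rdistr\<close>)
  show ?thesis
    unfolding u v using assms by (simp add: P.single_add add.nat_pow_mult)
qed

lemma poly_partial_mult:
  assumes a: "a \<in> carrier P.M" and b: "b \<in> carrier P.M"
  shows "poly_partial S i (a \<otimes>\<^bsub>P.M\<^esub> b) =
    poly_partial S i a \<otimes>\<^bsub>P.M\<^esub> b \<oplus>\<^bsub>P.M\<^esub> a \<otimes>\<^bsub>P.M\<^esub> poly_partial S i b"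
  using a
proof (induction a rule: P.induct)
  case zero
  then show ?case using b by simp
next
  case (single r u)
  have mset: "set_mset (m - {#i#}) \<subseteq> {1..2 * n}" if "set_mset m \<subseteq> {1..2 * n}" for m
    using that by (auto dest: in_diffD)
  show ?case
    using b
  proof (induction b rule: P.induct)
    case (single s v)
    then show ?case
      using \<open>r \<in> carrier S\<close> \<open>u \<in> _\<close> mset[of u] mset[of v]
      by (simp only: P.single_mult poly_partial_single monomials_simps m_closed poly_partial_single_mult add.nat_pow_closed)
  next
    case (add b b')
    then show ?case using single by (simp add: P.M.r_distr poly_partial_apply_add P.M.a_ac)
  qed (use single in simp)
next
  case (add a a')
  then show ?case using b by (simp add: P.M.l_distr poly_partial_apply_add P.M.a_ac)
qed

lemma poly_partial_minus:
  assumes "a \<in> carrier P.M"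
  shows "poly_partial S i (\<ominus>\<^bsub>P.M\<^esub> a) = \<ominus>\<^bsub>P.M\<^esub> poly_partial S i a"
proof -
  have "poly_partial S i (\<ominus>\<^bsub>P.M\<^esub> a) \<oplus>\<^bsub>P.M\<^esub> poly_partial S i a = \<zero>\<^bsub>P.M\<^esub>"
    using assms by (simp add: poly_partial_apply_add[symmetric] P.M.l_neg)
  then show ?thesis using assms by (metis P.M.minus_equality P.M.a_inv_closed poly_partial_poly)
qed

lemma poly_partial_diff:
  "a \<in> carrier P.M \<Longrightarrow> b \<in> carrier P.M \<Longrightarrow>
    poly_partial S i (a \<ominus>\<^bsub>P.M\<^esub> b) = poly_partial S i a \<ominus>\<^bsub>P.M\<^esub> poly_partial S i b"
  by (simp add: a_minus_def poly_partial_apply_add poly_partial_minus)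

abbreviation "pconst s \<equiv> single S s ({#} :: nat multiset)"
abbreviation "pgen i \<equiv> single S \<one> {#i :: nat#}"

lemma poly_partial_const: "s \<in> carrier S \<Longrightarrow> poly_partial S i (pconst s) = \<zero>\<^bsub>P.M\<^esub>"
  by (simp add: poly_partial_single P.single_zero)

lemma poly_partial_gen: "poly_partial S i (pgen j) = (if i = j then \<one>\<^bsub>P.M\<^esub> else \<zero>\<^bsub>P.M\<^esub>)"
  by (simp add: poly_partial_single P.single_zero P.one_eq)

text \<open>Generates S[x] as a ring instead of as a module, which suits properties that a product
  rule propagates.\<close>

lemma poly_induct [consumes 1, case_names const gen add mult]:
  assumes "a \<in> carrier P.M"
    and const: "\<And>s. s \<in> carrier S \<Longrightarrow> Q (pconst s)"
    and gen: "\<And>i. i \<in> {1..2 * n} \<Longrightarrow> Q (pgen i)"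
    and add: "\<And>a b. a \<in> carrier P.M \<Longrightarrow> b \<in> carrier P.M \<Longrightarrow> Q a \<Longrightarrow> Q b \<Longrightarrow> Q (a \<oplus>\<^bsub>P.M\<^esub> b)"
    and mult: "\<And>a b. a \<in> carrier P.M \<Longrightarrow> b \<in> carrier P.M \<Longrightarrow> Q a \<Longrightarrow> Q b \<Longrightarrow> Q (a \<otimes>\<^bsub>P.M\<^esub> b)"
  shows "Q a"
  using assms(1)
proof (induction a rule: P.induct)
  case zero
  then show ?case using const[of \<zero>] by (simp add: P.single_zero)
next
  case (single r u)
  have "set_mset u \<subseteq> {1..2 * n} \<Longrightarrow> Q (single S r u)"
  proof (induction u)
    case empty
    then show ?case using const single by simp
  next
    case (add i u)
    have "single S r (add_mset i u) = pgen i \<otimes>\<^bsub>P.M\<^esub> single S r u"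
      using single by (simp add: P.single_mult)
    then show ?case using add gen[of i] mult[of "pgen i" "single S r u"] single by simp
  qed
  then show ?case using single by simp
qed (rule add)

end

text \<open>Here n is a parameter for the number of variables of S[x], later chosen independently of
  the Weyl algebra of the theorem, and c lists generators of S. Lifting is demanded for the element
  type of the quotients of S[x] and for rings of characteristic p.\<close>

locale cartier = weyl_char S n p for S :: "('a, 'm) ring_scheme" (structure) and n p +
  fixes c :: "nat \<Rightarrow> 'a"
  assumes c: "\<And>i. i \<in> {1..2 * n} \<Longrightarrow> c i \<in> carrier S"
    and generate: "generate_ring S (c ` {1..2 * n}) = carrier S"
    and lift: "\<And>(B :: (nat multiset \<Rightarrow> 'a) set ring) J g. cring B \<Longrightarrow> [p] \<cdot>\<^bsub>B\<^esub> \<one>\<^bsub>B\<^esub> = \<zero>\<^bsub>B\<^esub> \<Longrightarrow> ideal J B \<Longrightarrow>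
      (\<forall>a\<in>J. \<forall>b\<in>J. a \<otimes>\<^bsub>B\<^esub> b = \<zero>\<^bsub>B\<^esub>) \<Longrightarrow> g \<in> ring_hom S (B Quot J) \<Longrightarrow>
      \<exists>h \<in> ring_hom S B. \<forall>s \<in> carrier S. J +>\<^bsub>B\<^esub> h s = g s"
begin

definition "\<phi> m = finprod S (\<lambda>i. c i [^] (count m i)) {1..2 * n}"

lemma \<phi>_closed [simp]: "\<phi> m \<in> carrier S"
  unfolding \<phi>_def by (rule finprod_closed) (use c in auto)

lemma \<phi>_add: "\<phi> (u + v) = \<phi> u \<otimes> \<phi> v"
proof -
  have "\<phi> (u + v) = finprod S (\<lambda>i. c i [^] (count u i) \<otimes> c i [^] (count v i)) {1..2 * n}"
    unfolding \<phi>_def by (rule finprod_cong') (use c in \<open>auto simp: nat_pow_mult\<close>)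
  then show ?thesis unfolding \<phi>_def using c by (subst (asm) finprod_multf) auto
qed

lemma \<phi>_empty [simp]: "\<phi> {#} = \<one>"
  by (simp add: \<phi>_def)

lemma \<phi>_single: "i \<in> {1..2 * n} \<Longrightarrow> \<phi> {#i#} = c i"
proof -
  assume i: "i \<in> {1..2 * n}"
  have "\<phi> {#i#} = finprod S (\<lambda>j. if i = j then c j else \<one>) {1..2 * n}"
    unfolding \<phi>_def by (rule finprod_cong') (use c in auto)
  then show ?thesis using i c by (simp add: finprod_singleton Pi_def)
qed

lemma \<phi>_repeat: "\<phi> (repeat_mset k m) = \<phi> m [^] k"
  by (induction k) (simp_all add: \<phi>_add m_comm)

text \<open>Presents S as an algebra over its own p-th powers: polynomials in the x_i^p are sent to
  p-th powers, constants included.\<close>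

definition "\<epsilon> = lin_ext S S (\<lambda>s. s [^] p) \<phi>"

lemma \<epsilon>_hom: "\<epsilon> \<in> ring_hom P.M S"
  unfolding \<epsilon>_def
  by (rule P.lin_ext_ring_hom[OF ring_axioms frobenius_hom[OF p char]]) (simp_all add: \<phi>_add m_comm)

sublocale \<epsilon>: ring_hom_ring "monoid_ring S (monomials n)" S \<epsilon>
  by (rule ring_hom_ringI2[OF P.M.ring_axioms ring_axioms \<epsilon>_hom])

lemma \<epsilon>_single: "r \<in> carrier S \<Longrightarrow> set_mset m \<subseteq> {1..2 * n} \<Longrightarrow> \<epsilon> (single S r m) = r [^] p \<otimes> \<phi> m"
  unfolding \<epsilon>_def
  using P.lin_ext_single[where \<phi> = \<phi>, OF ring_axioms frobenius_hom[OF p char] \<phi>_closed] by simp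

lemma \<epsilon>_gen: "i \<in> {1..2 * n} \<Longrightarrow> \<epsilon> (pgen i) = c i"
  using c[of i] by (simp add: \<epsilon>_single \<phi>_single)

lemma \<epsilon>_surj: "s \<in> carrier S \<Longrightarrow> \<exists>u \<in> carrier P.M. \<epsilon> u = s"
  unfolding generate[symmetric]
proof (induction s rule: generate_ring.induct)
  case one
  show ?case by (rule bexI[of _ "\<one>\<^bsub>P.M\<^esub>"]) simp_all
next
  case (incl h)
  then obtain i where "i \<in> {1..2 * n}" "h = c i" by blast
  then show ?case using \<epsilon>_gen[of i] by (intro bexI[of _ "pgen i"]) auto
next
  case (a_inv h)
  then obtain u where "u \<in> carrier P.M" "\<epsilon> u = h" by blast
  then show ?case by (intro bexI[of _ "\<ominus>\<^bsub>P.M\<^esub> u"]) simp_all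
next
  case (eng_add h1 h2)
  then obtain u v where "u \<in> carrier P.M" "\<epsilon> u = h1" "v \<in> carrier P.M" "\<epsilon> v = h2" by blast
  then show ?case by (intro bexI[of _ "u \<oplus>\<^bsub>P.M\<^esub> v"]) simp_all
next
  case (eng_mult h1 h2)
  then obtain u v where "u \<in> carrier P.M" "\<epsilon> u = h1" "v \<in> carrier P.M" "\<epsilon> v = h2" by blast
  then show ?case by (intro bexI[of _ "u \<otimes>\<^bsub>P.M\<^esub> v"]) simp_all
qed

text \<open>
  A chain of ideals with square zero successive quotients in which derivatives drop by one; it
  replaces the powers of the kernel of \<open>\<epsilon>\<close>.
\<close>
primrec N :: "nat \<Rightarrow> (nat multiset \<Rightarrow> 'a) set" where
  "N 0 = carrier P.M"
| "N (Suc k) = {u \<in> carrier P.M. \<epsilon> u = \<zero> \<and> (\<forall>i \<in> {1..2 * n}. poly_partial S i u \<in> N k)}"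

lemma N_subset: "N k \<subseteq> carrier P.M"
  by (cases k) auto

lemma N_Suc_subset: "N (Suc k) \<subseteq> N k"
  by (induction k) auto

lemma N_antimono: "k \<le> l \<Longrightarrow> N l \<subseteq> N k"
  by (rule lift_Suc_antimono_le[of N]) (rule N_Suc_subset)

lemma N_ideal: "ideal (N k) P.M"
proof (induction k)
  case 0
  then show ?case using P.M.oneideal by simp
next
  case (Suc k)
  interpret I: ideal "N k" P.M by (rule Suc)
  have sub: "u \<in> N k" if "u \<in> N (Suc k)" for u
    using that N_Suc_subset by blast
  show ?case
  proof (rule idealI[OF P.M.ring_axioms])
    show "subgroup (N (Suc k)) (add_monoid P.M)"
    proof (rule P.M.add.subgroupI)
      show "N (Suc k) \<noteq> {}" using I.zero_closed by (auto intro!: exI[of _ "\<zero>\<^bsub>P.M\<^esub>"])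
    qed (auto simp: poly_partial_minus poly_partial_apply_add)
    \<comment> \<open>The product rule contains the term (derivative of e) times a, so a itself must
      lie in \<open>N k\<close>; this is where the inclusion of consecutive ideals enters.\<close>
    fix a e assume "a \<in> N (Suc k)" "e \<in> carrier P.M"
    then have *: "e \<otimes>\<^bsub>P.M\<^esub> a \<in> N (Suc k)"
      using sub[of a] by (auto simp: poly_partial_mult intro!: I.a_closed I.I_l_closed)
    then show "e \<otimes>\<^bsub>P.M\<^esub> a \<in> N (Suc k)" .
    show "a \<otimes>\<^bsub>P.M\<^esub> e \<in> N (Suc k)"
      using * P.m_comm[of a e] \<open>a \<in> _\<close> \<open>e \<in> _\<close> N_subset by auto
  qed
qed

text \<open>By the product rule every derivative of a b lies in the ideal \<open>N k\<close> when
  both factors do. The condition k \<ge> 1 provides \<epsilon>(a) = 0 and thereby \<epsilon>(a b) =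
  0.\<close>

lemma N_square:
  assumes "k \<ge> 1" "a \<in> N k" "b \<in> N k"
  shows "a \<otimes>\<^bsub>P.M\<^esub> b \<in> N (Suc k)"
proof -
  interpret I: ideal "N k" P.M by (rule N_ideal)
  have ab: "a \<in> carrier P.M" "b \<in> carrier P.M" using assms N_subset by blast+
  have "a \<in> N (Suc 0)" using assms N_antimono[of "Suc 0" k] by auto
  moreover have "poly_partial S i (a \<otimes>\<^bsub>P.M\<^esub> b) \<in> N k" for i
    unfolding poly_partial_mult[OF ab]
    using I.a_closed[OF I.I_l_closed[OF assms(3), of "poly_partial S i a"] I.I_r_closed[OF assms(2), of "poly_partial S i b"]] ab
    by simp
  ultimately show ?thesis using ab by simp
qed

declare N.simps(2) [simp del]

abbreviation "E k \<equiv> P.M Quot N k"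

lemma E_cring: "cring (E k)"
  by (rule ideal.quotient_is_cring[OF N_ideal P.cring_axioms])

lemma E_hom: "ring_hom_ring P.M (E k) ((+>\<^bsub>P.M\<^esub>) (N k))"
  by (rule ideal.rcos_ring_hom_ring[OF N_ideal])

lemma E_surj: "C \<in> carrier (E k) \<Longrightarrow> \<exists>u \<in> carrier P.M. C = N k +>\<^bsub>P.M\<^esub> u"
  unfolding FactRing_def A_RCOSETS_def' by auto

lemma E_eq_iff:
  "u \<in> carrier P.M \<Longrightarrow> v \<in> carrier P.M \<Longrightarrow> N k +>\<^bsub>P.M\<^esub> u = N k +>\<^bsub>P.M\<^esub> v \<longleftrightarrow> u \<ominus>\<^bsub>P.M\<^esub> v \<in> N k"
  using P.M.quotient_eq_iff_same_a_r_cos[OF N_ideal] by blast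

lemma E_eq_zero_iff:
  assumes "u \<in> carrier P.M"
  shows "N k +>\<^bsub>P.M\<^esub> u = \<zero>\<^bsub>E k\<^esub> \<longleftrightarrow> u \<in> N k"
proof -
  interpret h: ring_hom_ring P.M "E k" "(+>\<^bsub>P.M\<^esub>) (N k)" by (rule E_hom)
  have "u \<ominus>\<^bsub>P.M\<^esub> \<zero>\<^bsub>P.M\<^esub> = u" using assms by (simp add: a_minus_def)
  then show ?thesis using E_eq_iff[OF assms P.M.zero_closed, of k] unfolding h.hom_zero by simp
qed

lemma ring_hom_nat_multiple:
  assumes "ring_hom_ring A B h" "a \<in> carrier A"
  shows "h ([(k::nat)] \<cdot>\<^bsub>A\<^esub> a) = [k] \<cdot>\<^bsub>B\<^esub> h a"
proof -
  interpret h: ring_hom_ring A B h by fact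
  show ?thesis using assms(2) by (induction k) simp_all
qed

lemma P_char: "[p] \<cdot>\<^bsub>P.M\<^esub> \<one>\<^bsub>P.M\<^esub> = \<zero>\<^bsub>P.M\<^esub>"
proof -
  have "[k] \<cdot>\<^bsub>P.M\<^esub> \<one>\<^bsub>P.M\<^esub> = pconst ([k] \<cdot>\<^bsub>S\<^esub> \<one>)" for k :: nat
    by (induction k) (simp_all add: P.single_zero P.single_add P.one_eq)
  then show ?thesis by (simp add: char P.single_zero)
qed

lemma E_char: "[p] \<cdot>\<^bsub>E k\<^esub> \<one>\<^bsub>E k\<^esub> = \<zero>\<^bsub>E k\<^esub>"
proof -
  interpret h: ring_hom_ring P.M "E k" "(+>\<^bsub>P.M\<^esub>) (N k)" by (rule E_hom)
  show ?thesis
    using ring_hom_nat_multiple[OF E_hom[of k], of "\<one>\<^bsub>P.M\<^esub>" p] h.hom_one h.hom_zero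
    by (simp add: P_char del: h.hom_one h.hom_zero)
qed

text \<open>Begins with the inverse of the isomorphism from E 1 to S and lifts along the map from E
  (k + 2) to E (k + 1), whose kernel has square zero by \<open>N_square\<close>.\<close>

lemma ex_section: "\<exists>T \<in> ring_hom S (E (Suc k)). \<forall>s \<in> carrier S. \<forall>u \<in> carrier P.M. T s = N (Suc k) +>\<^bsub>P.M\<^esub> u \<longrightarrow> \<epsilon> u = s"
proof (induction k)
  case 0
  interpret h: ring_hom_ring P.M "E (Suc 0)" "(+>\<^bsub>P.M\<^esub>) (N (Suc 0))" by (rule E_hom)
  obtain v where v: "\<And>s. s \<in> carrier S \<Longrightarrow> v s \<in> carrier P.M \<and> \<epsilon> (v s) = s"
    using \<epsilon>_surj by metis
  have eq: "N (Suc 0) +>\<^bsub>P.M\<^esub> u = N (Suc 0) +>\<^bsub>P.M\<^esub> w \<longleftrightarrow> \<epsilon> u = \<epsilon> w" if "u \<in> carrier P.M" "w \<in> carrier P.M" for u w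
  proof -
    have "u \<ominus>\<^bsub>P.M\<^esub> w \<in> N (Suc 0) \<longleftrightarrow> \<epsilon> u = \<epsilon> w"
      using that by (simp add: N.simps(2) a_minus_def r_right_minus_eq[unfolded a_minus_def])
    then show ?thesis using that by (simp only: E_eq_iff)
  qed
  show ?case
  proof (intro bexI[of _ "\<lambda>s. N (Suc 0) +>\<^bsub>P.M\<^esub> v s"] ballI impI)
    show "(\<lambda>s. N (Suc 0) +>\<^bsub>P.M\<^esub> v s) \<in> ring_hom S (E (Suc 0))"
    proof (rule ring_hom_memI)
      fix s t assume st: "s \<in> carrier S" "t \<in> carrier S"
      show "N (Suc 0) +>\<^bsub>P.M\<^esub> v (s \<otimes> t) = (N (Suc 0) +>\<^bsub>P.M\<^esub> v s) \<otimes>\<^bsub>E (Suc 0)\<^esub> (N (Suc 0) +>\<^bsub>P.M\<^esub> v t)"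
        using st v by (subst h.hom_mult[symmetric]) (simp_all add: eq del: h.hom_mult h.hom_add)
      show "N (Suc 0) +>\<^bsub>P.M\<^esub> v (s \<oplus> t) = (N (Suc 0) +>\<^bsub>P.M\<^esub> v s) \<oplus>\<^bsub>E (Suc 0)\<^esub> (N (Suc 0) +>\<^bsub>P.M\<^esub> v t)"
        using st v by (subst h.hom_add[symmetric]) (simp_all add: eq del: h.hom_mult h.hom_add)
    next
      show "N (Suc 0) +>\<^bsub>P.M\<^esub> v \<one> = \<one>\<^bsub>E (Suc 0)\<^esub>"
        using v by (subst h.hom_one[symmetric]) (simp add: eq del: h.hom_one)
    qed (use v h.hom_closed in blast)
    show "\<epsilon> u = s" if "s \<in> carrier S" "u \<in> carrier P.M" "N (Suc 0) +>\<^bsub>P.M\<^esub> v s = N (Suc 0) +>\<^bsub>P.M\<^esub> u" for s u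
      using that v eq[of "v s" u] by simp
  qed
next
  case (Suc k)
  let ?k = "Suc k"
  let ?B = "E (Suc ?k)"
  interpret B: cring ?B by (rule E_cring)
  interpret A: cring "E ?k" by (rule E_cring)
  interpret a: ring_hom_ring P.M "E ?k" "(+>\<^bsub>P.M\<^esub>) (N ?k)" by (rule E_hom)
  interpret b: ring_hom_ring P.M ?B "(+>\<^bsub>P.M\<^esub>) (N (Suc ?k))" by (rule E_hom)
  obtain T where T: "T \<in> ring_hom S (E ?k)"
    and T_\<epsilon>: "\<And>s u. s \<in> carrier S \<Longrightarrow> u \<in> carrier P.M \<Longrightarrow> T s = N ?k +>\<^bsub>P.M\<^esub> u \<Longrightarrow> \<epsilon> u = s"
    using Suc.IH by blast
  have N_zero: "\<forall>u\<in>N (Suc ?k). N ?k +>\<^bsub>P.M\<^esub> u = \<zero>\<^bsub>E ?k\<^esub>"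
    using N_Suc_subset[of ?k] E_eq_zero_iff N_subset by blast
  obtain H where H: "H \<in> ring_hom ?B (E ?k)"
    "\<And>u. u \<in> carrier P.M \<Longrightarrow> H (N (Suc ?k) +>\<^bsub>P.M\<^esub> u) = N ?k +>\<^bsub>P.M\<^esub> u"
    using quotient_ring_hom_lift[OF N_ideal A.ring_axioms a.homh N_zero] by (elim bexE) simp
  interpret H: ring_hom_ring ?B "E ?k" H
    by (rule ring_hom_ringI2[OF B.ring_axioms A.ring_axioms H(1)])
  define J where "J = a_kernel ?B (E ?k) H"
  interpret J: ideal J ?B unfolding J_def by (rule H.kernel_is_ideal)
  have J0: "\<forall>y\<in>J. \<forall>z\<in>J. y \<otimes>\<^bsub>?B\<^esub> z = \<zero>\<^bsub>?B\<^esub>"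
  proof (intro ballI)
    fix y z assume yz: "y \<in> J" "z \<in> J"
    have rep: "\<exists>u\<in>N ?k. y = N (Suc ?k) +>\<^bsub>P.M\<^esub> u" if "y \<in> J" for y
    proof -
      have y: "y \<in> carrier ?B" "H y = \<zero>\<^bsub>E ?k\<^esub>" using that unfolding J_def a_kernel_def' mem_Collect_eq by blast+
      obtain u where u: "u \<in> carrier P.M" "y = N (Suc ?k) +>\<^bsub>P.M\<^esub> u" using E_surj[OF y(1)] by (elim bexE)
      have "N ?k +>\<^bsub>P.M\<^esub> u = \<zero>\<^bsub>E ?k\<^esub>" using y(2) unfolding u(2) H(2)[OF u(1)] .
      then have "u \<in> N ?k" using E_eq_zero_iff[OF u(1)] by blast
      then show ?thesis using u by blast
    qed
    obtain u where u: "u \<in> N ?k" "y = N (Suc ?k) +>\<^bsub>P.M\<^esub> u" using rep[OF yz(1)] by (elim bexE)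
    obtain v where v: "v \<in> N ?k" "z = N (Suc ?k) +>\<^bsub>P.M\<^esub> v" using rep[OF yz(2)] by (elim bexE)
    have uv: "u \<in> carrier P.M" "v \<in> carrier P.M" using u(1) v(1) N_subset by blast+
    then have "y \<otimes>\<^bsub>?B\<^esub> z = N (Suc ?k) +>\<^bsub>P.M\<^esub> (u \<otimes>\<^bsub>P.M\<^esub> v)"
      unfolding u(2) v(2) by simp
    also have "\<dots> = \<zero>\<^bsub>?B\<^esub>"
      using E_eq_zero_iff[OF P.M.m_closed[OF uv]] N_square[OF _ u(1) v(1)] by simp
    finally show "y \<otimes>\<^bsub>?B\<^esub> z = \<zero>\<^bsub>?B\<^esub>" .
  qed
  have J_eq: "J +>\<^bsub>?B\<^esub> y = J +>\<^bsub>?B\<^esub> z \<longleftrightarrow> H y = H z" if "y \<in> carrier ?B" "z \<in> carrier ?B" for y z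
  proof -
    have "J +>\<^bsub>?B\<^esub> y = J +>\<^bsub>?B\<^esub> z \<longleftrightarrow> y \<ominus>\<^bsub>?B\<^esub> z \<in> J"
      using B.quotient_eq_iff_same_a_r_cos[OF J.ideal_axioms that] by (rule sym)
    also have "\<dots> \<longleftrightarrow> H (y \<ominus>\<^bsub>?B\<^esub> z) = \<zero>\<^bsub>E ?k\<^esub>"
      using B.minus_closed[OF that] unfolding J_def a_kernel_def' mem_Collect_eq by blast
    also have "\<dots> \<longleftrightarrow> H y = H z"
      using that by (simp add: a_minus_def A.r_right_minus_eq[unfolded a_minus_def])
    finally show ?thesis .
  qed
  have "\<exists>y \<in> carrier ?B. H y = T s" if sS: "s \<in> carrier S" for s
  proof -
    obtain u where u: "u \<in> carrier P.M" "T s = N ?k +>\<^bsub>P.M\<^esub> u"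
      using E_surj[OF ring_hom_closed[OF T sS]] by (elim bexE)
    show ?thesis by (rule bexI[of _ "N (Suc ?k) +>\<^bsub>P.M\<^esub> u"]) (simp_all only: u H(2) b.hom_closed)
  qed
  then obtain t where t: "\<And>s. s \<in> carrier S \<Longrightarrow> t s \<in> carrier ?B \<and> H (t s) = T s" by metis
  interpret j: ring_hom_ring ?B "?B Quot J" "(+>\<^bsub>?B\<^esub>) J" by (rule J.rcos_ring_hom_ring)
  \<comment> \<open>The preimages t s are chosen arbitrarily and respect sums and products only
    modulo J. This is the section T, read in the quotient of ?B by J.\<close>
  have g: "(\<lambda>s. J +>\<^bsub>?B\<^esub> t s) \<in> ring_hom S (?B Quot J)"
  proof (rule ring_hom_memI)
    fix r s assume rs: "r \<in> carrier S" "s \<in> carrier S"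
    show "J +>\<^bsub>?B\<^esub> t (r \<otimes> s) = (J +>\<^bsub>?B\<^esub> t r) \<otimes>\<^bsub>?B Quot J\<^esub> (J +>\<^bsub>?B\<^esub> t s)"
      using rs t ring_hom_mult[OF T rs] by (subst j.hom_mult[symmetric]) (simp_all add: J_eq del: j.hom_mult j.hom_add)
    show "J +>\<^bsub>?B\<^esub> t (r \<oplus> s) = (J +>\<^bsub>?B\<^esub> t r) \<oplus>\<^bsub>?B Quot J\<^esub> (J +>\<^bsub>?B\<^esub> t s)"
      using rs t ring_hom_add[OF T rs] by (subst j.hom_add[symmetric]) (simp_all add: J_eq del: j.hom_mult j.hom_add)
  next
    show "J +>\<^bsub>?B\<^esub> t \<one> = \<one>\<^bsub>?B Quot J\<^esub>"
      using t ring_hom_one[OF T] by (subst j.hom_one[symmetric]) (simp add: J_eq del: j.hom_one)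
  qed (use t j.hom_closed in blast)
  obtain h where h: "h \<in> ring_hom S ?B" "\<And>s. s \<in> carrier S \<Longrightarrow> J +>\<^bsub>?B\<^esub> h s = J +>\<^bsub>?B\<^esub> t s"
    using lift[OF E_cring E_char J.ideal_axioms J0 g] by blast
  have Hh: "H (h s) = T s" if "s \<in> carrier S" for s
    using h(2)[OF that] J_eq[of "h s" "t s"] t[OF that] ring_hom_closed[OF h(1) that] by simp
  show ?case
  proof (intro bexI[OF _ h(1)] ballI impI)
    fix s u assume su: "s \<in> carrier S" "u \<in> carrier P.M" "h s = N (Suc ?k) +>\<^bsub>P.M\<^esub> u"
    have "T s = N ?k +>\<^bsub>P.M\<^esub> u" using Hh[OF su(1)] su(2,3) H(2) by simp
    then show "\<epsilon> u = s" by (rule T_\<epsilon>[OF su(1,2)])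
  qed
qed

text \<open>
  A derivation \<open>D\<close> along \<open>T\<close> kills the constants of \<open>S[x]\<close> because \<open>\<epsilon>\<close> sends them to \<open>p\<close>-th powers.
\<close>
lemma derivation_along:
  assumes "cring Q" "[p] \<cdot>\<^bsub>Q\<^esub> \<one>\<^bsub>Q\<^esub> = \<zero>\<^bsub>Q\<^esub>" and T: "T \<in> ring_hom S Q"
    and D: "\<And>s. s \<in> carrier S \<Longrightarrow> D s \<in> carrier Q"
      "\<And>s t. s \<in> carrier S \<Longrightarrow> t \<in> carrier S \<Longrightarrow> D (s \<oplus> t) = D s \<oplus>\<^bsub>Q\<^esub> D t"
      "\<And>s t. s \<in> carrier S \<Longrightarrow> t \<in> carrier S \<Longrightarrow> D (s \<otimes> t) = D s \<otimes>\<^bsub>Q\<^esub> T t \<oplus>\<^bsub>Q\<^esub> T s \<otimes>\<^bsub>Q\<^esub> D t"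
    and w: "w \<in> carrier P.M"
  shows "D (\<epsilon> w) = finsum Q (\<lambda>i. T (\<epsilon> (poly_partial S i w)) \<otimes>\<^bsub>Q\<^esub> D (c i)) {1..2 * n}"
proof -
  interpret Q: cring Q by fact
  interpret T: ring_hom_ring S Q T by (rule ring_hom_ringI2[OF ring_axioms Q.ring_axioms T])
  note [simp] = D(1)
  have cD [simp]: "D (c i) \<in> carrier Q" if "i \<in> {1..2 * n}" for i
    using c that by (intro D(1)) auto
  have "D \<one> \<oplus>\<^bsub>Q\<^esub> D \<one> = D \<one>" using D(3)[of \<one> \<one>] by simp
  then have D1: "D \<one> = \<zero>\<^bsub>Q\<^esub>" by (metis Q.add.l_cancel_one D(1) one_closed)
  have pow: "D (s [^] k) = pow_deriv Q (T s) (D s) k" if "s \<in> carrier S" for s and k :: nat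
  proof (induction k)
    case (Suc k)
    have "T (s [^] k) = T s [^]\<^bsub>Q\<^esub> k" for k :: nat
      using that by (induction k) simp_all
    then show ?case using Suc that by (simp add: D(3))
  qed (simp add: D1)
  obtain k where k: "p = Suc (Suc k)" using prime_ge_2_nat[OF p] by (metis add_2_eq_Suc le_Suc_ex)
  \<comment> \<open>In the commutative ring Q every \<open>ad\<close> vanishes, and the formula for
    the derivative of a p-th power contains p - 1 \<ge> 1 of them.\<close>
  have Dp: "D (s [^] p) = \<zero>\<^bsub>Q\<^esub>" if "s \<in> carrier S" for s
  proof -
    have "ad Q (T s) (D s) = \<zero>\<^bsub>Q\<^esub>" using that by (simp add: Q.ad_eq_zero_iff Q.m_comm)
    moreover have "(ad Q (T s) ^^ k) \<zero>\<^bsub>Q\<^esub> = \<zero>\<^bsub>Q\<^esub>" for k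
      using that by (induction k) simp_all
    ultimately have "(ad Q (T s) ^^ (p - 1)) (D s) = \<zero>\<^bsub>Q\<^esub>"
      by (simp add: k funpow_swap1)
    then show ?thesis
      unfolding pow[OF that] using that by (subst Q.pow_deriv_char[OF p assms(2)]) simp_all
  qed
  let ?\<Sigma> = "\<lambda>w. finsum Q (\<lambda>i. T (\<epsilon> (poly_partial S i w)) \<otimes>\<^bsub>Q\<^esub> D (c i)) {1..2 * n}"
  show ?thesis
    using w
  proof (induction w rule: poly_induct)
    case (const s)
    have "?\<Sigma> (pconst s) = \<zero>\<^bsub>Q\<^esub>"
      by (intro Q.add.finprod_one_eqI) (use const in \<open>simp add: poly_partial_const del: atLeastAtMost_iff\<close>)
    then show ?case using const by (simp add: \<epsilon>_single Dp)
  next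
    case (gen i)
    have "?\<Sigma> (pgen i) = finsum Q (\<lambda>j. if i = j then D (c j) else \<zero>\<^bsub>Q\<^esub>) {1..2 * n}"
      by (rule Q.finsum_cong') (auto simp: poly_partial_gen)
    also have "\<dots> = D (c i)" using gen by (intro Q.finsum_singleton) auto
    finally show ?case using gen by (simp only: \<epsilon>_gen)
  next
    case (add u v)
    have "?\<Sigma> (u \<oplus>\<^bsub>P.M\<^esub> v) = finsum Q (\<lambda>i. T (\<epsilon> (poly_partial S i u)) \<otimes>\<^bsub>Q\<^esub> D (c i) \<oplus>\<^bsub>Q\<^esub>
        T (\<epsilon> (poly_partial S i v)) \<otimes>\<^bsub>Q\<^esub> D (c i)) {1..2 * n}"
      by (rule Q.finsum_cong') (use add in \<open>auto simp: poly_partial_apply_add Q.l_distr\<close>)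
    also have "\<dots> = ?\<Sigma> u \<oplus>\<^bsub>Q\<^esub> ?\<Sigma> v"
      by (rule Q.finsum_addf) (use add in auto)
    finally show ?case using add by (simp add: D(2))
  next
    case (mult u v)
    have "?\<Sigma> (u \<otimes>\<^bsub>P.M\<^esub> v) = finsum Q (\<lambda>i. T (\<epsilon> (poly_partial S i u)) \<otimes>\<^bsub>Q\<^esub> D (c i) \<otimes>\<^bsub>Q\<^esub> T (\<epsilon> v) \<oplus>\<^bsub>Q\<^esub>
        T (\<epsilon> u) \<otimes>\<^bsub>Q\<^esub> (T (\<epsilon> (poly_partial S i v)) \<otimes>\<^bsub>Q\<^esub> D (c i))) {1..2 * n}"
      by (rule Q.finsum_cong') (use mult in \<open>auto simp: poly_partial_mult Q.l_distr Q.r_distr Q.m_ac\<close>)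
    also have "\<dots> = finsum Q (\<lambda>i. T (\<epsilon> (poly_partial S i u)) \<otimes>\<^bsub>Q\<^esub> D (c i) \<otimes>\<^bsub>Q\<^esub> T (\<epsilon> v)) {1..2 * n} \<oplus>\<^bsub>Q\<^esub>
        finsum Q (\<lambda>i. T (\<epsilon> u) \<otimes>\<^bsub>Q\<^esub> (T (\<epsilon> (poly_partial S i v)) \<otimes>\<^bsub>Q\<^esub> D (c i))) {1..2 * n}"
      by (rule Q.finsum_addf) (use mult in auto)
    also have "\<dots> = ?\<Sigma> u \<otimes>\<^bsub>Q\<^esub> T (\<epsilon> v) \<oplus>\<^bsub>Q\<^esub> T (\<epsilon> u) \<otimes>\<^bsub>Q\<^esub> ?\<Sigma> v"
      using mult by (subst Q.finsum_ldistr, simp, simp, force, subst Q.finsum_rdistr, simp, simp, force) simp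
    finally show ?case using mult by (simp add: D(3))
  qed
qed

section \<open>Euler operators and the removal of exponents prime to p\<close>

definition "theta j v = mulvar S j (poly_partial S j v)"

lemma theta_apply: "v \<in> carrier P.M \<Longrightarrow> theta j v m = [(count m j)] \<cdot>\<^bsub>S\<^esub> v m"
proof -
  assume v: "v \<in> carrier P.M"
  show ?thesis
  proof (cases "j \<in># m")
    case True
    then have "Suc (count (m - {#j#}) j) = count m j"
      by (metis count_add_mset insert_DiffM)
    then show ?thesis using True
      by (simp add: theta_def mulvar_def poly_partial_def del: add.nat_pow_Suc count_diff)
  next
    case False
    then have "count m j = 0" by (simp add: not_in_iff)
    then show ?thesis using False by (simp add: theta_def mulvar_def)
  qed
qed

lemma theta_closed [simp]: "v \<in> carrier P.M \<Longrightarrow> j \<in> {1..2 * n} \<Longrightarrow> theta j v \<in> carrier P.M"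
  by (simp add: theta_def del: atLeastAtMost_iff)

lemma funpow_theta_closed [simp]: "v \<in> carrier P.M \<Longrightarrow> j \<in> {1..2 * n} \<Longrightarrow> (theta j ^^ k) v \<in> carrier P.M"
  by (induction k) (simp_all del: atLeastAtMost_iff)

lemma funpow_theta_apply:
  assumes "v \<in> carrier P.M" "j \<in> {1..2 * n}"
  shows "(theta j ^^ k) v m = [(count m j ^ k)] \<cdot>\<^bsub>S\<^esub> v m"
  using assms P.coeff_closed[OF assms(1)]
  by (induction k) (simp_all add: theta_apply add.nat_pow_pow mult.commute del: atLeastAtMost_iff)

lemma mulvar_eq_mult:
  assumes "v \<in> carrier P.M" and j: "j \<in> {1..2 * n}"
  shows "mulvar S j v = pgen j \<otimes>\<^bsub>P.M\<^esub> v"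
  using assms(1)
proof (induction v rule: P.induct)
  case zero
  have "mulvar S j \<zero>\<^bsub>P.M\<^esub> m = \<zero>\<^bsub>P.M\<^esub> m" for m by (simp add: mulvar_def P.zero_apply)
  then show ?case using j by auto
next
  case (single r u)
  then show ?case using j by (simp add: mulvar_single P.single_mult)
next
  case (add u v)
  have "mulvar S j (u \<oplus>\<^bsub>P.M\<^esub> v) m = (mulvar S j u \<oplus>\<^bsub>P.M\<^esub> mulvar S j v) m" for m
    by (simp add: mulvar_def P.add_apply)
  then show ?case using add j by (auto simp: P.M.r_distr)
qed

text \<open>The derivative costs one level of the chain, while multiplication by the variable stays
  in the ideal.\<close>

lemma theta_N:
  assumes "v \<in> N (Suc k)" "j \<in> {1..2 * n}"
  shows "theta j v \<in> N k"
proof -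
  have "poly_partial S j v \<in> N k" "v \<in> carrier P.M" using assms by (auto simp: N.simps(2))
  then show ?thesis
    using assms(2) ideal.I_l_closed[OF N_ideal, of "poly_partial S j v" k "pgen j"]
    by (simp add: theta_def mulvar_eq_mult)
qed

lemma funpow_theta_N:
  "v \<in> N (l + k) \<Longrightarrow> j \<in> {1..2 * n} \<Longrightarrow> (theta j ^^ l) v \<in> N k"
proof (induction l arbitrary: k)
  case (Suc l)
  then have "(theta j ^^ l) v \<in> N (Suc k)" by simp
  then show ?case using theta_N Suc.prems by simp
qed simp

text \<open>
  By Fermat's little theorem \<open>v - (x\<^sub>j \<partial>\<^sub>j)\<^sup>p\<^sup>-\<^sup>1 v\<close> keeps exactly the terms whose exponent of \<open>x\<^sub>j\<close> is
  divisible by \<open>p\<close>.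
\<close>
lemma restrict_step:
  assumes v: "v \<in> carrier P.M" and j: "j \<in> {1..2 * n}"
    and d: "\<And>i. i \<in> {1..2 * n} \<Longrightarrow> poly_partial S i v \<in> N (k + p)"
  shows "\<exists>w \<in> carrier P.M. \<epsilon> w = \<epsilon> v \<and> (\<forall>i \<in> {1..2 * n}. poly_partial S i w \<in> N k) \<and>
    (\<forall>m. w m \<noteq> \<zero> \<longrightarrow> v m \<noteq> \<zero> \<and> p dvd count m j)"
proof -
  obtain l where l: "p = Suc (Suc l)" using prime_ge_2_nat[OF p] by (metis add_2_eq_Suc le_Suc_ex)
  let ?t = "(theta j ^^ (p - 1)) v"
  have t: "?t \<in> carrier P.M" using v j by (rule funpow_theta_closed)
  \<comment> \<open>The first Euler operator costs nothing beyond the hypothesis, since the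
    derivative of v already lies in N (k + p). The other p - 2 lead to N (k + 2), deep enough for
    \<epsilon> to vanish on the result and for its derivatives to lie in N k.\<close>
  have "theta j v \<in> N (k + p)"
    using ideal.I_l_closed[OF N_ideal d[OF j], of "pgen j"] v j by (simp add: theta_def mulvar_eq_mult)
  moreover have "k + p = l + (k + 2)" "p - 1 = Suc l" using l by simp_all
  moreover have "(theta j ^^ Suc l) v = (theta j ^^ l) (theta j v)" by (simp add: funpow_swap1)
  ultimately have tN: "?t \<in> N (Suc (Suc k))"
    using funpow_theta_N[of "theta j v" l "k + 2" j] j by (simp only: add_2_eq_Suc')
  define w where "w = v \<ominus>\<^bsub>P.M\<^esub> ?t"
  have w: "w \<in> carrier P.M" using v t by (simp add: w_def)
  have "\<epsilon> ?t = \<zero>" using tN by (simp add: N.simps(2))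
  then have "\<epsilon> w = \<epsilon> v" using v t by (simp add: w_def a_minus_def)
  moreover have "poly_partial S i w \<in> N k" if i: "i \<in> {1..2 * n}" for i
  proof -
    interpret I: ideal "N k" P.M by (rule N_ideal)
    have "poly_partial S i ?t \<in> N (Suc k)" using tN i by (simp add: N.simps(2))
    then have "poly_partial S i ?t \<in> N k" using N_Suc_subset by blast
    moreover have "poly_partial S i v \<in> N k" using d[OF i] N_antimono[of k "k + p"] by auto
    ultimately show ?thesis
      unfolding w_def poly_partial_diff[OF v t] unfolding a_minus_def by (intro I.a_closed I.a_inv_closed)
  qed
  moreover have "v m \<noteq> \<zero> \<and> p dvd count m j" if "w m \<noteq> \<zero>" for m
  proof -
    have vm: "v m \<in> carrier S" using v by (rule P.coeff_closed)
    have wm: "w m = v m \<ominus> [(count m j ^ (p - 1))] \<cdot>\<^bsub>S\<^esub> v m"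
      using v j t by (simp add: w_def P.diff_apply funpow_theta_apply)
    have "v m \<noteq> \<zero>" using that wm by (auto simp: a_minus_def)
    moreover have "p dvd count m j"
    proof (rule ccontr)
      assume "\<not> p dvd count m j"
      from fermat_theorem[OF p this] have "(count m j ^ (p - 1)) mod p = 1"
        using prime_gt_1_nat[OF p] by (simp add: cong_def)
      then have eq: "count m j ^ (p - 1) = p * (count m j ^ (p - 1) div p) + 1"
        by (metis mult_div_mod_eq)
      have "[(count m j ^ (p - 1))] \<cdot>\<^bsub>S\<^esub> v m = [(p * (count m j ^ (p - 1) div p))] \<cdot>\<^bsub>S\<^esub> v m \<oplus> v m"
        using vm by (subst eq) simp
      also have "\<dots> = v m" using add_pow_dvd[OF char _ vm] vm by simp
      finally have "w m = \<zero>" using vm by (simp add: wm a_minus_def r_neg)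
      then show False using that by simp
    qed
    ultimately show ?thesis by simp
  qed
  ultimately show ?thesis using w by blast
qed

text \<open>Each variable uses up p levels, hence the factor \<open>length L\<close>. Since terms
  are only removed, the divisibility gained for earlier variables persists.\<close>

lemma restrict_list:
  assumes "set L \<subseteq> {1..2 * n}" "v \<in> carrier P.M"
    "\<And>i. i \<in> {1..2 * n} \<Longrightarrow> poly_partial S i v \<in> N (length L * p)"
  shows "\<exists>w \<in> carrier P.M. \<epsilon> w = \<epsilon> v \<and> (\<forall>m. w m \<noteq> \<zero> \<longrightarrow> v m \<noteq> \<zero> \<and> (\<forall>j \<in> set L. p dvd count m j))"
  using assms
proof (induction L arbitrary: v)
  case Nil
  then show ?case by auto
next
  case (Cons j L)
  have j: "j \<in> {1..2 * n}" and L: "set L \<subseteq> {1..2 * n}" using Cons.prems(1) by auto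
  have d: "poly_partial S i v \<in> N (length L * p + p)" if "i \<in> {1..2 * n}" for i
    using Cons.prems(3)[OF that] by (simp add: add.commute)
  obtain u where u: "u \<in> carrier P.M" "\<epsilon> u = \<epsilon> v" "\<And>i. i \<in> {1..2 * n} \<Longrightarrow> poly_partial S i u \<in> N (length L * p)"
    "\<And>m. u m \<noteq> \<zero> \<Longrightarrow> v m \<noteq> \<zero> \<and> p dvd count m j"
    using restrict_step[OF Cons.prems(2) j d] by blast
  obtain w where "w \<in> carrier P.M" "\<epsilon> w = \<epsilon> u" "\<And>m. w m \<noteq> \<zero> \<Longrightarrow> u m \<noteq> \<zero> \<and> (\<forall>j \<in> set L. p dvd count m j)"
    using Cons.IH[OF L u(1,3)] by blast
  then show ?case using u by (intro bexI[of _ w]) auto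
qed

text \<open>A monomial with exponents p l has the value \<phi>(l)^p, and \<epsilon> turns its
  coefficient into a p-th power; sums of p-th powers are p-th powers by the Frobenius.\<close>

lemma pth_power_if_divisible:
  assumes w: "w \<in> carrier P.M" and dvd: "\<And>m j. w m \<noteq> \<zero> \<Longrightarrow> j \<in> {1..2 * n} \<Longrightarrow> p dvd count m j"
  shows "\<epsilon> w \<in> pth_powers S p"
proof -
  have "w m [^] p \<otimes> \<phi> m \<in> pth_powers S p" if m: "w m \<noteq> \<zero>" for m
  proof -
    have "set_mset m \<subseteq> {1..2 * n}" using P.support_subset[OF w] m by auto
    then have "p dvd count m i" for i
      using dvd[OF m, of i] by (cases "i \<in># m") (auto simp: not_in_iff)
    then obtain l where l: "m = repeat_mset p l" using repeat_mset_exhaust[OF p_pos, of m] by metis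
    have wm: "w m \<in> carrier S" using w by (rule P.coeff_closed)
    then have "w m [^] p \<otimes> \<phi> m = (w m \<otimes> \<phi> l) [^] p"
      by (simp add: l \<phi>_repeat nat_pow_distrib)
    then show ?thesis using wm by (auto simp: pth_powers_def)
  qed
  then show ?thesis
    unfolding \<epsilon>_def lin_ext_def by (intro finsum_pth_powers[OF p char] P.finite_support[OF w]) auto
qed

text \<open>Two sections cooperate. The one modulo N 2 provides derivations of S; as these kill a,
  the chain rule for a much deeper section shows that the derivatives of its lift of a vanish to
  high order.\<close>

lemma pth_power_if_derivations_zero:
  assumes a: "a \<in> carrier S" and zero: "\<And>\<delta>. ring_derivation S \<delta> \<Longrightarrow> \<delta> a = \<zero>"
  shows "a \<in> pth_powers S p"
proof -
  have ex_rep: "\<exists>u. \<forall>s \<in> carrier S. u s \<in> carrier P.M \<and> T s = N k +>\<^bsub>P.M\<^esub> u s"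
    if T: "T \<in> ring_hom S (E k)" for T k
  proof -
    have "\<exists>u. u \<in> carrier P.M \<and> T s = N k +>\<^bsub>P.M\<^esub> u" if "s \<in> carrier S" for s
      using E_surj[OF ring_hom_closed[OF T that]] by (simp only: Bex_def)
    then have "\<forall>s. s \<in> carrier S \<longrightarrow> (\<exists>u. u \<in> carrier P.M \<and> T s = N k +>\<^bsub>P.M\<^esub> u)" by (intro allI impI)
    from this[unfolded choice_iff'] show ?thesis unfolding Ball_def .
  qed
  obtain T2 where T2: "T2 \<in> ring_hom S (E 2)"
    "\<And>s u. s \<in> carrier S \<Longrightarrow> u \<in> carrier P.M \<Longrightarrow> T2 s = N 2 +>\<^bsub>P.M\<^esub> u \<Longrightarrow> \<epsilon> u = s"
    using ex_section[of 1] by (auto simp: numeral_2_eq_2)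
  obtain u where u: "\<And>s. s \<in> carrier S \<Longrightarrow> u s \<in> carrier P.M \<and> T2 s = N 2 +>\<^bsub>P.M\<^esub> u s"
    using ex_rep[OF T2(1)] by blast
  have \<epsilon>u: "\<epsilon> (u s) = s" if "s \<in> carrier S" for s
    using T2(2) u that by blast
  interpret e2: ring_hom_ring P.M "E 2" "(+>\<^bsub>P.M\<^esub>) (N 2)" by (rule E_hom)
  have der: "ring_derivation S (\<lambda>s. \<epsilon> (poly_partial S i (u s)))" if i: "i \<in> {1..2 * n}" for i
  proof -
    \<comment> \<open>Derivatives of elements of N 2 lie in N 1, where \<epsilon> vanishes. So the
      value does not depend on the representative, and the product rule descends from S[x].\<close>
    have eq: "\<epsilon> (poly_partial S i v) = \<epsilon> (poly_partial S i w)"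
      if vw: "v \<in> carrier P.M" "w \<in> carrier P.M" "N 2 +>\<^bsub>P.M\<^esub> v = N 2 +>\<^bsub>P.M\<^esub> w" for v w
    proof -
      have "v \<ominus>\<^bsub>P.M\<^esub> w \<in> N 2" using E_eq_iff[OF vw(1,2)] vw(3) by simp
      then have "\<epsilon> (poly_partial S i (v \<ominus>\<^bsub>P.M\<^esub> w)) = \<zero>" using i by (simp add: numeral_2_eq_2 N.simps(2))
      then have "\<epsilon> (poly_partial S i v \<ominus>\<^bsub>P.M\<^esub> poly_partial S i w) = \<zero>"
        by (simp only: poly_partial_diff[OF vw(1,2)])
      then show ?thesis using vw(1,2) by (simp add: a_minus_def r_right_minus_eq[unfolded a_minus_def])
    qed
    show ?thesis
      unfolding ring_derivation_def
    proof (intro conjI ballI)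
      fix s t assume st: "s \<in> carrier S" "t \<in> carrier S"
      have cl: "u s \<in> carrier P.M" "u t \<in> carrier P.M" using u st by auto
      have "N 2 +>\<^bsub>P.M\<^esub> u (s \<oplus> t) = N 2 +>\<^bsub>P.M\<^esub> (u s \<oplus>\<^bsub>P.M\<^esub> u t)"
        using u st ring_hom_add[OF T2(1) st] e2.hom_add[OF cl] by (metis add.m_closed)
      then have "\<epsilon> (poly_partial S i (u (s \<oplus> t))) = \<epsilon> (poly_partial S i (u s \<oplus>\<^bsub>P.M\<^esub> u t))"
        using u st cl by (intro eq) auto
      then show "\<epsilon> (poly_partial S i (u (s \<oplus> t))) = \<epsilon> (poly_partial S i (u s)) \<oplus> \<epsilon> (poly_partial S i (u t))"
        using cl by (simp add: poly_partial_apply_add)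
      have "N 2 +>\<^bsub>P.M\<^esub> u (s \<otimes> t) = N 2 +>\<^bsub>P.M\<^esub> (u s \<otimes>\<^bsub>P.M\<^esub> u t)"
        using u st ring_hom_mult[OF T2(1) st] e2.hom_mult[OF cl] by (metis m_closed)
      then have "\<epsilon> (poly_partial S i (u (s \<otimes> t))) = \<epsilon> (poly_partial S i (u s \<otimes>\<^bsub>P.M\<^esub> u t))"
        using u st cl by (intro eq) auto
      then show "\<epsilon> (poly_partial S i (u (s \<otimes> t))) =
          \<epsilon> (poly_partial S i (u s)) \<otimes> t \<oplus> s \<otimes> \<epsilon> (poly_partial S i (u t))"
        using cl st by (simp add: poly_partial_mult \<epsilon>u)
    qed (use u in auto)
  qed
  have du: "\<epsilon> (poly_partial S i (u a)) = \<zero>" if "i \<in> {1..2 * n}" for i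
    using zero[OF der[OF that]] .
  \<comment> \<open>The p levels that \<open>restrict_list\<close> consumes, once for each of the 2
    n variables.\<close>
  define k where "k = length [1..<2 * n + 1] * p"
  obtain T where T: "T \<in> ring_hom S (E (Suc k))"
    "\<And>s u. s \<in> carrier S \<Longrightarrow> u \<in> carrier P.M \<Longrightarrow> T s = N (Suc k) +>\<^bsub>P.M\<^esub> u \<Longrightarrow> \<epsilon> u = s"
    using ex_section[of k] by blast
  obtain v where v: "\<And>s. s \<in> carrier S \<Longrightarrow> v s \<in> carrier P.M \<and> T s = N (Suc k) +>\<^bsub>P.M\<^esub> v s"
    using ex_rep[OF T(1)] by blast
  interpret e: ring_hom_ring P.M "E (Suc k)" "(+>\<^bsub>P.M\<^esub>) (N (Suc k))" by (rule E_hom)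
  interpret e': ring_hom_ring P.M "E k" "(+>\<^bsub>P.M\<^esub>) (N k)" by (rule E_hom)
  have eq: "N k +>\<^bsub>P.M\<^esub> s = N k +>\<^bsub>P.M\<^esub> t"
    "\<And>i. i \<in> {1..2 * n} \<Longrightarrow> N k +>\<^bsub>P.M\<^esub> poly_partial S i s = N k +>\<^bsub>P.M\<^esub> poly_partial S i t"
    if "s \<in> carrier P.M" "t \<in> carrier P.M" "N (Suc k) +>\<^bsub>P.M\<^esub> s = N (Suc k) +>\<^bsub>P.M\<^esub> t" for s t
  proof -
    have st: "s \<ominus>\<^bsub>P.M\<^esub> t \<in> N (Suc k)" using E_eq_iff that by blast
    then have "s \<ominus>\<^bsub>P.M\<^esub> t \<in> N k" using N_Suc_subset by blast
    then show "N k +>\<^bsub>P.M\<^esub> s = N k +>\<^bsub>P.M\<^esub> t" using E_eq_iff that by blast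
    fix i assume "i \<in> {1..2 * n}"
    then have "poly_partial S i s \<ominus>\<^bsub>P.M\<^esub> poly_partial S i t \<in> N k"
      using st that by (simp add: poly_partial_diff N.simps(2))
    then show "N k +>\<^bsub>P.M\<^esub> poly_partial S i s = N k +>\<^bsub>P.M\<^esub> poly_partial S i t"
      using E_eq_iff that by simp
  qed
  have vadd: "N (Suc k) +>\<^bsub>P.M\<^esub> v (s \<oplus> t) = N (Suc k) +>\<^bsub>P.M\<^esub> (v s \<oplus>\<^bsub>P.M\<^esub> v t)"
    and vmult: "N (Suc k) +>\<^bsub>P.M\<^esub> v (s \<otimes> t) = N (Suc k) +>\<^bsub>P.M\<^esub> (v s \<otimes>\<^bsub>P.M\<^esub> v t)"
    if st: "s \<in> carrier S" "t \<in> carrier S" for s t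
    using v st ring_hom_add[OF T(1) st] ring_hom_mult[OF T(1) st] e.hom_add[of "v s" "v t"] e.hom_mult[of "v s" "v t"]
    by (metis add.m_closed, metis m_closed)
  have vone: "N (Suc k) +>\<^bsub>P.M\<^esub> v \<one> = N (Suc k) +>\<^bsub>P.M\<^esub> \<one>\<^bsub>P.M\<^esub>"
    using v[of \<one>] ring_hom_one[OF T(1)] e.hom_one by simp
  have T': "(\<lambda>s. N k +>\<^bsub>P.M\<^esub> v s) \<in> ring_hom S (E k)"
  proof (rule ring_hom_memI)
    fix s t assume st: "s \<in> carrier S" "t \<in> carrier S"
    then have cl: "v s \<in> carrier P.M" "v t \<in> carrier P.M" "v (s \<oplus> t) \<in> carrier P.M" "v (s \<otimes> t) \<in> carrier P.M"
      using v by auto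
    show "N k +>\<^bsub>P.M\<^esub> v (s \<otimes> t) = (N k +>\<^bsub>P.M\<^esub> v s) \<otimes>\<^bsub>E k\<^esub> (N k +>\<^bsub>P.M\<^esub> v t)"
      using eq(1)[OF cl(4) _ vmult[OF st]] cl by simp
    show "N k +>\<^bsub>P.M\<^esub> v (s \<oplus> t) = (N k +>\<^bsub>P.M\<^esub> v s) \<oplus>\<^bsub>E k\<^esub> (N k +>\<^bsub>P.M\<^esub> v t)"
      using eq(1)[OF cl(3) _ vadd[OF st]] cl by simp
  next
    show "N k +>\<^bsub>P.M\<^esub> v \<one> = \<one>\<^bsub>E k\<^esub>"
      using eq(1)[OF _ _ vone] v by simp
  qed (use v in auto)
  have "N k +>\<^bsub>P.M\<^esub> poly_partial S j (v a) = \<zero>\<^bsub>E k\<^esub>" if j: "j \<in> {1..2 * n}" for j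
  proof -
    define D where "D s = N k +>\<^bsub>P.M\<^esub> poly_partial S j (v s)" for s
    \<comment> \<open>The representative u a from the first order section serves as a polynomial
      expression for a = \<epsilon>(u a); the chain rule then contains only the derivatives that are
      already known to vanish under \<epsilon>.\<close>
    have "D (\<epsilon> (u a)) = finsum (E k) (\<lambda>i. (N k +>\<^bsub>P.M\<^esub> v (\<epsilon> (poly_partial S i (u a)))) \<otimes>\<^bsub>E k\<^esub> D (c i)) {1..2 * n}"
    proof (rule derivation_along[OF E_cring E_char T'])
      show "D s \<in> carrier (E k)" if "s \<in> carrier S" for s
        using v that by (simp add: D_def)
      fix s t assume st: "s \<in> carrier S" "t \<in> carrier S"
      then have cl: "v s \<in> carrier P.M" "v t \<in> carrier P.M" "v (s \<oplus> t) \<in> carrier P.M" "v (s \<otimes> t) \<in> carrier P.M"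
        using v by auto
      show "D (s \<oplus> t) = D s \<oplus>\<^bsub>E k\<^esub> D t"
        using eq(2)[OF cl(3) _ vadd[OF st] j] cl by (simp add: D_def poly_partial_apply_add)
      show "D (s \<otimes> t) = D s \<otimes>\<^bsub>E k\<^esub> (N k +>\<^bsub>P.M\<^esub> v t) \<oplus>\<^bsub>E k\<^esub> (N k +>\<^bsub>P.M\<^esub> v s) \<otimes>\<^bsub>E k\<^esub> D t"
        using eq(2)[OF cl(4) _ vmult[OF st] j] cl by (simp add: D_def poly_partial_mult)
    qed (use u a in auto)
    also have "\<dots> = \<zero>\<^bsub>E k\<^esub>"
    proof (intro e'.S.add.finprod_one_eqI)
      fix i assume i: "i \<in> {1..2 * n}"
      have "N k +>\<^bsub>P.M\<^esub> v \<zero> = \<zero>\<^bsub>E k\<^esub>"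
        using ring_hom_zero[OF T' ring_axioms e'.S.ring_axioms] .
      moreover have "D (c i) \<in> carrier (E k)" using v c[OF i] by (simp add: D_def)
      ultimately show "(N k +>\<^bsub>P.M\<^esub> v (\<epsilon> (poly_partial S i (u a)))) \<otimes>\<^bsub>E k\<^esub> D (c i) = \<zero>\<^bsub>E k\<^esub>"
        using du[OF i] by simp
    qed
    finally show ?thesis using \<epsilon>u[OF a] by (simp add: D_def)
  qed
  then have dv: "poly_partial S j (v a) \<in> N (length [1..<2 * n + 1] * p)" if "j \<in> {1..2 * n}" for j
    using that E_eq_zero_iff[of "poly_partial S j (v a)" k] v[OF a] unfolding k_def[symmetric] by simp
  have "set [1..<2 * n + 1] \<subseteq> {1..2 * n}" by auto
  then obtain w where w: "w \<in> carrier P.M" "\<epsilon> w = \<epsilon> (v a)"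
    "\<And>m. w m \<noteq> \<zero> \<Longrightarrow> \<forall>j \<in> set [1..<2 * n + 1]. p dvd count m j"
    using restrict_list[OF _ _ dv] v[OF a] by blast
  have "\<epsilon> w \<in> pth_powers S p"
  proof (rule pth_power_if_divisible[OF w(1)])
    fix m j assume "w m \<noteq> \<zero>" "j \<in> {1..2 * n}"
    moreover from this have "j \<in> set [1..<2 * n + 1]" by auto
    ultimately show "p dvd count m j" using w(3) by blast
  qed
  moreover have "\<epsilon> (v a) = a" using T(2)[OF a] v[OF a] by blast
  ultimately show ?thesis using w(2) by simp
qed

end

section \<open>Torsion in finitely generated rings\<close>

context cring
begin

text \<open>Relative to a subset K of the same ring, so that one notion covers ideals of R and
  modules over its subrings. Negatives come from \<ominus> \<one> \<in> K in the cases that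
  occur.\<close>

definition submod :: "'a set \<Rightarrow> 'a set \<Rightarrow> bool" where
  "submod K M \<longleftrightarrow> M \<subseteq> carrier R \<and> \<zero> \<in> M \<and> (\<forall>a\<in>M. \<forall>b\<in>M. a \<oplus> b \<in> M) \<and> (\<forall>k\<in>K. \<forall>a\<in>M. k \<otimes> a \<in> M)"

definition span :: "'a set \<Rightarrow> 'a set \<Rightarrow> 'a set" where
  "span K A = \<Inter> {M. submod K M \<and> A \<subseteq> M}"

definition noeth :: "'a set \<Rightarrow> bool" where
  "noeth K \<longleftrightarrow> (\<forall>M. submod K M \<and> M \<subseteq> K \<longrightarrow> (\<exists>A. finite A \<and> A \<subseteq> M \<and> M \<subseteq> span K A))"

lemma span_minimal: "submod K M \<Longrightarrow> A \<subseteq> M \<Longrightarrow> span K A \<subseteq> M"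
  by (auto simp: span_def)

lemma span_superset: "A \<subseteq> span K A"
  by (auto simp: span_def)

lemma submod_span:
  assumes "K \<subseteq> carrier R" "A \<subseteq> carrier R"
  shows "submod K (span K A)"
proof -
  have "submod K (carrier R)" using assms by (auto simp: submod_def)
  then show ?thesis using assms unfolding submod_def span_def by auto
qed

text \<open>Division with remainder by the least positive d with d 1 in M, as for subgroups of the
  integers. It works in every characteristic: if it is positive, zero itself is a positive multiple
  of 1 in M.\<close>

lemma noethI_int: "noeth {r. \<exists>k::nat. r = [k] \<cdot>\<^bsub>R\<^esub> \<one> \<or> r = \<ominus> ([k] \<cdot>\<^bsub>R\<^esub> \<one>)}" (is "noeth ?K")
  unfolding noeth_def
proof (intro allI impI)
  fix M assume M: "submod ?K M \<and> M \<subseteq> ?K"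
  have sub: "M \<subseteq> carrier R" and add: "\<And>a b. a \<in> M \<Longrightarrow> b \<in> M \<Longrightarrow> a \<oplus> b \<in> M"
    and mult: "\<And>k a. k \<in> ?K \<Longrightarrow> a \<in> M \<Longrightarrow> k \<otimes> a \<in> M"
    using M unfolding submod_def by blast+
  have nat: "[k] \<cdot>\<^bsub>R\<^esub> a \<in> M" if "a \<in> M" for a and k :: nat
  proof -
    have "[k] \<cdot>\<^bsub>R\<^esub> \<one> \<in> ?K" by blast
    from mult[OF this that] show ?thesis using that sub by (auto simp: add_pow_ldistr)
  qed
  have neg: "\<ominus> a \<in> M" if "a \<in> M" for a
  proof -
    have "\<ominus> \<one> \<in> ?K" by (auto intro!: exI[of _ "1::nat"])
    then have "\<ominus> \<one> \<otimes> a \<in> M" using that by (rule mult)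
    then show ?thesis using that sub by (auto simp: l_minus)
  qed
  show "\<exists>A. finite A \<and> A \<subseteq> M \<and> M \<subseteq> span ?K A"
  proof (cases "\<exists>k>0. [(k::nat)] \<cdot>\<^bsub>R\<^esub> \<one> \<in> M")
    case False
    have "M \<subseteq> {\<zero>}"
    proof
      fix r assume r: "r \<in> M"
      then obtain k :: nat where "r = [k] \<cdot>\<^bsub>R\<^esub> \<one> \<or> r = \<ominus> ([k] \<cdot>\<^bsub>R\<^esub> \<one>)" using M by blast
      then have k: "[k] \<cdot>\<^bsub>R\<^esub> \<one> \<in> M" "k = 0 \<longrightarrow> r = \<zero>" using r neg[OF r] by (elim disjE; simp)+
      have "\<not> k > 0" using False k(1) by (intro notI) (erule notE, intro exI conjI)
      then show "r \<in> {\<zero>}" using k by simp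
    qed
    moreover have "\<zero> \<in> span ?K {}" unfolding span_def submod_def by blast
    ultimately show ?thesis by (intro exI[of _ "{}"]) auto
  next
    case True
    define d where "d = (LEAST k. k > 0 \<and> [(k::nat)] \<cdot>\<^bsub>R\<^esub> \<one> \<in> M)"
    have d: "d > 0" "[d] \<cdot>\<^bsub>R\<^esub> \<one> \<in> M" using True LeastI_ex[of "\<lambda>k. k > 0 \<and> [(k::nat)] \<cdot>\<^bsub>R\<^esub> \<one> \<in> M"] by (auto simp: d_def)
    have dvd: "d dvd k" if k: "[k] \<cdot>\<^bsub>R\<^esub> \<one> \<in> M" for k :: nat
    proof -
      have "[k] \<cdot>\<^bsub>R\<^esub> \<one> = [(d * (k div d))] \<cdot>\<^bsub>R\<^esub> \<one> \<oplus> [(k mod d)] \<cdot>\<^bsub>R\<^esub> \<one>"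
        by (simp add: add.nat_pow_mult)
      then have "[(k mod d)] \<cdot>\<^bsub>R\<^esub> \<one> = [k] \<cdot>\<^bsub>R\<^esub> \<one> \<oplus> \<ominus> ([(d * (k div d))] \<cdot>\<^bsub>R\<^esub> \<one>)"
        by (simp add: a_assoc r_neg a_comm[of "[(d * (k div d))] \<cdot>\<^bsub>R\<^esub> \<one>"])
      moreover have "[(d * (k div d))] \<cdot>\<^bsub>R\<^esub> \<one> \<in> M"
        using nat[OF d(2), of "k div d"] by (simp add: add.nat_pow_pow)
      ultimately have "[(k mod d)] \<cdot>\<^bsub>R\<^esub> \<one> \<in> M" using add neg k by simp
      then have "\<not> k mod d > 0" using d(1) not_less_Least[of "k mod d" "\<lambda>k. k > 0 \<and> [(k::nat)] \<cdot>\<^bsub>R\<^esub> \<one> \<in> M"]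
        by (auto simp: d_def[symmetric])
      then show ?thesis by (simp add: dvd_eq_mod_eq_0)
    qed
    have "M \<subseteq> span ?K {[d] \<cdot>\<^bsub>R\<^esub> \<one>}"
    proof
      fix r assume r: "r \<in> M"
      then obtain k :: nat where k: "r = [k] \<cdot>\<^bsub>R\<^esub> \<one> \<or> r = \<ominus> ([k] \<cdot>\<^bsub>R\<^esub> \<one>)" using M by blast
      then have "[k] \<cdot>\<^bsub>R\<^esub> \<one> \<in> M" using r neg[OF r] by auto
      then obtain l where l: "k = d * l" using dvd by blast
      have eq: "r = [l] \<cdot>\<^bsub>R\<^esub> \<one> \<otimes> [d] \<cdot>\<^bsub>R\<^esub> \<one> \<or> r = \<ominus> ([l] \<cdot>\<^bsub>R\<^esub> \<one>) \<otimes> [d] \<cdot>\<^bsub>R\<^esub> \<one>"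
        using k by (simp add: l add_pow_ldistr add.nat_pow_pow l_minus)
      show "r \<in> span ?K {[d] \<cdot>\<^bsub>R\<^esub> \<one>}"
        unfolding span_def
      proof (rule InterI)
        fix M' assume "M' \<in> {M. submod ?K M \<and> {[d] \<cdot>\<^bsub>R\<^esub> \<one>} \<subseteq> M}"
        then show "r \<in> M'" using eq unfolding submod_def by blast
      qed
    qed
    then show ?thesis using d(2) by (intro exI[of _ "{[d] \<cdot>\<^bsub>R\<^esub> \<one>}"]) auto
  qed
qed

end

section \<open>Hilbert's basis theorem for the adjunction of one element\<close>

locale one_generator_extension = cring R for R (structure) +
  fixes K x
  assumes K: "subring K R" and x: "x \<in> carrier R"
begin

lemma K_carrier: "k \<in> K \<Longrightarrow> k \<in> carrier R"
  using K subringE(1) by blast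

text \<open>Values at x of polynomials over K of degree less than d, with \<open>poly_le 0\<close>
  the zero module. The bound is a property of some expression in x, since x may satisfy algebraic
  relations over K.\<close>

primrec poly_le :: "nat \<Rightarrow> 'a set" where
  "poly_le 0 = {\<zero>}"
| "poly_le (Suc d) = {k \<otimes> x [^] d \<oplus> r | k r. k \<in> K \<and> r \<in> poly_le d}"

definition "Kx = (\<Union>d. poly_le d)"

lemma poly_le_carrier: "a \<in> poly_le d \<Longrightarrow> a \<in> carrier R"
  using x by (induction d arbitrary: a) (auto simp: K_carrier)

lemma zero_poly_le: "\<zero> \<in> poly_le d"
proof (induction d)
  case (Suc d)
  have "\<zero> = \<zero> \<otimes> x [^] d \<oplus> \<zero>" using x by simp
  then show ?case using Suc subringE(2)[OF K] by auto
qed simp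

lemma poly_le_Suc: "poly_le d \<subseteq> poly_le (Suc d)"
proof
  fix a assume a: "a \<in> poly_le d"
  then have "a = \<zero> \<otimes> x [^] d \<oplus> a" using x poly_le_carrier by simp
  then show "a \<in> poly_le (Suc d)" using a subringE(2)[OF K] by auto
qed

lemma poly_le_mono: "d \<le> e \<Longrightarrow> poly_le d \<subseteq> poly_le e"
  by (rule lift_Suc_mono_le[of poly_le]) (rule poly_le_Suc)

lemma poly_le_add: "a \<in> poly_le d \<Longrightarrow> b \<in> poly_le d \<Longrightarrow> a \<oplus> b \<in> poly_le d"
proof (induction d arbitrary: a b)
  case (Suc d)
  then obtain k r l s where kr: "k \<in> K" "r \<in> poly_le d" "a = k \<otimes> x [^] d \<oplus> r"
    and ls: "l \<in> K" "s \<in> poly_le d" "b = l \<otimes> x [^] d \<oplus> s" by auto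
  have "a \<oplus> b = (k \<oplus> l) \<otimes> x [^] d \<oplus> (r \<oplus> s)"
    using x kr ls poly_le_carrier[of r d] poly_le_carrier[of s d] by (simp add: K_carrier l_distr a_ac)
  then show ?case using kr ls Suc.IH[of r s] subringE(7)[OF K, of k l] by auto
qed simp

lemma poly_le_smult: "l \<in> K \<Longrightarrow> a \<in> poly_le d \<Longrightarrow> l \<otimes> a \<in> poly_le d"
proof (induction d arbitrary: a)
  case (Suc d)
  then obtain k r where kr: "k \<in> K" "r \<in> poly_le d" "a = k \<otimes> x [^] d \<oplus> r" by auto
  have "l \<otimes> a = (l \<otimes> k) \<otimes> x [^] d \<oplus> l \<otimes> r"
    using x kr Suc.prems(1) poly_le_carrier[of r d] by (simp add: K_carrier r_distr m_assoc)
  then show ?case using kr Suc.IH[of r] Suc.prems(1) subringE(6)[OF K, of l k] by auto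
qed (simp add: K_carrier)

lemma poly_le_mult_x: "a \<in> poly_le d \<Longrightarrow> x \<otimes> a \<in> poly_le (Suc d)"
proof (induction d arbitrary: a)
  case 0
  then show ?case using zero_poly_le[of "Suc 0"] x by simp
next
  case (Suc d)
  then obtain k r where kr: "k \<in> K" "r \<in> poly_le d" "a = k \<otimes> x [^] d \<oplus> r" by auto
  have "x \<otimes> a = k \<otimes> x [^] (Suc d) \<oplus> x \<otimes> r"
    using x kr poly_le_carrier[of r d] by (simp add: K_carrier r_distr m_ac)
  then show ?case using kr Suc.IH[of r] by (subst poly_le.simps(2)) blast
qed

lemma poly_le_mult_pow: "a \<in> poly_le d \<Longrightarrow> x [^] e \<otimes> a \<in> poly_le (d + e)"
proof (induction e)
  case 0
  then show ?case using poly_le_carrier by simp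
next
  case (Suc e)
  have "x [^] Suc e \<otimes> a = x \<otimes> (x [^] e \<otimes> a)"
    using x poly_le_carrier[OF Suc.prems] by (simp add: m_ac)
  then show ?case using poly_le_mult_x Suc by simp
qed

lemma poly_le_mult: "a \<in> poly_le d \<Longrightarrow> b \<in> poly_le e \<Longrightarrow> a \<otimes> b \<in> poly_le (e + d)"
proof (induction d arbitrary: a)
  case 0
  then show ?case using zero_poly_le poly_le_carrier by simp
next
  case (Suc d)
  then obtain k r where kr: "k \<in> K" "r \<in> poly_le d" "a = k \<otimes> x [^] d \<oplus> r" by auto
  have "a \<otimes> b = x [^] d \<otimes> (k \<otimes> b) \<oplus> r \<otimes> b"
    using x kr poly_le_carrier[of r d] poly_le_carrier[OF Suc.prems(2)] by (simp add: K_carrier l_distr r_distr m_ac)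
  moreover have "x [^] d \<otimes> (k \<otimes> b) \<in> poly_le (e + d)" using poly_le_mult_pow poly_le_smult kr Suc.prems by blast
  moreover have "r \<otimes> b \<in> poly_le (e + d)" using Suc.IH kr Suc.prems by blast
  ultimately have "a \<otimes> b \<in> poly_le (e + d)" by (simp add: poly_le_add)
  then show ?case using poly_le_Suc[of "e + d"] by auto
qed

lemma K_subset: "K \<subseteq> poly_le (Suc 0)"
proof
  fix k assume k: "k \<in> K"
  then have "k = k \<otimes> x [^] (0::nat) \<oplus> \<zero>" by (simp add: K_carrier)
  then show "k \<in> poly_le (Suc 0)" using k by auto
qed

lemma x_in: "x \<in> Kx"
  using poly_le_mult_x[of \<one> "Suc 0"] K_subset subringE(3)[OF K] x by (auto simp: Kx_def simp del: poly_le.simps)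

lemma K_sub_Kx: "K \<subseteq> Kx"
  using K_subset by (auto simp: Kx_def simp del: poly_le.simps)

lemma Kx_carrier: "Kx \<subseteq> carrier R"
  using poly_le_carrier by (auto simp: Kx_def)

lemma Kx_subring: "subring Kx R"
proof (rule subringI)
  have add: "a \<oplus> b \<in> Kx" and mult: "a \<otimes> b \<in> Kx" if "a \<in> Kx" "b \<in> Kx" for a b
  proof -
    obtain d e where d: "a \<in> poly_le d" and e: "b \<in> poly_le e" using \<open>a \<in> Kx\<close> \<open>b \<in> Kx\<close> by (auto simp: Kx_def)
    have "a \<in> poly_le (max d e)" "b \<in> poly_le (max d e)"
      using d e poly_le_mono[of d "max d e"] poly_le_mono[of e "max d e"] by auto
    then show "a \<oplus> b \<in> Kx" using poly_le_add unfolding Kx_def by blast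
    show "a \<otimes> b \<in> Kx" using poly_le_mult[OF d e] unfolding Kx_def by blast
  qed
  show "\<one> \<in> Kx" using K_sub_Kx subringE(3)[OF K] by blast
  show "\<ominus> a \<in> Kx" if "a \<in> Kx" for a
  proof -
    have "\<ominus> \<one> \<in> Kx" using K_sub_Kx subringE(3,5)[OF K] by blast
    from mult[OF this that] show ?thesis using that Kx_carrier by (auto simp: l_minus)
  qed
  show "a \<oplus> b \<in> Kx" "a \<otimes> b \<in> Kx" if "a \<in> Kx" "b \<in> Kx" for a b
    using add mult that by blast+
qed (rule Kx_carrier)

text \<open>Hilbert's argument with modules of leading coefficients. As an element may have several
  expressions in x, \<open>L d\<close> collects the leading coefficients of all of them.\<close>

lemma Kx_noeth:
  assumes "noeth K"
  shows "noeth Kx"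
  unfolding noeth_def
proof (intro allI impI)
  fix M assume M: "submod Kx M \<and> M \<subseteq> Kx"
  have sub: "M \<subseteq> carrier R" and zero: "\<zero> \<in> M" and add: "\<And>a b. a \<in> M \<Longrightarrow> b \<in> M \<Longrightarrow> a \<oplus> b \<in> M"
    and mult: "\<And>k a. k \<in> Kx \<Longrightarrow> a \<in> M \<Longrightarrow> k \<otimes> a \<in> M"
    using M unfolding submod_def by blast+
  define L where "L d = {k \<in> K. \<exists>r \<in> poly_le d. k \<otimes> x [^] d \<oplus> r \<in> M}" for d
  have L_K: "L d \<subseteq> K" for d by (auto simp: L_def)
  have L_submod: "submod K (L d)" for d
    unfolding submod_def
  proof (intro conjI ballI)
    show "L d \<subseteq> carrier R" using L_K K_carrier by blast
    show "\<zero> \<in> L d" using zero zero_poly_le[of d] subringE(2)[OF K] x by (auto simp: L_def intro!: bexI[of _ \<zero>])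
    fix a assume "a \<in> L d"
    then obtain r where a: "a \<in> K" "r \<in> poly_le d" "a \<otimes> x [^] d \<oplus> r \<in> M" by (auto simp: L_def)
    note [simp] = K_carrier poly_le_carrier[OF a(2)] x
    {
      fix b assume "b \<in> L d"
      then obtain s where b: "b \<in> K" "s \<in> poly_le d" "b \<otimes> x [^] d \<oplus> s \<in> M" by (auto simp: L_def)
      have "(a \<oplus> b) \<otimes> x [^] d \<oplus> (r \<oplus> s) = (a \<otimes> x [^] d \<oplus> r) \<oplus> (b \<otimes> x [^] d \<oplus> s)"
        using a b poly_le_carrier[OF b(2)] by (simp add: l_distr a_ac)
      then show "a \<oplus> b \<in> L d"
        using add[OF a(3) b(3)] poly_le_add[OF a(2) b(2)] subringE(7)[OF K a(1) b(1)] by (auto simp: L_def intro!: bexI[of _ "r \<oplus> s"])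
    }
    fix k assume k: "k \<in> K"
    have "(k \<otimes> a) \<otimes> x [^] d \<oplus> k \<otimes> r = k \<otimes> (a \<otimes> x [^] d \<oplus> r)"
      using a k by (simp add: r_distr m_assoc)
    then show "k \<otimes> a \<in> L d"
      using mult[of k, OF _ a(3)] K_sub_Kx poly_le_smult[OF k a(2)] subringE(6)[OF K k a(1)] k
      by (auto simp: L_def intro!: bexI[of _ "k \<otimes> r"])
  qed
  have L_Suc: "L d \<subseteq> L (Suc d)" for d
  proof
    fix a assume "a \<in> L d"
    then obtain r where a: "a \<in> K" "r \<in> poly_le d" "a \<otimes> x [^] d \<oplus> r \<in> M" by (auto simp: L_def)
    have "a \<otimes> x [^] Suc d \<oplus> x \<otimes> r = x \<otimes> (a \<otimes> x [^] d \<oplus> r)"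
      using a x poly_le_carrier[OF a(2)] by (simp add: r_distr m_ac K_carrier)
    then show "a \<in> L (Suc d)"
      using mult[OF x_in a(3)] poly_le_mult_x[OF a(2)] a(1) unfolding L_def
      by (intro CollectI conjI bexI[of _ "x \<otimes> r"]) (simp_all del: poly_le.simps nat_pow_Suc)
  qed
  then have L_mono: "L d \<subseteq> L e" if "d \<le> e" for d e
    using that by (rule lift_Suc_mono_le)
  have "submod K (\<Union>d. L d)"
    unfolding submod_def
  proof (intro conjI ballI)
    show "(\<Union>d. L d) \<subseteq> carrier R" using L_K K_carrier by blast
    show "\<zero> \<in> (\<Union>d. L d)" using L_submod[of 0] by (auto simp: submod_def)
    show "k \<otimes> a \<in> (\<Union>d. L d)" if "k \<in> K" "a \<in> (\<Union>d. L d)" for k a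
      using L_submod that unfolding submod_def by blast
    fix a b assume "a \<in> (\<Union>d. L d)" "b \<in> (\<Union>d. L d)"
    then obtain d e where "a \<in> L d" "b \<in> L e" by blast
    then have "a \<in> L (max d e)" "b \<in> L (max d e)" using L_mono[of d "max d e"] L_mono[of e "max d e"] by auto
    then show "a \<oplus> b \<in> (\<Union>d. L d)" using L_submod[of "max d e"] by (auto simp: submod_def)
  qed
  then obtain A where A: "finite A" "A \<subseteq> (\<Union>d. L d)" "(\<Union>d. L d) \<subseteq> span K A"
    using assms L_K unfolding noeth_def by (metis UN_least)
  \<comment> \<open>Finitely many generators of the union lie in one member of the chain, so the
    chain is constant from D on.\<close>
  obtain D where D: "A \<subseteq> L D"
  proof -
    have "\<exists>D. A \<subseteq> L D"
      using A(1,2)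
    proof (induction A rule: finite_induct)
      case (insert a A)
      then obtain D d where "A \<subseteq> L D" "a \<in> L d" by auto
      then show ?case using L_mono[of D "max D d"] L_mono[of d "max D d"] by (intro exI[of _ "max D d"]) auto
    qed simp
    then show ?thesis using that by blast
  qed
  have L_D: "L d \<subseteq> L D" for d
    using A(3) span_minimal[OF L_submod D] by blast
  have "\<forall>d. \<exists>B. finite B \<and> B \<subseteq> L d \<and> L d \<subseteq> span K B"
    using assms L_submod L_K unfolding noeth_def by blast
  then obtain B where B: "\<And>d. finite (B d)" "\<And>d. B d \<subseteq> L d" "\<And>d. L d \<subseteq> span K (B d)" by metis
  have "\<forall>d. \<forall>b \<in> L d. \<exists>g. g \<in> M \<and> (\<exists>r \<in> poly_le d. g = b \<otimes> x [^] d \<oplus> r)"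
    by (auto simp: L_def)
  then obtain g where g: "\<And>d b. b \<in> L d \<Longrightarrow> g d b \<in> M" "\<And>d b. b \<in> L d \<Longrightarrow> \<exists>r \<in> poly_le d. g d b = b \<otimes> x [^] d \<oplus> r"
    by metis
  define G where "G = (\<Union>d\<in>{..D}. g d ` B d)"
  have G_fin: "finite G" using B(1) by (auto simp: G_def)
  have G_M: "G \<subseteq> M" using g(1) B(2) by (fastforce simp: G_def)
  have span_M: "span Kx G \<subseteq> M" using M G_M by (intro span_minimal) auto
  have span_sub: "submod Kx (span Kx G)" using submod_span Kx_carrier G_M sub by blast
  \<comment> \<open>A generator with leading coefficient in degree e is multiplied by x^(d - e) to
    match degree d; e \<le> D because G contains generators for these degrees only.\<close>
  have lead: "\<exists>h \<in> span Kx G. \<exists>r \<in> poly_le d. h = k \<otimes> x [^] d \<oplus> r" if kL: "k \<in> L e" and ed: "e \<le> d" and eD: "e \<le> D" for k d e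
  proof -
    define Q where "Q = {k \<in> K. \<exists>h \<in> span Kx G. \<exists>r \<in> poly_le d. h = k \<otimes> x [^] d \<oplus> r}"
    have "submod K Q"
      unfolding submod_def
    proof (intro conjI ballI)
      show "Q \<subseteq> carrier R" using K_carrier by (auto simp: Q_def)
      have "\<zero> \<in> span Kx G" using span_sub by (simp add: submod_def)
      then show "\<zero> \<in> Q" using zero_poly_le[of d] subringE(2)[OF K] x by (auto simp: Q_def intro!: bexI[of _ \<zero>])
      fix a assume "a \<in> Q"
      then obtain r where a: "a \<in> K" "r \<in> poly_le d" "a \<otimes> x [^] d \<oplus> r \<in> span Kx G" by (auto simp: Q_def)
      note [simp] = K_carrier poly_le_carrier[OF a(2)] x
      {
        fix b assume "b \<in> Q"
        then obtain s where b: "b \<in> K" "s \<in> poly_le d" "b \<otimes> x [^] d \<oplus> s \<in> span Kx G" by (auto simp: Q_def)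
        have "(a \<otimes> x [^] d \<oplus> r) \<oplus> (b \<otimes> x [^] d \<oplus> s) = (a \<oplus> b) \<otimes> x [^] d \<oplus> (r \<oplus> s)"
          using a b poly_le_carrier[OF b(2)] by (simp add: l_distr a_ac)
        moreover have "(a \<otimes> x [^] d \<oplus> r) \<oplus> (b \<otimes> x [^] d \<oplus> s) \<in> span Kx G"
          using span_sub a(3) b(3) by (auto simp: submod_def)
        ultimately show "a \<oplus> b \<in> Q"
          using poly_le_add[OF a(2) b(2)] subringE(7)[OF K a(1) b(1)] unfolding Q_def by blast
      }
      fix k assume k: "k \<in> K"
      have "k \<otimes> (a \<otimes> x [^] d \<oplus> r) = (k \<otimes> a) \<otimes> x [^] d \<oplus> k \<otimes> r"
        using a k by (simp add: r_distr m_assoc)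
      moreover have "k \<otimes> (a \<otimes> x [^] d \<oplus> r) \<in> span Kx G"
        using span_sub a(3) k K_sub_Kx unfolding submod_def by blast
      ultimately show "k \<otimes> a \<in> Q"
        using poly_le_smult[OF k a(2)] subringE(6)[OF K k a(1)] unfolding Q_def by blast
    qed
    moreover have "B e \<subseteq> Q"
    proof
      fix b assume b: "b \<in> B e"
      then have bL: "b \<in> L e" using B(2) by blast
      obtain r where r: "r \<in> poly_le e" "g e b = b \<otimes> x [^] e \<oplus> r" using g(2)[OF bL] by blast
      have bK: "b \<in> K" using bL L_K by blast
      obtain f where f: "d = e + f" using ed le_Suc_ex by blast
      have "x [^] f \<otimes> g e b = b \<otimes> x [^] d \<oplus> x [^] f \<otimes> r"
        using r bK x poly_le_carrier[OF r(1)] by (simp add: f r_distr K_carrier nat_pow_mult[symmetric] m_ac)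
      moreover have "x [^] f \<in> Kx"
        using Kx_subring x_in by (induction f) (auto simp: subringE)
      moreover have "g e b \<in> span Kx G" using b eD span_superset by (fastforce simp: G_def)
      ultimately have "b \<otimes> x [^] d \<oplus> x [^] f \<otimes> r \<in> span Kx G"
        using span_sub unfolding submod_def by metis
      then show "b \<in> Q" using bK poly_le_mult_pow[OF r(1), of f] unfolding Q_def f by blast
    qed
    ultimately have "span K (B e) \<subseteq> Q" by (rule span_minimal)
    then show ?thesis using kL B(3) unfolding Q_def by blast
  qed
  have "m \<in> span Kx G" if "m \<in> M" "m \<in> poly_le d" for m d
    using that
  proof (induction d arbitrary: m)
    case 0
    then show ?case using span_sub by (simp add: submod_def)
  next
    case (Suc d)
    then obtain k r where kr: "k \<in> K" "r \<in> poly_le d" "m = k \<otimes> x [^] d \<oplus> r" by auto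
    then have k: "k \<in> L d" using Suc.prems by (auto simp: L_def)
    \<comment> \<open>Up to degree D the generators of the same degree are used, and above D those
      of degree D, whose leading coefficients already include everything.\<close>
    have "\<exists>h \<in> span Kx G. \<exists>s \<in> poly_le d. h = k \<otimes> x [^] d \<oplus> s"
      using lead[of k d d] lead[of k D d] k L_D by (metis linear subsetD)
    then obtain h s where h: "h \<in> span Kx G" "s \<in> poly_le d" "h = k \<otimes> x [^] d \<oplus> s" by blast
    note [simp] = poly_le_carrier[OF kr(2)] poly_le_carrier[OF h(2)] K_carrier[OF kr(1)] x
    have mone: "\<ominus> \<one> \<in> K" using subringE(3,5)[OF K] by blast
    have hM: "h \<in> M" using h(1) span_M by blast
    have "m \<oplus> \<ominus> \<one> \<otimes> h = r \<oplus> \<ominus> \<one> \<otimes> s"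
      by (simp add: kr(3) h(3) l_minus minus_add a_ac r_neg1 r_neg2 r_neg)
    moreover have "m \<oplus> \<ominus> \<one> \<otimes> h \<in> M" using add mult hM mone K_sub_Kx Suc.prems(1) by blast
    moreover have "r \<oplus> \<ominus> \<one> \<otimes> s \<in> poly_le d" using poly_le_add poly_le_smult kr(2) h(2) mone by blast
    ultimately have "m \<oplus> \<ominus> \<one> \<otimes> h \<in> span Kx G" using Suc.IH by simp
    then have "h \<oplus> (m \<oplus> \<ominus> \<one> \<otimes> h) \<in> span Kx G" using h(1) span_sub by (auto simp: submod_def)
    moreover have "h \<oplus> (m \<oplus> \<ominus> \<one> \<otimes> h) = m"
    proof -
      have "h \<in> carrier R" "m \<in> carrier R" using hM Suc.prems(1) sub by blast+
      then show ?thesis using a_lcomm[of h m "\<ominus> h"] by (simp add: l_minus r_neg)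
    qed
    ultimately show ?case by simp
  qed
  then have "M \<subseteq> span Kx G" using M unfolding Kx_def by blast
  then show "\<exists>A. finite A \<and> A \<subseteq> M \<and> M \<subseteq> span Kx A" using G_fin G_M by blast
qed

end

context cring
begin

lemma int_multiples_subring: "subring {r. \<exists>k::nat. r = [k] \<cdot>\<^bsub>R\<^esub> \<one> \<or> r = \<ominus> ([k] \<cdot>\<^bsub>R\<^esub> \<one>)} R" (is "subring ?K R")
proof (rule subringI)
  show "?K \<subseteq> carrier R" by auto
  show "\<one> \<in> ?K" by (auto intro!: exI[of _ "1::nat"])
  show "\<ominus> a \<in> ?K" if "a \<in> ?K" for a using that by auto
  fix a b assume ab: "a \<in> ?K" "b \<in> ?K"
  have mult: "[k] \<cdot>\<^bsub>R\<^esub> \<one> \<otimes> [l] \<cdot>\<^bsub>R\<^esub> \<one> = [(l * k)] \<cdot>\<^bsub>R\<^esub> \<one>" for k l :: nat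
    by (simp add: add_pow_ldistr add.nat_pow_pow)
  obtain k l :: nat where k: "a = [k] \<cdot>\<^bsub>R\<^esub> \<one> \<or> a = \<ominus> ([k] \<cdot>\<^bsub>R\<^esub> \<one>)" and l: "b = [l] \<cdot>\<^bsub>R\<^esub> \<one> \<or> b = \<ominus> ([l] \<cdot>\<^bsub>R\<^esub> \<one>)"
    using ab by auto
  show "a \<otimes> b \<in> ?K"
    using k l by (auto simp: l_minus r_minus mult intro!: exI[of _ "l * k"])
  have diff: "[k] \<cdot>\<^bsub>R\<^esub> \<one> \<oplus> \<ominus> ([l] \<cdot>\<^bsub>R\<^esub> \<one>) \<in> ?K" for k l :: nat
  proof (cases "l \<le> k")
    case True
    then obtain m where "k = l + m" using le_Suc_ex by blast
    then have "[k] \<cdot>\<^bsub>R\<^esub> \<one> = [m] \<cdot>\<^bsub>R\<^esub> \<one> \<oplus> [l] \<cdot>\<^bsub>R\<^esub> \<one>"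
      by (simp add: add.nat_pow_mult add.commute)
    then have "[k] \<cdot>\<^bsub>R\<^esub> \<one> \<oplus> \<ominus> ([l] \<cdot>\<^bsub>R\<^esub> \<one>) = [m] \<cdot>\<^bsub>R\<^esub> \<one>"
      by (simp add: a_assoc r_neg)
    then show ?thesis by auto
  next
    case False
    then obtain m where "l = k + m" using le_Suc_ex[of k l] by auto
    then have "[k] \<cdot>\<^bsub>R\<^esub> \<one> \<oplus> \<ominus> ([l] \<cdot>\<^bsub>R\<^esub> \<one>) = \<ominus> ([m] \<cdot>\<^bsub>R\<^esub> \<one>)"
      by (simp add: add.nat_pow_mult[symmetric] minus_add a_ac r_neg1 r_neg2)
    then show ?thesis by auto
  qed
  show "a \<oplus> b \<in> ?K"
    using k l
  proof (elim disjE)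
    assume "a = [k] \<cdot>\<^bsub>R\<^esub> \<one>" "b = [l] \<cdot>\<^bsub>R\<^esub> \<one>"
    then show ?thesis by (auto simp: add.nat_pow_mult)
  next
    assume "a = [k] \<cdot>\<^bsub>R\<^esub> \<one>" "b = \<ominus> ([l] \<cdot>\<^bsub>R\<^esub> \<one>)"
    then show ?thesis using diff[of k l] by (simp only:)
  next
    assume "a = \<ominus> ([k] \<cdot>\<^bsub>R\<^esub> \<one>)" "b = [l] \<cdot>\<^bsub>R\<^esub> \<one>"
    then have "a \<oplus> b = [l] \<cdot>\<^bsub>R\<^esub> \<one> \<oplus> \<ominus> ([k] \<cdot>\<^bsub>R\<^esub> \<one>)" by (simp add: a_comm)
    then show ?thesis using diff[of l k] by (simp only:)
  next
    assume "a = \<ominus> ([k] \<cdot>\<^bsub>R\<^esub> \<one>)" "b = \<ominus> ([l] \<cdot>\<^bsub>R\<^esub> \<one>)"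
    then have "a \<oplus> b = \<ominus> ([(k + l)] \<cdot>\<^bsub>R\<^esub> \<one>)" by (simp add: add.nat_pow_mult[symmetric] minus_add)
    then show ?thesis by blast
  qed
qed

text \<open>The generators are adjoined one after the other to the integral multiples of 1, and each
  step preserves the property.\<close>

lemma noeth_carrier:
  assumes "finitely_generated_ring R"
  shows "noeth (carrier R)"
proof -
  obtain A where A: "finite A" "A \<subseteq> carrier R" "generate_ring R A = carrier R"
    using assms unfolding finitely_generated_ring_def by blast
  have "\<exists>K. subring K R \<and> A \<subseteq> K \<and> noeth K"
    using A(1,2)
  proof (induction A rule: finite_induct)
    case empty
    then show ?case using noethI_int int_multiples_subring by blast
  next
    case (insert a A)
    then obtain K where KA: "subring K R" "A \<subseteq> K" "noeth K" by auto
    interpret one_generator_extension R K a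
      using KA(1) insert.prems
      by (intro one_generator_extension.intro one_generator_extension_axioms.intro cring_axioms) simp_all
    have "insert a A \<subseteq> Kx" using K_sub_Kx x_in KA(2) by blast
    then show ?case using Kx_subring Kx_noeth[OF KA(3)] by (intro exI[of _ Kx] conjI)
  qed
  then obtain K where K: "subring K R" "A \<subseteq> K" "noeth K" by blast
  have "r \<in> K" if "r \<in> generate_ring R A" for r
    using that by induction (use K in \<open>auto simp: subringE\<close>)
  then have "K = carrier R" using A(3) subringE(1)[OF K(1)] by blast
  then show ?thesis using K by simp
qed

text \<open>All torsion elements form an ideal. Being finitely generated, it is killed by a single N
  > 0; a prime p > N does not divide N, and an element killed by both is zero.\<close>

lemma torsion_bound:
  assumes "finitely_generated_ring R"
  shows "\<exists>N. \<forall>p > N. Factorial_Ring.prime p \<longrightarrow> (\<forall>r \<in> carrier R. [(p::nat)] \<cdot>\<^bsub>R\<^esub> r = \<zero> \<longrightarrow> r = \<zero>)"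
proof -
  define T where "T = {r \<in> carrier R. \<exists>k>0. [(k::nat)] \<cdot>\<^bsub>R\<^esub> r = \<zero>}"
  have pow: "[(k * l)] \<cdot>\<^bsub>R\<^esub> a = \<zero>" if "a \<in> carrier R" "[k] \<cdot>\<^bsub>R\<^esub> a = \<zero> \<or> [l] \<cdot>\<^bsub>R\<^esub> a = \<zero>" for a and k l :: nat
    using that add.nat_pow_pow[of a k l] add.nat_pow_pow[of a l k] by (auto simp: mult.commute)
  have T_sub: "T \<subseteq> carrier R" by (auto simp: T_def)
  have T_submod: "submod (carrier R) T"
    unfolding submod_def
  proof (intro conjI ballI)
    fix a b assume "a \<in> T" "b \<in> T"
    then obtain k l :: nat where "a \<in> carrier R" "b \<in> carrier R" "k > 0" "l > 0" "[k] \<cdot>\<^bsub>R\<^esub> a = \<zero>" "[l] \<cdot>\<^bsub>R\<^esub> b = \<zero>"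
      by (auto simp: T_def)
    then show "a \<oplus> b \<in> T"
      using pow by (auto simp: T_def add.nat_pow_distrib intro!: exI[of _ "k * l"])
  next
    fix k a assume k: "k \<in> carrier R" and "a \<in> T"
    then obtain l :: nat where "a \<in> carrier R" "l > 0" "[l] \<cdot>\<^bsub>R\<^esub> a = \<zero>" by (auto simp: T_def)
    then show "k \<otimes> a \<in> T"
      using k add_pow_rdistr[of k a l] by (auto simp: T_def)
  qed (auto simp: T_def intro!: exI[of _ "1::nat"])
  obtain A where A: "finite A" "A \<subseteq> T" "T \<subseteq> span (carrier R) A"
    using noeth_carrier[OF assms, unfolded noeth_def, THEN spec, THEN mp, OF conjI[OF T_submod T_sub]] by blast
  have "\<exists>N>0. \<forall>a \<in> A. [(N::nat)] \<cdot>\<^bsub>R\<^esub> a = \<zero>"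
    using A(1,2)
  proof (induction A rule: finite_induct)
    case (insert a A)
    then obtain N k :: nat where "N > 0" "\<forall>a \<in> A. [N] \<cdot>\<^bsub>R\<^esub> a = \<zero>" "k > 0" "[k] \<cdot>\<^bsub>R\<^esub> a = \<zero>" "a \<in> carrier R" "A \<subseteq> carrier R"
      by (auto simp: T_def)
    then show ?case using pow by (intro exI[of _ "N * k"]) auto
  qed auto
  then obtain N :: nat where N: "N > 0" "\<And>a. a \<in> A \<Longrightarrow> [N] \<cdot>\<^bsub>R\<^esub> a = \<zero>" by blast
  have "submod (carrier R) {r \<in> carrier R. [N] \<cdot>\<^bsub>R\<^esub> r = \<zero>}"
    unfolding submod_def by (auto simp: add.nat_pow_distrib add_pow_rdistr[symmetric])
  then have "span (carrier R) A \<subseteq> {r \<in> carrier R. [N] \<cdot>\<^bsub>R\<^esub> r = \<zero>}"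
    by (rule span_minimal) (use A N in \<open>auto simp: T_def\<close>)
  then have T: "[N] \<cdot>\<^bsub>R\<^esub> r = \<zero>" if "r \<in> T" for r
    using A(3) that by blast
  show ?thesis
  proof (intro exI[of _ N] allI impI ballI)
    fix p r assume p: "N < p" "Factorial_Ring.prime p" and r: "r \<in> carrier R" "[(p::nat)] \<cdot>\<^bsub>R\<^esub> r = \<zero>"
    then have "r \<in> T" using prime_gt_0_nat[OF p(2)] by (auto simp: T_def intro!: exI[of _ p])
    moreover have "\<not> p dvd N" using p(1) N(1) by (meson dvd_imp_le not_le)
    ultimately show "r = \<zero>" using add_pow_prime_cancel[OF p(2) r(2) _ r(1)] T by blast
  qed
qed

end

section \<open>The Poisson bracket\<close>

lemma (in cring) finsum_combination:
  assumes "finite I" "a \<in> carrier R" "b \<in> carrier R"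
    and "\<And>i. i \<in> I \<Longrightarrow> h1 i \<in> carrier R" "\<And>i. i \<in> I \<Longrightarrow> h2 i \<in> carrier R"
    and "\<And>i. i \<in> I \<Longrightarrow> h i = a \<otimes> h1 i \<oplus> b \<otimes> h2 i"
  shows "finsum R h I = a \<otimes> finsum R h1 I \<oplus> b \<otimes> finsum R h2 I"
proof -
  have "finsum R h I = finsum R (\<lambda>i. a \<otimes> h1 i \<oplus> b \<otimes> h2 i) I"
    by (rule finsum_cong') (use assms in auto)
  also have "\<dots> = finsum R (\<lambda>i. a \<otimes> h1 i) I \<oplus> finsum R (\<lambda>i. b \<otimes> h2 i) I"
    by (rule finsum_addf) (use assms in auto)
  finally show ?thesis
    using assms by (simp add: finsum_rdistr Pi_def)
qed

context weyl_algebra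
begin

abbreviation "pb \<equiv> poisson_bracket n S"

definition "pb_inner a b i = finsum P.M (\<lambda>j. pconst (omega S n i j) \<otimes>\<^bsub>P.M\<^esub>
  (poly_partial S i a \<otimes>\<^bsub>P.M\<^esub> poly_partial S j b)) {1..2 * n}"

lemma pb_eq: "pb a b = finsum P.M (pb_inner a b) {1..2 * n}"
  by (simp add: poisson_bracket_def Let_def poly_alg_eq poly_const_def monoid_ring_const_eq_single pb_inner_def[abs_def])

lemma pb_inner_closed [simp]: "a \<in> carrier P.M \<Longrightarrow> b \<in> carrier P.M \<Longrightarrow> pb_inner a b i \<in> carrier P.M"
  unfolding pb_inner_def by (rule P.M.finsum_closed) simp

lemma pb_closed [simp]: "a \<in> carrier P.M \<Longrightarrow> b \<in> carrier P.M \<Longrightarrow> pb a b \<in> carrier P.M"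
  unfolding pb_eq by (rule P.M.finsum_closed) simp

text \<open>The bracket depends on its first argument through the partial derivatives alone and is
  linear in them. Additivity, the product rule and the vanishing on constants are all
  instances.\<close>

lemma pb_combination_left:
  assumes cl: "c \<in> carrier P.M" "d \<in> carrier P.M" "a \<in> carrier P.M" "a' \<in> carrier P.M" "b \<in> carrier P.M"
    and e: "\<And>i. poly_partial S i e = c \<otimes>\<^bsub>P.M\<^esub> poly_partial S i a \<oplus>\<^bsub>P.M\<^esub> d \<otimes>\<^bsub>P.M\<^esub> poly_partial S i a'"
  shows "pb e b = c \<otimes>\<^bsub>P.M\<^esub> pb a b \<oplus>\<^bsub>P.M\<^esub> d \<otimes>\<^bsub>P.M\<^esub> pb a' b"
  unfolding pb_eq
proof (rule P.finsum_combination)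
  show "pb_inner e b i = c \<otimes>\<^bsub>P.M\<^esub> pb_inner a b i \<oplus>\<^bsub>P.M\<^esub> d \<otimes>\<^bsub>P.M\<^esub> pb_inner a' b i" for i
    unfolding pb_inner_def
    by (rule P.finsum_combination) (use cl in \<open>simp_all add: e P.M.l_distr P.M.r_distr P.m_ac\<close>)
qed (use cl in simp_all)

lemma pb_combination_right:
  assumes cl: "c \<in> carrier P.M" "d \<in> carrier P.M" "b \<in> carrier P.M" "b' \<in> carrier P.M" "a \<in> carrier P.M"
    and e: "\<And>i. poly_partial S i e = c \<otimes>\<^bsub>P.M\<^esub> poly_partial S i b \<oplus>\<^bsub>P.M\<^esub> d \<otimes>\<^bsub>P.M\<^esub> poly_partial S i b'"
  shows "pb a e = c \<otimes>\<^bsub>P.M\<^esub> pb a b \<oplus>\<^bsub>P.M\<^esub> d \<otimes>\<^bsub>P.M\<^esub> pb a b'"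
  unfolding pb_eq
proof (rule P.finsum_combination)
  show "pb_inner a e i = c \<otimes>\<^bsub>P.M\<^esub> pb_inner a b i \<oplus>\<^bsub>P.M\<^esub> d \<otimes>\<^bsub>P.M\<^esub> pb_inner a b' i" for i
    unfolding pb_inner_def
    by (rule P.finsum_combination) (use cl in \<open>simp_all add: e P.M.l_distr P.M.r_distr P.m_ac\<close>)
qed (use cl in simp_all)

lemma pb_add_left:
  "a \<in> carrier P.M \<Longrightarrow> a' \<in> carrier P.M \<Longrightarrow> b \<in> carrier P.M \<Longrightarrow> pb (a \<oplus>\<^bsub>P.M\<^esub> a') b = pb a b \<oplus>\<^bsub>P.M\<^esub> pb a' b"
  using pb_combination_left[of "\<one>\<^bsub>P.M\<^esub>" "\<one>\<^bsub>P.M\<^esub>" a a' b "a \<oplus>\<^bsub>P.M\<^esub> a'"] by (simp add: poly_partial_apply_add)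

lemma pb_add_right:
  "a \<in> carrier P.M \<Longrightarrow> b' \<in> carrier P.M \<Longrightarrow> b \<in> carrier P.M \<Longrightarrow> pb a (b \<oplus>\<^bsub>P.M\<^esub> b') = pb a b \<oplus>\<^bsub>P.M\<^esub> pb a b'"
  using pb_combination_right[of "\<one>\<^bsub>P.M\<^esub>" "\<one>\<^bsub>P.M\<^esub>" b b' a "b \<oplus>\<^bsub>P.M\<^esub> b'"] by (simp add: poly_partial_apply_add)

lemma pb_mult_left:
  "a \<in> carrier P.M \<Longrightarrow> a' \<in> carrier P.M \<Longrightarrow> b \<in> carrier P.M \<Longrightarrow>
    pb (a \<otimes>\<^bsub>P.M\<^esub> a') b = a' \<otimes>\<^bsub>P.M\<^esub> pb a b \<oplus>\<^bsub>P.M\<^esub> a \<otimes>\<^bsub>P.M\<^esub> pb a' b"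
  by (rule pb_combination_left) (simp_all add: poly_partial_mult P.m_comm)

lemma pb_mult_right:
  "a \<in> carrier P.M \<Longrightarrow> b' \<in> carrier P.M \<Longrightarrow> b \<in> carrier P.M \<Longrightarrow>
    pb a (b \<otimes>\<^bsub>P.M\<^esub> b') = b' \<otimes>\<^bsub>P.M\<^esub> pb a b \<oplus>\<^bsub>P.M\<^esub> b \<otimes>\<^bsub>P.M\<^esub> pb a b'"
  by (rule pb_combination_right) (simp_all add: poly_partial_mult P.m_comm)

lemma pb_const_left: "s \<in> carrier S \<Longrightarrow> b \<in> carrier P.M \<Longrightarrow> pb (pconst s) b = \<zero>\<^bsub>P.M\<^esub>"
  using pb_combination_left[of "\<zero>\<^bsub>P.M\<^esub>" "\<zero>\<^bsub>P.M\<^esub>" "\<zero>\<^bsub>P.M\<^esub>" "\<zero>\<^bsub>P.M\<^esub>" b "pconst s"] by (simp add: poly_partial_const)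

lemma pb_const_right: "s \<in> carrier S \<Longrightarrow> a \<in> carrier P.M \<Longrightarrow> pb a (pconst s) = \<zero>\<^bsub>P.M\<^esub>"
  using pb_combination_right[of "\<zero>\<^bsub>P.M\<^esub>" "\<zero>\<^bsub>P.M\<^esub>" "\<zero>\<^bsub>P.M\<^esub>" "\<zero>\<^bsub>P.M\<^esub>" a "pconst s"] by (simp add: poly_partial_const)

lemma pb_gen:
  assumes i: "i \<in> {1..2 * n}" and j: "j \<in> {1..2 * n}"
  shows "pb (pgen i) (pgen j) = pconst (omega S n i j)"
proof -
  have inner: "pb_inner (pgen i) (pgen j) k = (if i = k then pconst (omega S n i j) else \<zero>\<^bsub>P.M\<^esub>)" for k
  proof -
    have "pb_inner (pgen i) (pgen j) k = finsum P.M (\<lambda>l. if j = l then (if i = k then pconst (omega S n i l) else \<zero>\<^bsub>P.M\<^esub>) else \<zero>\<^bsub>P.M\<^esub>) {1..2 * n}"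
      unfolding pb_inner_def by (rule P.M.finsum_cong') (auto simp: poly_partial_gen)
    also have "\<dots> = (if i = k then pconst (omega S n i j) else \<zero>\<^bsub>P.M\<^esub>)"
      using j by (intro P.M.finsum_singleton) auto
    finally show ?thesis .
  qed
  have "pb (pgen i) (pgen j) = finsum P.M (\<lambda>k. if i = k then (\<lambda>_. pconst (omega S n i j)) k else \<zero>\<^bsub>P.M\<^esub>) {1..2 * n}"
    unfolding pb_eq inner[abs_def] ..
  also have "\<dots> = pconst (omega S n i j)"
    using i by (intro P.M.finsum_singleton) auto
  finally show ?thesis .
qed

text \<open>On powers of \<open>x j\<close> the commutator with \<open>x i\<close> is \<omega> times
  the derivative. The case k = p - 1 produces the factor (p - 1)! that Wilson's theorem
  evaluates.\<close>

lemma funpow_ad_pow: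
  assumes ij: "i \<in> {1..2 * n}" "j \<in> {1..2 * n}"
  shows "(ad W (x i) ^^ k) (x j [^]\<^bsub>W\<^esub> k) = \<kappa> ([(fact k :: nat)] \<cdot>\<^bsub>S\<^esub> (omega S n i j [^] k))"
proof (induction k)
  case 0
  then show ?case by simp
next
  case (Suc k)
  note [simp] = x_closed[OF ij(1)] x_closed[OF ij(2)]
  let ?s = "omega S n i j"
  have "ad W (x i) (x j [^]\<^bsub>W\<^esub> Suc k) = \<kappa> ([(Suc k)] \<cdot>\<^bsub>S\<^esub> ?s) \<otimes>\<^bsub>W\<^esub> x j [^]\<^bsub>W\<^esub> k"
  proof -
    have "pow_deriv W (x j) (\<kappa> ?s) N \<otimes>\<^bsub>W\<^esub> x j = \<kappa> ([N] \<cdot>\<^bsub>S\<^esub> ?s) \<otimes>\<^bsub>W\<^esub> x j [^]\<^bsub>W\<^esub> N" for N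
    proof (induction N)
      case (Suc N)
      have "x j [^]\<^bsub>W\<^esub> N \<otimes>\<^bsub>W\<^esub> \<kappa> ?s = \<kappa> ?s \<otimes>\<^bsub>W\<^esub> x j [^]\<^bsub>W\<^esub> N" by (rule \<kappa>_central) simp_all
      then show ?case using Suc by (simp add: W.l_distr W.m_assoc)
    qed simp
    moreover have "x j [^]\<^bsub>W\<^esub> k \<otimes>\<^bsub>W\<^esub> \<kappa> ?s = \<kappa> ?s \<otimes>\<^bsub>W\<^esub> x j [^]\<^bsub>W\<^esub> k" by (rule \<kappa>_central) simp_all
    ultimately show ?thesis
      unfolding W.ad_pow[OF x_closed[OF ij(1)] x_closed[OF ij(2)]] x_ad[OF ij]
      by (simp add: W.l_distr)
  qed
  then have "(ad W (x i) ^^ Suc k) (x j [^]\<^bsub>W\<^esub> Suc k) = (ad W (x i) ^^ k) (\<kappa> ([(Suc k)] \<cdot>\<^bsub>S\<^esub> ?s) \<otimes>\<^bsub>W\<^esub> x j [^]\<^bsub>W\<^esub> k)"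
    by (simp only: funpow_Suc_right comp_def)
  also have "\<dots> = \<kappa> ([(Suc k)] \<cdot>\<^bsub>S\<^esub> ?s \<otimes> [(fact k :: nat)] \<cdot>\<^bsub>S\<^esub> (?s [^] k))"
    by (subst funpow_ad_const_mult) (simp_all add: Suc del: add.nat_pow_Suc)
  also have "[(Suc k)] \<cdot>\<^bsub>S\<^esub> ?s \<otimes> [(fact k :: nat)] \<cdot>\<^bsub>S\<^esub> (?s [^] k) = [(fact (Suc k) :: nat)] \<cdot>\<^bsub>S\<^esub> (?s [^] Suc k)"
    by (simp add: add_pow_ldistr add_pow_rdistr add.nat_pow_pow m_comm mult.commute del: add.nat_pow_Suc)
  finally show ?case .
qed

end

context weyl_char
begin

text \<open>The values are 0, 1 and -1. That -1 is its own p-th power follows from additivity of the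
  Frobenius, which treats p = 2 along with the odd primes.\<close>

lemma omega_pow: "omega S n i j [^] p = omega S n i j"
proof -
  have z: "\<zero> [^] p = \<zero>" using p_pos by (simp add: nat_pow_zero)
  have "(\<ominus> \<one>) [^] p \<oplus> \<one> = (\<ominus> \<one> \<oplus> \<one>) [^] p" by (subst frobenius_add[OF p char]) simp_all
  also have "\<dots> = \<zero>" using z by (simp add: l_neg)
  finally have "(\<ominus> \<one>) [^] p = \<ominus> \<one>" by (metis minus_equality nat_pow_closed a_inv_closed one_closed)
  then show ?thesis using z by (simp add: omega_def a_minus_def r_neg l_neg)
qed

lemma wilson:
  assumes "t \<in> carrier S"
  shows "[(fact (p - 1) :: nat)] \<cdot>\<^bsub>S\<^esub> t = \<ominus> t"
proof -
  have "[int (fact (p - 1)) = - 1] (mod int p)"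
    using wilson_theorem[OF p] by simp
  then have "int p dvd int (fact (p - 1) + 1)"
    by (simp add: cong_iff_dvd_diff add.commute)
  then have "p dvd fact (p - 1) + 1" by (simp only: int_dvd_int_iff)
  from add_pow_dvd[OF char this assms] have "[(fact (p - 1) :: nat)] \<cdot>\<^bsub>S\<^esub> t \<oplus> t = \<zero>" using assms by simp
  then show ?thesis using assms by (metis minus_equality add.nat_pow_closed)
qed

lemma \<gamma>_const: "s \<in> carrier S \<Longrightarrow> \<gamma> (pconst s) = \<kappa> s"
  by (simp add: \<gamma>_single ymon_eq_ordmon)

lemma \<gamma>_gen: "i \<in> {1..2 * n} \<Longrightarrow> \<gamma> (pgen i) = y i"
proof -
  assume i: "i \<in> {1..2 * n}"
  have [simp]: "x i \<in> carrier W" using i by (rule x_closed)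
  have *: "yprod L e = (if i \<in> set L then y i else \<one>\<^bsub>W\<^esub>)"
    if e: "e i = 1" "\<And>k. k \<noteq> i \<Longrightarrow> e k = 0" and L: "distinct L" "set L \<subseteq> {1..2 * n}" for e L
    using L
  proof (induction L)
    case Nil
    then show ?case by (simp add: yprod_def)
  next
    case (Cons k L)
    then have "yprod (k # L) e = y k [^]\<^bsub>W\<^esub> e k \<otimes>\<^bsub>W\<^esub> (if i \<in> set L then y i else \<one>\<^bsub>W\<^esub>)"
      by (simp add: yprod_def)
    then show ?case using Cons.prems by (cases "k = i") (simp_all add: e)
  qed
  have "ymon {#i#} = y i"
    unfolding ymon_def using i by (subst *) auto
  then show ?thesis using i by (simp add: \<gamma>_single)
qed

end

context weyl_mod
begin

lemma red_pow_deriv: "z \<in> carrier A.W \<Longrightarrow> d \<in> carrier A.W \<Longrightarrow> red (pow_deriv A.W z d N) = pow_deriv B.W (red z) (red d) N"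
  by (induction N) (simp_all add: red_nat_pow)

text \<open>
  The Poisson bracket of the center, computed on lifts. With \<open>y\<^sub>i = x\<^sub>i\<^sup>p\<close> the order of \<open>w'\<close> and \<open>z'\<close>
  makes the sign come out right, because \<open>[y\<^sub>i, y\<^sub>j]\<close> is \<open>- p \<omega>\<^sub>i\<^sub>j\<close> modulo \<open>p\<^sup>2\<close>.
\<close>
definition bracket :: "(nat list \<Rightarrow> 'a set) set \<Rightarrow> (nat list \<Rightarrow> 'a set) set \<Rightarrow> (nat list \<Rightarrow> 'a set) set \<Rightarrow> bool" where
  "bracket z w u \<longleftrightarrow> z \<in> ring_center B.W \<and> w \<in> ring_center B.W \<and>
     (\<exists>z' \<in> carrier A.W. \<exists>w' \<in> carrier A.W. \<exists>u' \<in> carrier A.W.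
        red z' = z \<and> red w' = w \<and> ad A.W w' z' = [p] \<cdot>\<^bsub>A.W\<^esub> u' \<and> red u' = u)"

lemma bracketI:
  "red z' \<in> ring_center B.W \<Longrightarrow> red w' \<in> ring_center B.W \<Longrightarrow> z' \<in> carrier A.W \<Longrightarrow> w' \<in> carrier A.W \<Longrightarrow>
    u' \<in> carrier A.W \<Longrightarrow> ad A.W w' z' = [p] \<cdot>\<^bsub>A.W\<^esub> u' \<Longrightarrow> bracket (red z') (red w') (red u')"
  by (auto simp: bracket_def)

lemma ad_add_pow_right: "z \<in> carrier A.W \<Longrightarrow> w \<in> carrier A.W \<Longrightarrow> ad A.W z ([(k::nat)] \<cdot>\<^bsub>A.W\<^esub> w) = [k] \<cdot>\<^bsub>A.W\<^esub> ad A.W z w"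
  by (induction k) (simp_all add: A.W.ad_add)

lemma ad_add_pow_left: "z \<in> carrier A.W \<Longrightarrow> w \<in> carrier A.W \<Longrightarrow> ad A.W ([(k::nat)] \<cdot>\<^bsub>A.W\<^esub> w) z = [k] \<cdot>\<^bsub>A.W\<^esub> ad A.W w z"
  by (induction k) (simp_all add: A.W.ad_add_left)

lemma red_eq_imp:
  assumes "z \<in> carrier A.W" "w \<in> carrier A.W" "red z = red w"
  shows "\<exists>u \<in> carrier A.W. z = w \<oplus>\<^bsub>A.W\<^esub> [p] \<cdot>\<^bsub>A.W\<^esub> u"
proof -
  have "red (z \<ominus>\<^bsub>A.W\<^esub> w) = \<zero>\<^bsub>B.W\<^esub>" using assms by (simp add: a_minus_def B.W.r_neg)
  then obtain u where u: "u \<in> carrier A.W" "z \<ominus>\<^bsub>A.W\<^esub> w = [p] \<cdot>\<^bsub>A.W\<^esub> u"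
    using red_eq_zero[of "z \<ominus>\<^bsub>A.W\<^esub> w"] assms by auto
  have "z = w \<oplus>\<^bsub>A.W\<^esub> (z \<ominus>\<^bsub>A.W\<^esub> w)"
    using assms by (simp add: a_minus_def A.W.a_lcomm[of w z] A.W.r_neg)
  then show ?thesis using u by auto
qed

text \<open>Replacing a lift by one that differs by p s changes the divided commutator by a
  commutator with s. The latter reduces to zero because the other argument reduces to a central
  element, so any lifts may be used.\<close>

lemma bracket_lift:
  assumes br: "bracket z w u" and z'': "z'' \<in> carrier A.W" "red z'' = z" and w'': "w'' \<in> carrier A.W" "red w'' = w"
  shows "\<exists>u'' \<in> carrier A.W. ad A.W w'' z'' = [p] \<cdot>\<^bsub>A.W\<^esub> u'' \<and> red u'' = u"
proof -
  obtain z' w' u' where zw: "z' \<in> carrier A.W" "w' \<in> carrier A.W" "u' \<in> carrier A.W"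
    "red z' = z" "red w' = w" "ad A.W w' z' = [p] \<cdot>\<^bsub>A.W\<^esub> u'" "red u' = u"
    and c: "z \<in> ring_center B.W" "w \<in> ring_center B.W"
    using br unfolding bracket_def by blast
  obtain s where s: "s \<in> carrier A.W" "z'' = z' \<oplus>\<^bsub>A.W\<^esub> [p] \<cdot>\<^bsub>A.W\<^esub> s"
    using red_eq_imp[of z'' z'] z'' zw by auto
  obtain t where t: "t \<in> carrier A.W" "w'' = w' \<oplus>\<^bsub>A.W\<^esub> [p] \<cdot>\<^bsub>A.W\<^esub> t"
    using red_eq_imp[of w'' w'] w'' zw by auto
  define u'' where "u'' = u' \<oplus>\<^bsub>A.W\<^esub> ad A.W w' s \<oplus>\<^bsub>A.W\<^esub> ad A.W t z''"
  have "ad A.W w'' z'' = ad A.W w' z' \<oplus>\<^bsub>A.W\<^esub> [p] \<cdot>\<^bsub>A.W\<^esub> ad A.W w' s \<oplus>\<^bsub>A.W\<^esub> [p] \<cdot>\<^bsub>A.W\<^esub> ad A.W t z''"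
    unfolding t(2) using z''(1) s t zw(1,2)
    by (simp add: A.W.ad_add_left ad_add_pow_left) (simp add: A.W.ad_add ad_add_pow_right)
  also have "\<dots> = [p] \<cdot>\<^bsub>A.W\<^esub> u''"
    unfolding u''_def zw(6) using z'' s t zw by (simp add: A.W.add.nat_pow_distrib)
  finally have 1: "ad A.W w'' z'' = [p] \<cdot>\<^bsub>A.W\<^esub> u''" .
  have "ad B.W w (red s) = \<zero>\<^bsub>B.W\<^esub>" "ad B.W (red t) z = \<zero>\<^bsub>B.W\<^esub>"
    using B.central_ad[OF c(1), of "red t"] B.central_ad[OF c(2), of "red s"] s(1) t(1) c
      B.W.ad_minus[of "red s" w] by (auto simp: ring_center_def)
  then have "red u'' = u"
    unfolding u''_def using s(1) t(1) z'' zw by (auto simp: red_ad)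
  then show ?thesis using 1 s t z'' zw by (intro bexI[of _ u'']) (auto simp: u''_def)
qed

lemma bracket_add:
  assumes 1: "bracket z w u" and 2: "bracket z' w u'"
  shows "bracket (z \<oplus>\<^bsub>B.W\<^esub> z') w (u \<oplus>\<^bsub>B.W\<^esub> u')"
proof -
  have c: "z \<in> ring_center B.W" "z' \<in> ring_center B.W" "w \<in> ring_center B.W" using 1 2 by (auto simp: bracket_def)
  then have cl: "z \<in> carrier B.W" "z' \<in> carrier B.W" "w \<in> carrier B.W" by (auto simp: ring_center_def)
  obtain a b d where a: "a \<in> carrier A.W" "red a = z" "b \<in> carrier A.W" "red b = z'" "d \<in> carrier A.W" "red d = w"
    using cl red_surj by meson
  obtain e where e: "e \<in> carrier A.W" "ad A.W d a = [p] \<cdot>\<^bsub>A.W\<^esub> e" "red e = u" using bracket_lift[OF 1 a(1,2) a(5,6)] by blast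
  obtain e' where e': "e' \<in> carrier A.W" "ad A.W d b = [p] \<cdot>\<^bsub>A.W\<^esub> e'" "red e' = u'" using bracket_lift[OF 2 a(3,4) a(5,6)] by blast
  have "z \<oplus>\<^bsub>B.W\<^esub> z' \<in> ring_center B.W" using c by (simp add: ring_center_def B.W.l_distr B.W.r_distr)
  then have "bracket (red (a \<oplus>\<^bsub>A.W\<^esub> b)) (red d) (red (e \<oplus>\<^bsub>A.W\<^esub> e'))"
    by (intro bracketI) (use a e e' c in \<open>simp_all add: A.W.ad_add A.W.add.nat_pow_distrib\<close>)
  then show ?thesis using a e e' by simp
qed

lemma bracket_mult:
  assumes 1: "bracket z w u" and 2: "bracket z' w u'"
  shows "bracket (z \<otimes>\<^bsub>B.W\<^esub> z') w (u \<otimes>\<^bsub>B.W\<^esub> z' \<oplus>\<^bsub>B.W\<^esub> z \<otimes>\<^bsub>B.W\<^esub> u')"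
proof -
  have c: "z \<in> ring_center B.W" "z' \<in> ring_center B.W" "w \<in> ring_center B.W" using 1 2 by (auto simp: bracket_def)
  then have cl: "z \<in> carrier B.W" "z' \<in> carrier B.W" "w \<in> carrier B.W" by (auto simp: ring_center_def)
  obtain a b d where a: "a \<in> carrier A.W" "red a = z" "b \<in> carrier A.W" "red b = z'" "d \<in> carrier A.W" "red d = w"
    using cl red_surj by meson
  obtain e where e: "e \<in> carrier A.W" "ad A.W d a = [p] \<cdot>\<^bsub>A.W\<^esub> e" "red e = u" using bracket_lift[OF 1 a(1,2) a(5,6)] by blast
  obtain e' where e': "e' \<in> carrier A.W" "ad A.W d b = [p] \<cdot>\<^bsub>A.W\<^esub> e'" "red e' = u'" using bracket_lift[OF 2 a(3,4) a(5,6)] by blast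
  have "z \<otimes>\<^bsub>B.W\<^esub> z' \<otimes>\<^bsub>B.W\<^esub> v = v \<otimes>\<^bsub>B.W\<^esub> (z \<otimes>\<^bsub>B.W\<^esub> z')" if v: "v \<in> carrier B.W" for v
  proof -
    have "z \<otimes>\<^bsub>B.W\<^esub> z' \<otimes>\<^bsub>B.W\<^esub> v = z \<otimes>\<^bsub>B.W\<^esub> v \<otimes>\<^bsub>B.W\<^esub> z'"
      using c(2) v cl by (simp add: ring_center_def B.W.m_assoc)
    also have "\<dots> = v \<otimes>\<^bsub>B.W\<^esub> (z \<otimes>\<^bsub>B.W\<^esub> z')"
      using c(1) v cl by (simp add: ring_center_def B.W.m_assoc)
    finally show ?thesis .
  qed
  then have "z \<otimes>\<^bsub>B.W\<^esub> z' \<in> ring_center B.W" using cl by (simp add: ring_center_def)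
  then have "bracket (red (a \<otimes>\<^bsub>A.W\<^esub> b)) (red d) (red (e \<otimes>\<^bsub>A.W\<^esub> b \<oplus>\<^bsub>A.W\<^esub> a \<otimes>\<^bsub>A.W\<^esub> e'))"
    by (intro bracketI) (use a e e' c in \<open>simp_all add: A.W.ad_mult A.W.add.nat_pow_distrib A.W.add_pow_ldistr A.W.add_pow_rdistr\<close>)
  then show ?thesis using a e e' by simp
qed

text \<open>Antisymmetry transfers additivity and the product rule from the first argument to the
  second.\<close>

lemma bracket_swap:
  assumes "bracket z w u"
  shows "bracket w z (\<ominus>\<^bsub>B.W\<^esub> u)"
proof -
  obtain z' w' u' where zw: "z' \<in> carrier A.W" "w' \<in> carrier A.W" "u' \<in> carrier A.W"
    "red z' = z" "red w' = w" "ad A.W w' z' = [p] \<cdot>\<^bsub>A.W\<^esub> u'" "red u' = u"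
    and c: "z \<in> ring_center B.W" "w \<in> ring_center B.W"
    using assms unfolding bracket_def by blast
  have "ad A.W z' w' = [p] \<cdot>\<^bsub>A.W\<^esub> (\<ominus>\<^bsub>A.W\<^esub> u')"
    using zw A.W.ad_minus[of w' z'] by (simp add: A.W.add.nat_pow_inv)
  then have "bracket (red w') (red z') (red (\<ominus>\<^bsub>A.W\<^esub> u'))"
    by (intro bracketI) (use zw c in simp_all)
  then show ?thesis using zw by simp
qed

lemma bracket_const:
  assumes "s \<in> carrier S" "w \<in> ring_center B.W"
  shows "bracket (B.\<kappa> s) w \<zero>\<^bsub>B.W\<^esub>"
proof -
  obtain r where r: "r \<in> carrier R" "s = q r" using q_surj assms(1) by blast
  have w: "w \<in> carrier B.W" using assms(2) by (simp add: ring_center_def)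
  then obtain d where d: "d \<in> carrier A.W" "red d = w" using red_surj by meson
  have "B.\<kappa> s \<in> ring_center B.W" using assms(1) B.\<kappa>_central by (simp add: ring_center_def)
  moreover have "ad A.W d (A.\<kappa> r) = \<zero>\<^bsub>A.W\<^esub>" using d r A.\<kappa>_central[of r d] by (simp add: A.W.ad_eq_zero_iff)
  ultimately have "bracket (red (A.\<kappa> r)) (red d) (red \<zero>\<^bsub>A.W\<^esub>)"
    by (intro bracketI) (use d r assms(2) in \<open>simp_all add: red_const\<close>)
  then show ?thesis using d r by (simp add: red_const)
qed

text \<open>After division by p, the reduction is p - 1 commutators with x_i applied to - \<omega>
  x_j^(p - 1). This is - \<omega> (p - 1)! \<omega>^(p - 1), where the sign cancels against (p - 1)!
  = -1 and \<omega>^p = \<omega> remains.\<close>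

lemma bracket_gen:
  assumes ij: "i \<in> {1..2 * n}" "j \<in> {1..2 * n}"
  shows "bracket (B.y i) (B.y j) (B.\<kappa> (omega S n i j))"
proof -
  note xA [simp] = A.x_closed[OF ij(1)] A.x_closed[OF ij(2)]
  note xB [simp] = B.x_closed[OF ij(1)] B.x_closed[OF ij(2)]
  let ?c = "A.\<kappa> (omega R n i j)" and ?d = "B.\<kappa> (omega S n i j)"
  have pd: "pow_deriv A.W (A.x j) ?c N = ?c \<otimes>\<^bsub>A.W\<^esub> pow_deriv A.W (A.x j) \<one>\<^bsub>A.W\<^esub> N" for N
  proof (induction N)
    case (Suc N)
    have "A.x j [^]\<^bsub>A.W\<^esub> N \<otimes>\<^bsub>A.W\<^esub> ?c = ?c \<otimes>\<^bsub>A.W\<^esub> A.x j [^]\<^bsub>A.W\<^esub> N" by (rule A.\<kappa>_central) simp_all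
    then show ?case using Suc by (simp add: A.W.r_distr A.W.m_assoc)
  qed simp
  \<comment> \<open>The commutator of x_j^p with x_i, divided by p. Taking this quotient first
    leaves an expression linear in e for the commutator with x_i^p.\<close>
  define e where "e = \<ominus>\<^bsub>A.W\<^esub> (?c \<otimes>\<^bsub>A.W\<^esub> A.x j [^]\<^bsub>A.W\<^esub> (p - 1))"
  have e [simp]: "e \<in> carrier A.W" by (simp add: e_def)
  have "ad A.W (A.x i) (A.x j [^]\<^bsub>A.W\<^esub> p) = [p] \<cdot>\<^bsub>A.W\<^esub> (?c \<otimes>\<^bsub>A.W\<^esub> A.x j [^]\<^bsub>A.W\<^esub> (p - 1))"
    by (simp add: A.W.ad_pow A.x_ad[OF ij] pd A.W.pow_deriv_one A.W.add_pow_rdistr)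
  then have "ad A.W (A.x j [^]\<^bsub>A.W\<^esub> p) (A.x i) = [p] \<cdot>\<^bsub>A.W\<^esub> e"
    using A.W.ad_minus[of "A.x i" "A.x j [^]\<^bsub>A.W\<^esub> p"] by (simp add: e_def A.W.add.nat_pow_inv)
  then have 1: "ad A.W (A.x j [^]\<^bsub>A.W\<^esub> p) (A.x i [^]\<^bsub>A.W\<^esub> p) = [p] \<cdot>\<^bsub>A.W\<^esub> pow_deriv A.W (A.x i) e p"
    by (simp add: A.W.ad_pow A.W.pow_deriv_add_pow)
  have re: "red e = B.\<kappa> (\<ominus>\<^bsub>S\<^esub> omega S n i j) \<otimes>\<^bsub>B.W\<^esub> B.x j [^]\<^bsub>B.W\<^esub> (p - 1)"
    using ij by (simp add: e_def red_const red_nat_pow red_gen q_omega B.W.l_minus)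
  have "red (pow_deriv A.W (A.x i) e p) = (ad B.W (B.x i) ^^ (p - 1)) (red e)"
    using red_gen[OF ij(1)] by (subst red_pow_deriv, simp, simp) (simp add: B.W.pow_deriv_char[OF prime_p B.char_W])
  also have "\<dots> = B.\<kappa> (\<ominus>\<^bsub>S\<^esub> omega S n i j) \<otimes>\<^bsub>B.W\<^esub> B.\<kappa> ([(fact (p - 1) :: nat)] \<cdot>\<^bsub>S\<^esub> (omega S n i j [^]\<^bsub>S\<^esub> (p - 1)))"
    unfolding re B.funpow_ad_pow[OF ij, symmetric] by (rule B.funpow_ad_const_mult) simp_all
  also have "\<dots> = B.\<kappa> (\<ominus>\<^bsub>S\<^esub> omega S n i j \<otimes>\<^bsub>S\<^esub> \<ominus>\<^bsub>S\<^esub> (omega S n i j [^]\<^bsub>S\<^esub> (p - 1)))"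
    by (subst B.wilson) (simp_all del: B.\<kappa>.hom_mult B.\<kappa>.hom_a_inv add: B.\<kappa>.hom_mult[symmetric])
  also have "\<ominus>\<^bsub>S\<^esub> omega S n i j \<otimes>\<^bsub>S\<^esub> \<ominus>\<^bsub>S\<^esub> (omega S n i j [^]\<^bsub>S\<^esub> (p - 1)) = omega S n i j [^]\<^bsub>S\<^esub> Suc (p - 1)"
    by (simp add: B.S.l_minus B.S.r_minus B.S.m_comm)
  also have "omega S n i j [^]\<^bsub>S\<^esub> Suc (p - 1) = omega S n i j"
    using B.omega_pow B.p_pos by simp
  finally have 2: "red (pow_deriv A.W (A.x i) e p) = ?d" .
  have "bracket (red (A.x i [^]\<^bsub>A.W\<^esub> p)) (red (A.x j [^]\<^bsub>A.W\<^esub> p)) (red (pow_deriv A.W (A.x i) e p))"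
    by (intro bracketI 1) (use B.y_central[OF ij(1)] B.y_central[OF ij(2)] ij in \<open>simp_all add: red_nat_pow red_gen\<close>)
  then show ?thesis using ij by (simp add: 2 red_nat_pow red_gen)
qed

text \<open>Both sides obey a product rule in each argument and vanish on constants, so generators
  decide. The inner induction, over b, works through \<open>bracket_swap\<close>.\<close>

lemma bracket_\<gamma>:
  assumes a: "a \<in> carrier B.P.M" and b: "b \<in> carrier B.P.M"
  shows "bracket (B.\<gamma> a) (B.\<gamma> b) (B.\<gamma> (B.pb a b))"
  using a
proof (induction a rule: B.poly_induct)
  case (const s)
  then show ?case
    using bracket_const[OF const B.\<gamma>_central[OF b]] b by (simp add: B.pb_const_left B.\<gamma>_const)
next
  case (add a a')
  then show ?case using bracket_add[of "B.\<gamma> a" "B.\<gamma> b" "B.\<gamma> (B.pb a b)" "B.\<gamma> a'" "B.\<gamma> (B.pb a' b)"] b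
    by (simp add: B.pb_add_left)
next
  case (mult a a')
  have "B.pb (a \<otimes>\<^bsub>B.P.M\<^esub> a') b = B.pb a b \<otimes>\<^bsub>B.P.M\<^esub> a' \<oplus>\<^bsub>B.P.M\<^esub> a \<otimes>\<^bsub>B.P.M\<^esub> B.pb a' b"
    using mult b by (simp add: B.pb_mult_left B.P.m_comm B.P.M.a_comm)
  then show ?case using mult bracket_mult[of "B.\<gamma> a" "B.\<gamma> b" "B.\<gamma> (B.pb a b)" "B.\<gamma> a'" "B.\<gamma> (B.pb a' b)"] b
    by simp
next
  case (gen i)
  have gi [simp]: "single S \<one>\<^bsub>S\<^esub> {#i#} \<in> carrier B.P.M" using gen by simp
  show ?case
    using b
  proof (induction b rule: B.poly_induct)
    case (const s)
    from bracket_swap[OF bracket_const[OF const B.\<gamma>_central[OF gi]]]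
    show ?case using const by (simp add: B.pb_const_right B.\<gamma>_const)
  next
    case (gen j)
    then show ?case using bracket_gen[OF \<open>i \<in> _\<close> gen]
      by (simp only: B.pb_gen[OF \<open>i \<in> _\<close> gen] B.\<gamma>_gen B.\<gamma>_const B.omega_closed \<open>i \<in> _\<close>)
  next
    case (add b b')
    from bracket_swap[OF bracket_add[OF add(3,4)[THEN bracket_swap]]]
    show ?case using add(1,2) by (simp add: B.pb_add_right B.W.minus_add)
  next
    case (mult b b')
    have "B.pb (single S \<one>\<^bsub>S\<^esub> {#i#}) (b \<otimes>\<^bsub>B.P.M\<^esub> b') =
        B.pb (single S \<one>\<^bsub>S\<^esub> {#i#}) b \<otimes>\<^bsub>B.P.M\<^esub> b' \<oplus>\<^bsub>B.P.M\<^esub> b \<otimes>\<^bsub>B.P.M\<^esub> B.pb (single S \<one>\<^bsub>S\<^esub> {#i#}) b'"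
      using mult by (simp add: B.pb_mult_right B.P.m_comm B.P.M.a_comm)
    moreover from bracket_swap[OF bracket_mult[OF mult(3,4)[THEN bracket_swap]]]
    have "bracket (B.\<gamma> (single S \<one>\<^bsub>S\<^esub> {#i#})) (B.\<gamma> (b \<otimes>\<^bsub>B.P.M\<^esub> b'))
      (B.\<gamma> (B.pb (single S \<one>\<^bsub>S\<^esub> {#i#}) b \<otimes>\<^bsub>B.P.M\<^esub> b' \<oplus>\<^bsub>B.P.M\<^esub> b \<otimes>\<^bsub>B.P.M\<^esub> B.pb (single S \<one>\<^bsub>S\<^esub> {#i#}) b'))"
      using mult(1,2) by (simp add: B.W.minus_add B.W.l_minus B.W.r_minus)
    ultimately show ?case by simp
  qed
qed

text \<open>The commutator of given lifts fixes only p times the lifted bracket. Absence of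
  p-torsion in R, applied to each coordinate, allows the division.\<close>

lemma bracket_unique:
  assumes tf: "\<And>r. r \<in> carrier R \<Longrightarrow> [p] \<cdot>\<^bsub>R\<^esub> r = \<zero> \<Longrightarrow> r = \<zero>"
    and "bracket z w u" "bracket z w v"
  shows "u = v"
proof -
  have "z \<in> carrier B.W" "w \<in> carrier B.W" using assms(2) by (auto simp: bracket_def ring_center_def)
  then obtain a d where a: "a \<in> carrier A.W" "red a = z" "d \<in> carrier A.W" "red d = w" using red_surj by meson
  obtain e where e: "e \<in> carrier A.W" "ad A.W d a = [p] \<cdot>\<^bsub>A.W\<^esub> e" "red e = u" using bracket_lift[OF assms(2) a(1,2) a(3,4)] by blast
  obtain e' where e': "e' \<in> carrier A.W" "ad A.W d a = [p] \<cdot>\<^bsub>A.W\<^esub> e'" "red e' = v" using bracket_lift[OF assms(3) a(1,2) a(3,4)] by blast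
  have "A.coef e m = A.coef e' m" for m
  proof -
    note [simp] = A.coef_closed[OF e(1), unfolded A.coeff_space_iff, rule_format]
      A.coef_closed[OF e'(1), unfolded A.coeff_space_iff, rule_format]
    have "(\<lambda>m. [p] \<cdot>\<^bsub>R\<^esub> A.coef e m) = (\<lambda>m. [p] \<cdot>\<^bsub>R\<^esub> A.coef e' m)"
      unfolding A.coef_add_pow[OF e(1), symmetric] A.coef_add_pow[OF e'(1), symmetric] e(2)[symmetric] e'(2)[symmetric] ..
    from fun_cong[OF this, of m] have "[p] \<cdot>\<^bsub>R\<^esub> (A.coef e m \<oplus> \<ominus> A.coef e' m) = \<zero>"
      by (simp add: A.S.add.nat_pow_distrib A.S.add.nat_pow_inv A.S.r_neg)
    then have "A.coef e m \<oplus> \<ominus> A.coef e' m = \<zero>" by (rule tf[rotated]) simp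
    then show ?thesis by (simp add: A.S.r_right_minus_eq[unfolded a_minus_def])
  qed
  then have "e = e'" using A.coef_inject[OF e(1) e'(1)] by blast
  then show ?thesis using e e' by simp
qed

end

section \<open>The automorphism of the center\<close>

context weyl_mod_aut
begin

abbreviation "\<Gamma> \<equiv> centr_aut n R p f"

text \<open>The equation between \<gamma> \<circ> \<Gamma> and fp \<circ> \<gamma> characterizes
  \<Gamma> because \<gamma> is injective. The algebraic properties of \<Gamma> are all verified
  after applying \<gamma>.\<close>

lemma centr_aut_apply:
  assumes a: "a \<in> carrier B.P.M"
  shows "\<Gamma> a \<in> carrier B.P.M" "B.\<gamma> (\<Gamma> a) = fp (B.\<gamma> a)"
proof -
  have z: "B.\<gamma> a \<in> ring_center B.W" by (rule B.\<gamma>_central[OF a])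
  have eq: "\<Gamma> a = inv_into (carrier B.P.M) B.\<gamma> (fp (B.\<gamma> a))"
    using z by (simp add: centr_aut_def Let_def B.poly_alg_eq)
  have im: "fp (B.\<gamma> a) \<in> B.\<gamma> ` carrier B.P.M"
    using fp_central[OF z] B.\<gamma>_bij by (simp add: bij_betw_def)
  show "\<Gamma> a \<in> carrier B.P.M" unfolding eq by (rule inv_into_into[OF im])
  show "B.\<gamma> (\<Gamma> a) = fp (B.\<gamma> a)" unfolding eq by (rule f_inv_into_f[OF im])
qed

lemma \<gamma>_inject: "a \<in> carrier B.P.M \<Longrightarrow> b \<in> carrier B.P.M \<Longrightarrow> B.\<gamma> a = B.\<gamma> b \<Longrightarrow> a = b"
  using B.\<gamma>_bij by (auto simp: bij_betw_def inj_on_def)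

lemma centr_aut_hom: "\<Gamma> \<in> ring_hom B.P.M B.P.M"
proof (rule ring_hom_memI)
  fix a b assume a: "a \<in> carrier B.P.M" and b: "b \<in> carrier B.P.M"
  note cl = centr_aut_apply(1)[OF a] centr_aut_apply(1)[OF b]
  show "\<Gamma> (a \<otimes>\<^bsub>B.P.M\<^esub> b) = \<Gamma> a \<otimes>\<^bsub>B.P.M\<^esub> \<Gamma> b"
    using a b cl by (intro \<gamma>_inject) (simp_all add: centr_aut_apply)
  show "\<Gamma> (a \<oplus>\<^bsub>B.P.M\<^esub> b) = \<Gamma> a \<oplus>\<^bsub>B.P.M\<^esub> \<Gamma> b"
    using a b cl by (intro \<gamma>_inject) (simp_all add: centr_aut_apply)
next
  show "\<Gamma> \<one>\<^bsub>B.P.M\<^esub> = \<one>\<^bsub>B.P.M\<^esub>"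
    by (intro \<gamma>_inject) (simp_all add: centr_aut_apply)
qed (rule centr_aut_apply(1))

lemma centr_aut_const: "s \<in> carrier S \<Longrightarrow> \<Gamma> (poly_const n S s) = poly_const n S s"
  unfolding poly_const_def monoid_ring_const_eq_single
  by (intro \<gamma>_inject) (simp_all add: centr_aut_apply B.\<gamma>_const fp_const)

text \<open>The locale is symmetric in f and g; this supplies the inverse of \<Gamma> and its
  coefficients without repeating any argument.\<close>

lemma weyl_mod_aut_swap: "weyl_mod_aut R n p g f"
  using f g gf fg by unfold_locales

lemma centr_aut_inverse: "a \<in> carrier B.P.M \<Longrightarrow> \<Gamma> (centr_aut n R p g a) = a"
proof -
  assume a: "a \<in> carrier B.P.M"
  interpret swap: weyl_mod_aut R n p g f by (rule weyl_mod_aut_swap)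
  note sw = swap.centr_aut_apply[OF a]
  show ?thesis
    using a sw by (intro \<gamma>_inject) (simp_all add: centr_aut_apply fp_gp)
qed

lemma centr_aut_bij: "bij_betw \<Gamma> (carrier B.P.M) (carrier B.P.M)"
proof -
  interpret swap: weyl_mod_aut R n p g f by (rule weyl_mod_aut_swap)
  show ?thesis
    by (rule bij_betw_byWitness[where f' = "centr_aut n R p g"])
       (auto simp: centr_aut_inverse swap.centr_aut_inverse centr_aut_apply(1) swap.centr_aut_apply(1))
qed

text \<open>The automorphism f over R transports the lifts and the divided commutator. Here it
  matters that the automorphism modulo p comes from one over R.\<close>

lemma bracket_fp:
  assumes "bracket z w u"
  shows "bracket (fp z) (fp w) (fp u)"
proof -
  obtain z' w' u' where zw: "z' \<in> carrier A.W" "w' \<in> carrier A.W" "u' \<in> carrier A.W"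
    "red z' = z" "red w' = w" "ad A.W w' z' = [p] \<cdot>\<^bsub>A.W\<^esub> u'" "red u' = u"
    and c: "z \<in> ring_center B.W" "w \<in> ring_center B.W"
    using assms unfolding bracket_def by blast
  have "f ([k] \<cdot>\<^bsub>A.W\<^esub> u') = [k] \<cdot>\<^bsub>A.W\<^esub> f u'" for k :: nat
    using zw(3) by (induction k) simp_all
  moreover have "f (ad A.W w' z') = ad A.W (f w') (f z')"
    using zw(1,2) by (simp add: ad_def a_minus_def)
  ultimately have "ad A.W (f w') (f z') = [p] \<cdot>\<^bsub>A.W\<^esub> f u'" by (simp add: zw(6))
  then have "bracket (red (f z')) (red (f w')) (red (f u'))"
    using zw c by (intro bracketI) (simp_all add: fp_red[symmetric] fp_central)
  then show ?thesis using zw by (simp add: fp_red[symmetric])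
qed

lemma centr_aut_poisson:
  assumes "\<And>r. r \<in> carrier R \<Longrightarrow> [p] \<cdot>\<^bsub>R\<^esub> r = \<zero> \<Longrightarrow> r = \<zero>"
  shows "\<Gamma> \<in> poisson_aut n S"
proof -
  have "\<Gamma> (B.pb a b) = B.pb (\<Gamma> a) (\<Gamma> b)" if a: "a \<in> carrier B.P.M" and b: "b \<in> carrier B.P.M" for a b
  proof (rule \<gamma>_inject)
    note cl = centr_aut_apply(1)[OF a] centr_aut_apply(1)[OF b]
    have "bracket (B.\<gamma> (\<Gamma> a)) (B.\<gamma> (\<Gamma> b)) (B.\<gamma> (\<Gamma> (B.pb a b)))"
      using bracket_fp[OF bracket_\<gamma>[OF a b]] a b by (simp add: centr_aut_apply)
    then show "B.\<gamma> (\<Gamma> (B.pb a b)) = B.\<gamma> (B.pb (\<Gamma> a) (\<Gamma> b))"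
      using bracket_\<gamma>[OF cl] by (rule bracket_unique[rotated]) (rule assms)
    show "\<Gamma> (B.pb a b) \<in> carrier B.P.M" "B.pb (\<Gamma> a) (\<Gamma> b) \<in> carrier B.P.M"
      using a b cl by (simp_all add: centr_aut_apply(1))
  qed
  then show ?thesis
    using centr_aut_hom centr_aut_bij centr_aut_const
    by (simp add: poisson_aut_def algebra_aut_def ring_iso_def B.poly_alg_eq)
qed

lemma centr_aut_defined_over:
  assumes nilp: "\<And>i m. i \<in> {1..2 * n} \<Longrightarrow> A.coef (f (A.x i)) m \<noteq> \<zero> \<Longrightarrow> (ad A.W (A.x i) ^^ (p - 1)) (g (A.ordmon m)) = \<zero>\<^bsub>A.W\<^esub>"
    and nilp': "\<And>i m. i \<in> {1..2 * n} \<Longrightarrow> A.coef (g (A.x i)) m \<noteq> \<zero> \<Longrightarrow> (ad A.W (A.x i) ^^ (p - 1)) (f (A.ordmon m)) = \<zero>\<^bsub>A.W\<^esub>"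
    and pth: "\<And>s. s \<in> carrier S \<Longrightarrow> (\<And>\<delta>. ring_derivation S \<delta> \<Longrightarrow> \<delta> s = \<zero>\<^bsub>S\<^esub>) \<Longrightarrow> s \<in> pth_powers S p"
  shows "defined_over n S (pth_powers S p) \<Gamma>"
proof -
  interpret swap: weyl_mod_aut R n p g f by (rule weyl_mod_aut_swap)
  have "range (\<Gamma> (poly_gen S i)) \<subseteq> pth_powers S p \<and>
      range (inv_into (carrier (poly_alg n S)) \<Gamma> (poly_gen S i)) \<subseteq> pth_powers S p"
    if i: "i \<in> {1..2 * n}" for i
  proof -
    let ?y = "single S \<one>\<^bsub>S\<^esub> {#i#}"
    have y: "?y \<in> carrier B.P.M" using i by simp
    have gen: "poly_gen S i = ?y" by (simp add: poly_gen_def monoid_ring_gen_eq_single)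
    have "\<Gamma> ?y m \<in> pth_powers S p" for m
    proof (rule pth)
      show "\<Gamma> ?y m \<in> carrier S" by (rule B.P.coeff_closed[OF centr_aut_apply(1)[OF y]])
      show "\<delta> (\<Gamma> ?y m) = \<zero>\<^bsub>S\<^esub>" if "ring_derivation S \<delta>" for \<delta>
        by (rule derivation_center_coeff[OF that i nilp[OF i] centr_aut_apply(1)[OF y]])
           (simp_all add: centr_aut_apply(2)[OF y] B.\<gamma>_gen[OF i])
    qed
    moreover have "centr_aut n R p g ?y m \<in> pth_powers S p" for m
    proof (rule pth)
      show "centr_aut n R p g ?y m \<in> carrier S" by (rule B.P.coeff_closed[OF swap.centr_aut_apply(1)[OF y]])
      show "\<delta> (centr_aut n R p g ?y m) = \<zero>\<^bsub>S\<^esub>" if "ring_derivation S \<delta>" for \<delta>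
        by (rule swap.derivation_center_coeff[OF that i nilp'[OF i] swap.centr_aut_apply(1)[OF y]])
           (simp_all add: swap.centr_aut_apply(2)[OF y] B.\<gamma>_gen[OF i])
    qed
    moreover have "inv_into (carrier B.P.M) \<Gamma> ?y = centr_aut n R p g ?y"
      using centr_aut_bij swap.centr_aut_apply(1)[OF y] centr_aut_inverse[OF y]
      by (intro inv_into_f_eq) (simp_all add: bij_betw_def)
    ultimately show ?thesis by (auto simp: gen B.poly_alg_eq)
  qed
  then show ?thesis unfolding defined_over_def by blast
qed

end

section \<open>Generators and formal smoothness of the reduction\<close>

context weyl_mod
begin

text \<open>The index set has the even size that \<open>cartier\<close> prescribes for its
  variables. Adjoining 1 makes the list of generators nonempty, and running through it twice makes
  its length even.\<close>

lemma finitely_generated_mod: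
  assumes "finitely_generated_ring R"
  shows "\<exists>(m::nat) c. (\<forall>i \<in> {1..2 * m}. c i \<in> carrier S) \<and> generate_ring S (c ` {1..2 * m}) = carrier S"
proof -
  obtain A where A: "finite A" "A \<subseteq> carrier R" "generate_ring R A = carrier R"
    using assms unfolding finitely_generated_ring_def by blast
  define B where "B = insert \<one>\<^bsub>S\<^esub> (q ` A)"
  have B: "finite B" "B \<noteq> {}" "B \<subseteq> carrier S" using A by (auto simp: B_def)
  define m where "m = card B"
  have m: "m > 0" using B by (simp add: m_def card_gt_0_iff)
  obtain b where b: "bij_betw b {0..<m} B" using ex_bij_betw_nat_finite[OF B(1)] by (auto simp: m_def)
  have "(\<lambda>i. b (i mod m)) ` {1..2 * m} = B"
  proof
    show "(\<lambda>i. b (i mod m)) ` {1..2 * m} \<subseteq> B" using b m by (auto simp: bij_betw_def)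
    show "B \<subseteq> (\<lambda>i. b (i mod m)) ` {1..2 * m}"
    proof
      fix s assume "s \<in> B"
      then obtain k where "k < m" "s = b k" using b by (auto simp: bij_betw_def)
      then show "s \<in> (\<lambda>i. b (i mod m)) ` {1..2 * m}" by (intro image_eqI[of _ _ "m + k"]) auto
    qed
  qed
  moreover have "generate_ring S B = carrier S"
  proof
    show "generate_ring S B \<subseteq> carrier S" by (rule B.S.generate_ring_incl[OF B(3)])
    have "q r \<in> generate_ring S B" if "r \<in> generate_ring R A" for r
      using that
    proof induction
      case one
      show ?case unfolding q.hom_one by (rule generate_ring.one)
    next
      case (incl h)
      then show ?case by (intro generate_ring.incl) (simp add: B_def)
    next
      case (a_inv h)
      then have "h \<in> carrier R" using A(3) by simp
      then have "q (\<ominus> h) = \<ominus>\<^bsub>S\<^esub> q h" by (rule q.hom_a_inv)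
      then show ?case using generate_ring.a_inv[OF a_inv.IH] by simp
    next
      case (eng_add h1 h2)
      then have "h1 \<in> carrier R" "h2 \<in> carrier R" using A(3) by simp_all
      then have "q (h1 \<oplus> h2) = q h1 \<oplus>\<^bsub>S\<^esub> q h2" by (rule q.hom_add)
      then show ?case using generate_ring.eng_add[OF eng_add.IH] by simp
    next
      case (eng_mult h1 h2)
      then have "h1 \<in> carrier R" "h2 \<in> carrier R" using A(3) by simp_all
      then have "q (h1 \<otimes> h2) = q h1 \<otimes>\<^bsub>S\<^esub> q h2" by (rule q.hom_mult)
      then show ?case using generate_ring.eng_mult[OF eng_mult.IH] by simp
    qed
    then show "carrier S \<subseteq> generate_ring S B" using q_surj A(3) by blast
  qed
  ultimately show ?thesis
    using B(3) by (intro exI[of _ m] exI[of _ "\<lambda>i. b (i mod m)"]) auto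
qed

text \<open>Compose with the projection from R, lift by formal smoothness over the integers, and
  factor the lift through R / p R, which is possible because p is zero in the test ring.\<close>

lemma lift_mod:
  fixes D :: "'b ring"
  assumes smooth: "formally_smooth TYPE('b) R"
    and D: "cring D" "[p] \<cdot>\<^bsub>D\<^esub> \<one>\<^bsub>D\<^esub> = \<zero>\<^bsub>D\<^esub>" "ideal J D" "\<forall>a\<in>J. \<forall>b\<in>J. a \<otimes>\<^bsub>D\<^esub> b = \<zero>\<^bsub>D\<^esub>"
    and g: "g \<in> ring_hom S (D Quot J)"
  shows "\<exists>h \<in> ring_hom S D. \<forall>s \<in> carrier S. J +>\<^bsub>D\<^esub> h s = g s"
proof -
  interpret D: cring D by fact
  have gq: "(\<lambda>r. g (q r)) \<in> ring_hom R (D Quot J)"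
    using ring_hom_trans[OF q_hom g] by (simp add: comp_def)
  obtain h where h: "h \<in> ring_hom R D" "\<And>r. r \<in> carrier R \<Longrightarrow> J +>\<^bsub>D\<^esub> h r = g (q r)"
    using smooth[unfolded formally_smooth_def, THEN spec, THEN spec, THEN spec, THEN mp, THEN mp,
        THEN mp, THEN mp, OF D(1,3,4) gq] by blast
  interpret h: ring_hom_ring R D h
    by (rule ring_hom_ringI2[OF A.ring_axioms D.ring_axioms h(1)])
  have "h r = \<zero>\<^bsub>D\<^esub>" if "r \<in> mod_ideal R p" for r
  proof -
    obtain c where c: "c \<in> carrier R" "r = [p] \<cdot>\<^bsub>R\<^esub> c" using \<open>r \<in> mod_ideal R p\<close> mod_ideal_iff by blast
    have "h ([k] \<cdot>\<^bsub>R\<^esub> c) = [k] \<cdot>\<^bsub>D\<^esub> h c" for k :: nat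
      using c(1) by (induction k) simp_all
    then show ?thesis using D.add_pow_dvd[OF D(2) dvd_refl, of "h c"] c by simp
  qed
  then have h0: "\<forall>r\<in>mod_ideal R p. h r = \<zero>\<^bsub>D\<^esub>" by blast
  obtain H where H: "H \<in> ring_hom (R Quot mod_ideal R p) D" "\<And>r. r \<in> carrier R \<Longrightarrow> H (q r) = h r"
    using quotient_ring_hom_lift[OF mod_ideal D.ring_axioms h(1) h0] by (elim bexE) simp
  show ?thesis
  proof (intro bexI[of _ H] ballI)
    show "H \<in> ring_hom S D" using H(1) by (simp add: mod_ring_def)
    fix s assume "s \<in> carrier S"
    then obtain r where r: "r \<in> carrier R" "s = q r" using q_surj by blast
    show "J +>\<^bsub>D\<^esub> H s = g s" unfolding r(2) H(2)[OF r(1)] by (rule h(2)[OF r(1)])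
  qed
qed

lemma pth_power_mod:
  assumes fg: "finitely_generated_ring R" and smooth: "formally_smooth TYPE(nat) R"
    and s: "s \<in> carrier S" "\<And>\<delta>. ring_derivation S \<delta> \<Longrightarrow> \<delta> s = \<zero>\<^bsub>S\<^esub>"
  shows "s \<in> pth_powers S p"
proof -
  obtain m :: nat and c where mc: "\<forall>i \<in> {1..2 * m}. c i \<in> carrier S" and gen: "generate_ring S (c ` {1..2 * m}) = carrier S"
    using finitely_generated_mod[OF fg] by (elim exE conjE)
  note c = bspec[OF mc] gen
  \<comment> \<open>The quotients of polynomial rings over S have elements of this type, to which
    smoothness tested on countable rings is transferred.\<close>
  have fs: "formally_smooth TYPE((nat multiset \<Rightarrow> 'a set) set) R"
    by (rule formally_smooth_all_test_rings[OF A.cring_axioms fg smooth])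
  have "weyl_char S p"
    by (simp add: weyl_char_def weyl_char_axioms_def weyl_algebra_def cring_S prime_p char_S)
  then interpret cartier S m p c
    by (rule cartier.intro) (rule cartier_axioms.intro[OF c lift_mod[OF fs]])
  show ?thesis
  proof (rule pth_power_if_derivations_zero[OF s(1)])
    show "\<delta> s = \<zero>\<^bsub>S\<^esub>" if "ring_derivation S \<delta>" for \<delta>
      by (rule s(2)[OF that])
  qed
qed

end

section \<open>The bound on p and the final assembly\<close>

lemma (in weyl_algebra) eventually_nilpotent:
  assumes h: "h \<in> ring_hom W W" and h': "h' \<in> ring_hom W W"
  shows "\<forall>\<^sub>F k in sequentially. \<forall>i \<in> {1..2 * n}. \<forall>m \<in> {m. coef (h (x i)) m \<noteq> \<zero>}. (ad W (x i) ^^ k) (h' (ordmon m)) = \<zero>\<^bsub>W\<^esub>"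
proof (intro eventually_ball_finite ballI)
  fix i m assume i: "i \<in> {1..2 * n}"
  show "\<forall>\<^sub>F k in sequentially. (ad W (x i) ^^ k) (h' (ordmon m)) = \<zero>\<^bsub>W\<^esub>"
    by (rule ad_nilpotent[OF ring_hom_closed[OF h' ordmon_closed] i])
next
  fix i assume i: "i \<in> {1..2 * n}"
  show "finite {m. coef (h (x i)) m \<noteq> \<zero>}"
    by (rule P.finite_support[OF coef_poly[OF ring_hom_closed[OF h x_closed[OF i]]]])
qed simp

theorem theorem2:
  fixes R :: "('a, 'm) ring_scheme" and n :: nat
    and f :: "(nat list \<Rightarrow> 'a) set \<Rightarrow> (nat list \<Rightarrow> 'a) set"
  assumes "n \<ge> 1"
    and "cring R"
    and "finitely_generated_ring R"
    and "smooth_over_Z R"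
    and "f \<in> weyl_aut n R"
  shows "\<exists>N. \<forall>p > N. Factorial_Ring.prime p \<longrightarrow>
           centr_aut n R p f \<in> poisson_aut n (mod_ring R p) \<and>
           defined_over n (mod_ring R p) (pth_powers (mod_ring R p) p) (centr_aut n R p f)"
proof -
  interpret A: weyl_algebra R n by (simp add: weyl_algebra_def assms(2))
  have f: "f \<in> ring_hom A.W A.W" "bij_betw f (carrier A.W) (carrier A.W)"
    "\<And>r. r \<in> carrier R \<Longrightarrow> f (A.\<kappa> r) = A.\<kappa> r"
    using assms(5) by (auto simp: weyl_aut_def algebra_aut_def ring_iso_def)
  define g where "g = inv_into (carrier A.W) f"
  have fg: "f (g w) = w" and gf: "g (f w) = w" if "w \<in> carrier A.W" for w
    using that f(2) by (simp_all add: g_def f_inv_into_f bij_betw_def)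
  have "f \<in> ring_iso A.W A.W" using f by (simp add: ring_iso_def)
  then have "g \<in> ring_iso A.W A.W" unfolding g_def by (rule ring_iso_set_sym[OF A.W.ring_axioms])
  moreover have "g (A.\<kappa> r) = A.\<kappa> r" if "r \<in> carrier R" for r
    using gf[of "A.\<kappa> r"] f(3)[OF that] that by simp
  ultimately have g: "g \<in> weyl_aut n R" "g \<in> ring_hom A.W A.W"
    by (simp_all add: weyl_aut_def algebra_aut_def ring_iso_def)
  obtain K where K: "\<And>k i m. k \<ge> K \<Longrightarrow> i \<in> {1..2 * n} \<Longrightarrow> A.coef (f (A.x i)) m \<noteq> \<zero>\<^bsub>R\<^esub> \<Longrightarrow>
      (ad A.W (A.x i) ^^ k) (g (A.ordmon m)) = \<zero>\<^bsub>A.W\<^esub>"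
    using A.eventually_nilpotent[OF f(1) g(2)] unfolding eventually_sequentially by blast
  obtain K' where K': "\<And>k i m. k \<ge> K' \<Longrightarrow> i \<in> {1..2 * n} \<Longrightarrow> A.coef (g (A.x i)) m \<noteq> \<zero>\<^bsub>R\<^esub> \<Longrightarrow>
      (ad A.W (A.x i) ^^ k) (f (A.ordmon m)) = \<zero>\<^bsub>A.W\<^esub>"
    using A.eventually_nilpotent[OF g(2) f(1)] unfolding eventually_sequentially by blast
  obtain N where N: "\<And>p r. N < p \<Longrightarrow> Factorial_Ring.prime p \<Longrightarrow> r \<in> carrier R \<Longrightarrow> [(p::nat)] \<cdot>\<^bsub>R\<^esub> r = \<zero>\<^bsub>R\<^esub> \<Longrightarrow> r = \<zero>\<^bsub>R\<^esub>"
    using A.torsion_bound[OF assms(3)] by blast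
  have smooth: "formally_smooth TYPE(nat) R" using assms(4) by (simp add: smooth_over_Z_def)
  show ?thesis
  \<comment> \<open>N rules out p-torsion, while K and K' are the nilpotency bounds for the two
    directions. The strict inequality turns into a bound for the exponent p - 1.\<close>
  proof (intro exI[of _ "max N (max K K')"] allI impI)
    fix p assume p: "max N (max K K') < p" "Factorial_Ring.prime p"
    interpret weyl_mod_aut R n p f g
      by (intro weyl_mod_aut.intro weyl_mod_aut_axioms.intro weyl_mod.intro weyl_mod_axioms.intro A.weyl_algebra_axioms)
         (simp_all add: p assms(5) g(1) fg gf)
    show "centr_aut n R p f \<in> poisson_aut n (mod_ring R p) \<and>
        defined_over n (mod_ring R p) (pth_powers (mod_ring R p) p) (centr_aut n R p f)"
    proof
      show "centr_aut n R p f \<in> poisson_aut n (mod_ring R p)"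
        by (rule centr_aut_poisson) (rule N[of p]; use p in simp)
      show "defined_over n (mod_ring R p) (pth_powers (mod_ring R p) p) (centr_aut n R p f)"
      proof (rule centr_aut_defined_over)
        have pK: "K \<le> p - 1" "K' \<le> p - 1" using p(1) by linarith+
        show "(ad A.W (A.x i) ^^ (p - 1)) (g (A.ordmon m)) = \<zero>\<^bsub>A.W\<^esub>"
          if "i \<in> {1..2 * n}" "A.coef (f (A.x i)) m \<noteq> \<zero>\<^bsub>R\<^esub>" for i m
          by (rule K[OF pK(1) that])
        show "(ad A.W (A.x i) ^^ (p - 1)) (f (A.ordmon m)) = \<zero>\<^bsub>A.W\<^esub>"
          if "i \<in> {1..2 * n}" "A.coef (g (A.x i)) m \<noteq> \<zero>\<^bsub>R\<^esub>" for i m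
          by (rule K'[OF pK(2) that])
      qed (rule pth_power_mod[OF assms(3) smooth])
    qed
  qed
qed

end
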